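(* Let $X \subset W := S(1,1,1) \subset \mathbb{P}^5$ be a projective surface which, as a divisor on $W$, is linearly equivalent to $H + (d-3)F$ for some $d \geq 5$, where $H$ is a hyperplane section and $F$ is a ruling plane of $W$. Then the Betti numbers $\beta_{i,j}=\beta_{i,j}(X)$ in the range $1\le i\le 5$, $1\le j\le d-3$ are as follows: $$\beta_{1,1}=3,\quad \beta_{2,1}=2,\quad \beta_{3,1}=\beta_{4,1}=\beta_{5,1}=0,$$ $$\beta_{i,j}=0 \quad\text{for } 1\le i\le 5 \text{ and } 2\le j\le d-4,$$ $$\beta_{1,d-3}=\binom{d-1}{2},\quad \beta_{2,d-3}=2(d-1)(d-3),\quad \beta_{3,d-3}=3(d^2-5d+5),$$ $$\beta_{4,d-3}=2(d-2)(d-4),\quad \beta_{5,d-3}=\binom{d-3}{2}.$$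
   Context: $\Bbbk$ is an algebraically closed field, $S=\Bbbk[x_0,\ldots,x_5]$, $\mathbb{P}^5=\mathrm{Proj}(S)$. $S(1,1,1)\subset\mathbb{P}^5$ is the smooth rational normal $3$-fold scroll, i.e. the Segre embedding of $\mathbb{P}^1\times\mathbb{P}^2$, whose ruling planes are the fibres over $\mathbb{P}^1$. For a closed subscheme $Z$ with homogeneous vanishing ideal $I_Z\subset S$ and coordinate ring $A_Z=S/I_Z$, $\beta_{i,j}(Z):=\dim_\Bbbk\big(\mathrm{Tor}^S_i(\Bbbk,A_Z)_{i+j}\big)$. For $X$ as in the claim, $\deg(X)=d$ and the Castelnuovo-Mumford regularity is $\mathrm{reg}(X)=d-2$; the Betti numbers are listed in the range $1\le i\le r+1-\mathrm{depth}(X)$ (with $r=5$), $1\le j<\mathrm{reg}(X)$. *)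

theory Defs
  imports
    "HOL-Library.Poly_Mapping"
    "HOL-Library.Numeral_Type"
    "HOL-Library.Function_Algebras"
    "HOL-Computational_Algebra.Polynomial"
begin

section \<open>Polynomials and homogeneous ideals\<close>

text \<open>Polynomials over \<open>'a\<close> in the variables \<open>x\<^sub>i\<close>, \<open>i\<close> ranging over the finite type \<open>'n\<close>. For
  \<open>'n = 6\<close> this is \<open>k[x\<^sub>0, ..., x\<^sub>5]\<close>. Ideals are the sets \<^term>\<open>module.span (*) G\<close>.\<close>

type_synonym ('n, 'a) mvpoly = "('n \<Rightarrow>\<^sub>0 nat) \<Rightarrow>\<^sub>0 'a"

definition var :: "'n \<Rightarrow> ('n, 'a::comm_ring_1) mvpoly" where
  "var i = Poly_Mapping.single (Poly_Mapping.single i 1) 1"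

definition const :: "'a::comm_ring_1 \<Rightarrow> ('n, 'a) mvpoly" where
  "const c = Poly_Mapping.single 0 c"

definition peval :: "('n::finite, 'a::comm_ring_1) mvpoly \<Rightarrow> ('n \<Rightarrow> 'a) \<Rightarrow> 'a" where
  "peval f v = (\<Sum>m\<in>Poly_Mapping.keys f.
      Poly_Mapping.lookup f m * (\<Prod>i\<in>UNIV. v i ^ Poly_Mapping.lookup m i))"

text \<open>The graded piece \<open>S\<^sub>n\<close>; it contains \<open>0\<close>, and it is \<open>{0}\<close> for negative \<open>n\<close>.\<close>

definition homog :: "int \<Rightarrow> ('n::finite, 'a::comm_ring_1) mvpoly set" where
  "homog n = {f. \<forall>m\<in>Poly_Mapping.keys f. int (\<Sum>i\<in>UNIV. Poly_Mapping.lookup m i) = n}"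

definition ideal_power ::
    "('n::finite, 'a::field) mvpoly set \<Rightarrow> nat \<Rightarrow> ('n, 'a) mvpoly set" where
  "ideal_power J n = module.span (*) {\<Prod>k<n. f k | f. \<forall>k<n. f k \<in> J}"

definition irrelevant_ideal :: "('n::finite, 'a::field) mvpoly set" where
  "irrelevant_ideal = module.span (*) (range var)"


section \<open>Closed subsets of projective space\<close>

text \<open>A subset of the projective space with coordinates indexed by \<open>'n\<close> is represented by the set
  of all homogeneous coordinate vectors of its points, that is, by its punctured affine cone.\<close>

definition proj_closed :: "('n::finite \<Rightarrow> 'a::field) set \<Rightarrow> bool" where
  "proj_closed Z \<longleftrightarrow> (\<exists>G. (\<forall>g\<in>G. \<exists>n. g \<in> homog n) \<and> Z = {v. v \<noteq> 0 \<and> (\<forall>g\<in>G. peval g v = 0)})"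

definition proj_variety :: "('n::finite \<Rightarrow> 'a::field) set \<Rightarrow> bool" where
  "proj_variety Z \<longleftrightarrow> proj_closed Z \<and> Z \<noteq> {} \<and>
     (\<forall>A B. proj_closed A \<and> proj_closed B \<and> Z = A \<union> B \<longrightarrow> A = Z \<or> B = Z)"

definition vanishing_ideal ::
    "('n::finite \<Rightarrow> 'a::field) set \<Rightarrow> ('n, 'a) mvpoly set" where
  "vanishing_ideal Z = module.span (*) {f. (\<exists>n. f \<in> homog n) \<and> (\<forall>v\<in>Z. peval f v = 0)}"


section \<open>Weil divisors and linear equivalence\<close>

definition prime_divisor ::
    "('n::finite \<Rightarrow> 'a::field) set \<Rightarrow> ('n \<Rightarrow> 'a) set \<Rightarrow> bool" where
  "prime_divisor V Y \<longleftrightarrow> proj_variety Y \<and> Y \<subset> V \<and>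
     \<not> (\<exists>Z. proj_variety Z \<and> Y \<subset> Z \<and> Z \<subset> V)"

text \<open>The order of vanishing along the prime divisor \<open>Y\<close> of a form \<open>f\<close> not vanishing on \<open>V\<close>, for
  \<open>V\<close> a variety regular in codimension one. If \<open>l\<close> is a linear form not vanishing on \<open>Y\<close>, then
  \<open>f / l ^ deg f\<close> lies in the discrete valuation ring \<open>O\<^bsub>V,Y\<^esub>\<close>, the degree-zero part of the
  localization of \<open>S / I(V)\<close> at the forms \<open>s\<close> outside \<open>I(Y)\<close>. Its valuation is the largest \<open>n\<close>
  for which it lies in the \<open>n\<close>-th power of the maximal ideal; below, this membership is cleared of
  denominators.\<close>

definition ord_along ::
    "('n::finite \<Rightarrow> 'a::field) set \<Rightarrow> ('n \<Rightarrow> 'a) set \<Rightarrow> ('n, 'a) mvpoly \<Rightarrow> nat" where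
  "ord_along V Y f = (GREATEST n. \<exists>m s. s \<in> homog m \<and> s \<notin> vanishing_ideal Y \<and>
     (\<exists>a\<in>ideal_power (vanishing_ideal Y) n. \<exists>b\<in>vanishing_ideal V. s * f = a + b))"

text \<open>A divisor on \<open>V\<close> is given by its integer coefficients; only the values at the prime divisors of
  \<open>V\<close> matter. Nonzero rational functions on \<open>V\<close> are the quotients \<open>g / h\<close> of forms of equal degree
  that do not vanish identically on \<open>V\<close>.\<close>

type_synonym ('n, 'a) divisor = "('n \<Rightarrow> 'a) set \<Rightarrow> int"

definition prime_div :: "('n \<Rightarrow> 'a) set \<Rightarrow> ('n, 'a) divisor" where
  "prime_div Y = (\<lambda>Z. if Z = Y then 1 else 0)"

definition form_div ::
    "('n::finite \<Rightarrow> 'a::field) set \<Rightarrow> ('n, 'a) mvpoly \<Rightarrow> ('n, 'a) divisor" where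
  "form_div V f = (\<lambda>Y. int (ord_along V Y f))"

definition lin_equiv ::
    "('n::finite \<Rightarrow> 'a::field) set \<Rightarrow> ('n, 'a) divisor \<Rightarrow> ('n, 'a) divisor \<Rightarrow> bool" where
  "lin_equiv V D E \<longleftrightarrow> (\<exists>n g h. g \<in> homog n \<and> h \<in> homog n \<and>
     g \<notin> vanishing_ideal V \<and> h \<notin> vanishing_ideal V \<and>
     (\<forall>Y. prime_divisor V Y \<longrightarrow> D Y - E Y = form_div V g Y - form_div V h Y))"


section \<open>The scroll \<open>S(1,1,1)\<close>\<close>

definition segre_map :: "(2 \<Rightarrow> 'a::field) \<Rightarrow> (3 \<Rightarrow> 'a) \<Rightarrow> (6 \<Rightarrow> 'a)" where
  "segre_map s t = (\<lambda>k.
     if k = 0 then s 0 * t 0 else if k = 1 then s 1 * t 0 else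
     if k = 2 then s 0 * t 1 else if k = 3 then s 1 * t 1 else
     if k = 4 then s 0 * t 2 else s 1 * t 2)"

definition scroll111 :: "(6 \<Rightarrow> 'a::field) set" where
  "scroll111 = {segre_map s t | s t. s \<noteq> 0 \<and> t \<noteq> 0}"

text \<open>The fibre of the scroll over the point \<open>s\<close> of the projective line.\<close>

definition ruling_plane :: "(2 \<Rightarrow> 'a::field) \<Rightarrow> (6 \<Rightarrow> 'a) set" where
  "ruling_plane s = {segre_map s t | t. t \<noteq> 0}"


section \<open>Tor and graded Betti numbers\<close>

text \<open>A sequence \<open>... \<rightarrow> F\<^sub>1 \<rightarrow> F\<^sub>0 \<rightarrow> S / J\<close> of graded free modules of finite rank: \<open>F\<^sub>i\<close> has \<open>rk i\<close>
  basis elements, of degrees \<open>gdeg i b\<close>; \<open>dmat i\<close> is the matrix of the map from \<open>F\<^bsub>i+1\<^esub>\<close> to \<open>F\<^sub>i\<close>; and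
  \<open>aug b\<close> represents the image in \<open>S / J\<close> of the \<open>b\<close>-th basis element of \<open>F\<^sub>0\<close>.\<close>

record (overloaded) ('n, 'a) free_seq =
  rk :: "nat \<Rightarrow> nat"
  gdeg :: "nat \<Rightarrow> nat \<Rightarrow> int"
  dmat :: "nat \<Rightarrow> nat \<Rightarrow> nat \<Rightarrow> ('n, 'a) mvpoly"
  aug :: "nat \<Rightarrow> ('n, 'a) mvpoly"

definition free_mod :: "('n::finite, 'a::field) free_seq \<Rightarrow> nat \<Rightarrow> (nat \<Rightarrow> ('n, 'a) mvpoly) set" where
  "free_mod P i = {v. \<forall>b\<ge>rk P i. v b = 0}"

definition free_mod_deg ::
    "('n::finite, 'a::field) free_seq \<Rightarrow> nat \<Rightarrow> int \<Rightarrow> (nat \<Rightarrow> ('n, 'a) mvpoly) set" where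
  "free_mod_deg P i n = {v \<in> free_mod P i. \<forall>b<rk P i. v b \<in> homog (n - gdeg P i b)}"

definition dmap :: "('n::finite, 'a::field) free_seq \<Rightarrow> nat \<Rightarrow>
    (nat \<Rightarrow> ('n, 'a) mvpoly) \<Rightarrow> (nat \<Rightarrow> ('n, 'a) mvpoly)" where
  "dmap P i v = (\<lambda>a. if a < rk P i then \<Sum>b<rk P (Suc i). dmat P i a b * v b else 0)"

definition augmap :: "('n::finite, 'a::field) free_seq \<Rightarrow>
    (nat \<Rightarrow> ('n, 'a) mvpoly) \<Rightarrow> ('n, 'a) mvpoly" where
  "augmap P v = (\<Sum>b<rk P 0. aug P b * v b)"

definition graded_free_resolution ::
    "('n::finite, 'a::field) mvpoly set \<Rightarrow> ('n, 'a) free_seq \<Rightarrow> bool" where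
  "graded_free_resolution J P \<longleftrightarrow>
     (\<forall>b<rk P 0. aug P b \<in> homog (gdeg P 0 b)) \<and>
     (\<forall>i. \<forall>a<rk P i. \<forall>b<rk P (Suc i). dmat P i a b \<in> homog (gdeg P (Suc i) b - gdeg P i a)) \<and>
     (\<forall>f. \<exists>v\<in>free_mod P 0. f - augmap P v \<in> J) \<and>
     (\<forall>v\<in>free_mod P 0. augmap P v \<in> J \<longleftrightarrow> (\<exists>w\<in>free_mod P 1. v = dmap P 0 w)) \<and>
     (\<forall>i. \<forall>v\<in>free_mod P (Suc i).
        dmap P i v = 0 \<longleftrightarrow> (\<exists>w\<in>free_mod P (Suc (Suc i)). v = dmap P (Suc i) w))"

text \<open>The preimages in the degree-\<open>n\<close> part of \<open>F\<^sub>i\<close> of the cycles and of the boundaries of the complex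
  \<open>F \<otimes> S / I\<close>. Both contain the degree-\<open>n\<close> part of \<open>I F\<^sub>i\<close>, so their quotient is
  \<open>H\<^sub>i(F \<otimes> S / I)\<^sub>n\<close>.\<close>

definition tensor_cycles :: "('n::finite, 'a::field) free_seq \<Rightarrow> ('n, 'a) mvpoly set \<Rightarrow>
    nat \<Rightarrow> int \<Rightarrow> (nat \<Rightarrow> ('n, 'a) mvpoly) set" where
  "tensor_cycles P I i n = {v \<in> free_mod_deg P i n.
     case i of 0 \<Rightarrow> True | Suc k \<Rightarrow> \<forall>a. dmap P k v a \<in> I}"

definition tensor_boundaries :: "('n::finite, 'a::field) free_seq \<Rightarrow> ('n, 'a) mvpoly set \<Rightarrow>
    nat \<Rightarrow> int \<Rightarrow> (nat \<Rightarrow> ('n, 'a) mvpoly) set" where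
  "tensor_boundaries P I i n = {v \<in> free_mod_deg P i n.
     \<exists>w\<in>free_mod_deg P (Suc i) n. \<forall>a. v a - dmap P i w a \<in> I}"

definition cscale :: "'a::field \<Rightarrow> (nat \<Rightarrow> ('n, 'a) mvpoly) \<Rightarrow> (nat \<Rightarrow> ('n, 'a) mvpoly)" where
  "cscale c v = (\<lambda>b. const c * v b)"

lemma vector_space_cscale: "vector_space cscale"
  by unfold_locales
    (auto simp: cscale_def const_def fun_eq_iff algebra_simps single_add mult_single
      simp flip: mult.assoc)

text \<open>The dimension over the field of the degree-\<open>n\<close> part of \<open>Tor\<^sub>i(S / J, S / I)\<close>, for homogeneous
  ideals \<open>J\<close> and \<open>I\<close>: the homology of \<open>F \<otimes> S / I\<close> for a graded free resolution \<open>F\<close> of \<open>S / J\<close>,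
  which up to isomorphism does not depend on \<open>F\<close>. All spaces involved are finite-dimensional, since
  \<open>F\<close> has finite rank in each homological degree.\<close>

definition tor_dim :: "('n::finite, 'a::field) mvpoly set \<Rightarrow> ('n, 'a) mvpoly set \<Rightarrow>
    nat \<Rightarrow> int \<Rightarrow> nat" where
  "tor_dim J I i n = (let P = (SOME P. graded_free_resolution J P) in
     vector_space.dim cscale (tensor_cycles P I i n) -
     vector_space.dim cscale (tensor_boundaries P I i n))"

definition betti :: "('n::finite \<Rightarrow> 'a::field) set \<Rightarrow> nat \<Rightarrow> nat \<Rightarrow> nat" where
  "betti Z i j = tor_dim irrelevant_ideal (vanishing_ideal Z) i (int (i + j))"

end

theory Submission
  imports Defs "HOL-Computational_Algebra.Polynomial_Factorial" "HOL-Computational_Algebra.Field_as_Ring"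
begin

text \<open>
  The surface \<open>X\<close> is the zero set of a prime form \<open>q\<close> of bidegree \<open>(d - 2, 1)\<close> in the Cox ring
  \<open>k[s0, s1, t0, t1, t2]\<close> of the scroll \<open>W\<close>. Put \<open>M\<^sub>e = (\<Oplus>n. H\<^sup>0(W, O(n, n + e)))\<close>, so that \<open>M\<^sub>0\<close> is
  the coordinate ring of \<open>W\<close>. Multiplication by \<open>q\<close> identifies the ideal of \<open>X\<close> in \<open>M\<^sub>0\<close> with
  \<open>M\<^sub>e(-(d - 2))\<close>, where \<open>e = d - 3\<close>. This ideal starts in degree \<open>d - 2\<close>; therefore
  \<open>Tor\<^sub>i\<close> of \<open>X\<close> in degree \<open>i + j\<close> equals that of \<open>W\<close> for \<open>j \<le> d - 4\<close>, and for \<open>j = d - 3\<close> the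
  connecting map identifies it with the degree \<open>i - 1\<close> part of \<open>Tor\<^bsub>i-1\<^esub>(k, M\<^sub>e)\<close>, since \<open>M\<^sub>0\<close>
  has a linear resolution after its generator. All Tor groups are computed by the Koszul complex on
  six linear forms, of which four are parameters for \<open>M\<^sub>e\<close>; the remaining strands are exact
  but for one place, and there the dimension is an Euler characteristic.\<close>

text \<open>The class H has bidegree (1, 1) and F has (1, 0), so H + (d - 3) F has (d - 2, 1).
  Linear equivalence turns into an equality up to a unit because the Cox ring, unlike the coordinate
  ring of W, is factorial: prime divisors are zero sets of bihomogeneous primes, and orders of
  vanishing are multiplicities. An element of unbalanced bidegree is not the restriction of a form
  on the ambient space; it is balanced by factors in the s or t variables.

  The obstacle is that for e >= 2 the module M_e is not Cohen-Macaulay, so the four parameters are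
  no regular sequence on it. Injectivity fails only in degree 0, which affects only the diagonal n =
  i of the Koszul complex. On that diagonal there are no boundaries, since M_e vanishes in negative
  degrees, and Tor_i is the space of cycles, which the exact places before it determine.

  \<open>tor_dim\<close> refers to a resolution picked by \<open>SOME\<close>, so independence of
  the resolution has to be proved before the Koszul complex can be used. The bound d >= 5 makes the
  strand of M_0 that carries the connecting map exact: M_0 is exact at homological degree i from n =
  i + 2 on.\<close>

section \<open>Linear algebra of finite-dimensional subspaces\<close>

text \<open>The ambient spaces are infinite-dimensional and \<open>dim\<close> is the cardinality of
  a basis, hence 0 for an infinite one. Finiteness is therefore carried along with each
  subspace.\<close>

definition fin_dim :: "('a::field \<Rightarrow> 'b::ab_group_add \<Rightarrow> 'b) \<Rightarrow> 'b set \<Rightarrow> bool" where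
  "fin_dim s U \<longleftrightarrow> module.subspace s U \<and> (\<exists>B. finite B \<and> U \<subseteq> module.span s B)"

lemma fin_dim_subspace: "fin_dim s U \<Longrightarrow> module.subspace s U"
  by (simp add: fin_dim_def)

lemma fin_dim_subset: "fin_dim s U \<Longrightarrow> module.subspace s V \<Longrightarrow> V \<subseteq> U \<Longrightarrow> fin_dim s V"
  unfolding fin_dim_def by blast

lemma independent_finite_in_fin_dim:
  assumes "vector_space s" "fin_dim s U" "\<not> module.dependent s B" "B \<subseteq> U"
  shows "finite B"
proof -
  interpret V: vector_space s by fact
  show ?thesis using assms V.independent_span_bound unfolding fin_dim_def by blast
qed

lemma dim_mono_fin_dim:
  assumes "vector_space s" "fin_dim s U" "V \<subseteq> U"
  shows "vector_space.dim s V \<le> vector_space.dim s U"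
proof -
  interpret V: vector_space s by fact
  obtain B where B: "B \<subseteq> V" "V.independent B" "V \<subseteq> V.span B" "card B = V.dim V"
    using V.basis_exists by blast
  obtain C where C: "C \<subseteq> U" "V.independent C" "U \<subseteq> V.span C" "card C = V.dim U"
    using V.basis_exists by blast
  have "finite C" using independent_finite_in_fin_dim[OF assms(1,2) C(2,1)] .
  moreover have "B \<subseteq> V.span C" using B C assms(3) by blast
  ultimately have "card B \<le> card C"
    using V.independent_span_bound[OF _ B(2)] by blast
  then show ?thesis using B C by simp
qed

lemma dim_zero_subspace:
  assumes "vector_space s"
  shows "vector_space.dim s {0} = 0"
proof -
  interpret V: vector_space s by fact
  show ?thesis
    using V.dim_span_eq_card_independent[OF V.independent_empty] by (simp only: V.span_empty card.empty)
qed

context vector_space_pair begin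

lemma fin_dim_image:
  assumes f: "Vector_Spaces.linear s1 s2 f" and U: "fin_dim s1 U"
  shows "fin_dim s2 (f ` U)"
proof -
  interpret f: Vector_Spaces.linear s1 s2 f by fact
  obtain B where "finite B" "U \<subseteq> vs1.span B" using U by (auto simp: fin_dim_def)
  then have "finite (f ` B)" "f ` U \<subseteq> vs2.span (f ` B)"
    using f.spans_image by auto
  then show ?thesis
    using f.subspace_image[OF fin_dim_subspace[OF U]] by (auto simp: fin_dim_def)
qed

text \<open>A basis \<open>A\<close> of the kernel is extended to a basis \<open>C\<close> of
  \<open>U\<close>. On the span of \<open>C - A\<close> the map is injective: a kernel element there
  has coordinates supported both in \<open>A\<close> and in \<open>C - A\<close>.\<close>

lemma dim_image_plus_kernel:
  assumes f: "Vector_Spaces.linear s1 s2 f" and U: "fin_dim s1 U"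
  shows "vs1.dim U = vs2.dim (f ` U) + vs1.dim {x \<in> U. f x = 0}"
proof -
  interpret f: Vector_Spaces.linear s1 s2 f by fact
  let ?K = "{x \<in> U. f x = 0}"
  have sU: "vs1.subspace U" using U by (rule fin_dim_subspace)
  have sK: "vs1.subspace ?K"
    using vs1.subspace_inter[OF sU f.subspace_kernel] by (simp add: Int_def)
  obtain A where A: "A \<subseteq> ?K" "vs1.independent A" "?K \<subseteq> vs1.span A" "card A = vs1.dim ?K"
    using vs1.basis_exists by blast
  obtain C where C: "A \<subseteq> C" "C \<subseteq> U" "vs1.independent C" "U \<subseteq> vs1.span C"
    using vs1.maximal_independent_subset_extend[of A U] A by blast
  have finC: "finite C" using independent_finite_in_fin_dim[OF vs1.vector_space_axioms U C(3,2)] .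
  have spC: "vs1.span C = U" using vs1.span_subspace[OF C(2,4) sU] .
  have spA: "vs1.span A = ?K" using vs1.span_subspace[OF A(1,3) sK] .
  have sub: "vs1.span (C - A) \<subseteq> U" using vs1.span_mono[of "C - A" C] spC by auto
  have inj: "inj_on f (vs1.span (C - A))"
  proof (subst f.inj_on_iff_eq_0, simp, intro ballI impI)
    fix x assume x: "x \<in> vs1.span (C - A)" "f x = 0"
    then have xA: "x \<in> vs1.span A" using sub spA by auto
    have "vs1.representation C x = vs1.representation A x"
      using vs1.representation_extend[OF C(3) xA C(1)] .
    moreover have "vs1.representation C x = vs1.representation (C - A) x"
      using vs1.representation_extend[OF C(3) x(1)] by auto
    ultimately have r: "vs1.representation C x b = 0" for b
    proof -
      assume eq: "vs1.representation C x = vs1.representation A x"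
        "vs1.representation C x = vs1.representation (C - A) x"
      show ?thesis
      proof (rule ccontr)
        assume "vs1.representation C x b \<noteq> 0"
        then have "vs1.representation A x b \<noteq> 0" "vs1.representation (C - A) x b \<noteq> 0"
          using eq by simp_all
        then have "b \<in> A" "b \<in> C - A" by (auto dest: vs1.representation_ne_zero)
        then show False by simp
      qed
    qed
    have "x = (\<Sum>b\<in>C. s1 (vs1.representation C x b) b)"
      using vs1.sum_representation_eq[OF C(3) _ finC subset_refl] x sub spC by auto
    then show "x = 0" using r by simp
  qed
  have ind: "vs2.independent (f ` (C - A))"
    using f.independent_injective_image[OF _ inj] vs1.independent_mono[OF C(3)] by blast
  have sp: "f ` U \<subseteq> vs2.span (f ` (C - A))"
  proof -
    have "f ` U = vs2.span (f ` C)" using f.span_image[of C] spC by simp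
    moreover have "f ` C \<subseteq> insert 0 (f ` (C - A))" using A(1) by auto
    ultimately show ?thesis using vs2.span_mono[of "f ` C" "insert 0 (f ` (C - A))"]
      by (simp add: vs2.span_insert_0)
  qed
  have "card (f ` (C - A)) = vs2.dim (f ` U)"
    using vs2.basis_card_eq_dim[OF _ sp ind] C(2) by blast
  moreover have "card (f ` (C - A)) = card (C - A)"
    using inj vs1.span_superset by (meson card_image inj_on_subset)
  moreover have "card C = vs1.dim U" using vs1.basis_card_eq_dim[OF C(2,4,3)] .
  moreover have "card C = card (C - A) + card A"
    using finC C(1) by (metis card_Diff_subset card_mono finite_subset le_add_diff_inverse2)
  ultimately show ?thesis using A(4) by simp
qed

end

text \<open>Comparison of the dimensions of two quotients: \<open>f\<close> induces an injection of \<open>Z / B\<close>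
  into \<open>Z' / B'\<close>.\<close>

lemma (in vector_space_pair) dim_quotient_le:
  assumes f: "Vector_Spaces.linear s1 s2 f"
    and Z: "fin_dim s1 Z" and Z': "fin_dim s2 Z'"
    and B: "vs1.subspace B" "B \<subseteq> Z" and B': "vs2.subspace B'" "B' \<subseteq> Z'"
    and fZ: "f ` Z \<subseteq> Z'" and fB: "\<And>z. z \<in> Z \<Longrightarrow> f z \<in> B' \<longleftrightarrow> z \<in> B"
  shows "vs1.dim Z + vs2.dim B' \<le> vs2.dim Z' + vs1.dim B"
proof -
  interpret f: Vector_Spaces.linear s1 s2 f by fact
  have fdB: "fin_dim s1 B" using fin_dim_subset[OF Z B] .
  have k: "{x \<in> Z. f x = 0} = {x \<in> B. f x = 0}"
  proof -
    have "x \<in> B" if "x \<in> Z" "f x = 0" for x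
      using fB[OF that(1)] that(2) vs2.subspace_0[OF B'(1)] by simp
    then show ?thesis using B(2) by blast
  qed
  have d1: "vs1.dim Z = vs2.dim (f ` Z) + vs1.dim {x \<in> B. f x = 0}"
    using dim_image_plus_kernel[OF f Z] k by simp
  have d2: "vs1.dim B = vs2.dim (f ` B) + vs1.dim {x \<in> B. f x = 0}"
    using dim_image_plus_kernel[OF f fdB] .
  have inter: "f ` Z \<inter> B' = f ` B"
  proof (intro equalityI subsetI)
    fix y assume "y \<in> f ` Z \<inter> B'"
    then obtain x where "x \<in> Z" "y = f x" "y \<in> B'" by blast
    then show "y \<in> f ` B" using fB[of x] by blast
  next
    fix y assume "y \<in> f ` B"
    then obtain x where "x \<in> B" "y = f x" by blast
    then show "y \<in> f ` Z \<inter> B'" using fB[of x] B(2) by blast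
  qed
  \<comment> \<open>Modularity: a basis \<open>C\<close> of the image of \<open>Z\<close> and a
    basis \<open>D\<close> of \<open>B'\<close> both extend a basis \<open>A\<close> of their
    intersection, the image of \<open>B\<close>. It suffices that the union of \<open>C\<close> and
    \<open>D\<close>, which lies in \<open>Z'\<close>, is independent.\<close>
  have "vs2.dim (f ` Z) + vs2.dim B' \<le> vs2.dim Z' + vs2.dim (f ` B)"
  proof -
    obtain A where A: "A \<subseteq> f ` B" "vs2.independent A" "f ` B \<subseteq> vs2.span A" "card A = vs2.dim (f ` B)"
      using vs2.basis_exists by blast
    obtain C where C: "A \<subseteq> C" "C \<subseteq> f ` Z" "vs2.independent C" "f ` Z \<subseteq> vs2.span C"
      using vs2.maximal_independent_subset_extend[OF order_trans[OF A(1) image_mono[OF B(2)]] A(2)] by metis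
    have sfZ: "vs2.subspace (f ` Z)" using f.subspace_image[OF fin_dim_subspace[OF Z]] .
    have sfB: "vs2.subspace (f ` B)" using f.subspace_image[OF B(1)] .
    obtain D where D: "D \<subseteq> B'" "A \<subseteq> D" "vs2.independent D" "B' \<subseteq> vs2.span D"
      using vs2.maximal_independent_subset_extend[of A B', OF _ A(2)] A(1) inter by (metis inf.cobounded2 order_trans)
    have finC: "finite C" using independent_finite_in_fin_dim[OF vs2.vector_space_axioms Z' C(3)] C(2) fZ by auto
    have finD: "finite D" using independent_finite_in_fin_dim[OF vs2.vector_space_axioms Z' D(3)] D(1) B'(2) by auto
    have CD: "C \<inter> D = A"
    proof -
      have "x \<in> A" if "x \<in> C" "x \<in> D" for x
      proof (rule ccontr)
        assume "x \<notin> A"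
        have "x \<in> f ` Z \<inter> B'" using that C(2) D(1) by (auto simp only: subset_iff)
        then have "x \<in> f ` B" by (simp only: inter)
        then have "x \<in> vs2.span A" using A(3) by blast
        then have "x \<in> vs2.span (C - {x})" using vs2.span_mono[of A "C - {x}"] C(1) \<open>x \<notin> A\<close> by auto
        then show False using C(3) that(1) by (auto simp: vs2.dependent_def)
      qed
      then have "C \<inter> D \<subseteq> A" by auto
      moreover have "A \<subseteq> C \<inter> D" using C(1) D(2) by auto
      ultimately show ?thesis by (rule subset_antisym)
    qed
    have ind: "vs2.independent (C \<union> D)"
    proof (rule ccontr)
      assume "\<not> ?thesis"
      then obtain u where u: "(\<Sum>v\<in>C \<union> D. s2 (u v) v) = 0" "\<exists>v\<in>C \<union> D. u v \<noteq> 0"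
        using vs2.dependent_finite[of "C \<union> D"] finC finD by blast
      \<comment> \<open>In a relation on the union, the part \<open>?y\<close> lies in
        \<open>B'\<close> and, being \<open>- ?x\<close>, also in the image of \<open>Z\<close>;
        hence it lies in the span of \<open>A\<close>. Independence of \<open>D\<close> then kills
        its coefficients, and independence of \<open>C\<close> the others.\<close>
      let ?x = "\<Sum>v\<in>C. s2 (u v) v" and ?y = "\<Sum>v\<in>D - A. s2 (u v) v"
      have CDA: "C \<inter> (D - A) = {}" using CD by blast
      have eqCD: "C \<union> D = C \<union> (D - A)" using C(1) by blast
      have xy: "?x + ?y = 0"
        using u(1) unfolding eqCD sum.union_disjoint[OF finC finite_Diff[OF finD] CDA] .
      then have xy': "?y = - ?x" by (metis eq_neg_iff_add_eq_0 add.commute)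
      have yB: "?y \<in> B'" using D(1) by (intro vs2.subspace_sum[OF B'(1)] vs2.subspace_scale[OF B'(1)]) auto
      have "?x \<in> f ` Z" using C(2) by (intro vs2.subspace_sum[OF sfZ] vs2.subspace_scale[OF sfZ]) auto
      then have "- ?x \<in> f ` Z" by (rule vs2.subspace_neg[OF sfZ])
      then have y: "?y \<in> f ` B"
        using yB unfolding xy'[symmetric] inter[symmetric] by (rule IntI)
      then have yA: "?y \<in> vs2.span A" using subsetD[OF A(3)] by iprover
      have finA: "finite A" using finite_subset[OF C(1) finC] .
      obtain w where w: "?y = (\<Sum>v\<in>A. s2 (w v) v)" using yA vs2.span_finite[OF finA] by auto
      have z: "(\<Sum>v\<in>D. s2 ((if v \<in> A then - w v else u v)) v) = 0"
      proof -
        have "(\<Sum>v\<in>D. s2 ((if v \<in> A then - w v else u v)) v)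
          = (\<Sum>v\<in>A. s2 (- w v) v) + (\<Sum>v\<in>D - A. s2 (u v) v)"
          using sum.subset_diff[OF D(2) finD, of "\<lambda>v. s2 ((if v \<in> A then - w v else u v)) v"]
          by (simp add: add.commute)
        then show ?thesis using w by (simp add: sum_negf)
      qed
      have uD: "u v = 0" if "v \<in> D - A" for v
        using vs2.independentD[OF D(3) finD subset_refl z, of v] that by auto
      have y0: "?y = 0" by (rule sum.neutral) (simp add: uD)
      have "?x = 0" using xy unfolding y0 by simp
      then have "u v = 0" if "v \<in> C" for v
        using vs2.independentD[OF C(3) finC subset_refl] that by blast
      then show False using uD u(2) CD by blast
    qed
    have "card (C \<union> D) \<le> vs2.dim Z'"
    proof -
      have "C \<union> D \<subseteq> Z'" using order_trans[OF C(2) fZ] order_trans[OF D(1) B'(2)] by (rule Un_least)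
      then have "vs2.dim (C \<union> D) \<le> vs2.dim Z'" by (rule dim_mono_fin_dim[OF vs2.vector_space_axioms Z'])
      then show ?thesis using vs2.dim_eq_card_independent[OF ind] by simp
    qed
    moreover have "card C + card D = card (C \<union> D) + card A"
      using card_Un_Int[OF finC finD] CD by simp
    moreover have "card C = vs2.dim (f ` Z)" using vs2.basis_card_eq_dim[OF C(2,4,3)] .
    moreover have "card D = vs2.dim B'" using vs2.basis_card_eq_dim[OF D(1,4,3)] .
    ultimately show ?thesis using A(4) by linarith
  qed
  then show ?thesis using d1 d2 by linarith
qed

section \<open>Ring homomorphisms and evaluation of polynomials\<close>

definition rhom :: "('r::comm_ring_1 \<Rightarrow> 's::comm_ring_1) \<Rightarrow> bool" where
  "rhom h \<longleftrightarrow> h 1 = 1 \<and> (\<forall>x y. h (x + y) = h x + h y) \<and> (\<forall>x y. h (x * y) = h x * h y)"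

lemma rhom_1: "rhom h \<Longrightarrow> h 1 = 1"
  and rhom_add: "rhom h \<Longrightarrow> h (x + y) = h x + h y"
  and rhom_mult: "rhom h \<Longrightarrow> h (x * y) = h x * h y"
  by (simp_all add: rhom_def)

lemma rhom_0: "rhom h \<Longrightarrow> h 0 = 0"
  using rhom_add[of h 0 0] by simp

lemma rhom_uminus: "rhom h \<Longrightarrow> h (- x) = - h x"
  using rhom_add[of h x "- x"] rhom_0[of h] by (simp add: eq_neg_iff_add_eq_0 add.commute)

lemma rhom_diff: "rhom h \<Longrightarrow> h (x - y) = h x - h y"
  using rhom_add[of h x "- y"] rhom_uminus[of h y] by simp

lemma rhom_sum: "rhom h \<Longrightarrow> h (sum f A) = (\<Sum>x\<in>A. h (f x))"
  by (induction A rule: infinite_finite_induct) (auto simp: rhom_0 rhom_add)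

lemma rhom_prod: "rhom h \<Longrightarrow> h (prod f A) = (\<Prod>x\<in>A. h (f x))"
  by (induction A rule: infinite_finite_induct) (auto simp: rhom_1 rhom_mult)

lemma rhom_power: "rhom h \<Longrightarrow> h (x ^ n) = h x ^ n"
  by (induction n) (auto simp: rhom_1 rhom_mult)

lemma rhom_comp: "rhom g \<Longrightarrow> rhom h \<Longrightarrow> rhom (\<lambda>x. g (h x))"
  by (simp add: rhom_def)

lemma rhom_id: "rhom (\<lambda>x. x)"
  by (simp add: rhom_def)

lemmas rhom_simps = rhom_0 rhom_1 rhom_add rhom_mult rhom_uminus rhom_diff rhom_sum rhom_prod rhom_power

lemma mvpoly_induct [case_names single add]:
  fixes f :: "'b \<Rightarrow>\<^sub>0 'a::comm_monoid_add"
  assumes s: "\<And>m c. P (Poly_Mapping.single m c)" and a: "\<And>f g. P f \<Longrightarrow> P g \<Longrightarrow> P (f + g)"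
  shows "P f"
proof (induction f rule: update_induct)
  case const
  then show ?case using s[of undefined 0] by simp
next
  case (update f m c)
  have "Poly_Mapping.update m c f = f + Poly_Mapping.single m c"
    using update by (intro poly_mapping_eqI) (auto simp: lookup_update lookup_add lookup_single in_keys_iff)
  then show ?case using update a s by metis
qed

lemma mvpoly_as_sum:
  fixes f :: "'b \<Rightarrow>\<^sub>0 'a::comm_monoid_add"
  shows "f = (\<Sum>m\<in>Poly_Mapping.keys f. Poly_Mapping.single m (Poly_Mapping.lookup f m))"
  by (intro poly_mapping_eqI)
    (auto simp: lookup_sum lookup_single when_def sum.delta in_keys_iff)

text \<open>Instances are \<open>peval\<close> (identity on coefficients), the restriction
  \<open>phi\<close> to the scroll, and the retractions of the polynomial ring in
  \<open>kos_resolution_step\<close>.\<close>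

definition mv_eval :: "('a::comm_ring_1 \<Rightarrow> 'r::comm_ring_1) \<Rightarrow> ('n::finite \<Rightarrow> 'r) \<Rightarrow> ('n, 'a) mvpoly \<Rightarrow> 'r" where
  "mv_eval c v f = (\<Sum>m\<in>Poly_Mapping.keys f.
      c (Poly_Mapping.lookup f m) * (\<Prod>i\<in>UNIV. v i ^ Poly_Mapping.lookup m i))"

lemma peval_eq_mv_eval: "peval f v = mv_eval (\<lambda>x. x) v f"
  by (simp add: peval_def mv_eval_def)

lemma mv_eval_superset:
  assumes "rhom c" "finite A" "Poly_Mapping.keys f \<subseteq> A"
  shows "mv_eval c v f = (\<Sum>m\<in>A. c (Poly_Mapping.lookup f m) * (\<Prod>i\<in>UNIV. v i ^ Poly_Mapping.lookup m i))"
  unfolding mv_eval_def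
  by (rule sum.mono_neutral_left) (use assms in \<open>auto simp: rhom_0 in_keys_iff\<close>)

lemma mv_eval_add:
  assumes "rhom c"
  shows "mv_eval c v (f + g) = mv_eval c v f + mv_eval c v g"
proof -
  let ?A = "Poly_Mapping.keys f \<union> Poly_Mapping.keys g"
  have "Poly_Mapping.keys (f + g) \<subseteq> ?A" by (rule keys_add)
  then show ?thesis
    using assms by (simp add: mv_eval_superset[of c ?A] lookup_add rhom_add distrib_right sum.distrib)
qed

lemma mv_eval_single:
  "rhom c \<Longrightarrow> mv_eval c v (Poly_Mapping.single m a) = c a * (\<Prod>i\<in>UNIV. v i ^ Poly_Mapping.lookup m i)"
  by (simp add: mv_eval_superset[of c "{m}"])

lemma mv_eval_rhom:
  assumes "rhom c"
  shows "rhom (mv_eval c v)"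
  unfolding rhom_def
proof (intro conjI allI)
  show "mv_eval c v 1 = 1"
    using mv_eval_single[OF assms, of v 0 1] assms by (simp add: rhom_1)
  show "mv_eval c v (f + g) = mv_eval c v f + mv_eval c v g" for f g
    by (rule mv_eval_add[OF assms])
  show "mv_eval c v (f * g) = mv_eval c v f * mv_eval c v g" for f g
  proof (induction f rule: mvpoly_induct)
    case (single m a)
    show ?case
      by (induction g rule: mvpoly_induct)
        (simp_all add: mult_single mv_eval_single assms rhom_mult lookup_add power_add prod.distrib
          distrib_left mv_eval_add)
  next
    case (add f f')
    then show ?case by (simp add: distrib_right mv_eval_add assms)
  qed
qed

lemma mv_eval_const: "rhom c \<Longrightarrow> mv_eval c v (const a) = c a"
  by (simp add: const_def mv_eval_single)

lemma mv_eval_var: "rhom c \<Longrightarrow> mv_eval c v (var i) = v i"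
proof -
  assume c: "rhom c"
  have "(\<Prod>j\<in>UNIV. v j ^ Poly_Mapping.lookup (Poly_Mapping.single i 1) j) = (\<Prod>j\<in>UNIV. if j = i then v j else 1)"
    by (intro prod.cong) (auto simp: lookup_single)
  then show ?thesis using c by (simp add: var_def mv_eval_single rhom_1)
qed

lemma rhom_const: "rhom (const :: 'a::comm_ring_1 \<Rightarrow> ('n, 'a) mvpoly)"
  by (simp add: rhom_def const_def single_add mult_single)

lemma const_0 [simp]: "const 0 = 0" and const_1 [simp]: "const 1 = 1"
  by (simp_all add: const_def)

lemma single_eq_const_prod_var:
  fixes m :: "'n::finite \<Rightarrow>\<^sub>0 nat"
  shows "Poly_Mapping.single m c = const c * (\<Prod>i\<in>UNIV. var i ^ Poly_Mapping.lookup m i)"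
proof -
  have pw: "(var i :: ('n, 'a::comm_ring_1) mvpoly) ^ k = Poly_Mapping.single (Poly_Mapping.single i k) 1"
    for i :: 'n and k
    by (induction k) (simp_all add: var_def mult_single single_add[symmetric])
  have pr: "(\<Prod>i\<in>A. Poly_Mapping.single (f i) (1::'a::comm_ring_1)) = Poly_Mapping.single (\<Sum>i\<in>A. f i) 1"
    if "finite A" for A and f :: "'n \<Rightarrow> 'n \<Rightarrow>\<^sub>0 nat"
    using that by induction (simp_all add: mult_single)
  have "(\<Sum>i\<in>UNIV. Poly_Mapping.single i (Poly_Mapping.lookup m i)) = m"
    by (intro poly_mapping_eqI) (simp add: lookup_sum lookup_single when_def)
  then show ?thesis by (simp add: pw pr const_def mult_single)
qed

lemma rhom_eq_mv_eval:
  assumes "rhom h"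
  shows "h f = mv_eval (\<lambda>x. h (const x)) (\<lambda>i. h (var i)) f"
proof -
  have c: "rhom (\<lambda>x. h (const x))" using rhom_comp[OF assms rhom_const] .
  show ?thesis
    by (induction f rule: mvpoly_induct)
      (simp_all only: mv_eval_single[OF c] mv_eval_add[OF c] rhom_add[OF assms],
        simp add: single_eq_const_prod_var rhom_simps assms)
qed

lemma rhom_mv_ext:
  fixes g h :: "('n::finite, 'a::comm_ring_1) mvpoly \<Rightarrow> 'r::comm_ring_1"
  assumes "rhom g" "rhom h" "\<And>x. g (const x) = h (const x)" "\<And>i. g (var i) = h (var i)"
  shows "g f = h f"
  by (subst rhom_eq_mv_eval[OF assms(1)], subst rhom_eq_mv_eval[OF assms(2)]) (simp add: assms(3,4))

subsection \<open>Homogeneous components\<close>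

definition mdeg :: "('n::finite \<Rightarrow>\<^sub>0 nat) \<Rightarrow> int" where
  "mdeg m = int (\<Sum>i\<in>UNIV. Poly_Mapping.lookup m i)"

lemma mdeg_nonneg: "0 \<le> mdeg m"
  unfolding mdeg_def by (rule of_nat_0_le_iff)

lemma homog_iff: "f \<in> homog n \<longleftrightarrow> (\<forall>m. Poly_Mapping.lookup f m \<noteq> 0 \<longrightarrow> mdeg m = n)"
  by (auto simp: homog_def mdeg_def in_keys_iff)

lemma homog_0 [simp]: "0 \<in> homog n"
  by (simp add: homog_iff)

lemma homog_add: "f \<in> homog n \<Longrightarrow> g \<in> homog n \<Longrightarrow> f + g \<in> homog n"
  by (auto simp: homog_iff lookup_add) (metis add.right_neutral)

lemma homog_uminus: "f \<in> homog n \<Longrightarrow> - f \<in> homog n"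
  by (auto simp: homog_iff)

lemma homog_diff: "f \<in> homog n \<Longrightarrow> g \<in> homog n \<Longrightarrow> f - g \<in> homog n"
  using homog_add[of f n "- g"] homog_uminus[of g n] by simp

lemma homog_sum: "(\<And>x. x \<in> A \<Longrightarrow> f x \<in> homog n) \<Longrightarrow> sum f A \<in> homog n"
  by (induction A rule: infinite_finite_induct) (auto intro: homog_add)

lemma homog_mult: "f \<in> homog m \<Longrightarrow> g \<in> homog n \<Longrightarrow> f * g \<in> homog (m + n)"
  unfolding homog_def mem_Collect_eq
proof
  fix k assume f: "\<forall>m'\<in>Poly_Mapping.keys f. int (\<Sum>i\<in>UNIV. Poly_Mapping.lookup m' i) = m"
    and g: "\<forall>m\<in>Poly_Mapping.keys g. int (\<Sum>i\<in>UNIV. Poly_Mapping.lookup m i) = n"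
    and k: "k \<in> Poly_Mapping.keys (f * g)"
  obtain a b where "k = a + b" "a \<in> Poly_Mapping.keys f" "b \<in> Poly_Mapping.keys g"
    using keys_mult[of f g] k by auto
  then show "int (\<Sum>i\<in>UNIV. Poly_Mapping.lookup k i) = m + n"
    using f g by (auto simp: lookup_add sum.distrib)
qed

lemma const_homog: "const c \<in> homog 0"
  by (auto simp: const_def homog_iff lookup_single when_def mdeg_def)

lemma one_homog: "1 \<in> homog 0"
  using const_homog[of 1] by simp

lemma var_homog: "var i \<in> homog 1"
  by (auto simp: var_def homog_iff lookup_single when_def mdeg_def simp del: of_nat_sum split: if_splits)

lemma homog_power: "f \<in> homog m \<Longrightarrow> f ^ k \<in> homog (int k * m)"
  by (induction k) (auto simp: one_homog algebra_simps intro: homog_mult)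

lemma homog_negative: "n < 0 \<Longrightarrow> f \<in> homog n \<Longrightarrow> f = 0"
  by (intro poly_mapping_eqI) (metis homog_iff lookup_zero mdeg_nonneg not_less)

definition hcomp :: "int \<Rightarrow> ('n::finite, 'a::comm_ring_1) mvpoly \<Rightarrow> ('n, 'a) mvpoly" where
  "hcomp n f = (\<Sum>m\<in>{m \<in> Poly_Mapping.keys f. mdeg m = n}. Poly_Mapping.single m (Poly_Mapping.lookup f m))"

lemma lookup_hcomp: "Poly_Mapping.lookup (hcomp n f) m = (if mdeg m = n then Poly_Mapping.lookup f m else 0)"
  by (auto simp: hcomp_def lookup_sum lookup_single when_def sum.delta in_keys_iff)

lemma hcomp_homog: "hcomp n f \<in> homog n"
  by (simp add: homog_iff lookup_hcomp)

lemma hcomp_add: "hcomp n (f + g) = hcomp n f + hcomp n g"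
  by (intro poly_mapping_eqI) (simp add: lookup_hcomp lookup_add)

lemma hcomp_0 [simp]: "hcomp n 0 = 0"
  by (intro poly_mapping_eqI) (simp add: lookup_hcomp)

lemma hcomp_sum: "hcomp n (sum f A) = (\<Sum>x\<in>A. hcomp n (f x))"
  by (induction A rule: infinite_finite_induct) (auto simp: hcomp_add)

lemma hcomp_of_homog: "f \<in> homog m \<Longrightarrow> hcomp n f = (if m = n then f else 0)"
  by (intro poly_mapping_eqI) (auto simp: lookup_hcomp homog_iff)

lemma hcomp_single: "hcomp n (Poly_Mapping.single m c) = (if mdeg m = n then Poly_Mapping.single m c else 0)"
  by (intro poly_mapping_eqI) (auto simp: lookup_hcomp lookup_single when_def)

lemma single_homog: "Poly_Mapping.single m c \<in> homog (mdeg m)"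
  by (auto simp: homog_iff lookup_single when_def split: if_splits)

lemma hcomp_mult_homog:
  assumes f: "f \<in> homog m"
  shows "hcomp n (f * g) = f * hcomp (n - m) g"
proof (induction g rule: mvpoly_induct)
  case (single k c)
  have "f * Poly_Mapping.single k c \<in> homog (m + mdeg k)"
    using homog_mult[OF f single_homog] .
  then show ?case by (auto simp: hcomp_of_homog hcomp_single)
next
  case (add g h)
  then show ?case by (simp add: distrib_left hcomp_add)
qed

lemma homog_as_span:
  fixes f :: "('n::finite, 'a::comm_ring_1) mvpoly"
  assumes "f \<in> homog n"
  shows "f = (\<Sum>m\<in>Poly_Mapping.keys f. const (Poly_Mapping.lookup f m) * Poly_Mapping.single m 1)"
    and "Poly_Mapping.keys f \<subseteq> {m. mdeg m = n}"
  using mvpoly_as_sum[of f] assms by (auto simp: const_def mult_single homog_def mdeg_def)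

lemma finite_mdeg: "finite {m :: 'n::finite \<Rightarrow>\<^sub>0 nat. mdeg m = n}"
proof -
  have "{m :: 'n \<Rightarrow>\<^sub>0 nat. mdeg m = n} \<subseteq> Abs_poly_mapping ` {f. \<forall>i. f i \<in> {..nat n}}"
  proof
    fix m :: "'n \<Rightarrow>\<^sub>0 nat" assume "m \<in> {m. mdeg m = n}"
    then have "Poly_Mapping.lookup m i \<le> nat n" for i
      using member_le_sum[of i UNIV "Poly_Mapping.lookup m"] by (auto simp: mdeg_def simp del: of_nat_sum)
    then show "m \<in> Abs_poly_mapping ` {f. \<forall>i. f i \<in> {..nat n}}"
      by (intro image_eqI[of _ _ "Poly_Mapping.lookup m"]) (auto simp: lookup_inverse)
  qed
  moreover have "finite {f :: 'n \<Rightarrow> nat. \<forall>i. f i \<in> {..nat n}}"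
    using finite_set_of_finite_funs[of "UNIV :: 'n set" "{..nat n}" undefined] by auto
  ultimately show ?thesis using finite_surj by blast
qed

section \<open>Vectors over the polynomial ring and degree-preserving linear maps\<close>

type_synonym ('n, 'a) vec = "nat \<Rightarrow> ('n, 'a) mvpoly"

definition smul :: "'r::comm_ring_1 \<Rightarrow> (nat \<Rightarrow> 'r) \<Rightarrow> nat \<Rightarrow> 'r" where
  "smul f v = (\<lambda>b. f * v b)"

lemma smul_apply [simp]: "smul f v b = f * v b"
  by (simp add: smul_def)

lemma cscale_eq_smul: "cscale c v = smul (const c) v"
  by (simp add: cscale_def smul_def)

lemma free_mod_0 [simp]: "0 \<in> free_mod P i"
  by (simp add: free_mod_def)

lemma free_mod_add: "v \<in> free_mod P i \<Longrightarrow> w \<in> free_mod P i \<Longrightarrow> v + w \<in> free_mod P i"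
  and free_mod_diff: "v \<in> free_mod P i \<Longrightarrow> w \<in> free_mod P i \<Longrightarrow> v - w \<in> free_mod P i"
  and free_mod_smul: "v \<in> free_mod P i \<Longrightarrow> smul f v \<in> free_mod P i"
  by (simp_all add: free_mod_def)

lemma free_mod_deg_sub: "v \<in> free_mod_deg P i n \<Longrightarrow> v \<in> free_mod P i"
  by (simp add: free_mod_deg_def)

lemma free_mod_deg_0 [simp]: "0 \<in> free_mod_deg P i n"
  by (simp add: free_mod_deg_def)

lemma free_mod_deg_add: "v \<in> free_mod_deg P i n \<Longrightarrow> w \<in> free_mod_deg P i n \<Longrightarrow> v + w \<in> free_mod_deg P i n"
  and free_mod_deg_diff: "v \<in> free_mod_deg P i n \<Longrightarrow> w \<in> free_mod_deg P i n \<Longrightarrow> v - w \<in> free_mod_deg P i n"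
  by (simp_all add: free_mod_deg_def free_mod_add free_mod_diff homog_add homog_diff)

lemma free_mod_deg_smul:
  assumes "f \<in> homog m" "v \<in> free_mod_deg P i n"
  shows "smul f v \<in> free_mod_deg P i (m + n)"
proof -
  have "f * v b \<in> homog (m + n - gdeg P i b)" if "b < rk P i" for b
    using homog_mult[OF assms(1), of "v b" "n - gdeg P i b"] assms(2) that
    by (simp add: free_mod_deg_def algebra_simps)
  then show ?thesis using assms by (simp add: free_mod_deg_def free_mod_smul)
qed

lemma dmap_0 [simp]: "dmap P i 0 = 0"
  by (simp add: dmap_def fun_eq_iff)

lemma dmap_add: "dmap P i (v + w) = dmap P i v + dmap P i w"
  and dmap_diff: "dmap P i (v - w) = dmap P i v - dmap P i w"
  by (auto simp: dmap_def fun_eq_iff algebra_simps sum.distrib sum_subtractf)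

lemma dmap_smul: "dmap P i (smul f v) = smul f (dmap P i v)"
  by (auto simp: dmap_def fun_eq_iff sum_distrib_left algebra_simps intro!: sum.cong)

lemma augmap_0 [simp]: "augmap P 0 = 0"
  by (simp add: augmap_def)

lemma augmap_add: "augmap P (v + w) = augmap P v + augmap P w"
  and augmap_diff: "augmap P (v - w) = augmap P v - augmap P w"
  by (simp_all add: augmap_def algebra_simps sum.distrib sum_subtractf)

lemma augmap_smul: "augmap P (smul f v) = f * augmap P v"
  by (simp add: augmap_def sum_distrib_left algebra_simps)

lemma dmap_free_mod: "dmap P i v \<in> free_mod P i"
  by (simp add: dmap_def free_mod_def)

text \<open>The linear map that sends the \<open>b\<close>-th basis vector to \<open>c b\<close>.
  Chain maps and homotopies are obtained in this form, one basis vector at a time.\<close>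

definition lext :: "('n::finite, 'a::field) free_seq \<Rightarrow> nat \<Rightarrow> (nat \<Rightarrow> ('n, 'a) vec) \<Rightarrow> ('n, 'a) vec \<Rightarrow> ('n, 'a) vec" where
  "lext P i c v = (\<Sum>b<rk P i. smul (v b) (c b))"

lemma sum_fun_apply: "(\<Sum>x\<in>A. f x) b = (\<Sum>x\<in>A. f x b)"
  by (induction A rule: infinite_finite_induct) auto

lemma lext_apply: "lext P i c v a = (\<Sum>b<rk P i. v b * c b a)"
  by (simp add: lext_def sum_fun_apply)

definition unit_vec :: "nat \<Rightarrow> nat \<Rightarrow> 'r::comm_ring_1" where
  "unit_vec b = (\<lambda>a. if a = b then 1 else 0)"

lemma unit_vec_free_mod_deg:
  assumes "b < rk P i"
  shows "unit_vec b \<in> free_mod_deg P i (gdeg P i b)"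
  using assms by (auto simp: unit_vec_def free_mod_deg_def free_mod_def one_homog)

definition slin :: "((nat \<Rightarrow> 'r::comm_ring_1) \<Rightarrow> (nat \<Rightarrow> 'r)) \<Rightarrow> bool" where
  "slin L \<longleftrightarrow> (\<forall>v w. L (v + w) = L v + L w) \<and> (\<forall>f v. L (smul f v) = smul f (L v))"

lemma slin_add: "slin L \<Longrightarrow> L (v + w) = L v + L w"
  and slin_smul: "slin L \<Longrightarrow> L (smul f v) = smul f (L v)"
  by (simp_all add: slin_def)

lemma slin_0: "slin L \<Longrightarrow> L 0 = 0"
  using slin_add[of L 0 0] by simp

lemma slin_uminus:
  assumes "slin L"
  shows "L (- v) = - L v"
proof -
  have "L (- v) + L v = L (- v + v)" by (rule slin_add[OF assms, symmetric])
  also have "\<dots> = 0" using slin_0[OF assms] by simp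
  finally show ?thesis by (simp add: eq_neg_iff_add_eq_0)
qed

lemma slin_diff:
  assumes "slin L"
  shows "L (v - w) = L v - L w"
  using slin_add[OF assms, of v "- w"] slin_uminus[OF assms, of w] by simp

lemma slin_sum: "slin L \<Longrightarrow> L (\<Sum>x\<in>A. f x) = (\<Sum>x\<in>A. L (f x))"
  by (induction A rule: infinite_finite_induct) (auto simp: slin_0 slin_add)

lemma slin_lext: "slin (lext P i c)"
  by (auto simp: slin_def lext_apply fun_eq_iff algebra_simps sum.distrib sum_distrib_left)

lemma slin_dmap: "slin (dmap P i)"
  by (simp add: slin_def dmap_add dmap_smul)

lemma free_mod_expand:
  assumes "v \<in> free_mod P i"
  shows "v = (\<Sum>b<rk P i. smul (v b) (unit_vec b))"
proof
  fix a
  have "(\<Sum>b<rk P i. smul (v b) (unit_vec b)) a = (\<Sum>b<rk P i. if a = b then v b else 0)"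
    unfolding sum_fun_apply by (rule sum.cong) (auto simp: unit_vec_def)
  then show "v a = (\<Sum>b<rk P i. smul (v b) (unit_vec b)) a"
    using assms by (auto simp: free_mod_def)
qed

lemma slin_eq_lext:
  assumes "slin L" "v \<in> free_mod P i"
  shows "L v = lext P i (\<lambda>b. L (unit_vec b)) v"
proof -
  have "L v = L (\<Sum>b<rk P i. smul (v b) (unit_vec b))" using free_mod_expand[OF assms(2)] by simp
  then show ?thesis by (simp add: slin_sum[OF assms(1)] slin_smul[OF assms(1)] lext_def)
qed

text \<open>Graded homomorphisms of degree 0. They are represented by functions on all sequences, of
  which only the values on \<open>free_mod\<close> count.\<close>

definition gmap :: "('n::finite, 'a::field) free_seq \<Rightarrow> nat \<Rightarrow> ('n, 'a) free_seq \<Rightarrow> nat \<Rightarrow>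
    (('n, 'a) vec \<Rightarrow> ('n, 'a) vec) \<Rightarrow> bool" where
  "gmap P i Q j L \<longleftrightarrow> slin L \<and> (\<forall>v\<in>free_mod P i. L v \<in> free_mod Q j) \<and>
     (\<forall>n. \<forall>v\<in>free_mod_deg P i n. L v \<in> free_mod_deg Q j n)"

lemma gmap_slin: "gmap P i Q j L \<Longrightarrow> slin L"
  and gmap_free_mod: "gmap P i Q j L \<Longrightarrow> v \<in> free_mod P i \<Longrightarrow> L v \<in> free_mod Q j"
  and gmap_free_mod_deg: "gmap P i Q j L \<Longrightarrow> v \<in> free_mod_deg P i n \<Longrightarrow> L v \<in> free_mod_deg Q j n"
  by (simp_all add: gmap_def)

lemma gmap_comp: "gmap Q j R k M \<Longrightarrow> gmap P i Q j L \<Longrightarrow> gmap P i R k (\<lambda>v. M (L v))"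
  by (simp add: gmap_def slin_def)

lemma gmap_diff: "gmap P i Q j L \<Longrightarrow> gmap P i Q j M \<Longrightarrow> gmap P i Q j (\<lambda>v. L v - M v)"
  unfolding gmap_def
  by (auto simp: slin_def fun_eq_iff algebra_simps intro: free_mod_diff free_mod_deg_diff)

lemma gmap_ident: "gmap P i P i (\<lambda>v. v)"
  by (simp add: gmap_def slin_def)

lemma lext_gmap:
  assumes c: "\<And>b. b < rk P i \<Longrightarrow> c b \<in> free_mod_deg Q j (gdeg P i b)"
  shows "gmap P i Q j (lext P i c)"
proof -
  have fm: "lext P i c v \<in> free_mod Q j" for v
    using c by (auto simp: free_mod_def free_mod_deg_def lext_apply)
  have "lext P i c v \<in> free_mod_deg Q j n" if v: "v \<in> free_mod_deg P i n" for v n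
  proof -
    have "lext P i c v a \<in> homog (n - gdeg Q j a)" if a: "a < rk Q j" for a
      unfolding lext_apply
    proof (rule homog_sum)
      fix b assume b: "b \<in> {..<rk P i}"
      then have "v b * c b a \<in> homog ((n - gdeg P i b) + (gdeg P i b - gdeg Q j a))"
        using v c[of b] a by (intro homog_mult) (auto simp: free_mod_deg_def)
      then show "v b * c b a \<in> homog (n - gdeg Q j a)" by simp
    qed
    then show ?thesis using fm by (simp add: free_mod_deg_def)
  qed
  then show ?thesis using fm slin_lext by (simp add: gmap_def)
qed

section \<open>Graded ideals and exactness in a fixed degree\<close>

definition is_ideal :: "('n::finite, 'a::field) mvpoly set \<Rightarrow> bool" where
  "is_ideal J \<longleftrightarrow> 0 \<in> J \<and> (\<forall>f\<in>J. \<forall>g\<in>J. f + g \<in> J) \<and> (\<forall>f\<in>J. \<forall>r. r * f \<in> J)"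

lemma is_ideal_0: "is_ideal J \<Longrightarrow> 0 \<in> J"
  and is_ideal_add: "is_ideal J \<Longrightarrow> f \<in> J \<Longrightarrow> g \<in> J \<Longrightarrow> f + g \<in> J"
  and is_ideal_mult: "is_ideal J \<Longrightarrow> f \<in> J \<Longrightarrow> r * f \<in> J"
  by (simp_all add: is_ideal_def)

lemma is_ideal_uminus: "is_ideal J \<Longrightarrow> f \<in> J \<Longrightarrow> - f \<in> J"
  using is_ideal_mult[of J f "- 1"] by simp

lemma is_ideal_diff: "is_ideal J \<Longrightarrow> f \<in> J \<Longrightarrow> g \<in> J \<Longrightarrow> f - g \<in> J"
  using is_ideal_add[of J f "- g"] is_ideal_uminus[of J g] by simp

lemma is_ideal_sum: "is_ideal J \<Longrightarrow> (\<And>x. x \<in> A \<Longrightarrow> f x \<in> J) \<Longrightarrow> sum f A \<in> J"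
  by (induction A rule: infinite_finite_induct) (auto intro: is_ideal_0 is_ideal_add)

lemma module_mult: "module ((*) :: ('n, 'a::field) mvpoly \<Rightarrow> _)"
  by unfold_locales (auto simp: algebra_simps)

lemma is_ideal_span: "is_ideal (module.span (*) (G :: ('n::finite, 'a::field) mvpoly set))"
proof -
  interpret module "(*) :: ('n, 'a) mvpoly \<Rightarrow> _" by (rule module_mult)
  show ?thesis unfolding is_ideal_def by (auto intro: span_zero span_add span_scale)
qed

definition graded_ideal :: "('n::finite, 'a::field) mvpoly set \<Rightarrow> bool" where
  "graded_ideal J \<longleftrightarrow> is_ideal J \<and> (\<forall>f\<in>J. \<forall>n. hcomp n f \<in> J)"

text \<open>Exactness at \<open>F_0\<close> concerns \<open>augmap\<close> modulo \<open>J\<close>,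
  further up it concerns a differential. Treating both as one predicate allows a single recursion
  over the homological degree.\<close>

definition is_cyc :: "('n::finite, 'a::field) mvpoly set \<Rightarrow> ('n, 'a) free_seq \<Rightarrow> nat \<Rightarrow> ('n, 'a) vec \<Rightarrow> bool" where
  "is_cyc J P i v \<longleftrightarrow> (case i of 0 \<Rightarrow> augmap P v \<in> J | Suc k \<Rightarrow> dmap P k v = 0)"

lemma is_cyc_simps [simp]: "is_cyc J P 0 v \<longleftrightarrow> augmap P v \<in> J" "is_cyc J P (Suc k) v \<longleftrightarrow> dmap P k v = 0"
  by (simp_all add: is_cyc_def)

definition vcomp :: "('n::finite, 'a::field) free_seq \<Rightarrow> nat \<Rightarrow> int \<Rightarrow> ('n, 'a) vec \<Rightarrow> ('n, 'a) vec" where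
  "vcomp P i n v = (\<lambda>b. hcomp (n - gdeg P i b) (v b))"

lemma vcomp_free_mod_deg: "v \<in> free_mod P i \<Longrightarrow> vcomp P i n v \<in> free_mod_deg P i n"
  by (auto simp: vcomp_def free_mod_def free_mod_deg_def hcomp_homog)

lemma vcomp_of_deg:
  assumes "v \<in> free_mod_deg P i n"
  shows "vcomp P i n v = v"
proof
  fix b
  show "vcomp P i n v b = v b"
    using assms by (cases "b < rk P i") (auto simp: vcomp_def free_mod_deg_def free_mod_def hcomp_of_homog)
qed

lemma dmap_vcomp:
  assumes "graded_free_resolution J P"
  shows "dmap P i (vcomp P (Suc i) n v) = vcomp P i n (dmap P i v)"
proof
  fix a
  show "dmap P i (vcomp P (Suc i) n v) a = vcomp P i n (dmap P i v) a"
  proof (cases "a < rk P i")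
    case True
    have "hcomp (n - gdeg P i a) (dmat P i a b * v b) = dmat P i a b * hcomp (n - gdeg P (Suc i) b) (v b)"
      if "b < rk P (Suc i)" for b
    proof -
      have "dmat P i a b \<in> homog (gdeg P (Suc i) b - gdeg P i a)"
        using assms True that by (simp add: graded_free_resolution_def)
      from hcomp_mult_homog[OF this, of "n - gdeg P i a" "v b"] show ?thesis by simp
    qed
    then show ?thesis using True by (simp add: vcomp_def dmap_def hcomp_sum)
  qed (simp add: vcomp_def dmap_def)
qed

lemma gmap_dmap:
  assumes "graded_free_resolution J P"
  shows "gmap P (Suc i) P i (dmap P i)"
  unfolding gmap_def
proof (intro conjI allI ballI)
  fix n v assume v: "v \<in> free_mod_deg P (Suc i) n"
  have "dmap P i v = vcomp P i n (dmap P i v)"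
    using dmap_vcomp[OF assms, of i n v] vcomp_of_deg[OF v] by simp
  also have "\<dots> \<in> free_mod_deg P i n" by (rule vcomp_free_mod_deg[OF dmap_free_mod])
  finally show "dmap P i v \<in> free_mod_deg P i n" .
qed (simp_all add: slin_dmap dmap_free_mod)

text \<open>\<open>graded_free_resolution\<close> asserts exactness for arbitrary vectors. Since the
  differentials are homogeneous, the component of degree \<open>n\<close> of any preimage is again a
  preimage.\<close>

lemma res_exact:
  assumes P: "graded_free_resolution J P" and v: "v \<in> free_mod_deg P i n" "is_cyc J P i v"
  shows "\<exists>w\<in>free_mod_deg P (Suc i) n. dmap P i w = v"
proof -
  have "\<exists>w\<in>free_mod P (Suc i). v = dmap P i w"
    using P v free_mod_deg_sub[OF v(1)] by (cases i) (auto simp: graded_free_resolution_def)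
  then obtain w where w: "w \<in> free_mod P (Suc i)" "v = dmap P i w" by blast
  have "dmap P i (vcomp P (Suc i) n w) = v"
    using dmap_vcomp[OF P, of i n w] vcomp_of_deg[OF v(1)] w(2) by simp
  then show ?thesis using vcomp_free_mod_deg[OF w(1)] by blast
qed

lemma is_cyc_dmap:
  assumes P: "graded_free_resolution J P" and w: "w \<in> free_mod P (Suc i)"
  shows "is_cyc J P i (dmap P i w)"
  using P w dmap_free_mod[of P i w] by (cases i) (auto simp: graded_free_resolution_def)

lemma res_surj:
  assumes P: "graded_free_resolution J P" and J: "graded_ideal J" and f: "f \<in> homog n"
  shows "\<exists>v\<in>free_mod_deg P 0 n. f - augmap P v \<in> J"
proof -
  have "\<forall>f. \<exists>v\<in>free_mod P 0. f - augmap P v \<in> J"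
    using P unfolding graded_free_resolution_def by (elim conjE)
  then obtain v where v: "v \<in> free_mod P 0" "f - augmap P v \<in> J" by blast
  have "hcomp n (augmap P v) = augmap P (vcomp P 0 n v)"
  proof -
    have "hcomp n (aug P b * v b) = aug P b * hcomp (n - gdeg P 0 b) (v b)" if "b < rk P 0" for b
      using P that by (intro hcomp_mult_homog) (auto simp: graded_free_resolution_def)
    then show ?thesis by (simp add: augmap_def hcomp_sum vcomp_def)
  qed
  moreover have "hcomp n (f - augmap P v) = hcomp n f - hcomp n (augmap P v)"
    using hcomp_add[of n "f - augmap P v" "augmap P v"] by (simp add: algebra_simps)
  moreover have "hcomp n (f - augmap P v) \<in> J" using J v(2) by (simp add: graded_ideal_def)
  ultimately have "f - augmap P (vcomp P 0 n v) \<in> J" using hcomp_of_homog[OF f, of n] by simp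
  then show ?thesis using vcomp_free_mod_deg[OF v(1)] by blast
qed

section \<open>Comparison of resolutions\<close>

text \<open>Freeness of the source: a homogeneous preimage is chosen for each basis vector and
  extended linearly.\<close>

lemma lift_gmap:
  assumes Q: "graded_free_resolution J Q" and L: "gmap P i Q j L"
    and cyc: "\<And>v. v \<in> free_mod P i \<Longrightarrow> is_cyc J Q j (L v)"
  shows "\<exists>M. gmap P i Q (Suc j) M \<and> (\<forall>v\<in>free_mod P i. dmap Q j (M v) = L v)"
proof -
  have "\<exists>w. w \<in> free_mod_deg Q (Suc j) (gdeg P i b) \<and> dmap Q j w = L (unit_vec b)"
    if b: "b < rk P i" for b
  proof -
    have "unit_vec b \<in> free_mod_deg P i (gdeg P i b)" by (rule unit_vec_free_mod_deg[OF b])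
    then show ?thesis
      using res_exact[OF Q gmap_free_mod_deg[OF L] cyc[OF free_mod_deg_sub]] by blast
  qed
  then obtain c where c: "\<And>b. b < rk P i \<Longrightarrow> c b \<in> free_mod_deg Q (Suc j) (gdeg P i b)"
    "\<And>b. b < rk P i \<Longrightarrow> dmap Q j (c b) = L (unit_vec b)" by metis
  have "dmap Q j (lext P i c v) = L v" if "v \<in> free_mod P i" for v
  proof -
    have "dmap Q j (lext P i c v) = lext P i (\<lambda>b. L (unit_vec b)) v"
      by (simp add: lext_def slin_sum[OF slin_dmap] dmap_smul c(2))
    then show ?thesis using slin_eq_lext[OF gmap_slin[OF L] that] by simp
  qed
  then show ?thesis using lext_gmap[OF c(1)] by blast
qed

lemma augmap_sum: "augmap P (sum f A) = (\<Sum>x\<in>A. augmap P (f x))"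
  by (induction A rule: infinite_finite_induct)
    (simp_all only: sum.infinite sum.empty sum.insert augmap_0 augmap_add not_False_eq_True)

lemma lift_gmap_aug:
  assumes P: "graded_free_resolution J P" and Q: "graded_free_resolution J Q" and J: "graded_ideal J"
  shows "\<exists>M. gmap P 0 Q 0 M \<and> (\<forall>v\<in>free_mod P 0. augmap P v - augmap Q (M v) \<in> J)"
proof -
  have idl: "is_ideal J" using J by (simp add: graded_ideal_def)
  have "\<exists>w. w \<in> free_mod_deg Q 0 (gdeg P 0 b) \<and> aug P b - augmap Q w \<in> J" if b: "b < rk P 0" for b
  proof -
    have "aug P b \<in> homog (gdeg P 0 b)" using P b by (simp add: graded_free_resolution_def)
    then show ?thesis using res_surj[OF Q J] by blast
  qed
  then obtain c where c: "\<And>b. b < rk P 0 \<Longrightarrow> c b \<in> free_mod_deg Q 0 (gdeg P 0 b)"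
    "\<And>b. b < rk P 0 \<Longrightarrow> aug P b - augmap Q (c b) \<in> J" by metis
  have "augmap P v - augmap Q (lext P 0 c v) \<in> J" for v
  proof -
    have "augmap P v - augmap Q (lext P 0 c v) = (\<Sum>b<rk P 0. v b * (aug P b - augmap Q (c b)))"
      by (simp add: lext_def augmap_sum augmap_smul augmap_def[of P] algebra_simps sum_subtractf)
    then show ?thesis using c(2) by (auto intro!: is_ideal_sum[OF idl] is_ideal_mult[OF idl])
  qed
  then show ?thesis using lext_gmap[OF c(1)] by blast
qed

text \<open>The recursion carries the invariant that cycles go to cycles. Applied to the cycle
  \<open>dmap P i v\<close>, it makes the next lifting possible.\<close>

lemma chain_map_exists:
  assumes P: "graded_free_resolution J P" and Q: "graded_free_resolution J Q" and J: "graded_ideal J"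
  shows "\<exists>\<alpha>. (\<forall>i. gmap P i Q i (\<alpha> i)) \<and> (\<forall>v\<in>free_mod P 0. augmap P v - augmap Q (\<alpha> 0 v) \<in> J) \<and>
    (\<forall>i. \<forall>v\<in>free_mod P (Suc i). dmap Q i (\<alpha> (Suc i) v) = \<alpha> i (dmap P i v))"
proof -
  have idl: "is_ideal J" using J by (simp add: graded_ideal_def)
  let ?A = "\<lambda>i a. gmap P i Q i a \<and> (\<forall>v\<in>free_mod P i. is_cyc J P i v \<longrightarrow> is_cyc J Q i (a v)) \<and>
    (i = 0 \<longrightarrow> (\<forall>v\<in>free_mod P 0. augmap P v - augmap Q (a v) \<in> J))"
  let ?R = "\<lambda>i a a'. \<forall>v\<in>free_mod P (Suc i). dmap Q i (a' v) = a (dmap P i v)"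
  have "\<exists>\<alpha>. \<forall>i. ?A i (\<alpha> i) \<and> ?R i (\<alpha> i) (\<alpha> (Suc i))"
  proof (rule dependent_nat_choice)
    obtain M where M: "gmap P 0 Q 0 M" "\<forall>v\<in>free_mod P 0. augmap P v - augmap Q (M v) \<in> J"
      using lift_gmap_aug[OF P Q J] by blast
    have "augmap Q (M v) \<in> J" if v: "v \<in> free_mod P 0" "augmap P v \<in> J" for v
      using is_ideal_diff[OF idl v(2) bspec[OF M(2) v(1)]] by simp
    then show "\<exists>a. ?A 0 a" using M by auto
  next
    fix a i assume a: "?A i a"
    have "\<exists>M. gmap P (Suc i) Q (Suc i) M \<and> (\<forall>v\<in>free_mod P (Suc i). dmap Q i (M v) = a (dmap P i v))"
    proof (rule lift_gmap[OF Q])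
      show "gmap P (Suc i) Q i (\<lambda>v. a (dmap P i v))" using gmap_comp[OF _ gmap_dmap[OF P]] a by blast
      show "is_cyc J Q i (a (dmap P i v))" if "v \<in> free_mod P (Suc i)" for v
        using a is_cyc_dmap[OF P that] dmap_free_mod by blast
    qed
    then obtain M where M: "gmap P (Suc i) Q (Suc i) M" "\<forall>v\<in>free_mod P (Suc i). dmap Q i (M v) = a (dmap P i v)"
      by blast
    have "is_cyc J Q (Suc i) (M v)" if "v \<in> free_mod P (Suc i)" "is_cyc J P (Suc i) v" for v
      using M(2) that slin_0[OF gmap_slin[of P i Q i a]] a by simp
    then show "\<exists>y. ?A (Suc i) y \<and> ?R i a y" using M by auto
  qed
  then obtain \<alpha> where \<alpha>: "\<forall>i. ?A i (\<alpha> i) \<and> ?R i (\<alpha> i) (\<alpha> (Suc i))" by (rule exE)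
  show ?thesis by (rule exI[of _ \<alpha>]) (use \<alpha> in simp)
qed

text \<open>Meant for the difference of the identity and a round trip between two resolutions, which
  induces zero on \<open>S / J\<close>. The invariant says that \<open>s i\<close> already lifts
  \<open>g i\<close> on cycles; therefore \<open>g (Suc i) v - s i (dmap P i v)\<close> is a cycle
  and can be lifted.\<close>

lemma homotopy_exists:
  assumes P: "graded_free_resolution J P"
    and g: "\<And>i. gmap P i P i (g i)" "\<And>v. v \<in> free_mod P 0 \<Longrightarrow> augmap P (g 0 v) \<in> J"
    "\<And>i v. v \<in> free_mod P (Suc i) \<Longrightarrow> dmap P i (g (Suc i) v) = g i (dmap P i v)"
  shows "\<exists>s. (\<forall>i. gmap P i P (Suc i) (s i)) \<and>
    (\<forall>i. \<forall>v\<in>free_mod P (Suc i). dmap P (Suc i) (s (Suc i) v) = g (Suc i) v - s i (dmap P i v))"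
proof -
  let ?A = "\<lambda>i a. gmap P i P (Suc i) a \<and> (\<forall>v\<in>free_mod P i. is_cyc J P i v \<longrightarrow> dmap P i (a v) = g i v)"
  let ?R = "\<lambda>i a a'. \<forall>v\<in>free_mod P (Suc i). dmap P (Suc i) (a' v) = g (Suc i) v - a (dmap P i v)"
  have "\<exists>s. \<forall>i. ?A i (s i) \<and> ?R i (s i) (s (Suc i))"
  proof (rule dependent_nat_choice)
    have "\<exists>M. gmap P 0 P (Suc 0) M \<and> (\<forall>v\<in>free_mod P 0. dmap P 0 (M v) = g 0 v)"
      by (rule lift_gmap[OF P g(1)]) (simp add: g(2))
    then show "\<exists>a. ?A 0 a" by auto
  next
    fix a i assume a: "?A i a"
    have "\<exists>M. gmap P (Suc i) P (Suc (Suc i)) M \<and>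
      (\<forall>v\<in>free_mod P (Suc i). dmap P (Suc i) (M v) = g (Suc i) v - a (dmap P i v))"
    proof (rule lift_gmap[OF P])
      show "gmap P (Suc i) P (Suc i) (\<lambda>v. g (Suc i) v - a (dmap P i v))"
        using gmap_diff[OF g(1) gmap_comp[OF _ gmap_dmap[OF P]]] a by blast
      show "is_cyc J P (Suc i) (g (Suc i) v - a (dmap P i v))" if v: "v \<in> free_mod P (Suc i)" for v
        using a is_cyc_dmap[OF P v] dmap_free_mod[of P i v] g(3)[OF v] by (simp add: dmap_diff)
    qed
    then obtain M where M: "gmap P (Suc i) P (Suc (Suc i)) M"
      "\<forall>v\<in>free_mod P (Suc i). dmap P (Suc i) (M v) = g (Suc i) v - a (dmap P i v)" by blast
    have "dmap P (Suc i) (M v) = g (Suc i) v" if "v \<in> free_mod P (Suc i)" "is_cyc J P (Suc i) v" for v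
      using M(2) that slin_0[OF gmap_slin[of P i P "Suc i" a]] a by simp
    then show "\<exists>y. ?A (Suc i) y \<and> ?R i a y" using M by auto
  qed
  then obtain s where s: "\<forall>i. ?A i (s i) \<and> ?R i (s i) (s (Suc i))" by (rule exE)
  show ?thesis by (rule exI[of _ s]) (use s in simp)
qed

section \<open>Independence of Tor from the resolution\<close>

interpretation cs: vector_space "cscale :: 'a::field \<Rightarrow> ('n, 'a) vec \<Rightarrow> ('n, 'a) vec"
  by (rule vector_space_cscale)

lemma slin_linear:
  fixes L :: "('n, 'a::field) vec \<Rightarrow> ('n, 'a) vec"
  assumes "slin L"
  shows "Vector_Spaces.linear cscale cscale L"
  by unfold_locales (simp_all add: cscale_eq_smul slin_add[OF assms] slin_smul[OF assms])

lemma free_mod_deg_subspace: "module.subspace cscale (free_mod_deg P i n)"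
  by (rule cs.subspaceI)
    (use free_mod_deg_smul[OF const_homog] in \<open>auto simp: cscale_eq_smul free_mod_deg_add\<close>)

lemma fin_dim_free_mod_deg:
  fixes P :: "('n::finite, 'a::field) free_seq"
  shows "fin_dim cscale (free_mod_deg P i n)"
proof -
  let ?T = "Sigma {..<rk P i} (\<lambda>b. {m :: 'n \<Rightarrow>\<^sub>0 nat. mdeg m = n - gdeg P i b})"
  let ?g = "\<lambda>(b, m). smul (Poly_Mapping.single m (1::'a)) (unit_vec b)"
  have "finite (?g ` ?T)" by (intro finite_imageI finite_SigmaI finite_mdeg) simp
  moreover have "v \<in> cs.span (?g ` ?T)" if v: "v \<in> free_mod_deg P i n" for v
  proof -
    have "smul (v b) (unit_vec b) \<in> cs.span (?g ` ?T)" if b: "b < rk P i" for b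
    proof -
      have h: "v b \<in> homog (n - gdeg P i b)" using v b by (simp add: free_mod_deg_def)
      have "smul (v b) (unit_vec b) = (\<Sum>m\<in>Poly_Mapping.keys (v b).
          cscale (Poly_Mapping.lookup (v b) m) (smul (Poly_Mapping.single m 1) (unit_vec b)))"
      proof
        fix a
        show "smul (v b) (unit_vec b) a = (\<Sum>m\<in>Poly_Mapping.keys (v b).
          cscale (Poly_Mapping.lookup (v b) m) (smul (Poly_Mapping.single m 1) (unit_vec b))) a"
        proof (cases "a = b")
          case True
          have "smul (v b) (unit_vec b) a = v b" using True by (simp add: unit_vec_def)
          also have "\<dots> = (\<Sum>m\<in>Poly_Mapping.keys (v b). const (Poly_Mapping.lookup (v b) m) * Poly_Mapping.single m 1)"
            by (rule homog_as_span(1)[OF h])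
          also have "\<dots> = (\<Sum>m\<in>Poly_Mapping.keys (v b).
            cscale (Poly_Mapping.lookup (v b) m) (smul (Poly_Mapping.single m 1) (unit_vec b))) a"
            using True by (simp add: sum_fun_apply cscale_def unit_vec_def)
          finally show ?thesis .
        qed (simp add: sum_fun_apply cscale_def unit_vec_def)
      qed
      also have "\<dots> \<in> cs.span (?g ` ?T)"
      proof (intro cs.span_sum cs.span_scale cs.span_base)
        fix m assume "m \<in> Poly_Mapping.keys (v b)"
        then have "(b, m) \<in> ?T" using homog_as_span(2)[OF h] b by auto
        then show "smul (Poly_Mapping.single m 1) (unit_vec b) \<in> ?g ` ?T"
          by (rule rev_image_eqI) simp
      qed
      finally show ?thesis .
    qed
    then have "(\<Sum>b<rk P i. smul (v b) (unit_vec b)) \<in> cs.span (?g ` ?T)"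
      by (intro cs.span_sum) auto
    then show ?thesis using free_mod_expand[OF free_mod_deg_sub[OF v]] by simp
  qed
  ultimately show ?thesis using free_mod_deg_subspace unfolding fin_dim_def by blast
qed

lemma tensor_cycles_subspace:
  assumes I: "is_ideal I"
  shows "module.subspace cscale (tensor_cycles P I i n)"
proof (rule cs.subspaceI)
  show "0 \<in> tensor_cycles P I i n"
    by (auto simp: tensor_cycles_def is_ideal_0[OF I] split: nat.split)
  show "v + w \<in> tensor_cycles P I i n" if "v \<in> tensor_cycles P I i n" "w \<in> tensor_cycles P I i n" for v w
    using that by (auto simp: tensor_cycles_def free_mod_deg_add dmap_add is_ideal_add[OF I] split: nat.splits)
  show "cscale c v \<in> tensor_cycles P I i n" if "v \<in> tensor_cycles P I i n" for c v
    using that free_mod_deg_smul[OF const_homog, of v P i n c]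
    by (auto simp: tensor_cycles_def cscale_eq_smul dmap_smul is_ideal_mult[OF I] split: nat.splits)
qed

lemma tensor_boundariesI:
  "v \<in> free_mod_deg P i n \<Longrightarrow> w \<in> free_mod_deg P (Suc i) n \<Longrightarrow> (\<And>a. v a - dmap P i w a \<in> I) \<Longrightarrow>
    v \<in> tensor_boundaries P I i n"
  by (auto simp: tensor_boundaries_def)

lemma tensor_boundaries_subspace:
  assumes I: "is_ideal I"
  shows "module.subspace cscale (tensor_boundaries P I i n)"
proof (rule cs.subspaceI)
  show "0 \<in> tensor_boundaries P I i n"
    by (auto simp: tensor_boundaries_def is_ideal_0[OF I] intro!: bexI[of _ 0])
next
  fix v w assume vw: "v \<in> tensor_boundaries P I i n" "w \<in> tensor_boundaries P I i n"
  then obtain v' w' where v': "v' \<in> free_mod_deg P (Suc i) n" "\<forall>a. v a - dmap P i v' a \<in> I"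
    and w': "w' \<in> free_mod_deg P (Suc i) n" "\<forall>a. w a - dmap P i w' a \<in> I"
    by (auto simp: tensor_boundaries_def)
  have "(v + w) a - dmap P i (v' + w') a \<in> I" for a
    using is_ideal_add[OF I v'(2)[rule_format, of a] w'(2)[rule_format, of a]]
    by (simp add: dmap_add algebra_simps)
  then show "v + w \<in> tensor_boundaries P I i n"
    using vw free_mod_deg_add[OF v'(1) w'(1)] by (auto simp: tensor_boundaries_def free_mod_deg_add)
next
  fix c v assume v: "v \<in> tensor_boundaries P I i n"
  then obtain v' where v': "v' \<in> free_mod_deg P (Suc i) n" "\<forall>a. v a - dmap P i v' a \<in> I"
    by (auto simp: tensor_boundaries_def)
  have "smul (const c) v a - dmap P i (smul (const c) v') a \<in> I" for a
    using is_ideal_mult[OF I v'(2)[rule_format, of a], of "const c"]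
    by (simp add: dmap_smul algebra_simps)
  then show "cscale c v \<in> tensor_boundaries P I i n"
    using v free_mod_deg_smul[OF const_homog, of v P i n c] free_mod_deg_smul[OF const_homog v'(1), of c]
    by (auto simp: tensor_boundaries_def cscale_eq_smul)
qed

lemma fin_dim_tensor_cycles:
  assumes I: "is_ideal I"
  shows "fin_dim cscale (tensor_cycles P I i n)"
  by (rule fin_dim_subset[OF fin_dim_free_mod_deg[of P i n] tensor_cycles_subspace[OF I]])
    (simp add: tensor_cycles_def)

lemma dmap_in_ideal: "is_ideal I \<Longrightarrow> (\<And>a. v a \<in> I) \<Longrightarrow> dmap P i v a \<in> I"
  by (auto simp: dmap_def is_ideal_0 intro!: is_ideal_sum is_ideal_mult)

lemma slin_in_ideal:
  assumes I: "is_ideal I" and L: "slin L" and v: "v \<in> free_mod P i" "\<And>a. v a \<in> I"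
  shows "L v a \<in> I"
proof -
  have "v b * L (unit_vec b) a \<in> I" for b
    using is_ideal_mult[OF I v(2)[of b], of "L (unit_vec b) a"] by (simp add: mult.commute)
  then show ?thesis
    using slin_eq_lext[OF L v(1)] by (simp add: lext_apply is_ideal_sum[OF I])
qed

lemma tensor_boundaries_sub_cycles:
  assumes P: "graded_free_resolution J P" and I: "is_ideal I"
  shows "tensor_boundaries P I (Suc i) n \<subseteq> tensor_cycles P I (Suc i) n"
proof
  fix v assume "v \<in> tensor_boundaries P I (Suc i) n"
  then obtain w where v: "v \<in> free_mod_deg P (Suc i) n" and w: "w \<in> free_mod_deg P (Suc (Suc i)) n"
    "\<forall>a. v a - dmap P (Suc i) w a \<in> I" by (auto simp: tensor_boundaries_def)
  have "dmap P i (dmap P (Suc i) w) = 0" using is_cyc_dmap[OF P free_mod_deg_sub[OF w(1)]] by simp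
  then have eq: "dmap P i v = dmap P i (v - dmap P (Suc i) w)" by (simp add: dmap_diff)
  have "dmap P i v a \<in> I" for a unfolding eq by (rule dmap_in_ideal[OF I]) (simp add: w(2))
  then show "v \<in> tensor_cycles P I (Suc i) n" using v by (simp add: tensor_cycles_def)
qed

text \<open>The chain map \<open>\<alpha>\<close> induces an injection on the homology with
  coefficients in \<open>S / I\<close>, because \<open>\<beta>\<close> after \<open>\<alpha>\<close>
  is homotopic to the identity. The inequality is additive since \<open>tor_dim\<close> subtracts
  natural numbers.\<close>

lemma tor_le:
  assumes P: "graded_free_resolution J P" and Q: "graded_free_resolution J Q" and J: "graded_ideal J"
    and I: "is_ideal I"
  shows "vector_space.dim cscale (tensor_cycles P I (Suc i) n) + vector_space.dim cscale (tensor_boundaries Q I (Suc i) n)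
    \<le> vector_space.dim cscale (tensor_cycles Q I (Suc i) n) + vector_space.dim cscale (tensor_boundaries P I (Suc i) n)"
proof -
  obtain \<alpha> where \<alpha>: "\<And>i. gmap P i Q i (\<alpha> i)" "\<And>v. v \<in> free_mod P 0 \<Longrightarrow> augmap P v - augmap Q (\<alpha> 0 v) \<in> J"
    "\<And>i v. v \<in> free_mod P (Suc i) \<Longrightarrow> dmap Q i (\<alpha> (Suc i) v) = \<alpha> i (dmap P i v)"
    using chain_map_exists[OF P Q J] by blast
  obtain \<beta> where \<beta>: "\<And>i. gmap Q i P i (\<beta> i)" "\<And>v. v \<in> free_mod Q 0 \<Longrightarrow> augmap Q v - augmap P (\<beta> 0 v) \<in> J"
    "\<And>i v. v \<in> free_mod Q (Suc i) \<Longrightarrow> dmap P i (\<beta> (Suc i) v) = \<beta> i (dmap Q i v)"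
    using chain_map_exists[OF Q P J] by blast
  have idl: "is_ideal J" using J by (simp add: graded_ideal_def)
  define g where "g i v = \<beta> i (\<alpha> i v) - v" for i v
  have "\<exists>s. (\<forall>i. gmap P i P (Suc i) (s i)) \<and>
    (\<forall>i. \<forall>v\<in>free_mod P (Suc i). dmap P (Suc i) (s (Suc i) v) = g (Suc i) v - s i (dmap P i v))"
  proof (rule homotopy_exists[OF P])
    show "gmap P i P i (g i)" for i
      unfolding g_def by (rule gmap_diff[OF gmap_comp[OF \<beta>(1) \<alpha>(1)] gmap_ident])
    show "augmap P (g 0 v) \<in> J" if v: "v \<in> free_mod P 0" for v
    proof -
      have "augmap P (g 0 v) = - ((augmap P v - augmap Q (\<alpha> 0 v)) + (augmap Q (\<alpha> 0 v) - augmap P (\<beta> 0 (\<alpha> 0 v))))"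
        by (simp add: g_def augmap_diff)
      then show ?thesis
        using is_ideal_uminus[OF idl is_ideal_add[OF idl \<alpha>(2)[OF v] \<beta>(2)[OF gmap_free_mod[OF \<alpha>(1) v]]]] by simp
    qed
    show "dmap P i (g (Suc i) v) = g i (dmap P i v)" if v: "v \<in> free_mod P (Suc i)" for i v
      using \<alpha>(3)[OF v] \<beta>(3)[OF gmap_free_mod[OF \<alpha>(1) v]] by (simp add: g_def dmap_diff)
  qed
  then obtain s where s: "\<And>i. gmap P i P (Suc i) (s i)"
    "\<And>i v. v \<in> free_mod P (Suc i) \<Longrightarrow> dmap P (Suc i) (s (Suc i) v) = g (Suc i) v - s i (dmap P i v)"
    by blast
  interpret vp: vector_space_pair "cscale :: 'b \<Rightarrow> ('a, 'b) vec \<Rightarrow> _" "cscale :: 'b \<Rightarrow> ('a, 'b) vec \<Rightarrow> _" ..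
  have cyc: "\<alpha> (Suc i) v \<in> tensor_cycles Q I (Suc i) n" if v: "v \<in> tensor_cycles P I (Suc i) n" for v
  proof -
    have vd: "v \<in> free_mod_deg P (Suc i) n" and d: "\<And>a. dmap P i v a \<in> I"
      using v by (auto simp: tensor_cycles_def)
    show ?thesis
      using \<alpha>(3)[OF free_mod_deg_sub[OF vd]] gmap_free_mod_deg[OF \<alpha>(1) vd]
        slin_in_ideal[OF I gmap_slin[OF \<alpha>(1)] dmap_free_mod d] by (simp add: tensor_cycles_def)
  qed
  show ?thesis
  proof (rule vp.dim_quotient_le[OF slin_linear[OF gmap_slin[OF \<alpha>(1)[of "Suc i"]]]])
    show "fin_dim cscale (tensor_cycles P I (Suc i) n)" "fin_dim cscale (tensor_cycles Q I (Suc i) n)"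
      by (rule fin_dim_tensor_cycles[OF I])+
    show "\<alpha> (Suc i) ` tensor_cycles P I (Suc i) n \<subseteq> tensor_cycles Q I (Suc i) n"
      by (rule image_subsetI) (rule cyc)
    show "tensor_boundaries P I (Suc i) n \<subseteq> tensor_cycles P I (Suc i) n"
      by (rule tensor_boundaries_sub_cycles[OF P I])
    show "tensor_boundaries Q I (Suc i) n \<subseteq> tensor_cycles Q I (Suc i) n"
      by (rule tensor_boundaries_sub_cycles[OF Q I])
    fix z assume z: "z \<in> tensor_cycles P I (Suc i) n"
    then have zd: "z \<in> free_mod_deg P (Suc i) n" and dz: "\<And>a. dmap P i z a \<in> I"
      by (auto simp: tensor_cycles_def)
    show "\<alpha> (Suc i) z \<in> tensor_boundaries Q I (Suc i) n \<longleftrightarrow> z \<in> tensor_boundaries P I (Suc i) n"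
    proof
      assume "z \<in> tensor_boundaries P I (Suc i) n"
      then obtain w where w: "w \<in> free_mod_deg P (Suc (Suc i)) n" "\<And>a. z a - dmap P (Suc i) w a \<in> I"
        by (auto simp: tensor_boundaries_def)
      have eq: "\<alpha> (Suc i) z - dmap Q (Suc i) (\<alpha> (Suc (Suc i)) w) = \<alpha> (Suc i) (z - dmap P (Suc i) w)"
        using \<alpha>(3)[OF free_mod_deg_sub[OF w(1)]] slin_diff[OF gmap_slin[OF \<alpha>(1)]] by simp
      have "\<alpha> (Suc i) (z - dmap P (Suc i) w) a \<in> I" for a
        by (rule slin_in_ideal[OF I gmap_slin[OF \<alpha>(1)], of _ P "Suc i"])
          (use w(2) free_mod_diff[OF free_mod_deg_sub[OF zd] dmap_free_mod] in auto)
      then have "\<alpha> (Suc i) z a - dmap Q (Suc i) (\<alpha> (Suc (Suc i)) w) a \<in> I" for a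
        using fun_cong[OF eq, of a] by simp
      then show "\<alpha> (Suc i) z \<in> tensor_boundaries Q I (Suc i) n"
        by (rule tensor_boundariesI[OF gmap_free_mod_deg[OF \<alpha>(1) zd] gmap_free_mod_deg[OF \<alpha>(1) w(1)]])
    next
      assume "\<alpha> (Suc i) z \<in> tensor_boundaries Q I (Suc i) n"
      then obtain w where w: "w \<in> free_mod_deg Q (Suc (Suc i)) n" "\<And>a. \<alpha> (Suc i) z a - dmap Q (Suc i) w a \<in> I"
        by (auto simp: tensor_boundaries_def)
      \<comment> \<open>The homotopy reads \<beta>(\<alpha> z) - z = d (s z) + s (d z). Moving the
        boundaries \<beta>(d w) and d (s z) to the left leaves \<open>\<beta>\<close> of a vector
        with entries in \<open>I\<close>, and s (d z), whose entries lie in \<open>I\<close> because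
        \<open>z\<close> is a cycle modulo \<open>I\<close>.\<close>
      let ?w = "\<beta> (Suc (Suc i)) w - s (Suc i) z"
      have "z - dmap P (Suc i) ?w
        = (\<beta> (Suc i) (\<alpha> (Suc i) z) - \<beta> (Suc i) (dmap Q (Suc i) w)) - s i (dmap P i z)"
        using s(2)[OF free_mod_deg_sub[OF zd]] \<beta>(3)[OF free_mod_deg_sub[OF w(1)]]
        by (simp add: dmap_diff g_def)
      then have eq: "z - dmap P (Suc i) ?w = \<beta> (Suc i) (\<alpha> (Suc i) z - dmap Q (Suc i) w) - s i (dmap P i z)"
        by (simp add: slin_diff[OF gmap_slin[OF \<beta>(1)]])
      have m1: "\<beta> (Suc i) (\<alpha> (Suc i) z - dmap Q (Suc i) w) a \<in> I" for a
        by (rule slin_in_ideal[OF I gmap_slin[OF \<beta>(1)], of _ Q "Suc i"])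
          (use w(2) free_mod_diff[OF gmap_free_mod[OF \<alpha>(1) free_mod_deg_sub[OF zd]] dmap_free_mod] in auto)
      have m2: "s i (dmap P i z) a \<in> I" for a
        by (rule slin_in_ideal[OF I gmap_slin[OF s(1)] dmap_free_mod dz])
      have m3: "z a - dmap P (Suc i) ?w a \<in> I" for a
        using is_ideal_diff[OF I m1[of a] m2[of a]] fun_cong[OF eq, of a] by simp
      have "?w \<in> free_mod_deg P (Suc (Suc i)) n"
        by (rule free_mod_deg_diff[OF gmap_free_mod_deg[OF \<beta>(1) w(1)] gmap_free_mod_deg[OF s(1) zd]])
      then show "z \<in> tensor_boundaries P I (Suc i) n"
        by (rule tensor_boundariesI[OF zd _ m3])
    qed
  qed (rule tensor_boundaries_subspace[OF I])+
qed

text \<open>Frees \<open>tor_dim\<close> from the resolution chosen by \<open>SOME\<close>: the two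
  inequalities give equality of cross sums, hence of the truncated differences.\<close>

theorem tor_dim_eq:
  assumes Q: "graded_free_resolution J Q" and J: "graded_ideal J" and I: "is_ideal I"
  shows "tor_dim J I (Suc i) n = vector_space.dim cscale (tensor_cycles Q I (Suc i) n) -
     vector_space.dim cscale (tensor_boundaries Q I (Suc i) n)"
proof -
  define P where "P = (SOME P. graded_free_resolution J P)"
  have P: "graded_free_resolution J P" unfolding P_def using Q by (rule someI)
  have "tor_dim J I (Suc i) n = vector_space.dim cscale (tensor_cycles P I (Suc i) n) -
     vector_space.dim cscale (tensor_boundaries P I (Suc i) n)"
    by (simp add: tor_dim_def P_def Let_def)
  then show ?thesis
    using tor_le[OF P Q J I, of i n] tor_le[OF Q P J I, of i n] by arith
qed

subsection \<open>Mapping cones and Koszul complexes\<close>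

text \<open>\<open>vlo\<close> and \<open>vhi\<close> are the two blocks of a vector cut at position
  \<open>r\<close>, that is, its components in the two summands of a mapping cone;
  \<open>vjoin\<close> reassembles them.\<close>

definition vlo :: "nat \<Rightarrow> (nat \<Rightarrow> 'r::comm_ring_1) \<Rightarrow> nat \<Rightarrow> 'r" where
  "vlo r w = (\<lambda>b. if b < r then w b else 0)"

definition vhi :: "nat \<Rightarrow> (nat \<Rightarrow> 'r::comm_ring_1) \<Rightarrow> nat \<Rightarrow> 'r" where
  "vhi r w = (\<lambda>b. w (b + r))"

definition vjoin :: "nat \<Rightarrow> (nat \<Rightarrow> 'r::comm_ring_1) \<Rightarrow> (nat \<Rightarrow> 'r) \<Rightarrow> nat \<Rightarrow> 'r" where
  "vjoin r u v = (\<lambda>b. if b < r then u b else v (b - r))"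

lemma vjoin_lo_hi: "vjoin r (vlo r w) (vhi r w) = w"
  by (auto simp: vjoin_def vlo_def vhi_def fun_eq_iff)

lemma vhi_vjoin [simp]: "vhi r (vjoin r u v) = v"
  by (auto simp: vjoin_def vhi_def fun_eq_iff)

lemma vlo_vjoin [simp]: "vlo r (vjoin r u v) = vlo r u"
  by (auto simp: vjoin_def vlo_def fun_eq_iff)

lemma vlo_vjoin_eq: "(\<And>b. r \<le> b \<Longrightarrow> u b = 0) \<Longrightarrow> vlo r (vjoin r u v) = u"
  by (auto simp: vjoin_def vlo_def fun_eq_iff)

lemma vlo_id: "(\<And>b. r \<le> b \<Longrightarrow> u b = 0) \<Longrightarrow> vlo r u = u"
  by (auto simp: vlo_def fun_eq_iff)

lemma vlo_add: "vlo r (v + w) = vlo r v + vlo r w" and vhi_add: "vhi r (v + w) = vhi r v + vhi r w"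
  and vlo_smul: "vlo r (smul f v) = smul f (vlo r v)" and vhi_smul: "vhi r (smul f v) = smul f (vhi r v)"
  and vlo_0 [simp]: "vlo r 0 = 0" and vhi_0 [simp]: "vhi r 0 = 0"
  by (auto simp: vlo_def vhi_def fun_eq_iff)

lemma vjoin_add: "vjoin r (u + u') (v + v') = vjoin r u v + vjoin r u' v'"
  and vjoin_smul: "vjoin r (smul f u) (smul f v) = smul f (vjoin r u v)"
  and vjoin_0 [simp]: "vjoin r 0 0 = 0"
  by (auto simp: vjoin_def fun_eq_iff)

lemma smul_add: "smul f (v + w) = smul f v + smul f w" and smul_0 [simp]: "smul f 0 = 0"
  and smul_zero [simp]: "smul 0 v = 0" and smul_uminus: "smul (- f) v = - smul f v"
  and smul_smul: "smul f (smul g v) = smul (f * g) v" and smul_one [simp]: "smul 1 v = v"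
  by (auto simp: fun_eq_iff algebra_simps)

text \<open>The Koszul differentials of a sequence, built as iterated mapping cones: the kchains of
  \<open>y # ys\<close> in homological degree \<open>i\<close> are those of \<open>ys\<close> in degree \<open>i\<close>, followed by those in
  degree \<open>i - 1\<close>.\<close>

fun kd :: "'r::comm_ring_1 list \<Rightarrow> nat \<Rightarrow> (nat \<Rightarrow> 'r) \<Rightarrow> (nat \<Rightarrow> 'r)" where
  "kd [] i w = 0"
| "kd (y # ys) i w = vjoin (length ys choose i)
     (kd ys i (vlo (length ys choose Suc i) w) + smul ((- 1) ^ i * y) (vhi (length ys choose Suc i) w))
     (case i of 0 \<Rightarrow> 0 | Suc k \<Rightarrow> kd ys k (vhi (length ys choose Suc i) w))"

definition kchains :: "'r::comm_ring_1 list \<Rightarrow> nat \<Rightarrow> (nat \<Rightarrow> 'r) set" where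
  "kchains ys i = {w. \<forall>b\<ge>length ys choose i. w b = 0}"

lemma kd_add: "kd ys i (v + w) = kd ys i v + kd ys i w"
  by (induction ys arbitrary: i v w)
    (simp_all add: vlo_add vhi_add smul_add vjoin_add[symmetric] algebra_simps split: nat.split)

lemma kd_smul: "kd ys i (smul f v) = smul f (kd ys i v)"
  by (induction ys arbitrary: i v)
    (simp_all add: vlo_smul vhi_smul smul_add smul_smul vjoin_smul[symmetric] mult.commute split: nat.split)

lemma slin_kd: "slin (kd ys i)"
  by (simp add: slin_def kd_add kd_smul)

lemma kd_0 [simp]: "kd ys i 0 = 0"
  using slin_0[OF slin_kd] .

text \<open>With \<open>h = phi\<close> this moves the Tor computation from the polynomial ring to
  the Cox ring; it is the reason for defining \<open>kd\<close> over any commutative ring.\<close>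

lemma kd_hom:
  assumes h: "rhom h"
  shows "(\<lambda>b. h (kd ys i w b)) = kd (map h ys) i (\<lambda>b. h (w b))"
proof (induction ys arbitrary: i w)
  case Nil
  then show ?case by (simp add: rhom_0[OF h] fun_eq_iff)
next
  case (Cons y ys)
  have lo: "(\<lambda>b. h (vlo r w b)) = vlo r (\<lambda>b. h (w b))" and hi: "(\<lambda>b. h (vhi r w b)) = vhi r (\<lambda>b. h (w b))" for r
    by (auto simp: vlo_def vhi_def rhom_0[OF h])
  have IH: "h (kd ys i w b) = kd (map h ys) i (\<lambda>b. h (w b)) b" for i w b
    using fun_cong[OF Cons.IH] .
  show ?case
    by (rule ext, cases i)
      (auto simp: vjoin_def IH lo hi rhom_add[OF h] rhom_mult[OF h] rhom_power[OF h] rhom_uminus[OF h] rhom_diff[OF h]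
        rhom_1[OF h] rhom_0[OF h] vhi_def)
qed

lemma kd_kchains: "kd ys i w \<in> kchains ys i"
proof (induction ys arbitrary: i w)
  case (Cons y ys)
  have "kd ys k v b = 0" if "length ys choose k \<le> b" for k v b
    using Cons.IH[of k v] that by (simp add: kchains_def)
  then show ?case by (cases i) (auto simp: kchains_def vjoin_def)
qed (simp add: kchains_def)

lemma vhi_kchains: "w \<in> kchains (y # ys) (Suc i) \<Longrightarrow> vhi (length ys choose Suc i) w \<in> kchains ys i"
  by (auto simp: kchains_def vhi_def)

lemma vlo_kchains: "vlo (length ys choose i) w \<in> kchains ys i"
  by (auto simp: kchains_def vlo_def)

lemma vjoin_kchains: "v \<in> kchains ys i \<Longrightarrow> vjoin (length ys choose Suc i) u v \<in> kchains (y # ys) (Suc i)"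
  by (auto simp: kchains_def vjoin_def)

lemma kchains_0: "0 \<in> kchains ys i"
  and kchains_add: "v \<in> kchains ys i \<Longrightarrow> w \<in> kchains ys i \<Longrightarrow> v + w \<in> kchains ys i"
  and kchains_diff: "v \<in> kchains ys i \<Longrightarrow> w \<in> kchains ys i \<Longrightarrow> v - w \<in> kchains ys i"
  and kchains_smul: "v \<in> kchains ys i \<Longrightarrow> smul f v \<in> kchains ys i"
  by (auto simp: kchains_def)

lemma kd_vjoin:
  assumes "u \<in> kchains ys (Suc i)"
  shows "kd (y # ys) i (vjoin (length ys choose Suc i) u v) = vjoin (length ys choose i)
     (kd ys i u + smul ((- 1) ^ i * y) v) (case i of 0 \<Rightarrow> 0 | Suc k \<Rightarrow> kd ys k v)"
  using assms by (cases i) (simp_all add: vlo_id kchains_def)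

lemma kd_kd:
  assumes "w \<in> kchains ys (Suc (Suc i))"
  shows "kd ys i (kd ys (Suc i) w) = 0"
  using assms
proof (induction ys arbitrary: i w)
  case (Cons y ys)
  define u where "u = vlo (length ys choose Suc (Suc i)) w"
  define v where "v = vhi (length ys choose Suc (Suc i)) w"
  have uv: "u \<in> kchains ys (Suc (Suc i))" "v \<in> kchains ys (Suc i)"
    using Cons.prems by (simp_all add: u_def v_def vlo_kchains vhi_kchains)
  have c: "kd ys (Suc i) u + smul ((- 1) ^ Suc i * y) v \<in> kchains ys (Suc i)"
    by (intro kchains_add kchains_smul kd_kchains uv)
  have d1: "kd (y # ys) (Suc i) w = vjoin (length ys choose Suc i) (kd ys (Suc i) u + smul ((- 1) ^ Suc i * y) v) (kd ys i v)"
    by (simp add: u_def v_def)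
  have d2: "(case i of 0 \<Rightarrow> 0 | Suc k \<Rightarrow> kd ys k (kd ys i v)) = 0"
    using Cons.IH uv(2) by (cases i) auto
  have d3: "kd ys i (kd ys (Suc i) u + smul ((- 1) ^ Suc i * y) v) + smul ((- 1) ^ i * y) (kd ys i v) = 0"
    by (simp add: kd_add slin_diff[OF slin_kd] kd_smul smul_uminus Cons.IH[OF uv(1)] zero_fun_def)
  show ?case unfolding d1 kd_vjoin[OF c] d2 d3 by simp
qed simp

text \<open>Mapping cone of multiplication by the linear form \<open>y\<close>: \<open>F_i\<close>
  plus a copy of \<open>F_(i-1)\<close> with degrees raised by one. The sign
  \<open>(- 1) ^ i\<close> makes consecutive differentials compose to zero. At \<open>i = 0\<close>
  the second block is empty, so no valid index reaches the entries involving
  \<open>i - 1\<close>.\<close>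

definition cone :: "('n::finite, 'a::field) free_seq \<Rightarrow> ('n, 'a) mvpoly \<Rightarrow> ('n, 'a) free_seq" where
  "cone P y = \<lparr> rk = (\<lambda>i. rk P i + (case i of 0 \<Rightarrow> 0 | Suc k \<Rightarrow> rk P k)),
     gdeg = (\<lambda>i b. if b < rk P i then gdeg P i b else gdeg P (i - 1) (b - rk P i) + 1),
     dmat = (\<lambda>i a b. if b < rk P (Suc i) then (if a < rk P i then dmat P i a b else 0)
       else if a < rk P i then (if a = b - rk P (Suc i) then (- 1) ^ i * y else 0)
       else dmat P (i - 1) (a - rk P i) (b - rk P (Suc i))),
     aug = aug P \<rparr>"

lemma cone_rk [simp]: "rk (cone P y) 0 = rk P 0" "rk (cone P y) (Suc i) = rk P (Suc i) + rk P i"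
  and cone_aug [simp]: "aug (cone P y) = aug P"
  by (simp_all add: cone_def)

lemma sum_lessThan_add: "(\<Sum>b<m + n. f b) = (\<Sum>b<m. f b) + (\<Sum>b<n. f (b + m))"
  for f :: "nat \<Rightarrow> 'r::comm_monoid_add"
  by (induction n) (simp_all add: add.assoc add.commute[of m])

lemma dmap_cone: "dmap (cone P y) i w = vjoin (rk P i)
   (dmap P i (vlo (rk P (Suc i)) w) + smul ((- 1) ^ i * y) (vhi (rk P (Suc i)) w))
   (case i of 0 \<Rightarrow> 0 | Suc k \<Rightarrow> dmap P k (vhi (rk P (Suc i)) w))"
proof
  fix a
  let ?r = "rk P (Suc i)"
  consider "a < rk P i" | k where "\<not> a < rk P i" "i = Suc k" "a < rk (cone P y) i"
    | "\<not> a < rk P i" "\<not> a < rk (cone P y) i" by (cases i) auto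
  then show "dmap (cone P y) i w a = vjoin (rk P i)
   (dmap P i (vlo ?r w) + smul ((- 1) ^ i * y) (vhi ?r w))
   (case i of 0 \<Rightarrow> 0 | Suc k \<Rightarrow> dmap P k (vhi ?r w)) a"
  proof cases
    case 1
    then have r: "a < rk (cone P y) i" by (cases i) auto
    have "(\<Sum>b<rk P i. dmat (cone P y) i a (b + ?r) * w (b + ?r))
      = (\<Sum>b<rk P i. if a = b then (- 1) ^ i * y * w (b + ?r) else 0)"
      by (rule sum.cong) (use 1 in \<open>auto simp: cone_def\<close>)
    also have "\<dots> = (- 1) ^ i * y * w (a + ?r)" using 1 by simp
    moreover have "(\<Sum>b<?r. dmat (cone P y) i a b * w b) = (\<Sum>b<?r. dmat P i a b * vlo ?r w b)"
      by (rule sum.cong) (use 1 in \<open>auto simp: cone_def vlo_def\<close>)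
    ultimately show ?thesis
      using 1 r by (simp add: dmap_def[of "cone P y"] sum_lessThan_add vjoin_def vhi_def dmap_def[of P])
  next
    case (2 k)
    have "(\<Sum>b<?r. dmat (cone P y) i a b * w b) = 0"
      by (rule sum.neutral) (use 2 in \<open>auto simp: cone_def\<close>)
    moreover have "(\<Sum>b<rk P i. dmat (cone P y) i a (b + ?r) * w (b + ?r)) = (\<Sum>b<rk P i. dmat P k (a - rk P i) b * vhi ?r w b)"
      by (rule sum.cong) (use 2 in \<open>auto simp: cone_def vhi_def\<close>)
    moreover have "a - rk P i < rk P k" using 2 by auto
    ultimately show ?thesis
      using 2 by (simp add: dmap_def[of "cone P y"] sum_lessThan_add vjoin_def dmap_def[of P])
  next
    case 3
    then show ?thesis by (cases i) (auto simp: dmap_def vjoin_def)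
  qed
qed

lemma free_mod_cone_0: "free_mod (cone P y) 0 = free_mod P 0"
  by (simp add: free_mod_def)

lemma vlo_free_mod: "vlo (rk P i) w \<in> free_mod P i"
  by (simp add: free_mod_def vlo_def)

lemma vhi_free_mod: "w \<in> free_mod (cone P y) (Suc i) \<Longrightarrow> vhi (rk P (Suc i)) w \<in> free_mod P i"
  by (simp add: free_mod_def vhi_def)

lemma vjoin_free_mod: "v \<in> free_mod P i \<Longrightarrow> vjoin (rk P (Suc i)) u v \<in> free_mod (cone P y) (Suc i)"
  by (auto simp: free_mod_def vjoin_def)

lemma dmap_cone_vjoin:
  assumes "u \<in> free_mod P (Suc i)"
  shows "dmap (cone P y) i (vjoin (rk P (Suc i)) u v) = vjoin (rk P i)
     (dmap P i u + smul ((- 1) ^ i * y) v) (case i of 0 \<Rightarrow> 0 | Suc k \<Rightarrow> dmap P k v)"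
  using assms by (cases i) (simp_all add: dmap_cone vlo_id free_mod_def)

lemma vjoin_eq_0_iff:
  assumes "\<And>b. r \<le> b \<Longrightarrow> u b = 0"
  shows "vjoin r u v = 0 \<longleftrightarrow> u = 0 \<and> v = 0"
proof
  assume "vjoin r u v = 0"
  then have z: "vjoin r u v b = 0" for b by simp
  have "u b = 0" for b using z[of b] assms[of b] by (cases "b < r") (auto simp: vjoin_def)
  moreover have "v b = 0" for b using z[of "b + r"] by (simp add: vjoin_def)
  ultimately show "u = 0 \<and> v = 0" by (auto simp: fun_eq_iff)
qed simp

lemma vjoin_zero_right: "(\<And>b. r \<le> b \<Longrightarrow> u b = 0) \<Longrightarrow> vjoin r u 0 = u"
  by (auto simp: vjoin_def fun_eq_iff)

text \<open>The new complex can have homology above degree 0 only from the kernel of multiplication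
  by \<open>y\<close> on \<open>S / J\<close>, which \<open>nzd\<close> makes zero. For a cycle
  \<open>(u, v)\<close> of the cone, \<open>v\<close> is a cycle of \<open>P\<close>: at the bottom
  \<open>y * augmap P v\<close> lies in \<open>J\<close>, and \<open>y\<close> is cancelled. Writing
  \<open>v\<close> as a boundary, one corrects \<open>u\<close> to a cycle of
  \<open>P\<close>.\<close>

lemma cone_resolution:
  assumes P: "graded_free_resolution J P" and J: "is_ideal J" and y: "y \<in> homog 1"
    and nzd: "\<And>f. y * f \<in> J \<Longrightarrow> f \<in> J"
  shows "graded_free_resolution {h. \<exists>g. h - y * g \<in> J} (cone P y)"
proof -
  have deg: "dmat P i a b \<in> homog (gdeg P (Suc i) b - gdeg P i a)" if "a < rk P i" "b < rk P (Suc i)" for i a b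
    using P that by (simp add: graded_free_resolution_def)
  have surj: "\<exists>v\<in>free_mod P 0. f - augmap P v \<in> J" for f
    using P unfolding graded_free_resolution_def by (elim conjE) (erule allE)
  have ex0: "augmap P v \<in> J \<longleftrightarrow> (\<exists>w\<in>free_mod P 1. v = dmap P 0 w)" if "v \<in> free_mod P 0" for v
    using P that unfolding graded_free_resolution_def by (elim conjE) (erule bspec)
  have exS: "dmap P i v = 0 \<longleftrightarrow> (\<exists>w\<in>free_mod P (Suc (Suc i)). v = dmap P (Suc i) w)" if "v \<in> free_mod P (Suc i)" for v i
    using P that unfolding graded_free_resolution_def by (elim conjE) (erule allE, erule bspec)
  have ex: "is_cyc J P i v \<longleftrightarrow> (\<exists>w\<in>free_mod P (Suc i). v = dmap P i w)" if "v \<in> free_mod P i" for v i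
    using that ex0 exS by (cases i) auto
  have augc: "augmap (cone P y) v = augmap P v" for v by (simp add: augmap_def)
  have yh: "(- 1) ^ i * y \<in> homog 1" for i
    using y homog_uminus[OF y] by (cases "even i") auto
  show ?thesis
    unfolding graded_free_resolution_def
  proof (intro conjI allI ballI impI)
    fix b assume "b < rk (cone P y) 0"
    then show "aug (cone P y) b \<in> homog (gdeg (cone P y) 0 b)"
      using P by (simp add: graded_free_resolution_def) (simp add: cone_def)
  next
    fix i a b assume a: "a < rk (cone P y) i" and b: "b < rk (cone P y) (Suc i)"
    show "dmat (cone P y) i a b \<in> homog (gdeg (cone P y) (Suc i) b - gdeg (cone P y) i a)"
    proof (cases "b < rk P (Suc i)")
      case True
      then show ?thesis using deg[of a i b] by (simp add: cone_def)
    next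
      case False
      show ?thesis
      proof (cases "a < rk P i")
        case True
        then show ?thesis using False yh[of i] by (simp add: cone_def)
      next
        case a': False
        then obtain k where k: "i = Suc k" using a by (cases i) auto
        have "dmat P k (a - rk P i) (b - rk P (Suc i)) \<in> homog (gdeg P (Suc k) (b - rk P (Suc i)) - gdeg P k (a - rk P i))"
          using a b a' False k by (intro deg) auto
        then show ?thesis using a' False k by (simp add: cone_def)
      qed
    qed
  next
    fix f
    obtain v where v: "v \<in> free_mod P 0" "f - augmap P v \<in> J" using surj by blast
    then have "f - augmap P v - y * 0 \<in> J" by simp
    then show "\<exists>v\<in>free_mod (cone P y) 0. f - augmap (cone P y) v \<in> {h. \<exists>g. h - y * g \<in> J}"
      using v(1) unfolding free_mod_cone_0 augc by blast
  next
    fix v assume "v \<in> free_mod (cone P y) 0"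
    then have v: "v \<in> free_mod P 0" by (simp add: free_mod_cone_0)
    show "augmap (cone P y) v \<in> {h. \<exists>g. h - y * g \<in> J} \<longleftrightarrow> (\<exists>w\<in>free_mod (cone P y) 1. v = dmap (cone P y) 0 w)"
    proof
      assume "augmap (cone P y) v \<in> {h. \<exists>g. h - y * g \<in> J}"
      then obtain g where g: "augmap P v - y * g \<in> J" unfolding augc by blast
      obtain v' where v': "v' \<in> free_mod P 0" "g - augmap P v' \<in> J" using surj by blast
      have "augmap P (v - smul y v') = (augmap P v - y * g) + y * (g - augmap P v')"
        by (simp add: augmap_diff augmap_smul algebra_simps)
      then have "augmap P (v - smul y v') \<in> J" using is_ideal_add[OF J g is_ideal_mult[OF J v'(2)]] by simp
      then obtain u where u: "u \<in> free_mod P 1" "v - smul y v' = dmap P 0 u"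
        using ex0[OF free_mod_diff[OF v free_mod_smul[OF v'(1)]]] by blast
      have v0: "v b = 0" if "rk P 0 \<le> b" for b using v that by (simp add: free_mod_def)
      have "dmap (cone P y) 0 (vjoin (rk P (Suc 0)) u v') = vjoin (rk P 0) (dmap P 0 u + smul y v') 0"
        using dmap_cone_vjoin[of u P 0 y v'] u(1) by simp
      also have "\<dots> = vjoin (rk P 0) v 0" by (simp flip: u(2))
      also have "\<dots> = v" using vjoin_zero_right[of "rk P 0" v] v0 by blast
      finally show "\<exists>w\<in>free_mod (cone P y) 1. v = dmap (cone P y) 0 w"
        using vjoin_free_mod[OF v'(1), of u y] by auto
    next
      assume "\<exists>w\<in>free_mod (cone P y) 1. v = dmap (cone P y) 0 w"
      then obtain w where w: "w \<in> free_mod (cone P y) 1" "v = dmap (cone P y) 0 w" by blast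
      let ?u = "vlo (rk P (Suc 0)) w" and ?v = "vhi (rk P (Suc 0)) w"
      have hv: "?v \<in> free_mod P 0" using vhi_free_mod[of w P y 0] w(1) by simp
      have "dmap P 0 ?u + smul y ?v \<in> free_mod P 0"
        by (intro free_mod_add dmap_free_mod free_mod_smul hv)
      then have "v = dmap P 0 ?u + smul y ?v"
        using w(2) vjoin_zero_right[of "rk P 0" "dmap P 0 ?u + smul y ?v"] by (simp add: dmap_cone free_mod_def)
      then have "augmap P v - y * augmap P ?v = augmap P (dmap P 0 ?u)"
        by (simp add: augmap_add augmap_smul)
      moreover have "augmap P (dmap P 0 ?u) \<in> J"
        using ex0[OF dmap_free_mod] vlo_free_mod[of P "Suc 0" w] by auto
      ultimately have "augmap P v - y * augmap P ?v \<in> J" by simp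
      then show "augmap (cone P y) v \<in> {h. \<exists>g. h - y * g \<in> J}" unfolding augc by blast
    qed
  next
    fix i w assume w: "w \<in> free_mod (cone P y) (Suc i)"
    define u where "u = vlo (rk P (Suc i)) w"
    define v where "v = vhi (rk P (Suc i)) w"
    have uv: "u \<in> free_mod P (Suc i)" "v \<in> free_mod P i"
      using w by (simp_all add: u_def v_def vlo_free_mod vhi_free_mod)
    have wj: "w = vjoin (rk P (Suc i)) u v" by (simp add: u_def v_def vjoin_lo_hi)
    let ?s = "(- 1) ^ i * y"
    have "dmap P i u + smul ?s v \<in> free_mod P i"
      by (intro free_mod_add dmap_free_mod free_mod_smul uv)
    then have z: "dmap (cone P y) i w = 0 \<longleftrightarrow>
        dmap P i u + smul ?s v = 0 \<and> (case i of 0 \<Rightarrow> 0 | Suc k \<Rightarrow> dmap P k v) = 0"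
      unfolding wj dmap_cone_vjoin[OF uv(1)] by (intro vjoin_eq_0_iff) (simp add: free_mod_def)
    show "dmap (cone P y) i w = 0 \<longleftrightarrow> (\<exists>w'\<in>free_mod (cone P y) (Suc (Suc i)). w = dmap (cone P y) (Suc i) w')"
    proof
      assume "dmap (cone P y) i w = 0"
      then have z1: "dmap P i u + smul ?s v = 0" and z2: "(case i of 0 \<Rightarrow> 0 | Suc k \<Rightarrow> dmap P k v) = 0"
        using z by auto
      have "is_cyc J P i v"
      proof (cases i)
        case 0
        have "augmap P (dmap P 0 u) \<in> J" using ex0[OF dmap_free_mod] uv(1) 0 by auto
        moreover have "augmap P (dmap P 0 u) + y * augmap P v = 0"
          using z1 0 augmap_add[of P "dmap P 0 u" "smul y v"] by (simp add: augmap_smul)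
        ultimately have "y * augmap P v \<in> J"
          using is_ideal_uminus[OF J] by (metis add.commute add_eq_0_iff)
        then show ?thesis using nzd 0 by simp
      next
        case (Suc k)
        then show ?thesis using z2 by simp
      qed
      then obtain v2 where v2: "v2 \<in> free_mod P (Suc i)" "v = dmap P i v2" using ex[OF uv(2)] by blast
      have "dmap P i (u + smul ?s v2) = 0" using z1 v2(2) by (simp add: dmap_add dmap_smul)
      then obtain u2 where u2: "u2 \<in> free_mod P (Suc (Suc i))" "u + smul ?s v2 = dmap P (Suc i) u2"
        using exS[OF free_mod_add[OF uv(1) free_mod_smul[OF v2(1)]]] by blast
      have "dmap P (Suc i) u2 + smul ((- 1) ^ Suc i * y) v2 = u"
        unfolding u2(2)[symmetric] by (simp add: smul_uminus)
      then have "dmap (cone P y) (Suc i) (vjoin (rk P (Suc (Suc i))) u2 v2) = w"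
        unfolding dmap_cone_vjoin[OF u2(1)] wj by (simp add: v2(2))
      then show "\<exists>w'\<in>free_mod (cone P y) (Suc (Suc i)). w = dmap (cone P y) (Suc i) w'"
        using vjoin_free_mod[OF v2(1), of u2 y] by blast
    next
      assume "\<exists>w'\<in>free_mod (cone P y) (Suc (Suc i)). w = dmap (cone P y) (Suc i) w'"
      then obtain w' where w': "w' \<in> free_mod (cone P y) (Suc (Suc i))" "w = dmap (cone P y) (Suc i) w'" by blast
      define u2 where "u2 = vlo (rk P (Suc (Suc i))) w'"
      define v2 where "v2 = vhi (rk P (Suc (Suc i))) w'"
      have uv2: "u2 \<in> free_mod P (Suc (Suc i))" "v2 \<in> free_mod P (Suc i)"
        using w' by (simp_all add: u2_def v2_def vlo_free_mod vhi_free_mod)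
      have c: "dmap P (Suc i) u2 + smul ((- 1) ^ Suc i * y) v2 \<in> free_mod P (Suc i)"
        by (intro free_mod_add dmap_free_mod free_mod_smul uv2)
      have weq: "w = vjoin (rk P (Suc i)) (dmap P (Suc i) u2 + smul ((- 1) ^ Suc i * y) v2) (dmap P i v2)"
        using w'(2) by (simp add: dmap_cone u2_def v2_def)
      have u': "u = dmap P (Suc i) u2 + smul ((- 1) ^ Suc i * y) v2"
        unfolding u_def weq using c by (intro vlo_vjoin_eq) (simp add: free_mod_def)
      have v': "v = dmap P i v2" unfolding v_def weq by simp
      have "dmap P i (dmap P (Suc i) u2) = 0" using exS[OF dmap_free_mod] uv2(1) by blast
      then have "dmap P i u + smul ?s v = 0" unfolding u' v' by (simp add: dmap_diff dmap_smul smul_uminus)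
      moreover have "(case i of 0 \<Rightarrow> 0 | Suc k \<Rightarrow> dmap P k v) = 0"
        using exS[OF dmap_free_mod] uv2(2) unfolding v' by (auto split: nat.split)
      ultimately show "dmap (cone P y) i w = 0" using z by blast
    qed
  qed
qed

definition unit_res :: "('n::finite, 'a::field) free_seq" where
  "unit_res = \<lparr> rk = (\<lambda>i. if i = 0 then 1 else 0), gdeg = (\<lambda>i b. 0), dmat = (\<lambda>i a b. 0), aug = (\<lambda>b. 1) \<rparr>"

lemma unit_res_resolution: "graded_free_resolution {0} unit_res"
proof -
  have d: "dmap unit_res i w = 0" for i and w :: "('a, 'b) vec" by (simp add: dmap_def unit_res_def fun_eq_iff)
  have z: "v \<in> free_mod unit_res (Suc i) \<Longrightarrow> v = 0" for v :: "('a, 'b) vec" and i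
    by (simp add: free_mod_def unit_res_def fun_eq_iff)
  show ?thesis
    unfolding graded_free_resolution_def
  proof (intro conjI allI ballI impI)
    fix f :: "('a, 'b) mvpoly"
    show "\<exists>v\<in>free_mod unit_res 0. f - augmap unit_res v \<in> {0}"
      by (rule bexI[of _ "\<lambda>b. if b = 0 then f else 0"]) (auto simp: augmap_def free_mod_def unit_res_def)
  next
    fix v :: "('a, 'b) vec" assume v: "v \<in> free_mod unit_res 0"
    then have "augmap unit_res v \<in> {0} \<longleftrightarrow> v = 0"
      by (auto simp: augmap_def free_mod_def unit_res_def fun_eq_iff Suc_le_eq) (metis not_gr_zero)
    then show "augmap unit_res v \<in> {0} \<longleftrightarrow> (\<exists>w\<in>free_mod unit_res 1. v = dmap unit_res 0 w)"
      unfolding d using free_mod_0 by blast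
  next
    fix i and v :: "('a, 'b) vec" assume "v \<in> free_mod unit_res (Suc i)"
    then show "dmap unit_res i v = 0 \<longleftrightarrow> (\<exists>w\<in>free_mod unit_res (Suc (Suc i)). v = dmap unit_res (Suc i) w)"
      using z free_mod_0 unfolding d by blast
  qed (simp_all add: unit_res_def one_homog)
qed

fun kos :: "('n::finite, 'a::field) mvpoly list \<Rightarrow> ('n, 'a) free_seq" where
  "kos [] = unit_res"
| "kos (y # ys) = cone (kos ys) y"

text \<open>Written in the shape in which \<open>cone_resolution\<close> yields it;
  \<open>kos_ideal_member\<close> and \<open>kos_ideal_least\<close> identify it as the ideal
  generated by the list.\<close>

fun kos_ideal :: "('n::finite, 'a::field) mvpoly list \<Rightarrow> ('n, 'a) mvpoly set" where
  "kos_ideal [] = {0}"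
| "kos_ideal (y # ys) = {h. \<exists>g. h - y * g \<in> kos_ideal ys}"

lemma rk_kos: "rk (kos ys) i = length ys choose i"
proof (induction ys arbitrary: i)
  case Nil
  then show ?case by (cases i) (simp_all add: unit_res_def)
next
  case (Cons y ys)
  then show ?case by (cases i) simp_all
qed

lemma gdeg_kos: "b < length ys choose i \<Longrightarrow> gdeg (kos ys) i b = int i"
proof (induction ys arbitrary: i b)
  case Nil
  then show ?case by (cases i) (simp_all add: unit_res_def)
next
  case (Cons y ys)
  then show ?case by (cases i) (auto simp: cone_def rk_kos)
qed

lemma dmap_kos: "dmap (kos ys) i w = kd ys i w"
proof (induction ys arbitrary: i w)
  case Nil
  then show ?case by (simp add: dmap_def unit_res_def fun_eq_iff)
next
  case (Cons y ys)
  then show ?case by (simp add: dmap_cone rk_kos split: nat.split)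
qed

lemma free_mod_kos: "free_mod (kos ys) i = kchains ys i"
  by (simp add: free_mod_def kchains_def rk_kos)

lemma is_ideal_kos_ideal: "is_ideal (kos_ideal ys)"
proof (induction ys)
  case Nil
  then show ?case by (simp add: is_ideal_def)
next
  case (Cons y ys)
  show ?case
    unfolding is_ideal_def
  proof (intro conjI ballI allI)
    show "0 \<in> kos_ideal (y # ys)" using is_ideal_0[OF Cons] by (auto intro!: exI[of _ 0])
    fix f assume "f \<in> kos_ideal (y # ys)"
    then obtain a where a: "f - y * a \<in> kos_ideal ys" by auto
    show "r * f \<in> kos_ideal (y # ys)" for r
      using is_ideal_mult[OF Cons a, of r] by (auto intro!: exI[of _ "r * a"] simp: algebra_simps)
    fix g assume "g \<in> kos_ideal (y # ys)"
    then obtain b where b: "g - y * b \<in> kos_ideal ys" by auto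
    show "f + g \<in> kos_ideal (y # ys)"
      using is_ideal_add[OF Cons a b] by (auto intro!: exI[of _ "a + b"] simp: algebra_simps)
  qed
qed

lemma kos_ideal_member: "y \<in> set ys \<Longrightarrow> y \<in> kos_ideal ys"
proof (induction ys)
  case (Cons z ys)
  show ?case
  proof (cases "y = z")
    case True
    then show ?thesis using is_ideal_0[OF is_ideal_kos_ideal, of ys] by (auto intro!: exI[of _ 1])
  next
    case False
    then show ?thesis using Cons by (auto intro!: exI[of _ 0])
  qed
qed simp

lemma kos_ideal_least: "is_ideal I \<Longrightarrow> set ys \<subseteq> I \<Longrightarrow> kos_ideal ys \<subseteq> I"
proof (induction ys)
  case Nil
  then show ?case by (simp add: is_ideal_0)
next
  case (Cons y ys)
  show ?case
  proof
    fix h assume "h \<in> kos_ideal (y # ys)"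
    then obtain g where "h - y * g \<in> kos_ideal ys" by auto
    then have "h - y * g \<in> I" using Cons by auto
    moreover have "g * y \<in> I" using Cons.prems by (intro is_ideal_mult) auto
    ultimately have "(h - y * g) + g * y \<in> I" by (rule is_ideal_add[OF Cons.prems(1)])
    then show "h \<in> I" by (simp add: mult.commute)
  qed
qed

text \<open>If the ideal of \<open>ys\<close> is the kernel of a retraction \<open>\<sigma>\<close> of the polynomial ring, then \<open>y\<close> is a
  nonzerodivisor modulo that ideal as soon as \<open>\<sigma> y \<noteq> 0\<close>.\<close>

lemma kos_resolution_step:
  fixes ys :: "('n::{finite, linorder}, 'a::field) mvpoly list"
  assumes res: "graded_free_resolution (kos_ideal ys) (kos ys)" and y: "y \<in> homog 1"
    and v: "\<And>i. v i - var i \<in> kos_ideal ys" and ker: "\<And>z. z \<in> set ys \<Longrightarrow> mv_eval const v z = 0"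
    and ne: "mv_eval const v y \<noteq> 0"
  shows "graded_free_resolution (kos_ideal (y # ys)) (kos (y # ys))"
proof -
  let ?\<sigma> = "mv_eval const v"
  let ?J = "kos_ideal ys"
  have hom: "rhom ?\<sigma>" by (rule mv_eval_rhom[OF rhom_const])
  have ret: "?\<sigma> f - f \<in> ?J" for f
  proof -
    have hid: "rhom (\<lambda>x :: ('n, 'a) mvpoly. x)" by (rule rhom_id)
    have m1: "?\<sigma> (f * g) - f * g \<in> ?J" if "?\<sigma> f - f \<in> ?J" "?\<sigma> g - g \<in> ?J" for f g
    proof -
      have "?\<sigma> (f * g) - f * g = ?\<sigma> g * (?\<sigma> f - f) + f * (?\<sigma> g - g)"
        by (simp add: rhom_mult[OF hom] algebra_simps)
      then show ?thesis
        using is_ideal_add[OF is_ideal_kos_ideal is_ideal_mult[OF is_ideal_kos_ideal that(1)]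
            is_ideal_mult[OF is_ideal_kos_ideal that(2)]] by simp
    qed
    have m0: "?\<sigma> 1 - 1 \<in> ?J" using rhom_1[OF hom] is_ideal_0[OF is_ideal_kos_ideal] by simp
    have mp: "?\<sigma> (f ^ k) - f ^ k \<in> ?J" if "?\<sigma> f - f \<in> ?J" for f k
      by (induction k) (simp_all add: m0 m1 that del: power_Suc, simp add: m1 that)
    have mprod: "?\<sigma> (prod h A) - prod h A \<in> ?J" if "\<And>i. i \<in> A \<Longrightarrow> ?\<sigma> (h i) - h i \<in> ?J" "finite A" for h :: "'n \<Rightarrow> _" and A
      using that(2,1) by (induction A) (simp_all add: m0 m1)
    have mv: "?\<sigma> (var i) - var i \<in> ?J" for i using v by (simp add: mv_eval_var[OF rhom_const])
    have mc: "?\<sigma> (const c) - const c \<in> ?J" for c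
      using is_ideal_0[OF is_ideal_kos_ideal] by (simp add: mv_eval_const[OF rhom_const])
    show ?thesis
    proof (induction f rule: mvpoly_induct)
      case (single m c)
      show ?case unfolding single_eq_const_prod_var by (intro m1 mc mprod mp mv) simp
    next
      case (add f g)
      then show ?case
        using is_ideal_add[OF is_ideal_kos_ideal add] by (simp add: rhom_add[OF hom] algebra_simps)
    qed
  qed
  have "is_ideal {f. ?\<sigma> f = 0}"
    by (auto simp: is_ideal_def rhom_0[OF hom] rhom_add[OF hom] rhom_mult[OF hom])
  then have kill: "f \<in> ?J \<Longrightarrow> ?\<sigma> f = 0" for f
    using kos_ideal_least[of "{f. ?\<sigma> f = 0}" ys] ker by auto
  \<comment> \<open>The retraction takes values in an integral domain, so
    \<open>?\<sigma> f = 0\<close>, and by \<open>ret\<close> every \<open>f\<close> is congruent to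
    its retraction modulo \<open>?J\<close>.\<close>
  have "f \<in> ?J" if "y * f \<in> ?J" for f
  proof -
    have "?\<sigma> f = 0" using kill[OF that] ne by (simp add: rhom_mult[OF hom])
    then show ?thesis using is_ideal_uminus[OF is_ideal_kos_ideal ret[of f]] by simp
  qed
  then show ?thesis using cone_resolution[OF res is_ideal_kos_ideal y] by simp
qed

subsection \<open>The Koszul resolution of the irrelevant ideal in six variables\<close>

lemma UNIV_6: "(UNIV :: 6 set) = {0, 1, 2, 3, 4, 5}"
proof -
  have "card {0, 1, 2, 3, 4, 5 :: 6} = 6" by simp
  then show ?thesis by (intro card_subset_eq[symmetric]) simp_all
qed

text \<open>The order is chosen with a view to the scroll: the first four forms, read from the right,
  are a system of parameters of its coordinate ring.\<close>

definition x_forms :: "(6, 'a::field) mvpoly list" where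
  "x_forms = [var 3, var 1, var 3 + var 4, var 1 + var 2, var 5, var 0]"

lemma var_lookup: "Poly_Mapping.lookup (var i) (Poly_Mapping.single j 1) = (if i = j then 1 else 0 :: 'a::comm_ring_1)"
proof -
  have "Poly_Mapping.single i (1::nat) = Poly_Mapping.single j 1 \<longleftrightarrow> i = j"
    by (metis lookup_single_eq lookup_single_not_eq zero_neq_one)
  then show ?thesis by (simp add: var_def lookup_single when_def)
qed

lemma var_neq_0: "(var i :: ('n, 'a::field) mvpoly) \<noteq> 0"
  using var_lookup[of i i] by (metis lookup_zero zero_neq_one)

lemma var_add_neq_0: "i \<noteq> j \<Longrightarrow> (var i + var j :: ('n, 'a::field) mvpoly) \<noteq> 0"
  using var_lookup[of i i] var_lookup[of j i]
  by (metis add.right_neutral lookup_add lookup_zero zero_neq_one)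

lemma kos_x_forms_resolution: "graded_free_resolution (kos_ideal x_forms) (kos (x_forms :: (6, 'a::field) mvpoly list))"
proof -
  note ev = mv_eval_var[OF rhom_const] rhom_add[OF mv_eval_rhom[OF rhom_const]]
  note h = var_homog homog_add[OF var_homog var_homog]
  have "graded_free_resolution (kos_ideal []) (kos ([] :: (6, 'a) mvpoly list))"
    using unit_res_resolution by simp
  then have r1: "graded_free_resolution (kos_ideal [var 0]) (kos [var 0 :: (6, 'a) mvpoly])"
    by (rule kos_resolution_step[where v = var]) (simp_all add: h ev var_neq_0)
  let ?l2 = "[var 5, var 0 :: (6, 'a) mvpoly]"
  have m: "v \<in> set l \<Longrightarrow> - v \<in> kos_ideal l" "v \<in> set l \<Longrightarrow> v \<in> kos_ideal l" "0 \<in> kos_ideal l"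
    for v :: "(6, 'a) mvpoly" and l
    using is_ideal_uminus[OF is_ideal_kos_ideal] kos_ideal_member is_ideal_0[OF is_ideal_kos_ideal] by blast+
  \<comment> \<open>Here and below \<open>v\<close> eliminates one variable per form already in the
    list: x0 and x5 become 0, x2 becomes -x1, x4 becomes -x3, and finally x1 becomes 0, together
    with x2.\<close>
  have r2: "graded_free_resolution (kos_ideal ?l2) (kos ?l2)"
    by (rule kos_resolution_step[OF r1, where v = "\<lambda>i. if i = 0 then 0 else var i"])
      (auto simp: h ev var_neq_0 m simp del: kos_ideal.simps)
  let ?l3 = "(var 1 + var 2) # ?l2"
  have r3: "graded_free_resolution (kos_ideal ?l3) (kos ?l3)"
    by (rule kos_resolution_step[OF r2, where v = "\<lambda>i. if i = 0 \<or> i = 5 then 0 else var i"])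
      (auto simp: h ev var_add_neq_0 m simp del: kos_ideal.simps)
  let ?l4 = "(var 3 + var 4) # ?l3"
  have x: "- var 1 - var 2 \<in> kos_ideal l" if "var 1 + var 2 \<in> set l" for l :: "(6, 'a) mvpoly list"
    using m(1)[OF that] by simp
  have x': "- var 3 - var 4 \<in> kos_ideal l" if "var 3 + var 4 \<in> set l" for l :: "(6, 'a) mvpoly list"
    using m(1)[OF that] by simp
  have x'': "- var 2 \<in> kos_ideal l" if "var 1 + var 2 \<in> set l" "var 1 \<in> set l" for l :: "(6, 'a) mvpoly list"
    using is_ideal_diff[OF is_ideal_kos_ideal m(2)[OF that(2)] m(2)[OF that(1)]] by simp
  have r4: "graded_free_resolution (kos_ideal ?l4) (kos ?l4)"
    by (rule kos_resolution_step[OF r3, where v = "\<lambda>i. if i = 0 \<or> i = 5 then 0 else if i = 2 then - var 1 else var i"])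
      (auto simp: h ev var_add_neq_0 m x simp del: kos_ideal.simps)
  let ?l5 = "var 1 # ?l4"
  have r5: "graded_free_resolution (kos_ideal ?l5) (kos ?l5)"
    by (rule kos_resolution_step[OF r4, where v = "\<lambda>i. if i = 0 \<or> i = 5 then 0 else if i = 2 then - var 1
          else if i = 4 then - var 3 else var i"])
      (auto simp: h ev var_neq_0 m x x' simp del: kos_ideal.simps)
  show ?thesis
    unfolding x_forms_def
    by (rule kos_resolution_step[OF r5, where v = "\<lambda>i. if i = 0 \<or> i = 5 \<or> i = 1 \<or> i = 2 then 0
          else if i = 4 then - var 3 else var i"])
      (auto simp: h ev var_neq_0 m x'' x' simp del: kos_ideal.simps)
qed

lemma kos_ideal_x_forms: "kos_ideal x_forms = (irrelevant_ideal :: (6, 'a::field) mvpoly set)"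
proof
  interpret module "(*) :: (6, 'a) mvpoly \<Rightarrow> _" by (rule module_mult)
  have v: "var i \<in> span (range (var :: 6 \<Rightarrow> (6, 'a) mvpoly))" for i by (rule span_base) simp
  show "kos_ideal x_forms \<subseteq> (irrelevant_ideal :: (6, 'a) mvpoly set)"
    unfolding irrelevant_ideal_def
    by (rule kos_ideal_least[OF is_ideal_span]) (auto simp: x_forms_def intro!: v span_add)
  have i: "is_ideal (kos_ideal (x_forms :: (6, 'a) mvpoly list))" by (rule is_ideal_kos_ideal)
  have m: "y \<in> set x_forms \<Longrightarrow> y \<in> kos_ideal x_forms" for y :: "(6, 'a) mvpoly" by (rule kos_ideal_member)
  have 2: "var 2 \<in> kos_ideal (x_forms :: (6, 'a) mvpoly list)"
    using is_ideal_diff[OF i m[of "var 1 + var 2"] m[of "var 1"]] by (simp add: x_forms_def)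
  have 4: "var 4 \<in> kos_ideal (x_forms :: (6, 'a) mvpoly list)"
    using is_ideal_diff[OF i m[of "var 3 + var 4"] m[of "var 3"]] by (simp add: x_forms_def)
  have "range (var :: 6 \<Rightarrow> (6, 'a) mvpoly) \<subseteq> kos_ideal x_forms"
    unfolding UNIV_6 using 2 4 by (auto intro!: m) (simp_all add: x_forms_def)
  moreover have "subspace (kos_ideal (x_forms :: (6, 'a) mvpoly list))"
    using i by (intro subspaceI) (auto simp: is_ideal_def)
  ultimately show "irrelevant_ideal \<subseteq> kos_ideal (x_forms :: (6, 'a) mvpoly list)"
    unfolding irrelevant_ideal_def by (rule span_minimal)
qed

lemma graded_ideal_irrelevant: "graded_ideal (irrelevant_ideal :: (6, 'a::field) mvpoly set)"
proof -
  interpret module "(*) :: (6, 'a) mvpoly \<Rightarrow> _" by (rule module_mult)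
  have "hcomp n f \<in> span (range var)" if "f \<in> span (range (var :: 6 \<Rightarrow> (6, 'a) mvpoly))" for f n
    using that
  proof (induction arbitrary: n rule: span_induct_alt)
    case base
    then show ?case by (simp add: span_zero)
  next
    case (step c x y)
    obtain i where x: "x = var i" using step by auto
    have "hcomp n (c * x) = hcomp (n - 1) c * x"
      using hcomp_mult_homog[OF var_homog, of n i c] by (simp add: x mult.commute)
    moreover have "hcomp (n - 1) c * x \<in> span (range var)" using step by (intro span_scale span_base)
    ultimately show ?case using step by (simp add: hcomp_add span_add)
  qed
  then show ?thesis unfolding graded_ideal_def irrelevant_ideal_def using is_ideal_span by blast
qed

subsection \<open>A copy of the base field with trivial gcds\<close>

text \<open>The library proves unique factorization in polynomial rings over coefficient rings of class
  \<^class>\<open>factorial_ring_gcd\<close>. An arbitrary field does not belong to that class, but a copy of its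
  carrier can be made an instance.\<close>

typedef 'a gcd_copy = "UNIV :: 'a set" morphisms of_copy to_copy ..

setup_lifting type_definition_gcd_copy

instantiation gcd_copy :: (field) field
begin
lift_definition zero_gcd_copy :: "'a gcd_copy" is 0 .
lift_definition one_gcd_copy :: "'a gcd_copy" is 1 .
lift_definition plus_gcd_copy :: "'a gcd_copy \<Rightarrow> 'a gcd_copy \<Rightarrow> 'a gcd_copy" is "(+)" .
lift_definition minus_gcd_copy :: "'a gcd_copy \<Rightarrow> 'a gcd_copy \<Rightarrow> 'a gcd_copy" is "(-)" .
lift_definition uminus_gcd_copy :: "'a gcd_copy \<Rightarrow> 'a gcd_copy" is uminus .
lift_definition times_gcd_copy :: "'a gcd_copy \<Rightarrow> 'a gcd_copy \<Rightarrow> 'a gcd_copy" is "(*)" .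
lift_definition divide_gcd_copy :: "'a gcd_copy \<Rightarrow> 'a gcd_copy \<Rightarrow> 'a gcd_copy" is "(/)" .
lift_definition inverse_gcd_copy :: "'a gcd_copy \<Rightarrow> 'a gcd_copy" is inverse .
instance
  by standard (transfer; simp add: algebra_simps divide_inverse)+
end

instantiation gcd_copy ::
  (field) "{unique_euclidean_ring, normalization_euclidean_semiring, normalization_semidom_multiplicative}"
begin

definition [simp]: "normalize_gcd_copy = (normalize_field :: 'a gcd_copy \<Rightarrow> _)"
definition [simp]: "unit_factor_gcd_copy = (unit_factor_field :: 'a gcd_copy \<Rightarrow> _)"
definition [simp]: "modulo_gcd_copy = (mod_field :: 'a gcd_copy \<Rightarrow> _)"
definition [simp]: "euclidean_size_gcd_copy = (euclidean_size_field :: 'a gcd_copy \<Rightarrow> _)"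
definition [simp]: "division_segment (x :: 'a gcd_copy) = 1"

instance
  by standard
    (simp_all add: dvd_field_iff field_split_simps split: if_splits)

end

instantiation gcd_copy :: (field) euclidean_ring_gcd
begin

definition "gcd_gcd_copy = (Euclidean_Algorithm.gcd :: 'a gcd_copy \<Rightarrow> _)"
definition "lcm_gcd_copy = (Euclidean_Algorithm.lcm :: 'a gcd_copy \<Rightarrow> _)"
definition "Gcd_gcd_copy = (Euclidean_Algorithm.Gcd :: 'a gcd_copy set \<Rightarrow> _)"
definition "Lcm_gcd_copy = (Euclidean_Algorithm.Lcm :: 'a gcd_copy set \<Rightarrow> _)"

instance by standard (simp_all add: gcd_gcd_copy_def lcm_gcd_copy_def Gcd_gcd_copy_def Lcm_gcd_copy_def)

end

instance gcd_copy :: (field) field_gcd ..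

lemma rhom_of_copy: "rhom of_copy"
  unfolding rhom_def by (simp add: one_gcd_copy.rep_eq plus_gcd_copy.rep_eq times_gcd_copy.rep_eq)

lemma rhom_to_copy: "rhom to_copy"
  unfolding rhom_def
  by (simp add: one_gcd_copy.abs_eq plus_gcd_copy.abs_eq times_gcd_copy.abs_eq eq_onp_same_args)

lemma of_to_copy [simp]: "of_copy (to_copy x) = x" and to_of_copy [simp]: "to_copy (of_copy y) = y"
  by (simp_all add: to_copy_inverse of_copy_inverse)

lemma of_copy_eq_0_iff [simp]: "of_copy x = 0 \<longleftrightarrow> x = 0"
  by (metis of_copy_inverse zero_gcd_copy.rep_eq)

subsection \<open>Evaluation of univariate polynomials\<close>

definition pev :: "('r::comm_ring_1 \<Rightarrow> 's::comm_ring_1) \<Rightarrow> 's \<Rightarrow> 'r poly \<Rightarrow> 's" where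
  "pev e x F = poly (map_poly e F) x"

lemma pev_0: "pev e x 0 = 0"
  by (simp add: pev_def)

lemma map_poly_rhom_pCons: "rhom e \<Longrightarrow> map_poly e (pCons a p) = pCons (e a) (map_poly e p)"
  by (rule poly_eqI) (simp add: coeff_map_poly rhom_0 coeff_pCons split: nat.split)

lemma pev_pCons: "rhom e \<Longrightarrow> pev e x (pCons a p) = e a + x * pev e x p"
  by (simp add: pev_def map_poly_rhom_pCons)

lemma pev_add: "rhom e \<Longrightarrow> pev e x (p + q) = pev e x p + pev e x q"
proof (induction p q rule: poly_induct2)
  case 0
  then show ?case by (simp add: pev_0)
next
  case (pCons a p b q)
  then show ?case by (simp add: pev_pCons rhom_add algebra_simps)
qed

lemma pev_smult: "rhom e \<Longrightarrow> pev e x (smult a p) = e a * pev e x p"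
  by (induction p) (simp_all add: pev_0 pev_pCons rhom_mult algebra_simps)

lemma rhom_pev: "rhom e \<Longrightarrow> rhom (pev e x)"
  unfolding rhom_def[of "pev e x"]
proof (intro conjI allI)
  assume e: "rhom e"
  show "pev e x 1 = 1" using pev_pCons[OF e, of x 1 0] by (simp add: rhom_1[OF e] pev_0 one_pCons)
  show "pev e x (p + q) = pev e x p + pev e x q" for p q by (rule pev_add[OF e])
  show "pev e x (p * q) = pev e x p * pev e x q" for p q
    by (induction p) (simp_all add: pev_0 pev_pCons[OF e] pev_add[OF e] pev_smult[OF e] rhom_0[OF e] algebra_simps)
qed

lemma pev_const: "rhom e \<Longrightarrow> pev e x [:c:] = e c"
  by (simp add: pev_pCons pev_0)

lemma pev_X: "rhom e \<Longrightarrow> pev e x [:0, 1:] = x"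
  by (simp add: pev_pCons pev_0 rhom_0 rhom_1)

lemma rhom_pconst: "rhom (\<lambda>c. [:c:])"
  by (simp add: rhom_def one_pCons)

lemma poly_gen_induct:
  fixes P :: "'r::comm_ring_1 poly \<Rightarrow> bool"
  assumes "\<And>c. P [:c:]" "\<And>p q. P p \<Longrightarrow> P q \<Longrightarrow> P (p + q)" "\<And>p. P p \<Longrightarrow> P ([:0, 1:] * p)"
  shows "P p"
proof (induction p)
  case 0
  then show ?case using assms(1)[of 0] by simp
next
  case (pCons a p)
  have "pCons a p = [:a:] + [:0, 1:] * p" by simp
  then show ?case using assms pCons by metis
qed

subsection \<open>Hypersurfaces over an algebraically closed field\<close>

text \<open>The Nullstellensatz for hypersurfaces as a property of a set of points: a function
  vanishing wherever the prime \<open>q\<close> vanishes is divisible by \<open>q\<close>. In this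
  form, together with the separation of nonzero elements from 0, it passes from a ring to its
  polynomial ring.\<close>

definition null_points :: "('r::idom \<Rightarrow> 'k::field) set \<Rightarrow> bool" where
  "null_points E \<longleftrightarrow> (\<forall>e\<in>E. rhom e) \<and> (\<forall>r. r \<noteq> 0 \<longrightarrow> (\<exists>e\<in>E. e r \<noteq> 0)) \<and>
     (\<forall>q F. prime_elem q \<and> \<not> q dvd F \<longrightarrow> (\<exists>e\<in>E. e q = 0 \<and> e F \<noteq> 0))"

lemma infinite_UNIV_alg_closed: "infinite (UNIV :: 'k::alg_closed_field set)"
proof
  assume fin: "finite (UNIV :: 'k set)"
  let ?p = "(\<Prod>a\<in>UNIV. [:- a, 1:]) + 1 :: 'k poly"
  have d: "degree (\<Prod>a\<in>(UNIV :: 'k set). [:- a, 1:]) = card (UNIV :: 'k set)"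
    by (subst degree_prod_eq_sum_degree) auto
  have "card (UNIV :: 'k set) > 0" using fin by (simp add: card_gt_0_iff)
  then have "degree ?p > 0" using d by (subst degree_add_eq_left) auto
  then obtain x where "poly ?p x = 0" using alg_closed_imp_poly_has_root by blast
  moreover have "(\<Prod>a\<in>UNIV. x - a) = 0" using fin by (subst prod_zero_iff) auto
  ultimately show False by (simp add: poly_prod)
qed

lemma exists_nonroot:
  fixes p :: "'k::alg_closed_field poly"
  assumes "p \<noteq> 0"
  shows "\<exists>x. poly p x \<noteq> 0"
  using poly_roots_finite[OF assms] infinite_UNIV_alg_closed
  by (metis (mono_tags, lifting) Collect_cong UNIV_def)

text \<open>An element of minimal degree in the ideal \<open>(q, F)\<close> is constant: by pseudo-division it
  divides multiples of \<open>q\<close> and of \<open>F\<close> by nonzero constants.\<close>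

lemma prime_elem_bezout_const:
  fixes q F :: "'r::idom poly"
  assumes q: "prime_elem q" and dq: "degree q > 0" and F: "\<not> q dvd F"
  shows "\<exists>A B r. r \<noteq> 0 \<and> A * q + B * F = [:r:]"
proof -
  define I where "I = {g. \<exists>A B. g = A * q + B * F}"
  have q0: "q \<noteq> 0" using q by auto
  have Iadd: "g + h \<in> I" if gh: "g \<in> I" "h \<in> I" for g h
  proof -
    obtain A B A' B' where "g = A * q + B * F" "h = A' * q + B' * F" using gh by (auto simp: I_def)
    then have "g + h = (A + A') * q + (B + B') * F" by (simp add: algebra_simps)
    then show ?thesis unfolding I_def by blast
  qed
  have Imult: "f * g \<in> I" if g: "g \<in> I" for f g
  proof -
    obtain A B where "g = A * q + B * F" using g by (auto simp: I_def)
    then have "f * g = (f * A) * q + (f * B) * F" by (simp add: algebra_simps)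
    then show ?thesis unfolding I_def by blast
  qed
  have qI: "q \<in> I" unfolding I_def by (rule CollectI, rule exI[of _ 1], rule exI[of _ 0]) simp
  have FI: "F \<in> I" unfolding I_def by (rule CollectI, rule exI[of _ 0], rule exI[of _ 1]) simp
  have "\<exists>g. (g \<in> I \<and> g \<noteq> 0) \<and> (\<forall>h. h \<in> I \<and> h \<noteq> 0 \<longrightarrow> degree g \<le> degree h)"
    using ex_has_least_nat[of "\<lambda>g. g \<in> I \<and> g \<noteq> 0" q degree] qI q0 by blast
  then obtain g where g: "g \<in> I" "g \<noteq> 0" and gmin: "\<And>h. h \<in> I \<Longrightarrow> h \<noteq> 0 \<Longrightarrow> degree g \<le> degree h"
    by blast
  have div: "\<exists>a s. a \<noteq> 0 \<and> [:a:] * f = g * s" if f: "f \<in> I" for f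
  proof -
    obtain a s where as: "a \<noteq> 0" "smult a f = g * s + pseudo_mod f g" using pseudo_mod(1)[OF g(2)] by blast
    have "pseudo_mod f g = [:a:] * f + (- s) * g" using as(2) by (simp add: algebra_simps)
    then have "pseudo_mod f g \<in> I" using Iadd[OF Imult[OF f, of "[:a:]"] Imult[OF g(1), of "- s"]] by (simp only:)
    then have "pseudo_mod f g = 0" using pseudo_mod(2)[OF g(2), of f] gmin by fastforce
    then show ?thesis using as by auto
  qed
  \<comment> \<open>Since \<open>q\<close> is prime, \<open>[:a:] * q = g * s\<close> leaves two
    cases. If \<open>q\<close> divides \<open>g\<close>, it divides \<open>[:b:] * F\<close> and
    hence \<open>F\<close>, which is excluded. If \<open>q\<close> divides \<open>s\<close>,
    cancelling \<open>q\<close> shows that \<open>g\<close> divides the nonzero constant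
    \<open>[:a:]\<close>.\<close>
  have "degree g = 0"
  proof -
    obtain a s where as: "a \<noteq> 0" "[:a:] * q = g * s" using div[OF qI] by blast
    obtain b t where bt: "b \<noteq> 0" "[:b:] * F = g * t" using div[OF FI] by blast
    have nq: "\<not> q dvd [:c:]" if "c \<noteq> 0" for c
      using dvd_imp_degree_le[of q "[:c:]"] dq that by auto
    have "q dvd g * s" using as(2) by (metis dvd_triv_right)
    then consider "q dvd g" | "q dvd s" using q prime_elem_dvd_mult_iff by blast
    then show ?thesis
    proof cases
      case 1
      then have "q dvd [:b:] * F" unfolding bt(2) by (rule dvd_mult2)
      then show ?thesis using q F nq[OF bt(1)] prime_elem_dvd_mult_iff by blast
    next
      case 2
      then obtain s' where "s = q * s'" by (elim dvdE)
      then have "q * [:a:] = q * (g * s')" using as(2) by (simp add: algebra_simps)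
      then have e: "[:a:] = g * s'" using q0 mult_left_cancel by blast
      then have "s' \<noteq> 0" using as(1) by auto
      then have "degree g + degree s' = 0" using e degree_mult_eq[OF g(2)] by (metis degree_pCons_0)
      then show ?thesis by simp
    qed
  qed
  then obtain r where r: "g = [:r:]" by (auto elim: degree_eq_zeroE)
  then have "r \<noteq> 0" using g(2) by auto
  moreover obtain A B where "g = A * q + B * F" using g(1) by (auto simp: I_def)
  ultimately show ?thesis using r by (intro exI[of _ A] exI[of _ B] exI[of _ r]) simp
qed

text \<open>If \<open>q\<close> is a constant, some base point kills it and not some coefficient of
  \<open>F\<close>. Otherwise take \<open>A * q + B * F = [:r:]\<close> and a base point where
  neither \<open>r\<close> nor the leading coefficient of \<open>q\<close> vanishes. Over it
  \<open>q\<close> keeps a positive degree and so has a root, and there the product of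
  \<open>B\<close> and \<open>F\<close> is nonzero.\<close>

lemma null_points_poly:
  fixes E :: "('r::idom \<Rightarrow> 'k::alg_closed_field) set"
  assumes E: "null_points E"
  shows "null_points {pev e x | e x. e \<in> E}"
proof -
  have hom: "rhom e" if "e \<in> E" for e using E that by (simp add: null_points_def)
  have sep: "\<exists>e\<in>E. e r \<noteq> 0" if "r \<noteq> 0" for r using E that by (simp add: null_points_def)
  have nul: "\<exists>e\<in>E. e q = 0 \<and> e F \<noteq> 0" if "prime_elem q" "\<not> q dvd F" for q F
    using E that by (simp add: null_points_def)
  have nz: "\<exists>x. pev e x F \<noteq> 0" if "e \<in> E" "e (coeff F i) \<noteq> 0" for e F i
  proof -
    have "coeff (map_poly e F) i \<noteq> 0" using that hom by (simp add: coeff_map_poly rhom_0)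
    then have "map_poly e F \<noteq> 0" by auto
    then show ?thesis unfolding pev_def by (rule exists_nonroot)
  qed
  show ?thesis
    unfolding null_points_def
  proof (intro conjI ballI allI impI)
    fix e' assume "e' \<in> {pev e x | e x. e \<in> E}"
    then show "rhom e'" using hom rhom_pev by auto
  next
    fix r :: "'r poly" assume "r \<noteq> 0"
    then obtain i where "coeff r i \<noteq> 0" by (auto simp: poly_eq_iff)
    then obtain e where "e \<in> E" "e (coeff r i) \<noteq> 0" using sep by blast
    then obtain x where "pev e x r \<noteq> 0" using nz by blast
    then show "\<exists>e'\<in>{pev e x | e x. e \<in> E}. e' r \<noteq> 0" using \<open>e \<in> E\<close> by auto
  next
    fix q F :: "'r poly" assume "prime_elem q \<and> \<not> q dvd F"
    then have q: "prime_elem q" and F: "\<not> q dvd F" by auto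
    have "\<exists>e\<in>E. \<exists>x. pev e x q = 0 \<and> pev e x F \<noteq> 0"
    proof (cases "degree q = 0")
      case True
      then obtain c where c: "q = [:c:]" by (auto elim: degree_eq_zeroE)
      then have pc: "prime_elem c" using q by (simp add: prime_elem_const_poly_iff)
      obtain i where "\<not> c dvd coeff F i" using F c by (auto simp: const_poly_dvd_iff)
      then obtain e where e: "e \<in> E" "e c = 0" "e (coeff F i) \<noteq> 0" using nul[OF pc] by blast
      then obtain x where "pev e x F \<noteq> 0" using nz by blast
      then show ?thesis using e hom c by (auto simp: pev_const)
    next
      case False
      then obtain A B r where r: "r \<noteq> 0" "A * q + B * F = [:r:]"
        using prime_elem_bezout_const[OF q _ F] by auto
      have "r * lead_coeff q \<noteq> 0" using r(1) q by auto
      then obtain e where e: "e \<in> E" "e (r * lead_coeff q) \<noteq> 0" using sep by blast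
      have er: "e r \<noteq> 0" and el: "e (lead_coeff q) \<noteq> 0" using e(2) by (auto simp: rhom_mult[OF hom[OF e(1)]])
      have "coeff (map_poly e q) (degree q) \<noteq> 0"
        using el by (simp add: coeff_map_poly rhom_0[OF hom[OF e(1)]])
      then have "degree q \<le> degree (map_poly e q)" by (rule le_degree)
      then obtain x where x: "poly (map_poly e q) x = 0"
        using False alg_closed_imp_poly_has_root[of "map_poly e q"] by auto
      have h: "rhom (pev e x)" by (rule rhom_pev[OF hom[OF e(1)]])
      have "pev e x (A * q + B * F) = e r" unfolding r(2) by (rule pev_const[OF hom[OF e(1)]])
      then have "pev e x B * pev e x F = e r"
        using x by (simp add: rhom_add[OF h] rhom_mult[OF h] pev_def[of e x q])
      then have "pev e x F \<noteq> 0" using er by auto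
      then show ?thesis using x e(1) unfolding pev_def by blast
    qed
    then show "\<exists>e'\<in>{pev e x | e x. e \<in> E}. e' q = 0 \<and> e' F \<noteq> 0" by auto
  qed
qed

text \<open>Base of the induction over the five variables: a field has no prime elements, so the
  last condition is vacuous.\<close>

lemma null_points_field: "null_points {of_copy :: 'a::field gcd_copy \<Rightarrow> 'a}"
  unfolding null_points_def by (auto simp: rhom_of_copy prime_elem_def dvd_field_iff)

subsection \<open>The Cox ring of the scroll\<close>

text \<open>Iterated univariate polynomials, with \<open>s0\<close> outermost and \<open>t2\<close>
  innermost: factoriality and \<open>null_points_poly\<close> can then be applied one variable at a
  time.\<close>

type_synonym 'a cox = "'a gcd_copy poly poly poly poly poly"

definition kB :: "'a::field gcd_copy \<Rightarrow> 'a cox" where "kB c = [:[:[:[:[:c:]:]:]:]:]"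
definition s0 :: "'a::field cox" where "s0 = [:0, 1:]"
definition s1 :: "'a::field cox" where "s1 = [:[:0, 1:]:]"
definition t0 :: "'a::field cox" where "t0 = [:[:[:0, 1:]:]:]"
definition t1 :: "'a::field cox" where "t1 = [:[:[:[:0, 1:]:]:]:]"
definition t2 :: "'a::field cox" where "t2 = [:[:[:[:[:0, 1:]:]:]:]:]"

lemma rhom_kB: "rhom kB"
  by (simp add: rhom_def kB_def one_pCons)

lemma cox_induct [case_names const add s0 s1 t0 t1 t2]:
  fixes F :: "'a::field cox"
  assumes c: "\<And>c. P (kB c)" and a: "\<And>F G. P F \<Longrightarrow> P G \<Longrightarrow> P (F + G)"
    and s0: "\<And>F. P F \<Longrightarrow> P (s0 * F)" and s1: "\<And>F. P F \<Longrightarrow> P (s1 * F)"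
    and t0: "\<And>F. P F \<Longrightarrow> P (t0 * F)" and t1: "\<And>F. P F \<Longrightarrow> P (t1 * F)" and t2: "\<And>F. P F \<Longrightarrow> P (t2 * F)"
  shows "P F"
proof (induction F rule: poly_gen_induct)
  case (1 c)
  show ?case
  proof (induction c rule: poly_gen_induct)
    case (1 c)
    show ?case
    proof (induction c rule: poly_gen_induct)
      case (1 c)
      show ?case
      proof (induction c rule: poly_gen_induct)
        case (1 c)
        show ?case
        proof (induction c rule: poly_gen_induct)
          case (1 c)
          then show ?case using c unfolding kB_def .
        next
          case (2 p q) then show ?case using a[OF 2] by simp
        next
          case (3 p) then show ?case using t2[OF 3] by (simp add: t2_def)
        qed
      next
        case (2 p q) then show ?case using a[OF 2] by simp
      next
        case (3 p) then show ?case using t1[OF 3] by (simp add: t1_def)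
      qed
    next
      case (2 p q) then show ?case using a[OF 2] by simp
    next
      case (3 p) then show ?case using t0[OF 3] by (simp add: t0_def)
    qed
  next
    case (2 p q) then show ?case using a[OF 2] by simp
  next
    case (3 p) then show ?case using s1[OF 3] by (simp add: s1_def)
  qed
next
  case (2 p q) then show ?case using a[OF 2] by simp
next
  case (3 p) then show ?case using s0[OF 3] by (simp add: s0_def)
qed

definition hB :: "('a::field gcd_copy \<Rightarrow> 's::comm_ring_1) \<Rightarrow> 's \<Rightarrow> 's \<Rightarrow> 's \<Rightarrow> 's \<Rightarrow> 's \<Rightarrow> 'a cox \<Rightarrow> 's" where
  "hB e a b c d f = pev (pev (pev (pev (pev e f) d) c) b) a"

lemma rhom_hB: "rhom e \<Longrightarrow> rhom (hB e a b c d f)"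
  unfolding hB_def by (intro rhom_pev)

lemma hB_gens:
  assumes e: "rhom e"
  shows "hB e a b c d f (kB x) = e x" "hB e a b c d f s0 = a" "hB e a b c d f s1 = b"
    "hB e a b c d f t0 = c" "hB e a b c d f t1 = d" "hB e a b c d f t2 = f"
  using e by (simp_all add: hB_def kB_def s0_def s1_def t0_def t1_def t2_def pev_const pev_X rhom_pev)

definition evB :: "(2 \<Rightarrow> 'a::field) \<Rightarrow> (3 \<Rightarrow> 'a) \<Rightarrow> 'a cox \<Rightarrow> 'a" where
  "evB s t = hB of_copy (s 0) (s 1) (t 0) (t 1) (t 2)"

lemma rhom_evB: "rhom (evB s t)"
  unfolding evB_def by (rule rhom_hB[OF rhom_of_copy])

lemma evB_simps:
  "evB s t (kB c) = of_copy c" "evB s t s0 = s 0" "evB s t s1 = s 1"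
  "evB s t t0 = t 0" "evB s t t1 = t 1" "evB s t t2 = t 2"
  by (simp_all add: evB_def hB_gens[OF rhom_of_copy])

lemma hB_points: "null_points {hB (of_copy :: 'a::alg_closed_field gcd_copy \<Rightarrow> 'a) a b c d f | a b c d f. True}"
proof -
  let ?E = "{of_copy :: 'a gcd_copy \<Rightarrow> 'a}"
  let ?L = "{pev e x | e x. e \<in> {pev e x | e x. e \<in> {pev e x | e x. e \<in> {pev e x | e x. e \<in> {pev e x | e x. e \<in> ?E}}}}}"
  have "null_points ?L"
    by (intro null_points_poly null_points_field)
  moreover have "?L = {hB of_copy a b c d f | a b c d f. True}"
    unfolding hB_def by blast
  ultimately show ?thesis by (simp only:)
qed

lemma hB_eq_evB: "\<exists>s t. hB of_copy a b c d f = evB s t"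
proof (intro exI)
  show "hB of_copy a b c d f = evB (\<lambda>i. if i = 0 then a else b) (\<lambda>i. if i = 0 then c else if i = 1 then d else f)"
    by (simp add: evB_def)
qed

lemma evB_nonzero:
  fixes F :: "'a::alg_closed_field cox"
  assumes "F \<noteq> 0"
  shows "\<exists>s t. evB s t F \<noteq> 0"
proof -
  obtain a b c d f where "hB of_copy a b c d f F \<noteq> 0"
    using hB_points assms unfolding null_points_def by blast
  then show ?thesis using hB_eq_evB by metis
qed

lemma evB_prime:
  fixes q :: "'a::alg_closed_field cox"
  assumes "prime_elem q" "\<not> q dvd F"
  shows "\<exists>s t. evB s t q = 0 \<and> evB s t F \<noteq> 0"
proof -
  obtain a b c d f where "hB of_copy a b c d f q = 0 \<and> hB of_copy a b c d f F \<noteq> 0"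
    using hB_points assms unfolding null_points_def by blast
  then show ?thesis using hB_eq_evB by metis
qed

subsection \<open>Bihomogeneous elements\<close>

definition cf :: "'a::field cox \<Rightarrow> nat \<Rightarrow> nat \<Rightarrow> nat \<Rightarrow> nat \<Rightarrow> nat \<Rightarrow> 'a" where
  "cf F i j k l m = of_copy (coeff (coeff (coeff (coeff (coeff F i) j) k) l) m)"

lemma cf_add: "cf (F + G) i j k l m = cf F i j k l m + cf G i j k l m"
  by (simp add: cf_def rhom_add[OF rhom_of_copy])

lemma cf_0 [simp]: "cf 0 i j k l m = 0"
  by (simp add: cf_def)

lemma cf_uminus: "cf (- F) i j k l m = - cf F i j k l m"
  by (simp add: cf_def rhom_uminus[OF rhom_of_copy])

lemma cf_diff: "cf (F - G) i j k l m = cf F i j k l m - cf G i j k l m"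
  by (simp add: cf_def rhom_diff[OF rhom_of_copy])

lemma cf_sum: "cf (sum f A) i j k l m = (\<Sum>x\<in>A. cf (f x) i j k l m)"
  by (induction A rule: infinite_finite_induct) (auto simp: cf_add)

lemma cf_kB: "cf (kB c) i j k l m = (if i = 0 \<and> j = 0 \<and> k = 0 \<and> l = 0 \<and> m = 0 then of_copy c else 0)"
  by (simp add: cf_def kB_def coeff_pCons split: nat.split)

lemma cf_kB_mult: "cf (kB c * F) i j k l m = of_copy c * cf F i j k l m"
  by (simp add: cf_def kB_def rhom_mult[OF rhom_of_copy])

lemma cf_s0: "cf (s0 * F) i j k l m = (if i = 0 then 0 else cf F (i - 1) j k l m)"
  and cf_s1: "cf (s1 * F) i j k l m = (if j = 0 then 0 else cf F i (j - 1) k l m)"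
  and cf_t0: "cf (t0 * F) i j k l m = (if k = 0 then 0 else cf F i j (k - 1) l m)"
  and cf_t1: "cf (t1 * F) i j k l m = (if l = 0 then 0 else cf F i j k (l - 1) m)"
  and cf_t2: "cf (t2 * F) i j k l m = (if m = 0 then 0 else cf F i j k l (m - 1))"
  by (simp_all add: cf_def s0_def s1_def t0_def t1_def t2_def coeff_pCons split: nat.split)

lemmas cf_vars = cf_s0 cf_s1 cf_t0 cf_t1 cf_t2

lemma cox_eqI: "(\<And>i j k l m. cf F i j k l m = cf G i j k l m) \<Longrightarrow> F = G"
  unfolding cf_def by (intro poly_eqI) (simp add: of_copy_inject)

definition bih :: "nat \<Rightarrow> nat \<Rightarrow> 'a::field cox set" where
  "bih a b = {F. \<forall>i j k l m. cf F i j k l m \<noteq> 0 \<longrightarrow> i + j = a \<and> k + l + m = b}"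

lemma bih_cf: "F \<in> bih a b \<Longrightarrow> i + j \<noteq> a \<or> k + l + m \<noteq> b \<Longrightarrow> cf F i j k l m = 0"
  unfolding bih_def by blast

text \<open>The two gradings as coactions: \<open>\<theta>\<^sub>s\<close> scales \<open>s0\<close>, \<open>s1\<close> by a new variable, and \<open>\<theta>\<^sub>t\<close> scales
  \<open>t0\<close>, \<open>t1\<close>, \<open>t2\<close>.\<close>

definition theta_s :: "'a::field cox \<Rightarrow> 'a cox poly" where
  "theta_s = hB (\<lambda>c. [:kB c:]) [:0, s0:] [:0, s1:] [:t0:] [:t1:] [:t2:]"

definition theta_t :: "'a::field cox \<Rightarrow> 'a cox poly" where
  "theta_t = hB (\<lambda>c. [:kB c:]) [:s0:] [:s1:] [:0, t0:] [:0, t1:] [:0, t2:]"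

lemma rhom_pconst_kB: "rhom (\<lambda>c. [:kB c:])"
  by (rule rhom_comp[OF rhom_pconst rhom_kB])

lemma rhom_theta: "rhom theta_s" "rhom theta_t"
  unfolding theta_s_def theta_t_def by (rule rhom_hB[OF rhom_pconst_kB])+

lemmas theta_s_gens = hB_gens[OF rhom_pconst_kB, of "[:0, s0:]" "[:0, s1:]" "[:t0:]" "[:t1:]" "[:t2:]", folded theta_s_def]
lemmas theta_t_gens = hB_gens[OF rhom_pconst_kB, of "[:s0:]" "[:s1:]" "[:0, t0:]" "[:0, t1:]" "[:0, t2:]", folded theta_t_def]

lemma coeff_X_mult: "coeff ([:0, x:] * p) n = (if n = 0 then 0 else x * coeff p (n - 1))"
  for x :: "'r::comm_ring_1"
  by (simp add: coeff_pCons split: nat.split)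

lemma coeff_const_mult: "coeff ([:x:] * p) n = x * coeff p n"
  for x :: "'r::comm_ring_1"
  by simp

lemma cf_theta_s: "cf (coeff (theta_s F) n) i j k l m = (if i + j = n then cf F i j k l m else 0)"
proof (induction F arbitrary: n i j k l m rule: cox_induct)
  case (const c)
  show ?case by (cases n) (auto simp: theta_s_gens cf_kB)
next
  case (add F G)
  then show ?case by (simp add: rhom_add[OF rhom_theta(1)] cf_add)
next
  case (s0 F)
  then show ?case
    unfolding rhom_mult[OF rhom_theta(1)] theta_s_gens coeff_X_mult by (auto simp: cf_s0)
next
  case (s1 F)
  then show ?case
    unfolding rhom_mult[OF rhom_theta(1)] theta_s_gens coeff_X_mult by (auto simp: cf_s1)
qed (simp_all only: rhom_mult[OF rhom_theta(1)] theta_s_gens coeff_const_mult, auto simp: cf_vars)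

lemma cf_theta_t: "cf (coeff (theta_t F) n) i j k l m = (if k + l + m = n then cf F i j k l m else 0)"
proof (induction F arbitrary: n i j k l m rule: cox_induct)
  case (const c)
  show ?case by (cases n) (auto simp: theta_t_gens cf_kB)
next
  case (add F G)
  then show ?case by (simp add: rhom_add[OF rhom_theta(2)] cf_add)
next
  case (t0 F)
  then show ?case
    unfolding rhom_mult[OF rhom_theta(2)] theta_t_gens coeff_X_mult by (auto simp: cf_t0)
next
  case (t1 F)
  then show ?case
    unfolding rhom_mult[OF rhom_theta(2)] theta_t_gens coeff_X_mult by (auto simp: cf_t1)
next
  case (t2 F)
  then show ?case
    unfolding rhom_mult[OF rhom_theta(2)] theta_t_gens coeff_X_mult by (auto simp: cf_t2)
qed (simp_all only: rhom_mult[OF rhom_theta(2)] theta_t_gens coeff_const_mult, auto simp: cf_vars)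

text \<open>Because the coactions are ring homomorphisms, this form of bihomogeneity settles
  products at once and, with \<open>factor_of_monom\<close>, also factors.\<close>

lemma bih_theta: "F \<in> bih a b \<longleftrightarrow> theta_s F = monom F a \<and> theta_t F = monom F b"
proof
  assume F: "F \<in> bih a b"
  have "coeff (theta_s F) n = coeff (monom F a) n" for n
    by (rule cox_eqI) (auto simp: cf_theta_s bih_cf[OF F])
  moreover have "coeff (theta_t F) n = coeff (monom F b) n" for n
    by (rule cox_eqI) (auto simp: cf_theta_t bih_cf[OF F])
  ultimately show "theta_s F = monom F a \<and> theta_t F = monom F b" by (auto intro: poly_eqI)
next
  assume F: "theta_s F = monom F a \<and> theta_t F = monom F b"
  show "F \<in> bih a b"
    unfolding bih_def
  proof (intro CollectI allI impI conjI)
    fix i j k l m assume nz: "cf F i j k l m \<noteq> 0"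
    show "i + j = a" using cf_theta_s[of F a i j k l m] F nz by (auto split: if_splits)
    show "k + l + m = b" using cf_theta_t[of F b i j k l m] F nz by (auto split: if_splits)
  qed
qed

lemma theta_at_1: "poly (theta_s F) 1 = F" "poly (theta_t F) 1 = F"
  by (induction F rule: cox_induct)
    (simp_all add: rhom_add[OF rhom_theta(1)] rhom_mult[OF rhom_theta(1)] theta_s_gens
      rhom_add[OF rhom_theta(2)] rhom_mult[OF rhom_theta(2)] theta_t_gens)

lemma bih_0 [simp]: "0 \<in> bih a b"
  by (simp add: bih_def)

lemma bih_add: "F \<in> bih a b \<Longrightarrow> G \<in> bih a b \<Longrightarrow> F + G \<in> bih a b"
  by (auto simp: bih_theta rhom_add[OF rhom_theta(1)] rhom_add[OF rhom_theta(2)] add_monom)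

lemma bih_uminus: "F \<in> bih a b \<Longrightarrow> - F \<in> bih a b"
  by (auto simp: bih_theta rhom_uminus[OF rhom_theta(1)] rhom_uminus[OF rhom_theta(2)] minus_monom)

lemma bih_diff: "F \<in> bih a b \<Longrightarrow> G \<in> bih a b \<Longrightarrow> F - G \<in> bih a b"
  using bih_add[of F a b "- G"] bih_uminus[of G a b] by simp

lemma bih_mult: "F \<in> bih a b \<Longrightarrow> G \<in> bih c d \<Longrightarrow> F * G \<in> bih (a + c) (b + d)"
  by (auto simp: bih_theta rhom_mult[OF rhom_theta(1)] rhom_mult[OF rhom_theta(2)] mult_monom)

lemma bih_kB: "kB c \<in> bih 0 0"
  by (simp add: bih_def cf_kB)

lemma bih_1: "1 \<in> bih 0 0"
  using bih_kB[of 1] by (simp add: rhom_1[OF rhom_kB])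

lemma bih_kB_mult: "F \<in> bih a b \<Longrightarrow> kB c * F \<in> bih a b"
  using bih_mult[OF bih_kB, of F a b c] by simp

lemma bih_sum: "(\<And>x. x \<in> A \<Longrightarrow> f x \<in> bih a b) \<Longrightarrow> sum f A \<in> bih a b"
  by (induction A rule: infinite_finite_induct) (auto intro: bih_add)

lemma bih_vars: "s0 \<in> bih 1 0" "s1 \<in> bih 1 0" "t0 \<in> bih 0 1" "t1 \<in> bih 0 1" "t2 \<in> bih 0 1"
  by (simp_all add: bih_theta theta_s_gens theta_t_gens monom_Suc monom_0)

lemma bih_power: "F \<in> bih a b \<Longrightarrow> F ^ n \<in> bih (n * a) (n * b)"
  by (induction n) (auto simp: bih_1 intro: bih_mult)

lemma bih_unique:
  assumes "F \<in> bih a b" "F \<in> bih c d" "F \<noteq> 0"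
  shows "a = c" "b = d"
proof -
  have "coeff (monom F a) a = coeff (monom F c) a" "coeff (monom F b) b = coeff (monom F d) b"
    using assms(1,2) unfolding bih_theta by auto
  then show "a = c" "b = d" using assms(3) by (auto split: if_splits)
qed

text \<open>One of the two factors has constant term 0; cancelling the variable there lowers
  \<open>n\<close>. For \<open>n = 0\<close> degrees add up to 0.\<close>

lemma factor_of_monom:
  fixes p r :: "'r::idom poly"
  assumes "p * r = monom c n" "c \<noteq> 0"
  shows "\<exists>i d. p = monom d i"
  using assms
proof (induction n arbitrary: p r)
  case 0
  have "p \<noteq> 0" "r \<noteq> 0" using 0 by auto
  then have "degree p + degree r = 0" using 0 by (metis degree_monom_eq degree_mult_eq)
  then have "degree p = 0" by simp
  then obtain d where "p = [:d:]" by (auto elim: degree_eq_zeroE)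
  then show ?case by (metis monom_0)
next
  case (Suc n)
  have "coeff p 0 * coeff r 0 = 0" using Suc.prems(1) by (metis coeff_mult_0 coeff_monom Suc_neq_Zero)
  then consider "coeff p 0 = 0" | "coeff r 0 = 0" by auto
  then show ?case
  proof cases
    case 1
    then obtain p' where p: "p = pCons 0 p'" by (cases p) auto
    then have "p' * r = monom c n" using Suc.prems(1) by (simp add: monom_Suc)
    then obtain i d where "p' = monom d i" using Suc.IH Suc.prems(2) by blast
    then have "p = monom d (Suc i)" using p by (simp add: monom_Suc)
    then show ?thesis by blast
  next
    case 2
    then obtain r' where r: "r = pCons 0 r'" by (cases r) auto
    then have "p * r' = monom c n" using Suc.prems(1) by (simp add: monom_Suc)
    then show ?thesis using Suc.IH Suc.prems(2) by blast
  qed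
qed

text \<open>The coaction turns \<open>F * G\<close> into a monomial, so it turns \<open>F\<close>
  into a monomial; evaluating the new variable at 1 identifies its coefficient as
  \<open>F\<close>.\<close>

lemma bih_factor:
  assumes FG: "F * G \<in> bih a b" and nz: "F * G \<noteq> 0"
  shows "\<exists>i j. F \<in> bih i j"
proof -
  have "theta_s F * theta_s G = monom (F * G) a" "theta_t F * theta_t G = monom (F * G) b"
    using FG by (simp_all add: bih_theta rhom_mult[OF rhom_theta(1)] rhom_mult[OF rhom_theta(2)])
  then obtain i d j e where s: "theta_s F = monom d i" and t: "theta_t F = monom e j"
    using factor_of_monom nz by blast
  have "d = F" using theta_at_1(1)[of F] s by (simp add: poly_monom)
  moreover have "e = F" using theta_at_1(2)[of F] t by (simp add: poly_monom)
  ultimately show ?thesis using s t by (auto simp: bih_theta)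
qed

lemma bih_factors:
  assumes FG: "F * G \<in> bih a b" and nz: "F * G \<noteq> 0"
  shows "\<exists>i j k l. F \<in> bih i j \<and> G \<in> bih k l \<and> i + k = a \<and> j + l = b"
proof -
  obtain i j where F: "F \<in> bih i j" using bih_factor[OF FG nz] by blast
  obtain k l where G: "G \<in> bih k l" using bih_factor[of G F a b] FG nz by (auto simp: mult.commute)
  show ?thesis using bih_unique[OF bih_mult[OF F G] FG nz] F G by blast
qed

lemma bih_cancel:
  assumes "F * G \<in> bih a b" "F \<in> bih i j" "F \<noteq> 0" "G \<noteq> 0"
  shows "G \<in> bih (a - i) (b - j)" "i \<le> a" "j \<le> b"
proof -
  obtain i' j' k l where *: "F \<in> bih i' j'" "G \<in> bih k l" "i' + k = a" "j' + l = b"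
    using bih_factors[OF assms(1)] assms(3,4) by auto
  then have "i' = i" "j' = j" using bih_unique assms(2,3) by blast+
  then show "G \<in> bih (a - i) (b - j)" "i \<le> a" "j \<le> b" using * by auto
qed

lemma bih_unit_const:
  assumes "F \<in> bih 0 0"
  shows "F = kB (to_copy (cf F 0 0 0 0 0))"
proof (rule cox_eqI)
  fix i j k l m
  have "cf F i j k l m \<noteq> 0 \<longrightarrow> i + j = 0 \<and> k + l + m = 0" using assms unfolding bih_def by blast
  then show "cf F i j k l m = cf (kB (to_copy (cf F 0 0 0 0 0))) i j k l m" by (auto simp: cf_kB)
qed

subsection \<open>Monomials and dimensions\<close>

definition mon :: "nat \<Rightarrow> nat \<Rightarrow> nat \<Rightarrow> nat \<Rightarrow> nat \<Rightarrow> 'a::field cox" where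
  "mon i j k l m = s0 ^ i * (s1 ^ j * (t0 ^ k * (t1 ^ l * t2 ^ m)))"

lemma cf_powers:
  "cf (s0 ^ n * F) i j k l m = (if n \<le> i then cf F (i - n) j k l m else 0)"
  "cf (s1 ^ n * F) i j k l m = (if n \<le> j then cf F i (j - n) k l m else 0)"
  "cf (t0 ^ n * F) i j k l m = (if n \<le> k then cf F i j (k - n) l m else 0)"
  "cf (t1 ^ n * F) i j k l m = (if n \<le> l then cf F i j k (l - n) m else 0)"
  "cf (t2 ^ n * F) i j k l m = (if n \<le> m then cf F i j k l (m - n) else 0)"
proof -
  show "cf (s0 ^ n * F) i j k l m = (if n \<le> i then cf F (i - n) j k l m else 0)"
    by (induction n arbitrary: i) (auto simp: mult.assoc cf_s0)
  show "cf (s1 ^ n * F) i j k l m = (if n \<le> j then cf F i (j - n) k l m else 0)"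
    by (induction n arbitrary: j) (auto simp: mult.assoc cf_s1)
  show "cf (t0 ^ n * F) i j k l m = (if n \<le> k then cf F i j (k - n) l m else 0)"
    by (induction n arbitrary: k) (auto simp: mult.assoc cf_t0)
  show "cf (t1 ^ n * F) i j k l m = (if n \<le> l then cf F i j k (l - n) m else 0)"
    by (induction n arbitrary: l) (auto simp: mult.assoc cf_t1)
  show "cf (t2 ^ n * F) i j k l m = (if n \<le> m then cf F i j k l (m - n) else 0)"
    by (induction n arbitrary: m) (auto simp: mult.assoc cf_t2)
qed

lemma cf_one: "cf 1 i j k l m = (if i = 0 \<and> j = 0 \<and> k = 0 \<and> l = 0 \<and> m = 0 then 1 else 0)"
  using cf_kB[of 1 i j k l m] unfolding rhom_1[OF rhom_kB] rhom_1[OF rhom_of_copy] .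

lemma cf_mon: "cf (mon i j k l m) i' j' k' l' m' = (if (i, j, k, l, m) = (i', j', k', l', m') then 1 else 0)"
proof -
  have "cf (mon i j k l m) i' j' k' l' m' = cf (s0 ^ i * (s1 ^ j * (t0 ^ k * (t1 ^ l * (t2 ^ m * 1))))) i' j' k' l' m'"
    by (simp add: mon_def)
  then show ?thesis unfolding cf_powers cf_one by auto
qed

lemma mon_bih: "mon i j k l m \<in> bih (i + j) (k + l + m)"
  by (auto simp: bih_def cf_mon split: if_splits)

lemma mon_Suc: "mon (Suc i) j k l m = s0 * mon i j k l m" "mon i (Suc j) k l m = s1 * mon i j k l m"
  "mon i j (Suc k) l m = t0 * mon i j k l m" "mon i j k (Suc l) m = t1 * mon i j k l m"
  "mon i j k l (Suc m) = t2 * mon i j k l m"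
  by (simp_all add: mon_def algebra_simps)

definition scB :: "'a::field \<Rightarrow> 'a cox \<Rightarrow> 'a cox" where
  "scB c F = kB (to_copy c) * F"

lemma vector_space_scB: "vector_space scB"
  by unfold_locales
    (simp_all add: scB_def algebra_simps rhom_add[OF rhom_to_copy] rhom_add[OF rhom_kB]
      rhom_mult[OF rhom_to_copy] rhom_mult[OF rhom_kB] rhom_1[OF rhom_to_copy] rhom_1[OF rhom_kB])

lemma cf_scB: "cf (scB c F) i j k l m = c * cf F i j k l m"
  by (simp add: scB_def cf_kB_mult)

lemma scB_bih: "F \<in> bih a b \<Longrightarrow> scB c F \<in> bih a b"
  unfolding scB_def by (rule bih_kB_mult)

lemma scB_mult: "scB c F * G = scB c (F * G)" "F * scB c G = scB c (F * G)"
  by (simp_all add: scB_def algebra_simps)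

lemma scB_0 [simp]: "scB c 0 = 0" "scB 0 F = 0"
  by (simp_all add: scB_def rhom_0[OF rhom_kB] rhom_0[OF rhom_to_copy])

lemma scB_1 [simp]: "scB 1 F = F"
  by (simp add: scB_def rhom_1[OF rhom_kB] rhom_1[OF rhom_to_copy])

text \<open>Parametrised by the free exponents \<open>i\<close>, \<open>k\<close>, \<open>l\<close>,
  so that the cardinality is that of an interval times a triangle.\<close>

definition bimons :: "nat \<Rightarrow> nat \<Rightarrow> (nat \<times> nat \<times> nat \<times> nat \<times> nat) set" where
  "bimons a b = (\<lambda>(i, (k, l)). (i, a - i, k, l, b - k - l)) ` ({..a} \<times> Sigma {..b} (\<lambda>k. {..b - k}))"

lemma bimons_iff: "(i, j, k, l, m) \<in> bimons a b \<longleftrightarrow> i + j = a \<and> k + l + m = b"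
proof
  assume "i + j = a \<and> k + l + m = b"
  then have "(i, j, k, l, m) = (case (i, k, l) of (i, k, l) \<Rightarrow> (i, a - i, k, l, b - k - l))"
    and "(i, k, l) \<in> {..a} \<times> Sigma {..b} (\<lambda>k. {..b - k})" by auto
  then show "(i, j, k, l, m) \<in> bimons a b" unfolding bimons_def by (rule image_eqI)
qed (auto simp: bimons_def)

lemma finite_bimons: "finite (bimons a b)"
  unfolding bimons_def by (intro finite_imageI finite_cartesian_product finite_SigmaI) auto

lemma sum_countdown: "(\<Sum>k\<le>b. b - k + 1) = ((b + 2) choose 2)"
proof (induction b)
  case (Suc b)
  have "(\<Sum>k\<le>Suc b. Suc b - k + 1) = (\<Sum>k\<le>b. Suc b - k + 1) + 1" by simp
  also have "(\<Sum>k\<le>b. Suc b - k + 1) = (\<Sum>k\<le>b. (b - k + 1) + 1)"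
    by (rule sum.cong) (auto simp: Suc_diff_le)
  also have "\<dots> = (\<Sum>k\<le>b. b - k + 1) + (b + 1)" by (subst sum.distrib) simp
  also have "\<dots> + 1 = ((b + 2) choose 1) + ((b + 2) choose 2)" unfolding Suc.IH by (simp only: choose_one)
  also have "\<dots> = (Suc (b + 2)) choose 2" using binomial_Suc_Suc[of "b + 2" 1, unfolded Suc_1] by (rule sym)
  finally show ?case by (simp only: add_Suc)
qed (simp add: numeral_2_eq_2)

lemma card_bimons: "card (bimons a b) = (a + 1) * ((b + 2) choose 2)"
proof -
  let ?f = "\<lambda>(i, (k, l)). (i, a - i, k, l, b - k - l)"
  let ?S = "{..a} \<times> Sigma {..b} (\<lambda>k. {..b - k})"
  have "inj_on ?f ?S"
    by (rule inj_onI) (clarsimp simp only: prod.case prod.inject split_paired_all, simp)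
  then have "card (bimons a b) = card ?S" unfolding bimons_def by (rule card_image)
  also have "\<dots> = card {..a} * (\<Sum>k\<le>b. card {..b - k})" by (simp add: card_cartesian_product card_SigmaI)
  also have "\<dots> = (a + 1) * (\<Sum>k\<le>b. b - k + 1)" by (simp only: card_atMost Suc_eq_plus1)
  finally show ?thesis by (simp only: sum_countdown)
qed

definition mont :: "nat \<times> nat \<times> nat \<times> nat \<times> nat \<Rightarrow> 'a::field cox" where
  "mont = (\<lambda>(i, j, k, l, m). mon i j k l m)"

definition cft :: "'a::field cox \<Rightarrow> nat \<times> nat \<times> nat \<times> nat \<times> nat \<Rightarrow> 'a" where
  "cft F = (\<lambda>(i, j, k, l, m). cf F i j k l m)"

lemma cft_mont: "cft (mont x) y = (if x = y then 1 else 0)"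
  by (cases x, cases y) (simp add: cft_def mont_def cf_mon)

lemma cft_sum: "cft (sum f A) x = (\<Sum>y\<in>A. cft (f y) x)"
  by (cases x) (simp add: cft_def cf_sum)

lemma cft_scB: "cft (scB c F) x = c * cft F x"
  by (cases x) (simp add: cft_def cf_scB)

lemma cft_0: "cft 0 x = 0"
  by (cases x) (simp add: cft_def)

lemma cft_outside:
  assumes "F \<in> bih a b" "x \<notin> bimons a b"
  shows "cft F x = 0"
proof -
  obtain i j k l m where x: "x = (i, j, k, l, m)" by (cases x)
  have "cf F i j k l m \<noteq> 0 \<longrightarrow> i + j = a \<and> k + l + m = b" using assms(1) unfolding bih_def by blast
  then show ?thesis using assms(2) by (auto simp: x bimons_iff cft_def)
qed

lemma mont_inj: "inj (mont :: _ \<Rightarrow> 'a::field cox)"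
proof (rule injI)
  fix x y assume "mont x = (mont y :: 'a cox)"
  then have "cft (mont x :: 'a cox) x = cft (mont y) x" by simp
  then show "x = y" by (simp add: cft_mont split: if_splits)
qed

lemma bih_expand:
  assumes "F \<in> bih a b"
  shows "F = (\<Sum>x\<in>bimons a b. scB (cft F x) (mont x))"
proof (rule cox_eqI)
  fix i j k l m :: nat
  let ?x = "(i, j, k, l, m)"
  have "cft (\<Sum>x\<in>bimons a b. scB (cft F x) (mont x)) ?x = (\<Sum>x\<in>bimons a b. if x = ?x then cft F x else 0)"
    unfolding cft_sum by (rule sum.cong) (simp_all add: cft_scB cft_mont)
  also have "\<dots> = (if ?x \<in> bimons a b then cft F ?x else 0)" using finite_bimons by (simp add: sum.delta)
  also have "\<dots> = cft F ?x" using cft_outside[OF assms] by simp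
  finally show "cf F i j k l m = cf (\<Sum>x\<in>bimons a b. scB (cft F x) (mont x)) i j k l m"
    by (simp add: cft_def)
qed

interpretation sB: vector_space "scB :: 'a::field \<Rightarrow> 'a cox \<Rightarrow> 'a cox"
  by (rule vector_space_scB)

lemma bih_subspace: "module.subspace scB (bih a b)"
  by (rule sB.subspaceI) (simp_all only: bih_0 bih_add scB_bih)

lemma bih_span: "bih a b \<subseteq> module.span scB (mont ` bimons a b)"
proof
  fix F :: "'a cox" assume "F \<in> bih a b"
  then have "F = (\<Sum>x\<in>bimons a b. scB (cft F x) (mont x))" by (rule bih_expand)
  also have "\<dots> \<in> sB.span (mont ` bimons a b)"
    by (intro sB.span_sum sB.span_scale sB.span_base imageI)
  finally show "F \<in> sB.span (mont ` bimons a b)" .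
qed

lemma fin_dim_bih: "fin_dim scB (bih a b)"
  unfolding fin_dim_def
  by (intro conjI exI[of _ "mont ` bimons a b"] bih_subspace bih_span finite_imageI finite_bimons)

lemma dim_bih: "vector_space.dim scB (bih a b :: 'a::field cox set) = (a + 1) * ((b + 2) choose 2)"
proof -
  let ?M = "(mont :: _ \<Rightarrow> 'a cox) ` bimons a b"
  have "sB.independent ?M"
  proof (rule sB.independent_if_scalars_zero)
    show "finite ?M" using finite_bimons by blast
    fix f and y :: "'a cox" assume s: "(\<Sum>x\<in>?M. scB (f x) x) = 0" and y: "y \<in> ?M"
    obtain x where x: "x \<in> bimons a b" "y = mont x" using y by blast
    have "0 = (\<Sum>z\<in>bimons a b. scB (f (mont z)) (mont z))"
      using s by (simp add: sum.reindex[OF inj_on_subset[OF mont_inj subset_UNIV]])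
    then have "0 = cft (\<Sum>z\<in>bimons a b. scB (f (mont z)) (mont z)) x" by (simp add: cft_0)
    also have "\<dots> = (\<Sum>z\<in>bimons a b. if z = x then f (mont z) else 0)"
      unfolding cft_sum by (rule sum.cong) (simp_all add: cft_scB cft_mont)
    also have "\<dots> = f y" using x finite_bimons by (simp add: sum.delta)
    finally show "f y = 0" by simp
  qed
  moreover have "?M \<subseteq> bih a b"
  proof
    fix y :: "'a cox" assume "y \<in> ?M"
    then obtain i j k l m where "(i, j, k, l, m) \<in> bimons a b" "y = mon i j k l m" by (auto simp: mont_def)
    then show "y \<in> bih a b" using mon_bih[of i j k l m] by (simp add: bimons_iff)
  qed
  ultimately have "card ?M = sB.dim (bih a b :: 'a cox set)"
    by (intro sB.basis_card_eq_dim[OF _ bih_span])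
  moreover have "card ?M = card (bimons a b)" by (rule card_image[OF inj_on_subset[OF mont_inj subset_UNIV]])
  ultimately show ?thesis using card_bimons by simp
qed

subsection \<open>The coordinate ring of the scroll inside its Cox ring\<close>

definition seg :: "6 \<Rightarrow> 'a::field cox" where
  "seg k = (if k = 0 then s0 * t0 else if k = 1 then s1 * t0 else
     if k = 2 then s0 * t1 else if k = 3 then s1 * t1 else
     if k = 4 then s0 * t2 else s1 * t2)"

text \<open>The map of coordinate rings dual to the Segre embedding. It maps forms of degree
  \<open>n\<close> onto bidegree \<open>(n, n)\<close> by \<open>phi_surj\<close>, and by
  \<open>phi_eq_0\<close> and \<open>peval_segre\<close> its kernel consists of the polynomials
  vanishing on the scroll.\<close>

definition phi :: "(6, 'a::field) mvpoly \<Rightarrow> 'a cox" where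
  "phi = mv_eval (\<lambda>c. kB (to_copy c)) seg"

lemma rhom_kB_to_copy: "rhom (\<lambda>c. kB (to_copy c))"
  by (rule rhom_comp[OF rhom_kB rhom_to_copy])

lemma rhom_phi: "rhom phi"
  unfolding phi_def by (rule mv_eval_rhom[OF rhom_kB_to_copy])

lemma phi_const: "phi (const c) = kB (to_copy c)" and phi_var: "phi (var i) = seg i"
  unfolding phi_def by (rule mv_eval_const[OF rhom_kB_to_copy], rule mv_eval_var[OF rhom_kB_to_copy])

lemma phi_scale: "phi (const c * F) = scB c (phi F)"
  by (simp add: rhom_mult[OF rhom_phi] phi_const scB_def)

lemma rhom_peval: "rhom (\<lambda>F. peval F v)"
  unfolding peval_eq_mv_eval by (rule mv_eval_rhom[OF rhom_id])

lemma peval_const: "peval (const c) v = c" and peval_var: "peval (var i) v = v i"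
  unfolding peval_eq_mv_eval by (rule mv_eval_const[OF rhom_id], rule mv_eval_var[OF rhom_id])

lemma peval_segre: "peval F (segre_map s t) = evB s t (phi F)"
  by (rule rhom_mv_ext[OF rhom_peval rhom_comp[OF rhom_evB rhom_phi]])
    (simp_all add: peval_const peval_var phi_const phi_var evB_simps seg_def segre_map_def rhom_mult[OF rhom_evB])

lemma seg_bih: "seg i \<in> bih 1 1"
  by (simp add: seg_def bih_mult[of _ 1 0 _ 0 1, simplified] bih_vars[simplified])

lemma phi_homog:
  assumes "F \<in> homog (int n)"
  shows "phi F \<in> bih n n"
proof -
  have pr: "(\<Prod>i\<in>A. seg i ^ f i) \<in> bih (\<Sum>i\<in>A. f i) (\<Sum>i\<in>A. f i)" if "finite A" for A :: "6 set" and f :: "6 \<Rightarrow> nat"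
    using that
  proof (induction A)
    case empty
    then show ?case by (simp add: bih_1)
  next
    case (insert x A)
    then show ?case using bih_mult[OF bih_power[OF seg_bih, of x "f x"] insert.IH] by simp
  qed
  have "kB c * (\<Prod>i\<in>UNIV. seg i ^ Poly_Mapping.lookup m i) \<in> bih n n" if "m \<in> Poly_Mapping.keys F" for m c
  proof -
    have "(\<Sum>i\<in>UNIV. Poly_Mapping.lookup m i) = n" using that assms by (auto simp: homog_def simp del: of_nat_sum)
    then show ?thesis using pr[of UNIV "Poly_Mapping.lookup m"] bih_kB_mult by auto
  qed
  then show ?thesis unfolding phi_def mv_eval_def by (intro bih_sum)
qed

lemma phi_homog_int:
  assumes "F \<in> homog n" "phi F \<noteq> 0"
  shows "0 \<le> n" "phi F \<in> bih (nat n) (nat n)"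
proof -
  have "F \<noteq> 0" using assms(2) rhom_0[OF rhom_phi] by auto
  then show "0 \<le> n" using homog_negative[of n F] assms(1) by linarith
  then show "phi F \<in> bih (nat n) (nat n)" using phi_homog[of F "nat n"] assms(1) by simp
qed

text \<open>A monomial of bidegree (n + 1, n + 1) contains an s variable and a t variable, and their
  product is the image of a coordinate.\<close>

lemma phi_surj_mon: "i + j = n \<Longrightarrow> k + l + m = n \<Longrightarrow> \<exists>G\<in>homog (int n). phi G = (mon i j k l m :: 'a::field cox)"
proof (induction n arbitrary: i j k l m)
  case 0
  then show ?case using one_homog by (intro bexI[of _ 1]) (simp_all add: rhom_1[OF rhom_phi] mon_def)
next
  case (Suc n)
  have step: "\<exists>G\<in>homog (int (Suc n)). phi G = seg v * M" if M: "\<exists>G\<in>homog (int n). phi G = M" for v and M :: "'a cox"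
  proof -
    obtain G where G: "G \<in> homog (int n)" "phi G = M" using M by blast
    have "var v * G \<in> homog (int (Suc n))" using homog_mult[OF var_homog G(1), of v] by simp
    then show ?thesis using G(2) by (intro bexI[of _ "var v * G"]) (simp_all add: rhom_mult[OF rhom_phi] phi_var)
  qed
  have nz: "0 < i \<or> 0 < j" "0 < k \<or> 0 < l \<or> 0 < m" using Suc.prems by auto
  have "\<exists>G\<in>homog (int (Suc n)). phi G = (mon i j k l m :: 'a cox)" if i: "0 < i"
  proof -
    obtain i' where i': "i = Suc i'" using i by (cases i) auto
    consider k' where "k = Suc k'" | l' where "l = Suc l'" | m' where "m = Suc m'"
      using nz(2) by (metis gr0_implies_Suc)
    then show ?thesis
    proof cases
      case 1
      then show ?thesis using step[OF Suc.IH[of i' j k' l m], of 0] Suc.prems i' by (simp add: seg_def mon_Suc algebra_simps)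
    next
      case 2
      then show ?thesis using step[OF Suc.IH[of i' j k l' m], of 2] Suc.prems i' by (simp add: seg_def mon_Suc algebra_simps)
    next
      case 3
      then show ?thesis using step[OF Suc.IH[of i' j k l m'], of 4] Suc.prems i' by (simp add: seg_def mon_Suc algebra_simps)
    qed
  qed
  moreover have "\<exists>G\<in>homog (int (Suc n)). phi G = (mon i j k l m :: 'a cox)" if j: "0 < j"
  proof -
    obtain j' where j': "j = Suc j'" using j by (cases j) auto
    consider k' where "k = Suc k'" | l' where "l = Suc l'" | m' where "m = Suc m'"
      using nz(2) by (metis gr0_implies_Suc)
    then show ?thesis
    proof cases
      case 1
      then show ?thesis using step[OF Suc.IH[of i j' k' l m], of 1] Suc.prems j' by (simp add: seg_def mon_Suc algebra_simps)
    next
      case 2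
      then show ?thesis using step[OF Suc.IH[of i j' k l' m], of 3] Suc.prems j' by (simp add: seg_def mon_Suc algebra_simps)
    next
      case 3
      then show ?thesis using step[OF Suc.IH[of i j' k l m'], of 5] Suc.prems j' by (simp add: seg_def mon_Suc algebra_simps)
    qed
  qed
  ultimately show ?case using nz(1) by blast
qed

lemma phi_surj:
  fixes F :: "'a::field cox"
  assumes "F \<in> bih n n"
  shows "\<exists>G\<in>homog (int n). phi G = F"
proof -
  have "\<exists>G. G \<in> homog (int n) \<and> phi G = (mont x :: 'a cox)" if x: "x \<in> bimons n n" for x
  proof -
    obtain i j k l m where xx: "x = (i, j, k, l, m)" by (cases x)
    then show ?thesis using phi_surj_mon[of i j n k l m] x by (auto simp: bimons_iff mont_def)
  qed
  then obtain g where g: "\<And>x. x \<in> bimons n n \<Longrightarrow> g x \<in> homog (int n)"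
    "\<And>x. x \<in> bimons n n \<Longrightarrow> phi (g x) = (mont x :: 'a cox)" by metis
  let ?G = "\<Sum>x\<in>bimons n n. const (cft F x) * g x"
  have "?G \<in> homog (int n)" using homog_mult[OF const_homog g(1)] by (intro homog_sum) simp
  moreover have "phi ?G = F"
    by (subst bih_expand[OF assms]) (simp add: rhom_sum[OF rhom_phi] phi_scale g(2))
  ultimately show ?thesis by blast
qed

subsection \<open>Closed subsets of the scroll\<close>

lemma UNIV_2: "(UNIV :: 2 set) = {0, 1}"
proof -
  have "card {0, 1 :: 2} = 2" by simp
  then show ?thesis by (intro card_subset_eq[symmetric]) simp_all
qed

lemma UNIV_3: "(UNIV :: 3 set) = {0, 1, 2}"
proof -
  have "card {0, 1, 2 :: 3} = 3" by simp
  then show ?thesis by (intro card_subset_eq[symmetric]) simp_all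
qed

lemma nonzero_2: "s \<noteq> 0 \<longleftrightarrow> s 0 \<noteq> 0 \<or> s 1 \<noteq> 0" for s :: "2 \<Rightarrow> 'a::zero"
proof -
  have "(\<forall>i. s i = 0) \<longleftrightarrow> (\<forall>i\<in>{0, 1}. s i = 0)" unfolding UNIV_2[symmetric] by simp
  then show ?thesis by (auto simp: fun_eq_iff)
qed

lemma nonzero_3: "t \<noteq> 0 \<longleftrightarrow> t 0 \<noteq> 0 \<or> t 1 \<noteq> 0 \<or> t 2 \<noteq> 0" for t :: "3 \<Rightarrow> 'a::zero"
proof -
  have "(\<forall>i. t i = 0) \<longleftrightarrow> (\<forall>i\<in>{0, 1, 2}. t i = 0)" unfolding UNIV_3[symmetric] by simp
  then show ?thesis by (auto simp: fun_eq_iff)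
qed

lemma fun_eq_6: "v = w \<longleftrightarrow> v 0 = w 0 \<and> v 1 = w 1 \<and> v 2 = w 2 \<and> v 3 = w 3 \<and> v 4 = w 4 \<and> v 5 = w 5"
  for v w :: "6 \<Rightarrow> 'a"
proof -
  have "(\<forall>i. v i = w i) \<longleftrightarrow> (\<forall>i\<in>{0, 1, 2, 3, 4, 5}. v i = w i)" unfolding UNIV_6[symmetric] by simp
  then show ?thesis by (auto simp: fun_eq_iff)
qed

lemma segre_nonzero: "s \<noteq> 0 \<Longrightarrow> t \<noteq> 0 \<Longrightarrow> segre_map s t \<noteq> (0 :: 6 \<Rightarrow> 'a::field)"
  unfolding fun_eq_6 nonzero_2 nonzero_3 by (auto simp: segre_map_def)

text \<open>The three equations say that the 2 x 3 matrix with columns (v0, v1), (v2, v3), (v4, v5)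
  has rank at most one. Its first nonzero column serves as \<open>s\<close>, and the other columns
  are multiples of it.\<close>

lemma scroll_minors:
  fixes v :: "6 \<Rightarrow> 'a::field"
  assumes "v \<noteq> 0" "v 0 * v 3 = v 1 * v 2" "v 0 * v 5 = v 1 * v 4" "v 2 * v 5 = v 3 * v 4"
  shows "v \<in> scroll111"
proof -
  let ?s = "\<lambda>a b i :: 2. if i = 0 then a else (b :: 'a)"
  let ?t = "\<lambda>a b c i :: 3. if i = 0 then a else if i = 1 then b else (c :: 'a)"
  have I: "v \<in> scroll111" if "v = segre_map (?s a b) (?t c d e)" "a \<noteq> 0 \<or> b \<noteq> 0" "c \<noteq> 0 \<or> d \<noteq> 0 \<or> e \<noteq> 0" for a b c d e
  proof -
    have "?s a b \<noteq> 0" "?t c d e \<noteq> 0" unfolding nonzero_2 nonzero_3 using that by simp_all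
    then show ?thesis using that(1) unfolding scroll111_def mem_Collect_eq by (intro exI conjI)
  qed
  have q: "x = y * (z / w)" if "w \<noteq> 0" "w * x = y * z" for x y z w :: 'a
    using that by (simp add: eq_divide_eq mult.commute)
  have nz: "v 0 \<noteq> 0 \<or> v 1 \<noteq> 0 \<or> v 2 \<noteq> 0 \<or> v 3 \<noteq> 0 \<or> v 4 \<noteq> 0 \<or> v 5 \<noteq> 0"
    using assms(1) by (simp only: fun_eq_6 zero_fun_apply de_Morgan_conj)
  consider (a) "v 0 \<noteq> 0" | (b) "v 0 = 0" "v 1 \<noteq> 0" | (c) "v 0 = 0" "v 1 = 0" "v 2 \<noteq> 0"
    | (d) "v 0 = 0" "v 1 = 0" "v 2 = 0" "v 3 \<noteq> 0"
    | (e) "v 0 = 0" "v 1 = 0" "v 2 = 0" "v 3 = 0" "v 4 \<noteq> 0 \<or> v 5 \<noteq> 0"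
    using nz by metis
  then show ?thesis
  proof cases
    case a
    show ?thesis
    proof (rule I[of "v 0" "v 1" 1 "v 2 / v 0" "v 4 / v 0"])
      show "v = segre_map (?s (v 0) (v 1)) (?t 1 (v 2 / v 0) (v 4 / v 0))"
        using q[OF a assms(2)] q[OF a assms(3)] a by (simp only: fun_eq_6 segre_map_def) simp
    qed (use a in simp_all)
  next
    case b
    have "v 2 = 0" "v 4 = 0" using assms(2,3) b by simp_all
    then show ?thesis
      by (intro I[of "v 0" "v 1" 1 "v 3 / v 1" "v 5 / v 1"]) (use b in \<open>simp_all add: fun_eq_6 segre_map_def\<close>)
  next
    case c
    show ?thesis
    proof (rule I[of "v 2" "v 3" 0 1 "v 4 / v 2"])
      show "v = segre_map (?s (v 2) (v 3)) (?t 0 1 (v 4 / v 2))"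
        using q[OF c(3) assms(4)] c by (simp only: fun_eq_6 segre_map_def) simp
    qed (use c in simp_all)
  next
    case d
    have "v 4 = 0" using assms(4) d by simp
    then show ?thesis
      by (intro I[of "v 2" "v 3" 0 1 "v 5 / v 3"]) (use d in \<open>simp_all add: fun_eq_6 segre_map_def\<close>)
  next
    case e
    then show ?thesis
      by (intro I[of "v 4" "v 5" 0 0 1]) (simp_all add: fun_eq_6 segre_map_def)
  qed
qed

lemma scroll_iff: "v \<in> scroll111 \<longleftrightarrow> (\<exists>s t. v = segre_map s t \<and> s \<noteq> 0 \<and> t \<noteq> 0)"
  by (simp only: scroll111_def mem_Collect_eq)

lemma scrollE:
  assumes "v \<in> scroll111"
  obtains s t where "v = segre_map s t" "s \<noteq> 0" "t \<noteq> 0"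
  using assms unfolding scroll_iff by (elim exE conjE)

lemma scroll_nonzero: "v \<in> scroll111 \<Longrightarrow> v \<noteq> 0"
  by (elim scrollE) (simp only: segre_nonzero not_False_eq_True)

lemma scrollI: "s \<noteq> 0 \<Longrightarrow> t \<noteq> 0 \<Longrightarrow> segre_map s t \<in> scroll111"
  unfolding scroll_iff by (rule exI[of _ s], rule exI[of _ t]) simp

lemma vanishing_ideal_vanishes:
  fixes f :: "('n::finite, 'a::field) mvpoly"
  assumes "f \<in> vanishing_ideal Z" "v \<in> Z"
  shows "peval f v = 0"
proof -
  interpret module "(*) :: ('n, 'a) mvpoly \<Rightarrow> _" by (rule module_mult)
  have hom: "rhom (\<lambda>F :: ('n, 'a) mvpoly. peval F v)"
    unfolding peval_eq_mv_eval by (rule mv_eval_rhom[OF rhom_id])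
  from assms(1)[unfolded vanishing_ideal_def] show ?thesis
  proof (induction rule: span_induct_alt)
    case base
    show ?case by (rule rhom_0[OF hom])
  next
    case (step c x y)
    have "peval x v = 0" using step.hyps assms(2) by simp
    then show ?case using step.IH by (simp add: rhom_add[OF hom] rhom_mult[OF hom])
  qed
qed

lemma vanishing_ideal_homog:
  fixes f :: "('n::finite, 'a::field) mvpoly"
  assumes "f \<in> homog n"
  shows "f \<in> vanishing_ideal Z \<longleftrightarrow> (\<forall>v\<in>Z. peval f v = 0)"
proof
  interpret module "(*) :: ('n, 'a) mvpoly \<Rightarrow> _" by (rule module_mult)
  assume "\<forall>v\<in>Z. peval f v = 0"
  then show "f \<in> vanishing_ideal Z"
    unfolding vanishing_ideal_def by (intro span_base CollectI conjI exI[of _ n] assms)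
next
  assume "f \<in> vanishing_ideal Z"
  then show "\<forall>v\<in>Z. peval f v = 0" using vanishing_ideal_vanishes by (intro ballI)
qed

lemma proj_closed_Int: "proj_closed A \<Longrightarrow> proj_closed B \<Longrightarrow> proj_closed (A \<inter> B)"
proof -
  assume "proj_closed A" "proj_closed B"
  then obtain G H where G: "\<forall>g\<in>G. \<exists>n. g \<in> homog n" "A = {v. v \<noteq> 0 \<and> (\<forall>g\<in>G. peval g v = 0)}"
    and H: "\<forall>g\<in>H. \<exists>n. g \<in> homog n" "B = {v. v \<noteq> 0 \<and> (\<forall>g\<in>H. peval g v = 0)}"
    unfolding proj_closed_def by (elim exE conjE)
  have "A \<inter> B = {v. v \<noteq> 0 \<and> (\<forall>g\<in>G \<union> H. peval g v = 0)}"
    unfolding G(2) H(2) by auto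
  moreover have "\<forall>g\<in>G \<union> H. \<exists>n. g \<in> homog n" using G(1) H(1) by auto
  ultimately show ?thesis unfolding proj_closed_def by (intro exI[of _ "G \<union> H"] conjI)
qed

lemma proj_closed_separate:
  assumes "proj_closed A" "v \<notin> A" "v \<noteq> 0"
  shows "\<exists>n g. g \<in> homog n \<and> (\<forall>u\<in>A. peval g u = 0) \<and> peval g v \<noteq> 0"
proof -
  obtain G where G: "\<forall>g\<in>G. \<exists>n. g \<in> homog n" "A = {v. v \<noteq> 0 \<and> (\<forall>g\<in>G. peval g v = 0)}"
    using assms(1) unfolding proj_closed_def by (elim exE conjE)
  then obtain g where "g \<in> G" "peval g v \<noteq> 0" using assms(2,3) by auto
  then show ?thesis using G by blast
qed

text \<open>The zero set on the scroll of a bihomogeneous element \<open>A\<close>, described by the forms on the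
  ambient space whose restriction is a multiple of \<open>A\<close>.\<close>

definition zset :: "'a::field cox \<Rightarrow> (6 \<Rightarrow> 'a) set" where
  "zset A = {v \<in> scroll111. \<forall>n. \<forall>G\<in>homog n. A dvd phi G \<longrightarrow> peval G v = 0}"

lemma zset_scroll: "zset A \<subseteq> scroll111"
  unfolding zset_def by blast

lemma zset_zero: "v \<in> zset A \<Longrightarrow> G \<in> homog n \<Longrightarrow> A dvd phi G \<Longrightarrow> peval G v = 0"
  unfolding zset_def by blast

lemma zsetI: "v \<in> scroll111 \<Longrightarrow> (\<And>n G. G \<in> homog n \<Longrightarrow> A dvd phi G \<Longrightarrow> peval G v = 0) \<Longrightarrow> v \<in> zset A"
  unfolding zset_def by simp

lemma zset_dvd: "A dvd B \<Longrightarrow> zset A \<subseteq> zset B"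
  unfolding zset_def using dvd_trans by blast

lemma exists_nonzero_coord:
  assumes "s \<noteq> 0" "t \<noteq> 0"
  shows "\<exists>S T. S \<in> bih 1 0 \<and> T \<in> bih 0 1 \<and> evB s t S \<noteq> 0 \<and> evB s t T \<noteq> 0"
proof -
  have "\<exists>S. S \<in> bih 1 0 \<and> evB s t S \<noteq> 0" using assms(1) unfolding nonzero_2 by (metis bih_vars(1,2) evB_simps(2,3))
  moreover have "\<exists>T. T \<in> bih 0 1 \<and> evB s t T \<noteq> 0"
    using assms(2) unfolding nonzero_3 by (metis bih_vars(3,4,5) evB_simps(4,5,6))
  ultimately show ?thesis by blast
qed

text \<open>An element of bidegree (a, b) is made the restriction of a form of degree a + b by the
  factor \<open>S ^ b * T ^ a\<close>, with \<open>S\<close> and \<open>T\<close> of degree one in s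
  and in t, not vanishing at the point in question.\<close>

lemma zset_segre:
  assumes A: "A \<in> bih a b" and st: "s \<noteq> 0" "t \<noteq> 0"
  shows "segre_map s t \<in> zset A \<longleftrightarrow> evB s t A = 0"
proof
  assume v: "segre_map s t \<in> zset A"
  obtain S T where S: "S \<in> bih 1 0" "evB s t S \<noteq> 0" and T: "T \<in> bih 0 1" "evB s t T \<noteq> 0"
    using exists_nonzero_coord[OF st] by blast
  have "A * (S ^ b * T ^ a) \<in> bih (a + (b * 1 + a * 0)) (b + (b * 0 + a * 1))"
    by (intro bih_mult A bih_power S T)
  then have "A * (S ^ b * T ^ a) \<in> bih (a + b) (a + b)" by (simp add: add.commute)
  then obtain G where G: "G \<in> homog (int (a + b))" "phi G = A * (S ^ b * T ^ a)" using phi_surj by blast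
  have "peval G (segre_map s t) = 0" by (rule zset_zero[OF v G(1)]) (simp add: G(2))
  then show "evB s t A = 0"
    using S(2) T(2) by (simp add: peval_segre G(2) rhom_mult[OF rhom_evB] rhom_power[OF rhom_evB])
next
  assume z: "evB s t A = 0"
  have "peval G (segre_map s t) = 0" if "A dvd phi G" for G
    using that z by (auto simp: peval_segre rhom_mult[OF rhom_evB] elim!: dvdE)
  then show "segre_map s t \<in> zset A" by (rule zsetI[OF scrollI[OF st]])
qed

lemma proj_closed_zset: "proj_closed (zset A)"
proof -
  let ?G = "{G. (\<exists>n. G \<in> homog n) \<and> A dvd phi G}"
  \<comment> \<open>The quadrics defining the scroll belong to \<open>?G\<close>, since they
    restrict to 0, which every \<open>A\<close> divides.\<close>
  have m: "var i * var j - var k * var l \<in> ?G" if "seg i * seg j = (seg k * seg l :: 'a cox)" for i j k l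
  proof -
    have "var i * var j - var k * var l \<in> homog (1 + 1)"
      by (intro homog_diff homog_mult var_homog)
    moreover have "phi (var i * var j - var k * var l :: (6, 'a) mvpoly) = 0"
      using that by (simp add: rhom_diff[OF rhom_phi] rhom_mult[OF rhom_phi] phi_var)
    ultimately show ?thesis by auto
  qed
  have pm: "peval (var i * var j - var k * var l) v = v i * v j - v k * v l" for i j k l and v :: "6 \<Rightarrow> 'a"
    by (simp add: rhom_diff[OF rhom_peval] rhom_mult[OF rhom_peval] peval_var)
  have "zset A = {v. v \<noteq> 0 \<and> (\<forall>g\<in>?G. peval g v = 0)}"
  proof (intro equalityI subsetI)
    fix v assume v: "v \<in> zset A"
    have "peval g v = 0" if g: "g \<in> ?G" for g
    proof -
      obtain n where "g \<in> homog n" "A dvd phi g" using g by auto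
      then show ?thesis by (rule zset_zero[OF v])
    qed
    then show "v \<in> {v. v \<noteq> 0 \<and> (\<forall>g\<in>?G. peval g v = 0)}"
      using scroll_nonzero[OF subsetD[OF zset_scroll v]] by simp
  next
    fix v assume "v \<in> {v. v \<noteq> 0 \<and> (\<forall>g\<in>?G. peval g v = 0)}"
    then have v: "v \<noteq> 0" and vG: "\<And>g. g \<in> ?G \<Longrightarrow> peval g v = 0" by simp_all
    have mm: "v i * v j = v k * v l" if "seg i * seg j = (seg k * seg l :: 'a cox)" for i j k l
      using vG[OF m[OF that]] pm[of i j k l v] by simp
    have "v \<in> scroll111" by (rule scroll_minors[OF v]; rule mm) (simp_all add: seg_def)
    then show "v \<in> zset A" by (rule zsetI) (rule vG, simp, intro conjI exI)
  qed
  then show ?thesis unfolding proj_closed_def by (intro exI[of _ ?G] conjI ballI) simp_all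
qed

text \<open>The extra factor \<open>s0 * t0\<close> keeps the point found by
  \<open>evB_nonzero\<close> off the loci s = 0 and t = 0, which do not define points of the
  scroll.\<close>

lemma phi_eq_0:
  fixes F :: "(6, 'a::alg_closed_field) mvpoly"
  assumes "\<And>v. v \<in> scroll111 \<Longrightarrow> peval F v = 0"
  shows "phi F = 0"
proof (rule ccontr)
  assume "phi F \<noteq> 0"
  moreover have "s0 \<noteq> (0 :: 'a cox)" "t0 \<noteq> (0 :: 'a cox)" by (simp_all add: s0_def t0_def)
  ultimately have "phi F * (s0 * t0) \<noteq> 0" by simp
  then obtain s t where st: "evB s t (phi F * (s0 * t0)) \<noteq> 0" using evB_nonzero by blast
  then have "s 0 \<noteq> 0" "t 0 \<noteq> 0" "evB s t (phi F) \<noteq> 0" by (auto simp: rhom_mult[OF rhom_evB] evB_simps)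
  then have "s \<noteq> 0" "t \<noteq> 0" by (auto simp: nonzero_2 nonzero_3)
  then show False using assms[OF scrollI, of s t] \<open>evB s t (phi F) \<noteq> 0\<close> by (simp add: peval_segre)
qed

text \<open>A nonunit dividing an element of total degree one takes up the whole degree, so both
  \<open>x\<close> and \<open>y\<close> are scalar multiples of \<open>q\<close>. This prevents a
  prime from dividing two independent variables.\<close>

lemma common_linear_factor:
  fixes q x y :: "'a::field cox"
  assumes q: "\<not> q dvd 1" "q dvd x" "q dvd y" and xy: "x \<in> bih a b" "y \<in> bih a b" "a + b = 1" "x \<noteq> 0" "y \<noteq> 0"
  shows "\<exists>c. y = scB c x"
proof -
  have *: "\<exists>c. c \<noteq> 0 \<and> z = scB c q" if z: "q dvd z" "z \<in> bih a b" "z \<noteq> 0" for z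
  proof -
    obtain r where r: "z = q * r" using z(1) by (elim dvdE)
    obtain i j k l where d: "q \<in> bih i j" "r \<in> bih k l" "i + k = a" "j + l = b"
      using bih_factors[of q r a b] z r by auto
    have "\<not> (i = 0 \<and> j = 0)"
    proof
      assume "i = 0 \<and> j = 0"
      then have e: "q = kB (to_copy (cf q 0 0 0 0 0))" using bih_unit_const d(1) by blast
      have q0: "cf q 0 0 0 0 0 \<noteq> 0"
        using e z(3) r by (auto simp: rhom_0[OF rhom_to_copy] rhom_0[OF rhom_kB])
      have "q * kB (to_copy (inverse (cf q 0 0 0 0 0))) = 1"
        by (subst e) (simp add: rhom_mult[OF rhom_kB, symmetric] rhom_mult[OF rhom_to_copy, symmetric] q0
            rhom_1[OF rhom_to_copy] rhom_1[OF rhom_kB])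
      then show False using q(1) by (metis dvd_triv_left)
    qed
    then have "k = 0 \<and> l = 0" using d(3,4) xy(3) by linarith
    then have "r = kB (to_copy (cf r 0 0 0 0 0))" using bih_unit_const d(2) by blast
    then have "z = scB (cf r 0 0 0 0 0) q" unfolding r scB_def by (metis mult.commute)
    then show ?thesis using z(3) by (metis scB_0(2))
  qed
  obtain c where c: "c \<noteq> 0" "x = scB c q" using *[OF q(2) xy(1,4)] by blast
  obtain e where e: "y = scB e q" using *[OF q(3) xy(2,5)] by blast
  have "scB (e / c) x = y" unfolding c(2) e using c(1) by (simp add: sB.scale_scale)
  then show ?thesis by metis
qed

text \<open>A prime may divide \<open>s0\<close> but then not \<open>s1\<close>, and likewise for
  \<open>t0\<close> and \<open>t1\<close>. The elements \<open>S\<close> and \<open>T\<close> keep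
  points off the loci s = 0 and t = 0, and balance bidegrees without adding factors
  \<open>q\<close>.\<close>

lemma prime_avoid:
  fixes q :: "'a::field cox"
  assumes "prime_elem q"
  shows "\<exists>S T. S \<in> bih 1 0 \<and> T \<in> bih 0 1 \<and> \<not> q dvd S \<and> \<not> q dvd T \<and>
    (\<forall>s t. evB s t S \<noteq> 0 \<longrightarrow> s \<noteq> 0) \<and> (\<forall>s t. evB s t T \<noteq> 0 \<longrightarrow> t \<noteq> 0)"
proof -
  have nu: "\<not> q dvd 1" using assms by (simp add: prime_elem_def)
  have one: "cf s0 1 0 0 0 0 = (1 :: 'a)" "cf s1 1 0 0 0 0 = (0 :: 'a)" "cf t0 0 0 1 0 0 = (1 :: 'a)" "cf t1 0 0 1 0 0 = (0 :: 'a)"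
    using cf_s0[of 1 1 0 0 0 0] cf_s1[of 1 1 0 0 0 0] cf_t0[of 1 0 0 1 0 0] cf_t1[of 1 0 0 1 0 0]
    by (simp_all add: cf_one)
  have nz: "s0 \<noteq> (0 :: 'a cox)" "s1 \<noteq> (0 :: 'a cox)" "t0 \<noteq> (0 :: 'a cox)" "t1 \<noteq> (0 :: 'a cox)"
    by (simp_all add: s0_def s1_def t0_def t1_def)
  have "\<not> (q dvd s0 \<and> q dvd s1)"
  proof
    assume "q dvd s0 \<and> q dvd s1"
    then have "\<exists>c. (s1 :: 'a cox) = scB c s0"
      by (intro common_linear_factor[OF nu _ _ bih_vars(1,2) _ nz(1,2)]) simp_all
    then obtain c where c: "(s1 :: 'a cox) = scB c s0" by (rule exE)
    have "cf (s1 :: 'a cox) 1 0 0 0 0 = c * cf s0 1 0 0 0 0" unfolding c cf_scB ..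
    then show False using c nz(2) one by simp
  qed
  then have S: "\<exists>S. S \<in> bih 1 0 \<and> \<not> q dvd S \<and> (\<forall>s t. evB s t S \<noteq> 0 \<longrightarrow> s \<noteq> 0)"
    using bih_vars(1,2) evB_simps(2,3) by (metis nonzero_2)
  have "\<not> (q dvd t0 \<and> q dvd t1)"
  proof
    assume "q dvd t0 \<and> q dvd t1"
    then have "\<exists>c. (t1 :: 'a cox) = scB c t0"
      by (intro common_linear_factor[OF nu _ _ bih_vars(3,4) _ nz(3,4)]) simp_all
    then obtain c where c: "(t1 :: 'a cox) = scB c t0" by (rule exE)
    have "cf (t1 :: 'a cox) 0 0 1 0 0 = c * cf t0 0 0 1 0 0" unfolding c cf_scB ..
    then show False using c nz(4) one by simp
  qed
  then have "\<exists>T. T \<in> bih 0 1 \<and> \<not> q dvd T \<and> (\<forall>s t. evB s t T \<noteq> 0 \<longrightarrow> t \<noteq> 0)"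
    using bih_vars(3,4) evB_simps(4,5) by (metis nonzero_3)
  then show ?thesis using S by blast
qed

lemma prime_vanishing:
  fixes q F :: "'a::alg_closed_field cox"
  assumes q: "prime_elem q" and F: "\<not> q dvd F"
  shows "\<exists>s t. s \<noteq> 0 \<and> t \<noteq> 0 \<and> evB s t q = 0 \<and> evB s t F \<noteq> 0"
proof -
  obtain S T where ST: "\<not> q dvd S" "\<not> q dvd T" "\<And>s t. evB s t S \<noteq> 0 \<Longrightarrow> s \<noteq> 0" "\<And>s t. evB s t T \<noteq> 0 \<Longrightarrow> t \<noteq> 0"
    using prime_avoid[OF q] by blast
  have "\<not> q dvd F * (S * T)" using q F ST(1,2) by (simp add: prime_elem_dvd_mult_iff)
  then obtain s t where st: "evB s t q = 0" "evB s t (F * (S * T)) \<noteq> 0" using evB_prime[OF q] by blast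
  then have "evB s t F \<noteq> 0" "evB s t S \<noteq> 0" "evB s t T \<noteq> 0" by (auto simp: rhom_mult[OF rhom_evB])
  then show ?thesis using st(1) ST(3,4) by blast
qed

lemma vanishing_ideal_zset:
  fixes q :: "'a::alg_closed_field cox"
  assumes q: "prime_elem q" "q \<in> bih a b" and F: "F \<in> vanishing_ideal (zset q)"
  shows "q dvd phi F"
proof (rule ccontr)
  assume "\<not> q dvd phi F"
  then obtain s t where st: "s \<noteq> 0" "t \<noteq> 0" "evB s t q = 0" "evB s t (phi F) \<noteq> 0" using prime_vanishing[OF q(1)] by blast
  have "segre_map s t \<in> zset q" using zset_segre[OF q(2) st(1,2)] st(3) by simp
  then show False using vanishing_ideal_vanishes[OF F, of "segre_map s t"] st(4) by (simp add: peval_segre)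
qed

lemma vanishing_ideal_zset_homog:
  fixes q :: "'a::alg_closed_field cox"
  assumes q: "prime_elem q" "q \<in> bih a b" and F: "F \<in> homog n"
  shows "F \<in> vanishing_ideal (zset q) \<longleftrightarrow> q dvd phi F"
proof
  assume "q dvd phi F"
  then show "F \<in> vanishing_ideal (zset q)" unfolding vanishing_ideal_homog[OF F] by (intro ballI zset_zero[OF _ F])
qed (rule vanishing_ideal_zset[OF q])

lemma zset_sub_imp_dvd:
  fixes q A :: "'a::alg_closed_field cox"
  assumes q: "prime_elem q" "q \<in> bih a b" and A: "A \<in> bih c d" and sub: "zset q \<subseteq> zset A"
  shows "q dvd A"
proof (rule ccontr)
  assume "\<not> q dvd A"
  then obtain s t where st: "s \<noteq> 0" "t \<noteq> 0" "evB s t q = 0" "evB s t A \<noteq> 0" using prime_vanishing[OF q(1)] by blast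
  have "segre_map s t \<in> zset q" "segre_map s t \<notin> zset A"
    using zset_segre[OF q(2) st(1,2)] zset_segre[OF A st(1,2)] st(3,4) by simp_all
  then show False using subsetD[OF sub] by simp
qed

lemma zset_variety:
  fixes q :: "'a::alg_closed_field cox"
  assumes q: "prime_elem q" "q \<in> bih a b"
  shows "proj_variety (zset q)"
  unfolding proj_variety_def
proof (intro conjI allI impI)
  show "proj_closed (zset q)" by (rule proj_closed_zset)
  have "\<not> q dvd 1" using q(1) by (simp add: prime_elem_def)
  from prime_vanishing[OF q(1) this]
  obtain s t where st: "s \<noteq> 0" "t \<noteq> 0" "evB s t q = 0" by (elim exE conjE)
  have "segre_map s t \<in> zset q" using zset_segre[OF q(2) st(1,2)] st(3) by simp
  then show "zset q \<noteq> {}" by (intro notI) simp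
next
  fix A B assume AB: "proj_closed A \<and> proj_closed B \<and> zset q = A \<union> B"
  note cl = conjunct1[OF AB] conjunct1[OF conjunct2[OF AB]] and un = conjunct2[OF conjunct2[OF AB]]
  show "A = zset q \<or> B = zset q"
  proof (rule ccontr)
    assume "\<not> (A = zset q \<or> B = zset q)"
    then have "A \<noteq> zset q" "B \<noteq> zset q" by simp_all
    moreover have "A \<subseteq> zset q" "B \<subseteq> zset q" unfolding un by simp_all
    ultimately have ps: "A \<subset> zset q" "B \<subset> zset q" by (simp_all add: psubset_eq)
    obtain v where v: "v \<in> zset q" "v \<notin> A" using psubset_imp_ex_mem[OF ps(1)] by (elim exE DiffE)
    obtain w where w: "w \<in> zset q" "w \<notin> B" using psubset_imp_ex_mem[OF ps(2)] by (elim exE DiffE)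
    have nz: "v \<noteq> 0" "w \<noteq> 0" using scroll_nonzero[OF subsetD[OF zset_scroll v(1)]] scroll_nonzero[OF subsetD[OF zset_scroll w(1)]] .
    obtain m g where g': "g \<in> homog m" "\<forall>u\<in>A. peval g u = 0" "peval g v \<noteq> 0"
      using proj_closed_separate[OF cl(1) v(2) nz(1)] by (elim exE conjE)
    note g = g'(1) bspec[OF g'(2)] g'(3)
    obtain n h where h': "h \<in> homog n" "\<forall>u\<in>B. peval h u = 0" "peval h w \<noteq> 0"
      using proj_closed_separate[OF cl(2) w(2) nz(2)] by (elim exE conjE)
    note h = h'(1) bspec[OF h'(2)] h'(3)
    have gh: "g * h \<in> homog (m + n)" by (rule homog_mult[OF g(1) h(1)])
    have "peval (g * h) u = 0" if u: "u \<in> zset q" for u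
    proof -
      have "u \<in> A \<or> u \<in> B" using u unfolding un by simp
      then show ?thesis using g(2)[of u] h(2)[of u] by (auto simp: rhom_mult[OF rhom_peval])
    qed
    then have "g * h \<in> vanishing_ideal (zset q)" unfolding vanishing_ideal_homog[OF gh] by (intro ballI)
    then have "q dvd phi (g * h)" by (rule vanishing_ideal_zset[OF q])
    then have "q dvd phi g \<or> q dvd phi h"
      using q(1) by (simp add: rhom_mult[OF rhom_phi] prime_elem_dvd_mult_iff)
    then show False
    proof
      assume "q dvd phi g"
      then show False using zset_zero[OF v(1) g(1)] g(3) by simp
    next
      assume "q dvd phi h"
      then show False using zset_zero[OF w(1) h(1)] h(3) by simp
    qed
  qed
qed

lemma zset_proper:
  fixes A :: "'a::alg_closed_field cox"
  assumes A: "A \<in> bih a b" "A \<noteq> 0"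
  shows "zset A \<subset> scroll111"
proof -
  have "s0 \<noteq> (0 :: 'a cox)" "t0 \<noteq> (0 :: 'a cox)" by (simp_all add: s0_def t0_def)
  then have "A * (s0 * t0) \<noteq> 0" using A(2) by simp
  then obtain s t where st: "evB s t (A * (s0 * t0)) \<noteq> 0" using evB_nonzero by blast
  then have n: "s 0 \<noteq> 0" "t 0 \<noteq> 0" "evB s t A \<noteq> 0" by (auto simp: rhom_mult[OF rhom_evB] evB_simps)
  have st': "s \<noteq> 0" "t \<noteq> 0" unfolding nonzero_2 nonzero_3 using n by simp_all
  have "segre_map s t \<notin> zset A" using zset_segre[OF A(1) st'] \<open>evB s t A \<noteq> 0\<close> by simp
  then have "zset A \<noteq> scroll111" using scrollI[OF st'] by (intro notI) simp
  then show ?thesis using zset_scroll[of A] by (simp add: psubset_eq)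
qed

lemma zset_mult:
  assumes A: "A \<in> bih a b" and B: "B \<in> bih c d"
  shows "zset (A * B) \<subseteq> zset A \<union> zset B"
proof
  fix v assume v: "v \<in> zset (A * B)"
  then obtain s t where st: "v = segre_map s t" "s \<noteq> 0" "t \<noteq> 0" by (rule scrollE[OF subsetD[OF zset_scroll]])
  have "evB s t (A * B) = 0" using v zset_segre[OF bih_mult[OF A B] st(2,3)] st(1) by simp
  then have "evB s t A = 0 \<or> evB s t B = 0" by (simp add: rhom_mult[OF rhom_evB])
  then show "v \<in> zset A \<union> zset B" using st(1) zset_segre[OF A st(2,3)] zset_segre[OF B st(2,3)] by simp
qed

lemma variety_parts:
  assumes "proj_variety X"
  shows "proj_closed X" "X \<noteq> {}"
    and "proj_closed A \<Longrightarrow> proj_closed B \<Longrightarrow> X = A \<union> B \<Longrightarrow> A = X \<or> B = X"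
  using assms unfolding proj_variety_def by simp_all

text \<open>Induction over a prime factorization: an irreducible set inside the zero set of a
  product lies in that of a factor. The factors stay bihomogeneous, but their bidegrees change, so
  these are kept arbitrary.\<close>

lemma variety_in_prime_zset:
  fixes A :: "'a::alg_closed_field cox"
  assumes X: "proj_variety X"
  shows "A \<in> bih a b \<Longrightarrow> A \<noteq> 0 \<Longrightarrow> X \<subseteq> zset A \<Longrightarrow> \<exists>p i j. prime p \<and> p \<in> bih i j \<and> X \<subseteq> zset p"
proof (induction A arbitrary: a b rule: prime_divisors_induct)
  case (unit x)
  have "peval 1 v = 0" if v: "v \<in> zset x" for v
    by (rule zset_zero[OF v one_homog]) (use unit(1) in \<open>simp add: rhom_1[OF rhom_phi]\<close>)
  then have "v \<notin> zset x" for v using rhom_1[OF rhom_peval[of v]] by (metis zero_neq_one)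
  then have "X = {}" using unit(4) by (metis equals0I subsetD)
  then show ?case using variety_parts(2)[OF X] by simp
next
  case (factor p x)
  obtain i j k l where d: "p \<in> bih i j" "x \<in> bih k l" using bih_factors[OF factor.prems(1,2)] by (elim exE conjE)
  have "X \<subseteq> zset p \<union> zset x" using factor.prems(3) zset_mult[OF d] by (rule order_trans)
  then have un: "X = (X \<inter> zset p) \<union> (X \<inter> zset x)" by (simp only: Int_Un_distrib[symmetric] inf.absorb1)
  have cl: "proj_closed (X \<inter> zset p)" "proj_closed (X \<inter> zset x)"
    by (intro proj_closed_Int variety_parts(1)[OF X] proj_closed_zset)+
  have "X \<inter> zset p = X \<or> X \<inter> zset x = X" by (rule variety_parts(3)[OF X cl un])
  then have "X \<subseteq> zset p \<or> X \<subseteq> zset x" by (simp only: inf.absorb_iff1)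
  then show ?case
  proof
    assume "X \<subseteq> zset p"
    then show ?thesis using factor.hyps d(1) by (intro exI conjI)
  next
    assume "X \<subseteq> zset x"
    then show ?thesis using factor.IH[OF d(2)] factor.prems(2) by simp
  qed
qed simp

lemma variety_in_prime_zset':
  fixes X :: "(6 \<Rightarrow> 'a::alg_closed_field) set"
  assumes X: "proj_variety X" "X \<subset> scroll111"
  shows "\<exists>p i j. prime p \<and> p \<in> bih i j \<and> X \<subseteq> zset p"
proof -
  have "\<exists>w. w \<in> scroll111 - X" using psubset_imp_ex_mem[OF X(2)] .
  then obtain w where w: "w \<in> scroll111" "w \<notin> X" by (elim exE DiffE)
  obtain n g where g': "g \<in> homog n" "\<forall>u\<in>X. peval g u = 0" "peval g w \<noteq> 0"
    using proj_closed_separate[OF variety_parts(1)[OF X(1)] w(2) scroll_nonzero[OF w(1)]] by (elim exE conjE)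
    note g = g'(1) bspec[OF g'(2)] g'(3)
  obtain s t where "w = segre_map s t" using w(1) by (rule scrollE)
  then have nz: "phi g \<noteq> 0" using g(3) by (auto simp: peval_segre rhom_0[OF rhom_evB])
  have b: "phi g \<in> bih (nat n) (nat n)" using phi_homog_int[OF g(1) nz] by simp
  have "X \<subseteq> zset (phi g)"
  proof
    fix v assume v: "v \<in> X"
    then have vs: "v \<in> scroll111" using X(2) by (rule psubsetD[rotated])
    obtain s t where st: "v = segre_map s t" "s \<noteq> 0" "t \<noteq> 0" using vs by (rule scrollE)
    have "evB s t (phi g) = 0" using g(2)[OF v] st(1) by (simp add: peval_segre)
    then show "v \<in> zset (phi g)" using st(1) zset_segre[OF b st(2,3)] by simp
  qed
  then show ?thesis by (rule variety_in_prime_zset[OF X(1) b nz])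
qed

text \<open>A proper subvariety in between would lie in \<open>zset p\<close> for another
  bihomogeneous prime \<open>p\<close>. Then \<open>q\<close> divides \<open>p\<close>, so the two
  are associated and have the same zero set.\<close>

lemma zset_prime_divisor:
  fixes q :: "'a::alg_closed_field cox"
  assumes q: "prime_elem q" "q \<in> bih a b"
  shows "prime_divisor scroll111 (zset q)"
  unfolding prime_divisor_def
proof (intro conjI)
  show "proj_variety (zset q)" by (rule zset_variety[OF q])
  show "zset q \<subset> scroll111" by (rule zset_proper[OF q(2)]) (use q(1) in auto)
  show "\<not> (\<exists>Z. proj_variety Z \<and> zset q \<subset> Z \<and> Z \<subset> scroll111)"
  proof
    assume "\<exists>Z. proj_variety Z \<and> zset q \<subset> Z \<and> Z \<subset> scroll111"
    then obtain Z where Z: "proj_variety Z" "zset q \<subset> Z" "Z \<subset> scroll111" by (elim exE conjE)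
    obtain p i j where p: "prime p" "p \<in> bih i j" "Z \<subseteq> zset p"
      using variety_in_prime_zset'[OF Z(1,3)] by (elim exE conjE)
    have "zset q \<subseteq> zset p" using Z(2) p(3) by (meson order_trans psubset_imp_subset)
    then have "q dvd p" by (rule zset_sub_imp_dvd[OF q p(2)])
    moreover have "irreducible p" using p(1) by (intro prime_elem_imp_irreducible prime_imp_prime_elem)
    ultimately have "p dvd q" using q(1) by (meson irreducibleD' prime_elem_not_unit)
    then have "zset p \<subseteq> zset q" by (rule zset_dvd)
    then have "Z \<subseteq> zset q" using p(3) by (meson order_trans)
    then show False using Z(2) by (simp add: psubset_eq)
  qed
qed

text \<open>One equation suffices because it is taken in the Cox ring; a ruling plane, for instance,
  has an equation of bidegree (1, 0), not the restriction of a form.\<close>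

lemma prime_divisor_is_zset:
  fixes X :: "(6 \<Rightarrow> 'a::alg_closed_field) set"
  assumes X: "prime_divisor scroll111 X"
  shows "\<exists>q i j. prime q \<and> q \<in> bih i j \<and> X = zset q"
proof -
  note Xu = X[unfolded prime_divisor_def]
  note X' = conjunct1[OF Xu] conjunct1[OF conjunct2[OF Xu]] conjunct2[OF conjunct2[OF Xu]]
  obtain q i j where q: "prime q" "q \<in> bih i j" "X \<subseteq> zset q"
    using variety_in_prime_zset'[OF X'(1,2)] by (elim exE conjE)
  have qe: "prime_elem q" "q \<noteq> 0" using q(1) by auto
  have "X = zset q"
  proof (rule ccontr)
    assume "X \<noteq> zset q"
    then have "X \<subset> zset q" using q(3) by (simp add: psubset_eq)
    then show False using X'(3) zset_variety[OF qe(1) q(2)] zset_proper[OF q(2) qe(2)] by meson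
  qed
  then show ?thesis using q(1,2) by (intro exI conjI)
qed

subsection \<open>Orders of vanishing\<close>

lemma ideal_power_zset:
  fixes q :: "'a::alg_closed_field cox"
  assumes q: "prime_elem q" "q \<in> bih a b" and F: "F \<in> ideal_power (vanishing_ideal (zset q)) n"
  shows "q ^ n dvd phi F"
proof -
  interpret module "(*) :: (6, 'a) mvpoly \<Rightarrow> _" by (rule module_mult)
  show ?thesis
    using F unfolding ideal_power_def
  proof (induction rule: span_induct_alt)
    case base
    then show ?case by (simp add: rhom_0[OF rhom_phi])
  next
    case (step c x y)
    obtain f where f: "x = (\<Prod>k<n. f k)" "\<forall>k<n. f k \<in> vanishing_ideal (zset q)" using step.hyps by blast
    have "(\<Prod>k<n. q) dvd (\<Prod>k<n. phi (f k))"
      by (rule prod_dvd_prod) (use f(2) vanishing_ideal_zset[OF q] in simp)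
    then have "q ^ n dvd phi x" by (simp add: f(1) rhom_prod[OF rhom_phi])
    then show ?case using step.IH by (simp add: rhom_add[OF rhom_phi] rhom_mult[OF rhom_phi])
  qed
qed

text \<open>Write \<open>phi F\<close> as \<open>q ^ k * u\<close> with \<open>k\<close> the
  multiplicity. None of the three pieces is balanced, so auxiliary powers of \<open>S\<close> and
  \<open>T\<close> turn them into restrictions of forms; as \<open>q\<close> divides neither
  \<open>S\<close> nor \<open>T\<close>, the denominator \<open>s\<close> stays outside the ideal of
  \<open>zset q\<close>.\<close>

lemma ord_along_zset:
  fixes q :: "'a::alg_closed_field cox"
  assumes q: "prime_elem q" "q \<in> bih a b" and F: "F \<in> homog n" "phi F \<noteq> 0"
  shows "ord_along scroll111 (zset q) F = multiplicity q (phi F)"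
  unfolding ord_along_def
proof (rule Greatest_equality)
  interpret module "(*) :: (6, 'a) mvpoly \<Rightarrow> _" by (rule module_mult)
  have q0: "q \<noteq> 0" "\<not> q dvd 1" using q(1) by (auto simp: prime_elem_def)
  obtain n' where n: "n = int n'" using phi_homog_int(1)[OF F] by (metis nonneg_int_cases)
  obtain S T where ST: "S \<in> bih 1 0" "T \<in> bih 0 1" "\<not> q dvd S" "\<not> q dvd T" using prime_avoid[OF q(1)] by blast
  let ?k = "multiplicity q (phi F)"
  obtain u where u: "phi F = q ^ ?k * u" using multiplicity_dvd[of q "phi F"] by (elim dvdE)
  have Fb: "phi F \<in> bih n' n'" using phi_homog F(1) n by blast
  have qk: "q ^ ?k \<in> bih (?k * a) (?k * b)" by (rule bih_power[OF q(2)])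
  have u0: "u \<noteq> 0" using F(2) u by (metis mult_zero_right)
  have qk0: "q ^ ?k \<noteq> 0" using q0(1) by simp
  have "q ^ ?k * u \<in> bih n' n'" using Fb u by simp
  note can = bih_cancel[OF this qk qk0 u0]
  have ub: "u \<in> bih (n' - ?k * a) (n' - ?k * b)" "?k * a \<le> n'" "?k * b \<le> n'"
    by (rule can)+
  \<comment> \<open>With \<open>q\<close> of bidegree (a, b), the factor \<open>?w\<close> of
    bidegree (b, a) balances \<open>q\<close>, and \<open>?e\<close>, which has the bidegree of
    \<open>q ^ ?k\<close>, balances \<open>u\<close>. Multiplying \<open>phi F\<close> by
    \<open>?w ^ ?k * ?e\<close> allows both at once.\<close>
  let ?w = "S ^ b * T ^ a"
  let ?e = "S ^ (?k * a) * T ^ (?k * b)"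
  have wb: "?w \<in> bih b a"
    using bih_mult[OF bih_power[OF ST(1), of b] bih_power[OF ST(2), of a]] by simp
  have eb: "?e \<in> bih (?k * a) (?k * b)"
    using bih_mult[OF bih_power[OF ST(1), of "?k * a"] bih_power[OF ST(2), of "?k * b"]] by simp
  have "?w * q \<in> bih (a + b) (a + b)" using bih_mult[OF wb q(2)] by (simp add: add.commute)
  then obtain G where G: "G \<in> homog (int (a + b))" "phi G = ?w * q" using phi_surj by blast
  have "?w ^ ?k * ?e \<in> bih (?k * (a + b)) (?k * (a + b))"
    using bih_mult[OF bih_power[OF wb, of ?k] eb] by (simp add: algebra_simps)
  then obtain s where s: "s \<in> homog (int (?k * (a + b)))" "phi s = ?w ^ ?k * ?e" using phi_surj by blast
  have "u * ?e \<in> bih n' n'" using bih_mult[OF ub(1) eb] ub(2,3) by simp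
  then obtain G' where G': "G' \<in> homog (int n')" "phi G' = u * ?e" using phi_surj by blast
  have GY: "G \<in> vanishing_ideal (zset q)" using vanishing_ideal_zset_homog[OF q G(1)] G(2) by simp
  have "\<not> q dvd phi s"
    unfolding s(2) using q(1) ST(3,4) by (simp add: prime_elem_dvd_mult_iff prime_elem_dvd_power_iff)
  then have sY: "s \<notin> vanishing_ideal (zset q)" using vanishing_ideal_zset_homog[OF q s(1)] by blast
  have aP: "G ^ ?k * G' \<in> ideal_power (vanishing_ideal (zset q)) ?k"
  proof -
    have "(\<Prod>i<?k. G) \<in> span {\<Prod>k<?k. f k | f. \<forall>k<?k. f k \<in> vanishing_ideal (zset q)}"
      by (rule span_base) (use GY in blast)
    then have "G' * G ^ ?k \<in> ideal_power (vanishing_ideal (zset q)) ?k"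
      unfolding ideal_power_def by (intro span_scale) simp
    then show ?thesis by (simp add: mult.commute)
  qed
  let ?b = "s * F - G ^ ?k * G'"
  have bh: "?b \<in> homog (int (?k * (a + b)) + int n')"
    using homog_mult[OF s(1) F(1)] homog_mult[OF homog_power[OF G(1), of ?k] G'(1)] n by (intro homog_diff) simp_all
  have "phi ?b = (?w ^ ?k * ?e) * (q ^ ?k * u) - (?w * q) ^ ?k * (u * ?e)"
    by (simp add: rhom_diff[OF rhom_phi] rhom_mult[OF rhom_phi] rhom_power[OF rhom_phi] s(2) G(2) G'(2) u[symmetric])
  also have "\<dots> = 0"
    unfolding power_mult_distrib[of ?w q ?k] by (simp only: mult_ac diff_self)
  finally have b0: "phi ?b = 0" .
  have "peval ?b v = 0" if v: "v \<in> scroll111" for v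
  proof -
    obtain s' t' where "v = segre_map s' t'" using v by (rule scrollE)
    then show ?thesis by (simp only: peval_segre b0 rhom_0[OF rhom_evB])
  qed
  then have bV: "?b \<in> vanishing_ideal scroll111" using vanishing_ideal_homog[OF bh] by blast
  have "s * F = G ^ ?k * G' + ?b" by simp
  then show "\<exists>m s. s \<in> homog m \<and> s \<notin> vanishing_ideal (zset q) \<and>
    (\<exists>a\<in>ideal_power (vanishing_ideal (zset q)) ?k. \<exists>b\<in>vanishing_ideal scroll111. s * F = a + b)"
    using s(1) sY aP bV by blast
next
  fix k
  assume "\<exists>m s. s \<in> homog m \<and> s \<notin> vanishing_ideal (zset q) \<and>
    (\<exists>a\<in>ideal_power (vanishing_ideal (zset q)) k. \<exists>b\<in>vanishing_ideal scroll111. s * F = a + b)"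
  then obtain m s x y where s: "s \<in> homog m" "s \<notin> vanishing_ideal (zset q)"
    and x: "x \<in> ideal_power (vanishing_ideal (zset q)) k" and y: "y \<in> vanishing_ideal scroll111"
    and eq: "s * F = x + y" by blast
  have q0: "q \<noteq> 0" "\<not> q dvd 1" using q(1) by (auto simp: prime_elem_def)
  \<comment> \<open>Applying \<open>phi\<close> removes the summand from the ideal of the scroll and
    turns membership in the \<open>k\<close>-th power into divisibility by \<open>q ^ k\<close>;
    \<open>phi s\<close> contributes no factor \<open>q\<close>.\<close>
  have "phi y = 0" using phi_eq_0 vanishing_ideal_vanishes[OF y] by blast
  then have "phi s * phi F = phi x"
    using arg_cong[OF eq, of phi] by (simp add: rhom_mult[OF rhom_phi] rhom_add[OF rhom_phi])
  then have "q ^ k dvd phi s * phi F" using ideal_power_zset[OF q x] by simp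
  moreover have ns: "\<not> q dvd phi s" using vanishing_ideal_zset_homog[OF q s(1)] s(2) by blast
  then have "phi s \<noteq> 0" by auto
  ultimately have "k \<le> multiplicity q (phi s * phi F)"
    using multiplicity_geI[of "phi s * phi F" q k] F(2) q0 by simp
  then show "k \<le> multiplicity q (phi F)"
    using prime_elem_multiplicity_mult_distrib[OF q(1) \<open>phi s \<noteq> 0\<close> F(2)] not_dvd_imp_multiplicity_0[OF ns] by simp
qed

subsection \<open>The equation of the divisor\<close>

lemma linear_form_expand:
  fixes l :: "('n::finite, 'a::comm_ring_1) mvpoly"
  assumes "l \<in> homog 1"
  shows "l = (\<Sum>i\<in>UNIV. const (Poly_Mapping.lookup l (Poly_Mapping.single i 1)) * var i)"
proof (rule poly_mapping_eqI)
  fix m :: "'n \<Rightarrow>\<^sub>0 nat"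
  let ?r = "\<Sum>i\<in>UNIV. const (Poly_Mapping.lookup l (Poly_Mapping.single i 1)) * var i"
  have r: "Poly_Mapping.lookup ?r m = (\<Sum>i\<in>UNIV. if m = Poly_Mapping.single i 1 then Poly_Mapping.lookup l m else 0)"
    unfolding lookup_sum
    by (rule sum.cong) (auto simp: const_def var_def mult_single lookup_single when_def)
  show "Poly_Mapping.lookup l m = Poly_Mapping.lookup ?r m"
  proof (cases "\<exists>i. m = Poly_Mapping.single i 1")
    case True
    then obtain i where i: "m = Poly_Mapping.single i 1" by blast
    have e: "m = Poly_Mapping.single j 1 \<longleftrightarrow> j = i" for j
      unfolding i by (metis lookup_single_eq lookup_single_not_eq zero_neq_one)
    show ?thesis unfolding r e by simp
  next
    case False
    have "mdeg m \<noteq> 1"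
    proof
      assume m: "mdeg m = 1"
      then have s: "(\<Sum>i\<in>UNIV. Poly_Mapping.lookup m i) = 1" by (simp add: mdeg_def del: of_nat_sum)
      then obtain i where i: "Poly_Mapping.lookup m i = 1" "\<forall>j. j \<noteq> i \<longrightarrow> Poly_Mapping.lookup m j = 0"
        using sum_eq_1_iff[of UNIV "Poly_Mapping.lookup m"] by auto
      then have "m = Poly_Mapping.single i 1"
        by (intro poly_mapping_eqI) (auto simp: lookup_single when_def)
      then show False using False by blast
    qed
    then have "Poly_Mapping.lookup l m = 0" using assms unfolding homog_iff by blast
    then show ?thesis by (simp only: r if_cancel sum.neutral_const)
  qed
qed

lemma cf_seg: "cf (seg i :: 'a::field cox) 1 0 1 0 0 = (if i = 0 then 1 else 0)"
  "cf (seg i :: 'a cox) 0 1 1 0 0 = (if i = 1 then 1 else 0)"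
  "cf (seg i :: 'a cox) 1 0 0 1 0 = (if i = 2 then 1 else 0)"
  "cf (seg i :: 'a cox) 0 1 0 1 0 = (if i = 3 then 1 else 0)"
  "cf (seg i :: 'a cox) 1 0 0 0 1 = (if i = 4 then 1 else 0)"
  "cf (seg i :: 'a cox) 0 1 0 0 1 = (if i = 5 then 1 else 0)"
proof -
  have t: "cf t0 0 0 k l m = (if k = 1 \<and> l = 0 \<and> m = 0 then 1 else 0 :: 'a)"
    "cf t1 0 0 k l m = (if k = 0 \<and> l = 1 \<and> m = 0 then 1 else 0 :: 'a)"
    "cf t2 0 0 k l m = (if k = 0 \<and> l = 0 \<and> m = 1 then 1 else 0 :: 'a)" for k l m
    using cf_t0[of 1 0 0 k l m] cf_t1[of 1 0 0 k l m] cf_t2[of 1 0 0 k l m] by (auto simp: cf_one)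
  have i: "i \<in> {0, 1, 2, 3, 4, 5}" unfolding UNIV_6[symmetric] by simp
  show "cf (seg i :: 'a::field cox) 1 0 1 0 0 = (if i = 0 then 1 else 0)"
    "cf (seg i :: 'a cox) 0 1 1 0 0 = (if i = 1 then 1 else 0)"
    "cf (seg i :: 'a cox) 1 0 0 1 0 = (if i = 2 then 1 else 0)"
    "cf (seg i :: 'a cox) 0 1 0 1 0 = (if i = 3 then 1 else 0)"
    "cf (seg i :: 'a cox) 1 0 0 0 1 = (if i = 4 then 1 else 0)"
    "cf (seg i :: 'a cox) 0 1 0 0 1 = (if i = 5 then 1 else 0)"
    using i by (auto simp: seg_def cf_s0 cf_s1 t)
qed

lemma seg_independent:
  fixes c :: "6 \<Rightarrow> 'a::field"
  assumes "(\<Sum>i\<in>UNIV. scB (c i) (seg i)) = 0"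
  shows "c i = 0"
proof -
  have z: "(\<Sum>i\<in>UNIV. c i * cf (seg i) a b k l m) = 0" for a b k l m
    using arg_cong[OF assms, of "\<lambda>F. cf F a b k l m"] by (simp add: cf_sum cf_scB)
  have d: "(\<Sum>i\<in>UNIV. c i * (if i = a then 1 else 0)) = c a" for a
    by (simp add: if_distrib sum.delta cong: if_cong)
  have "c 0 = 0" "c 1 = 0" "c 2 = 0" "c 3 = 0" "c 4 = 0" "c 5 = 0"
    using z[of 1 0 1 0 0] z[of 0 1 1 0 0] z[of 1 0 0 1 0] z[of 0 1 0 1 0] z[of 1 0 0 0 1] z[of 0 1 0 0 1]
    by (simp_all only: cf_seg d)
  then have "\<forall>i\<in>UNIV. c i = 0" unfolding UNIV_6 by simp
  then show ?thesis by simp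
qed

text \<open>No hyperplane contains the scroll, since its six coordinates restrict to distinct
  monomials. So \<open>form_div scroll111 l\<close> is the divisor of an actual hyperplane
  section.\<close>

lemma phi_linear_form:
  fixes l :: "(6, 'a::field) mvpoly"
  assumes l: "l \<in> homog 1" "l \<noteq> 0"
  shows "phi l \<noteq> 0"
proof
  assume "phi l = 0"
  moreover have "phi l = (\<Sum>i\<in>UNIV. scB (Poly_Mapping.lookup l (Poly_Mapping.single i 1)) (seg i))"
    by (subst linear_form_expand[OF l(1)]) (simp add: rhom_sum[OF rhom_phi] phi_scale phi_var)
  ultimately have c: "Poly_Mapping.lookup l (Poly_Mapping.single i 1) = 0" for i
    using seg_independent[of "\<lambda>i. Poly_Mapping.lookup l (Poly_Mapping.single i 1)" i] by simp
  have "l = 0" by (subst linear_form_expand[OF l(1)]) (simp only: c const_0 mult_zero_left sum.neutral_const)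
  then show False using l(2) by simp
qed

definition fibre_eq :: "(2 \<Rightarrow> 'a::field) \<Rightarrow> 'a cox" where
  "fibre_eq p = scB (p 1) s0 - scB (p 0) s1"

lemma fibre_eq_bih: "fibre_eq p \<in> bih 1 0"
  unfolding fibre_eq_def by (intro bih_diff scB_bih bih_vars)

lemma evB_scB: "evB s t (scB c F) = c * evB s t F"
  by (simp add: scB_def rhom_mult[OF rhom_evB] evB_simps)

lemma evB_fibre_eq: "evB s t (fibre_eq p) = p 1 * s 0 - p 0 * s 1"
  by (simp add: fibre_eq_def rhom_diff[OF rhom_evB] evB_scB evB_simps)

lemma bih_0_unit:
  fixes F :: "'a::field cox"
  assumes "F \<in> bih 0 0" "F \<noteq> 0"
  shows "F dvd 1"
proof -
  let ?c = "cf F 0 0 0 0 0"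
  have e: "F = kB (to_copy ?c)" by (rule bih_unit_const[OF assms(1)])
  have "?c \<noteq> 0"
  proof
    assume "?c = 0"
    then have "F = 0" using e by (simp add: rhom_0[OF rhom_to_copy] rhom_0[OF rhom_kB])
    then show False using assms(2) by simp
  qed
  then have "1 = kB (to_copy ?c) * kB (to_copy (inverse ?c))"
    by (simp add: rhom_mult[OF rhom_kB, symmetric] rhom_mult[OF rhom_to_copy, symmetric] rhom_1[OF rhom_to_copy] rhom_1[OF rhom_kB])
  then show ?thesis using e by (metis dvd_triv_left)
qed

lemma prime_elem_fibre_eq:
  fixes p :: "2 \<Rightarrow> 'a::field"
  assumes "p \<noteq> 0"
  shows "prime_elem (fibre_eq p)"
proof (rule irreducible_imp_prime_elem, rule irreducibleI)
  have e: "evB (\<lambda>i. if i = 0 then x else y) 0 (fibre_eq p) = p 1 * x - p 0 * y" for x y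
    by (simp add: evB_fibre_eq)
  show nz: "fibre_eq p \<noteq> 0"
  proof
    assume "fibre_eq p = 0"
    then have "p 1 * x - p 0 * y = 0" for x y using e[of x y] by (simp add: rhom_0[OF rhom_evB])
    from this[of 1 0] this[of 0 1] show False using assms by (simp add: nonzero_2)
  qed
  show "\<not> fibre_eq p dvd 1"
  proof
    assume "fibre_eq p dvd 1"
    then obtain r where r: "1 = fibre_eq p * r" by (elim dvdE)
    then obtain i j k l where "fibre_eq p \<in> bih i j" "i + k = 0" using bih_factors[of "fibre_eq p" r 0 0] bih_1 by auto
    then show False using bih_unique(1)[OF fibre_eq_bih _ nz] by force
  qed
  fix F G assume FG: "fibre_eq p = F * G"
  then have nzFG: "F \<noteq> 0" "G \<noteq> 0" using nz by auto
  obtain i j k l where d: "F \<in> bih i j" "G \<in> bih k l" "i + k = 1" "j + l = 0"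
    using bih_factors[of F G 1 0] fibre_eq_bih[of p] FG nz by auto
  then have "(i = 0 \<and> j = 0) \<or> (k = 0 \<and> l = 0)" by linarith
  then show "F dvd 1 \<or> G dvd 1" using bih_0_unit d(1,2) nzFG by blast
qed

lemma ruling_plane_zset:
  fixes p :: "2 \<Rightarrow> 'a::field"
  assumes p: "p \<noteq> 0"
  shows "ruling_plane p = zset (fibre_eq p)"
proof (intro equalityI subsetI)
  fix v assume "v \<in> ruling_plane p"
  then obtain t where t: "v = segre_map p t" "t \<noteq> 0" unfolding ruling_plane_def by blast
  have "evB p t (fibre_eq p) = 0" by (simp add: evB_fibre_eq mult.commute)
  then show "v \<in> zset (fibre_eq p)" using zset_segre[OF fibre_eq_bih p t(2)] t(1) by blast
next
  fix v assume v: "v \<in> zset (fibre_eq p)"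
  then obtain s t where st: "v = segre_map s t" "s \<noteq> 0" "t \<noteq> 0" by (rule scrollE[OF subsetD[OF zset_scroll]])
  then have "evB s t (fibre_eq p) = 0" using v zset_segre[OF fibre_eq_bih] by blast
  then have eq: "p 1 * s 0 = p 0 * s 1" by (simp add: evB_fibre_eq)
  have "\<exists>c. c \<noteq> 0 \<and> s 0 = c * p 0 \<and> s 1 = c * p 1"
  proof (cases "p 0 = 0")
    case True
    then have "p 1 \<noteq> 0" "s 0 = 0" "s 1 \<noteq> 0" using p st(2) eq by (auto simp: nonzero_2)
    then show ?thesis using True by (intro exI[of _ "s 1 / p 1"]) simp
  next
    case False
    then have "s 0 \<noteq> 0" using st(2) eq by (auto simp: nonzero_2)
    then show ?thesis using False eq by (intro exI[of _ "s 0 / p 0"]) (simp add: field_simps)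
  qed
  then obtain c where c: "c \<noteq> 0" "s 0 = c * p 0" "s 1 = c * p 1" by blast
  have "segre_map s t = segre_map p (\<lambda>i. c * t i)" by (simp add: fun_eq_6 segre_map_def c(2,3))
  moreover have "(\<lambda>i. c * t i) \<noteq> 0" using st(3) c(1) by (auto simp: nonzero_3)
  ultimately show "v \<in> ruling_plane p" using st(1) unfolding ruling_plane_def by blast
qed

lemma multiplicity_prime_zset:
  fixes q r :: "'a::alg_closed_field cox"
  assumes q: "prime_elem q" "q \<in> bih a b" and r: "prime_elem r" "r \<in> bih c d"
  shows "multiplicity r q = (if zset r = zset q then 1 else 0)"
proof (cases "r dvd q")
  case True
  then have qr: "q dvd r"
    using q(1) r(1) prime_elem_imp_irreducible by (meson irreducibleD' prime_elem_not_unit)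
  then have "zset r = zset q" using zset_dvd True by blast
  moreover have "multiplicity r q = 1"
  proof (rule multiplicity_eqI)
    show "r ^ 1 dvd q" using True by simp
    show "\<not> r ^ Suc 1 dvd q"
    proof
      assume "r ^ Suc 1 dvd q"
      then have "r * r dvd r * 1" using dvd_trans[OF _ qr, of "r * r"] by simp
      moreover have "r \<noteq> 0" using r(1) by auto
      ultimately have "r dvd 1" by (metis dvd_times_left_cancel_iff)
      then show False using r(1) by (simp add: prime_elem_def)
    qed
  qed
  ultimately show ?thesis by simp
next
  case False
  then have "zset r \<noteq> zset q" using zset_sub_imp_dvd[OF r q(2)] by blast
  then show ?thesis using not_dvd_imp_multiplicity_0[OF False] by simp
qed

text \<open>With denominators cleared, linear equivalence says that two bihomogeneous elements have
  the same multiplicity at every prime. They then differ by a unit, and comparing bidegrees gives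
  (a, b) = (1, 1) + (d - 3) (1, 0).\<close>

lemma divisor_equation:
  fixes X :: "(6 \<Rightarrow> 'a::alg_closed_field) set"
  assumes d: "d \<ge> 3" and X: "prime_divisor scroll111 X" and l: "l \<in> homog 1" "l \<noteq> 0" and p: "p \<noteq> 0"
    and eq: "lin_equiv scroll111 (prime_div X)
           (\<lambda>Y. form_div scroll111 l Y + (int d - 3) * prime_div (ruling_plane p) Y)"
  shows "\<exists>q. prime_elem q \<and> q \<in> bih (d - 2) 1 \<and> X = zset q"
proof -
  obtain q a b where q: "prime q" "q \<in> bih a b" "X = zset q"
    using prime_divisor_is_zset[OF X] by (elim exE conjE)
  have qe: "prime_elem q" "q \<noteq> 0" using q(1) by auto
  obtain n g h where gh: "g \<in> homog n" "h \<in> homog n" "g \<notin> vanishing_ideal scroll111" "h \<notin> vanishing_ideal scroll111"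
    and div: "\<forall>Y. prime_divisor scroll111 Y \<longrightarrow>
      prime_div X Y - (form_div scroll111 l Y + (int d - 3) * prime_div (ruling_plane p) Y)
        = form_div scroll111 g Y - form_div scroll111 h Y"
    using eq unfolding lin_equiv_def by (elim exE conjE)
  have van: "f \<in> vanishing_ideal scroll111" if f0: "f \<in> homog n" "phi f = 0" for f :: "(6, 'a) mvpoly"
  proof -
    have "peval f v = 0" if v: "v \<in> scroll111" for v
    proof -
      obtain s t where "v = segre_map s t" using v by (rule scrollE)
      then show ?thesis using f0(2) by (simp add: peval_segre rhom_0[OF rhom_evB])
    qed
    then show ?thesis unfolding vanishing_ideal_homog[OF f0(1)] by (intro ballI)
  qed
  have nz: "phi g \<noteq> 0" "phi h \<noteq> 0" "phi l \<noteq> 0"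
    by (rule notI, rule notE[OF gh(3) van[OF gh(1)]], assumption)
      (rule notI, rule notE[OF gh(4) van[OF gh(2)]], assumption, rule phi_linear_form[OF l])
  let ?f = "fibre_eq p"
  have f: "prime_elem ?f" "?f \<in> bih 1 0" "?f \<noteq> 0" using prime_elem_fibre_eq[OF p] fibre_eq_bih by auto
  \<comment> \<open>\<open>A\<close> and \<open>C\<close> collect the two sides of X + div h = H +
    (d - 3) F + div g.\<close>
  define A where "A = q * phi h"
  define C where "C = phi l * (?f ^ (d - 3) * phi g)"
  have nzAC: "A \<noteq> 0" "C \<noteq> 0" using qe nz f(3) by (simp_all add: A_def C_def)
  have Ab: "A \<in> bih (a + nat n) (b + nat n)"
    unfolding A_def by (intro bih_mult q(2) phi_homog_int(2)[OF gh(2) nz(2)])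
  have "C \<in> bih (nat 1 + ((d - 3) * 1 + nat n)) (nat 1 + ((d - 3) * 0 + nat n))"
    unfolding C_def by (intro bih_mult bih_power f(2) phi_homog_int(2)[OF gh(1) nz(1)] phi_homog_int(2)[OF l(1) nz(3)])
  moreover have "nat 1 + ((d - 3) * 1 + nat n) = d - 2 + nat n" "nat 1 + ((d - 3) * 0 + nat n) = 1 + nat n"
    using d by simp_all
  ultimately have Cb: "C \<in> bih (d - 2 + nat n) (1 + nat n)" by (simp only:)
  have nAC: "normalize A = normalize C"
  proof (rule multiplicity_eq_imp_eq[OF nzAC])
    fix r :: "'a cox" assume "prime r"
    then have r: "prime_elem r" by auto
    show "multiplicity r A = multiplicity r C"
    proof (cases "\<exists>i j. r \<in> bih i j")
      case True
      then obtain i j where rb: "r \<in> bih i j" by blast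
      have o: "form_div scroll111 F (zset r) = int (multiplicity r (phi F))" if "F \<in> homog m" "phi F \<noteq> 0" for F m
        unfolding form_div_def using ord_along_zset[OF r rb that] by simp
      have pd: "prime_div (zset q') (zset r) = int (multiplicity r q')" if "prime_elem q'" "q' \<in> bih i' j'" for q' :: "'a cox" and i' j'
        using multiplicity_prime_zset[OF that r rb] by (simp add: prime_div_def)
      have e: "int d - 3 = int (d - 3)" using d by simp
      have h1: "int (multiplicity r q) - (int (multiplicity r (phi l)) + (int d - 3) * int (multiplicity r ?f))
          = int (multiplicity r (phi g)) - int (multiplicity r (phi h))"
        using div[rule_format, OF zset_prime_divisor[OF r rb]]
        unfolding q(3) ruling_plane_zset[OF p] pd[OF qe(1) q(2)] pd[OF f(1,2)] o[OF gh(1) nz(1)] o[OF gh(2) nz(2)] o[OF l(1) nz(3)] .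
      have "int (multiplicity r q + multiplicity r (phi h))
        = int (multiplicity r (phi l) + ((d - 3) * multiplicity r ?f + multiplicity r (phi g)))"
        using h1 unfolding e of_nat_add of_nat_mult by linarith
      then have "multiplicity r q + multiplicity r (phi h)
        = multiplicity r (phi l) + ((d - 3) * multiplicity r ?f + multiplicity r (phi g))" by (simp only: of_nat_eq_iff)
      then show ?thesis
        unfolding A_def C_def using qe(2) nz f(3)
        by (simp add: prime_elem_multiplicity_mult_distrib[OF r] prime_elem_multiplicity_power_distrib[OF r])
    next
      case False
      \<comment> \<open>The hypothesis speaks only of prime divisors, hence of bihomogeneous primes.
        Any other prime divides neither element, because factors of bihomogeneous elements are
        bihomogeneous.\<close>
      have nd: "\<not> r dvd F" if F: "F \<in> bih i j" "F \<noteq> 0" for F i j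
      proof
        assume "r dvd F"
        then obtain F' where F': "F = r * F'" by (elim dvdE)
        show False using bih_factor[of r F' i j] F False unfolding F' by simp
      qed
      show ?thesis
        unfolding not_dvd_imp_multiplicity_0[OF nd[OF Ab nzAC(1)]] not_dvd_imp_multiplicity_0[OF nd[OF Cb nzAC(2)]] ..
    qed
  qed
  have dv: "A dvd C" "C dvd A" by (rule associatedD1[OF nAC], rule associatedD2[OF nAC])
  obtain u where u: "C = A * u" using dv(1) by (elim dvdE)
  obtain w where w: "A = C * w" using dv(2) by (elim dvdE)
  have "A * (u * w) = C * w" unfolding u by (rule mult.assoc[symmetric])
  also have "\<dots> = A * 1" unfolding w[symmetric] by simp
  finally have "A * (u * w) = A * 1" .
  then have uw: "u * w = 1" using nzAC(1) mult_left_cancel by blast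
  \<comment> \<open>A unit has bidegree (0, 0), so the associated elements \<open>A\<close> and
    \<open>C\<close> have equal bidegrees.\<close>
  have uwb: "u * w \<in> bih 0 0" "u * w \<noteq> 0" unfolding uw by (simp_all add: bih_1)
  obtain i j k m where ij: "u \<in> bih i j" "i + k = 0" "j + m = 0" using bih_factors[OF uwb] by (elim exE conjE)
  then have "u \<in> bih 0 0" by simp
  then have "C \<in> bih (a + nat n) (b + nat n)" using bih_mult[OF Ab, of u 0 0] unfolding u by simp
  from bih_unique[OF Cb this nzAC(2)] have "a = d - 2" "b = 1" by simp_all
  then show ?thesis using q(2,3) qe(1) by (intro exI[of _ q]) simp
qed

subsection \<open>Koszul homology of the modules \<open>M e\<close>\<close>

lemma kd_Nil: "kd [] i w = 0"
  by (rule ext) simp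

declare kd.simps(1) [simp del] kd_Nil [simp]

text \<open>\<open>twist e k\<close> is the degree-\<open>k\<close> piece of the graded module over the coordinate ring of the scroll
  consisting of the global sections of \<open>O(k, k + e)\<close>.\<close>

definition twist :: "nat \<Rightarrow> int \<Rightarrow> 'a::field cox set" where
  "twist e k = (if k < 0 then {0} else bih (nat k) (nat k + e))"

lemma twist_neg: "k < 0 \<Longrightarrow> twist e k = {0}" and twist_nat: "twist e (int n) = bih n (n + e)"
  by (simp_all add: twist_def)

lemma twist_0 [simp]: "0 \<in> twist e k"
  and twist_add: "F \<in> twist e k \<Longrightarrow> G \<in> twist e k \<Longrightarrow> F + G \<in> twist e k"
  and twist_diff: "F \<in> twist e k \<Longrightarrow> G \<in> twist e k \<Longrightarrow> F - G \<in> twist e k"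
  and twist_uminus: "F \<in> twist e k \<Longrightarrow> - F \<in> twist e k"
  and twist_scB: "F \<in> twist e k \<Longrightarrow> scB c F \<in> twist e k"
  by (auto simp: twist_def bih_add bih_diff bih_uminus scB_bih split: if_splits)

lemma twist_mult:
  assumes y: "y \<in> bih 1 1" and F: "F \<in> twist e (k - 1)"
  shows "y * F \<in> twist e k"
proof (cases "k - 1 < 0")
  case True
  then show ?thesis using F by (simp add: twist_neg)
next
  case False
  then obtain n where n: "k - 1 = int n" by (metis nonneg_int_cases not_less)
  then have k: "k = int (Suc n)" by simp
  have "y * F \<in> bih (1 + n) (1 + (n + e))" using F y unfolding n twist_nat by (intro bih_mult)
  then show ?thesis unfolding k twist_nat by simp
qed

text \<open>The part of internal degree \<open>n\<close>. Basis elements in homological degree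
  \<open>i\<close> have degree \<open>i\<close>, so the entries have degree \<open>n - i\<close>; in
  particular the chains vanish for \<open>n < i\<close>.\<close>

definition kos_chain :: "'a::field cox list \<Rightarrow> nat \<Rightarrow> nat \<Rightarrow> int \<Rightarrow> (nat \<Rightarrow> 'a cox) set" where
  "kos_chain ys e i n = {w \<in> kchains ys i. \<forall>b. w b \<in> twist e (n - int i)}"

definition cyc :: "'a::field cox list \<Rightarrow> nat \<Rightarrow> (nat \<Rightarrow> 'a cox) \<Rightarrow> bool" where
  "cyc ys i z \<longleftrightarrow> (case i of 0 \<Rightarrow> True | Suc k \<Rightarrow> kd ys k z = 0)"

lemma cyc_simps [simp]: "cyc ys 0 z" "cyc ys (Suc k) z \<longleftrightarrow> kd ys k z = 0"
  by (simp_all add: cyc_def)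

lemma kos_chain_kchains: "w \<in> kos_chain ys e i n \<Longrightarrow> w \<in> kchains ys i"
  by (simp add: kos_chain_def)

lemma kos_chain_0 [simp]: "0 \<in> kos_chain ys e i n"
  by (simp add: kos_chain_def kchains_0)

lemma kos_chain_add: "v \<in> kos_chain ys e i n \<Longrightarrow> w \<in> kos_chain ys e i n \<Longrightarrow> v + w \<in> kos_chain ys e i n"
  and kos_chain_diff: "v \<in> kos_chain ys e i n \<Longrightarrow> w \<in> kos_chain ys e i n \<Longrightarrow> v - w \<in> kos_chain ys e i n"
  by (simp_all add: kos_chain_def kchains_add kchains_diff twist_add twist_diff)

lemma kos_chain_sign: "v \<in> kos_chain ys e i n \<Longrightarrow> smul ((- 1) ^ k) v \<in> kos_chain ys e i n"
  by (cases "even k") (simp_all add: kos_chain_def kchains_smul twist_uminus)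

lemma kos_chain_smul_form:
  assumes "y \<in> bih 1 1" "v \<in> kos_chain ys e i (n - 1)"
  shows "smul y v \<in> kos_chain ys e i n"
proof -
  have "n - 1 - int i = n - int i - 1" by simp
  moreover have "v b \<in> twist e (n - 1 - int i)" for b using assms(2) by (simp add: kos_chain_def)
  ultimately have "v b \<in> twist e (n - int i - 1)" for b by (simp only:)
  then have "y * v b \<in> twist e (n - int i)" for b by (rule twist_mult[OF assms(1)])
  then show ?thesis using kchains_smul[OF kos_chain_kchains[OF assms(2)]] by (simp add: kos_chain_def)
qed

lemma kos_chain_smul_sign_form:
  assumes "y \<in> bih 1 1" "v \<in> kos_chain ys e i (n - 1)"
  shows "smul ((- 1) ^ k * y) v \<in> kos_chain ys e i n"
  using kos_chain_sign[OF kos_chain_smul_form[OF assms], of k] by (simp only: smul_smul)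

lemma vhi_kos_chain: "w \<in> kos_chain (y # ys) e (Suc i) n \<Longrightarrow> vhi (length ys choose Suc i) w \<in> kos_chain ys e i (n - 1)"
proof -
  assume w: "w \<in> kos_chain (y # ys) e (Suc i) n"
  have e: "n - 1 - int i = n - int (Suc i)" by simp
  show ?thesis
    unfolding kos_chain_def e using w vhi_kchains[OF kos_chain_kchains[OF w]] by (simp add: kos_chain_def) (simp add: vhi_def)
qed

lemma vlo_kos_chain: "w \<in> kos_chain (y # ys) e i n \<Longrightarrow> vlo (length ys choose i) w \<in> kos_chain ys e i n"
  unfolding kos_chain_def mem_Collect_eq by (intro conjI vlo_kchains) (simp add: vlo_def)

lemma vjoin_kos_chain: "u \<in> kos_chain ys e (Suc i) n \<Longrightarrow> v \<in> kos_chain ys e i (n - 1) \<Longrightarrow>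
    vjoin (length ys choose Suc i) u v \<in> kos_chain (y # ys) e (Suc i) n"
proof -
  assume u: "u \<in> kos_chain ys e (Suc i) n" and v: "v \<in> kos_chain ys e i (n - 1)"
  have e: "n - 1 - int i = n - int (Suc i)" by simp
  have "v b \<in> twist e (n - int (Suc i))" for b using v unfolding kos_chain_def e by simp
  then show ?thesis
    using u vjoin_kchains[OF kos_chain_kchains[OF v], of u y] by (simp add: kos_chain_def) (simp add: vjoin_def)
qed

lemma kd_kos_chain: "set ys \<subseteq> bih 1 1 \<Longrightarrow> w \<in> kos_chain ys e (Suc i) n \<Longrightarrow> kd ys i w \<in> kos_chain ys e i n"
proof (induction ys arbitrary: i n w)
  case Nil
  show ?case unfolding kd_Nil by (rule kos_chain_0)
next
  case (Cons y ys)
  let ?u = "vlo (length ys choose Suc i) w" and ?v = "vhi (length ys choose Suc i) w"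
  have y: "y \<in> bih 1 1" and ys: "set ys \<subseteq> bih 1 1" using Cons.prems(1) by simp_all
  have u: "?u \<in> kos_chain ys e (Suc i) n" by (rule vlo_kos_chain[OF Cons.prems(2)])
  have v: "?v \<in> kos_chain ys e i (n - 1)" by (rule vhi_kos_chain[OF Cons.prems(2)])
  have a: "kd ys i ?u + smul ((- 1) ^ i * y) ?v \<in> kos_chain ys e i n"
    by (intro kos_chain_add Cons.IH[OF ys u] kos_chain_smul_sign_form[OF y v])
  show ?case
  proof (cases i)
    case 0
    then have "vjoin (length ys choose i) (kd ys i ?u + smul ((- 1) ^ i * y) ?v) 0
      = kd ys i ?u + smul ((- 1) ^ i * y) ?v"
      using kos_chain_kchains[OF a] by (intro vjoin_zero_right) (simp add: kchains_def)
    then show ?thesis using a 0 by (simp add: kos_chain_def kchains_def)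
  next
    case (Suc k)
    then have "kd ys k ?v \<in> kos_chain ys e k (n - 1)" using Cons.IH[OF ys] v by simp
    then show ?thesis using vjoin_kos_chain[of _ ys e k n] a Suc by simp
  qed
qed

definition exact :: "'a::field cox list \<Rightarrow> nat \<Rightarrow> nat \<Rightarrow> int \<Rightarrow> bool" where
  "exact ys e i n \<longleftrightarrow> (\<forall>z\<in>kos_chain ys e i n. cyc ys i z \<longrightarrow> (\<exists>w\<in>kos_chain ys e (Suc i) n. kd ys i w = z))"

text \<open>Injectivity of multiplication by \<open>y\<close> on the \<open>k\<close>-th Koszul
  homology, from internal degree \<open>m\<close> to \<open>m + 1\<close>, spelled out on
  representatives.\<close>

definition mult_inj :: "'a::field cox list \<Rightarrow> 'a cox \<Rightarrow> nat \<Rightarrow> nat \<Rightarrow> int \<Rightarrow> bool" where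
  "mult_inj ys y e k m \<longleftrightarrow> (\<forall>v\<in>kos_chain ys e k m. cyc ys k v \<longrightarrow> (\<exists>u\<in>kos_chain ys e (Suc k) (m + 1). kd ys k u = smul y v) \<longrightarrow>
     (\<exists>w\<in>kos_chain ys e (Suc k) m. kd ys k w = v))"

lemma exact_imp_mult_inj: "exact ys e k m \<Longrightarrow> mult_inj ys y e k m"
  unfolding exact_def mult_inj_def by simp

text \<open>One step of the long exact sequence of a mapping cone.\<close>

lemma exact_Cons:
  assumes y: "y \<in> bih 1 1" and ex: "exact ys e (Suc k) n" and inj: "mult_inj ys y e k (n - 1)"
  shows "exact (y # ys) e (Suc k) n"
  unfolding exact_def
proof (intro ballI impI)
  fix z assume z: "z \<in> kos_chain (y # ys) e (Suc k) n" "cyc (y # ys) (Suc k) z"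
  define u where "u = vlo (length ys choose Suc k) z"
  define v where "v = vhi (length ys choose Suc k) z"
  have zj: "z = vjoin (length ys choose Suc k) u v" by (simp only: u_def v_def vjoin_lo_hi)
  have u: "u \<in> kos_chain ys e (Suc k) n" unfolding u_def by (rule vlo_kos_chain[OF z(1)])
  have v: "v \<in> kos_chain ys e k (n - 1)" unfolding v_def by (rule vhi_kos_chain[OF z(1)])
  let ?s = "(- 1) ^ k * y"
  have "vjoin (length ys choose k) (kd ys k u + smul ?s v) (case k of 0 \<Rightarrow> 0 | Suc l \<Rightarrow> kd ys l v) = 0"
    using z(2) kd_vjoin[OF kos_chain_kchains[OF u], of y v] by (simp only: cyc_simps zj)
  moreover have "kd ys k u + smul ?s v \<in> kchains ys k"
    by (intro kchains_add kd_kchains kchains_smul kos_chain_kchains[OF v])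
  ultimately have k1: "kd ys k u + smul ?s v = 0" and k2: "(case k of 0 \<Rightarrow> 0 | Suc l \<Rightarrow> kd ys l v) = 0"
    using vjoin_eq_0_iff[of "length ys choose k" "kd ys k u + smul ?s v"] by (simp_all add: kchains_def)
  have cv: "cyc ys k v" using k2 by (cases k) simp_all
  have ss: "(- 1) ^ k * ((- 1) ^ k * x) = (x :: 'a cox)" for x
    by (cases "even k") simp_all
  have "kd ys k (smul ((- 1) ^ Suc k) u) = smul y v"
  proof
    fix b
    have "kd ys k u b + (- 1) ^ k * y * v b = 0" using fun_cong[OF k1, of b] by simp
    then have "kd ys k u b = - ((- 1) ^ k * (y * v b))" by (simp add: eq_neg_iff_add_eq_0 mult.assoc)
    then show "kd ys k (smul ((- 1) ^ Suc k) u) b = smul y v b" by (simp add: kd_smul ss)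
  qed
  moreover have "smul ((- 1) ^ Suc k) u \<in> kos_chain ys e (Suc k) (n - 1 + 1)" using kos_chain_sign[OF u, of "Suc k"] by simp
  \<comment> \<open>Up to sign \<open>y\<close> times \<open>v\<close> is the boundary of
    \<open>u\<close>, so injectivity makes \<open>v\<close> a boundary. Subtracting the
    corresponding multiple of \<open>w\<close> turns \<open>u\<close> into a cycle over
    \<open>ys\<close>, to which \<open>ex\<close> applies.\<close>
  ultimately obtain w where w: "w \<in> kos_chain ys e (Suc k) (n - 1)" "kd ys k w = v"
    using inj v cv unfolding mult_inj_def by blast
  have "kd ys k (u + smul ?s w) = 0" unfolding kd_add kd_smul w(2) by (rule k1)
  moreover have "u + smul ?s w \<in> kos_chain ys e (Suc k) n" by (intro kos_chain_add u kos_chain_smul_sign_form[OF y w(1)])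
  ultimately obtain u2 where u2: "u2 \<in> kos_chain ys e (Suc (Suc k)) n" "kd ys (Suc k) u2 = u + smul ?s w"
    using ex unfolding exact_def by auto
  have "kd (y # ys) (Suc k) (vjoin (length ys choose Suc (Suc k)) u2 w) = z"
    unfolding kd_vjoin[OF kos_chain_kchains[OF u2(1)]] u2(2) by (simp add: w(2) zj smul_uminus)
  then show "\<exists>w\<in>kos_chain (y # ys) e (Suc (Suc k)) n. kd (y # ys) (Suc k) w = z"
    using vjoin_kos_chain[OF u2(1) w(1)] by (intro bexI)
qed

section \<open>Homological degree zero: the submodules generated by the forms\<close>

fun lin_comb :: "'a::field cox list \<Rightarrow> nat \<Rightarrow> int \<Rightarrow> 'a cox set" where
  "lin_comb [] e n = {0}"
| "lin_comb (y # ys) e n = {y * G + H | G H. G \<in> twist e (n - 1) \<and> H \<in> lin_comb ys e n}"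

lemma lin_comb_ConsI: "G \<in> twist e (n - 1) \<Longrightarrow> H \<in> lin_comb ys e n \<Longrightarrow> F = y * G + H \<Longrightarrow> F \<in> lin_comb (y # ys) e n"
  unfolding lin_comb.simps by blast

lemma lin_comb_ConsE:
  assumes "F \<in> lin_comb (y # ys) e n"
  obtains G H where "F = y * G + H" "G \<in> twist e (n - 1)" "H \<in> lin_comb ys e n"
  using assms unfolding lin_comb.simps by blast

lemma lin_comb_0: "0 \<in> lin_comb ys e n"
  by (induction ys) (simp, rule lin_comb_ConsI[of 0 _ _ 0], simp_all)

lemma lin_comb_add: "F \<in> lin_comb ys e n \<Longrightarrow> G \<in> lin_comb ys e n \<Longrightarrow> F + G \<in> lin_comb ys e n"
proof (induction ys arbitrary: F G)
  case (Cons y ys)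
  obtain A H where F: "F = y * A + H" "A \<in> twist e (n - 1)" "H \<in> lin_comb ys e n" using Cons.prems(1) by (rule lin_comb_ConsE)
  obtain A' H' where G: "G = y * A' + H'" "A' \<in> twist e (n - 1)" "H' \<in> lin_comb ys e n" using Cons.prems(2) by (rule lin_comb_ConsE)
  show ?case
    by (rule lin_comb_ConsI[OF twist_add[OF F(2) G(2)] Cons.IH[OF F(3) G(3)]]) (simp add: F(1) G(1) algebra_simps)
qed simp

lemma lin_comb_scB: "F \<in> lin_comb ys e n \<Longrightarrow> scB c F \<in> lin_comb ys e n"
proof (induction ys arbitrary: F)
  case (Cons y ys)
  obtain A H where F: "F = y * A + H" "A \<in> twist e (n - 1)" "H \<in> lin_comb ys e n" using Cons.prems(1) by (rule lin_comb_ConsE)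
  show ?case
    by (rule lin_comb_ConsI[OF twist_scB[OF F(2), of c] Cons.IH[OF F(3)]]) (simp only: F(1) sB.scale_right_distrib scB_mult)
qed simp

lemma lin_comb_uminus: "F \<in> lin_comb ys e n \<Longrightarrow> - F \<in> lin_comb ys e n"
  using lin_comb_scB[of F ys e n "- 1"] by (simp add: sB.scale_minus_left)

lemma lin_comb_sum: "(\<And>x. x \<in> A \<Longrightarrow> f x \<in> lin_comb ys e n) \<Longrightarrow> sum f A \<in> lin_comb ys e n"
  by (induction A rule: infinite_finite_induct) (auto intro: lin_comb_0 lin_comb_add)

lemma lin_comb_weaken: "F \<in> lin_comb ys e n \<Longrightarrow> F \<in> lin_comb (y # ys) e n"
  by (rule lin_comb_ConsI[of 0]) simp_all

lemma lin_comb_head: "G \<in> twist e (n - 1) \<Longrightarrow> y * G \<in> lin_comb (y # ys) e n"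
  by (rule lin_comb_ConsI[OF _ lin_comb_0, of G]) simp_all

definition uv :: "'a::field cox \<Rightarrow> nat \<Rightarrow> 'a cox" where
  "uv F = (\<lambda>b. if b = 0 then F else 0)"

lemma kchains_0_eq: "w \<in> kchains ys 0 \<Longrightarrow> w = uv (w 0)"
  by (auto simp: kchains_def uv_def fun_eq_iff Suc_le_eq)

text \<open>Reduces exactness and injectivity in homological degree 0 to membership questions about
  single elements.\<close>

lemma lin_comb_boundary: "F \<in> lin_comb ys e n \<longleftrightarrow> (\<exists>u\<in>kos_chain ys e (Suc 0) n. kd ys 0 u = uv F)"
proof (induction ys arbitrary: F)
  case Nil
  have u0: "uv F = 0 \<longleftrightarrow> F = 0"
  proof
    assume "uv F = 0"
    from fun_cong[OF this, of 0] show "F = 0" by (simp add: uv_def)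
  qed (simp add: uv_def fun_eq_iff)
  show ?case
  proof
    assume "F \<in> lin_comb [] e n"
    then have "kd [] 0 0 = uv F" using u0 unfolding kd_Nil by simp
    then show "\<exists>u\<in>kos_chain [] e (Suc 0) n. kd [] 0 u = uv F" by (rule bexI[OF _ kos_chain_0])
  next
    assume "\<exists>u\<in>kos_chain [] e (Suc 0) n. kd [] 0 u = uv F"
    then have "uv F = 0" unfolding kd_Nil by metis
    then show "F \<in> lin_comb [] e n" using u0 by simp
  qed
next
  case (Cons y ys)
  have j: "vjoin (length ys choose 0) x 0 = x" if "x \<in> kchains ys 0" for x :: "nat \<Rightarrow> 'a cox"
    using that by (intro vjoin_zero_right) (simp add: kchains_def)
  show ?case
  proof
    assume "F \<in> lin_comb (y # ys) e n"
    then obtain G H where F: "F = y * G + H" "G \<in> twist e (n - 1)" "H \<in> lin_comb ys e n" by (rule lin_comb_ConsE)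
    obtain u where u: "u \<in> kos_chain ys e (Suc 0) n" "kd ys 0 u = uv H" using Cons.IH F(3) by blast
    have G: "uv G \<in> kos_chain ys e 0 (n - 1)" using F(2) by (simp add: kos_chain_def kchains_def uv_def)
    have "kd (y # ys) 0 (vjoin (length ys choose Suc 0) u (uv G)) = vjoin (length ys choose 0) (uv H + smul y (uv G)) 0"
      using kd_vjoin[OF kos_chain_kchains[OF u(1)], of y "uv G"] u(2) by simp
    also have "\<dots> = uv H + smul y (uv G)" by (rule j) (simp add: kchains_def uv_def)
    also have "\<dots> = uv F" by (auto simp: uv_def F(1) fun_eq_iff)
    finally show "\<exists>u\<in>kos_chain (y # ys) e (Suc 0) n. kd (y # ys) 0 u = uv F"
      using vjoin_kos_chain[OF u(1) G] by (intro bexI)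
  next
    assume "\<exists>u\<in>kos_chain (y # ys) e (Suc 0) n. kd (y # ys) 0 u = uv F"
    then obtain w where w: "w \<in> kos_chain (y # ys) e (Suc 0) n" "kd (y # ys) 0 w = uv F" by blast
    let ?u = "vlo (length ys choose Suc 0) w" and ?v = "vhi (length ys choose Suc 0) w"
    have u: "?u \<in> kos_chain ys e (Suc 0) n" by (rule vlo_kos_chain[OF w(1)])
    have v: "?v \<in> kos_chain ys e 0 (n - 1)" by (rule vhi_kos_chain[OF w(1)])
    have "kd ys 0 ?u + smul y ?v \<in> kchains ys 0"
      by (intro kchains_add kd_kchains kchains_smul kos_chain_kchains[OF v])
    from j[OF this] have eq: "kd ys 0 ?u + smul y ?v = uv F" using w(2) by simp
    have k: "kd ys 0 ?u = uv (kd ys 0 ?u 0)" by (rule kchains_0_eq[OF kd_kchains])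
    have "kd ys 0 ?u 0 \<in> lin_comb ys e n" using Cons.IH[of "kd ys 0 ?u 0"] u k by metis
    moreover have "?v 0 \<in> twist e (n - 1)" using v by (simp add: kos_chain_def)
    moreover have "F = y * ?v 0 + kd ys 0 ?u 0" using fun_cong[OF eq, of 0] by (simp add: uv_def add.commute)
    ultimately show "F \<in> lin_comb (y # ys) e n" by (intro lin_comb_ConsI)
  qed
qed

lemma exact_0: "(\<And>F. F \<in> twist e n \<Longrightarrow> F \<in> lin_comb ys e n) \<Longrightarrow> exact ys e 0 n"
  unfolding exact_def
proof (intro ballI impI)
  fix z assume *: "\<And>F. F \<in> twist e n \<Longrightarrow> F \<in> lin_comb ys e n" and z: "z \<in> kos_chain ys e 0 n"
  have "z 0 \<in> twist e n" using z by (simp add: kos_chain_def)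
  then have "\<exists>u\<in>kos_chain ys e (Suc 0) n. kd ys 0 u = uv (z 0)" by (rule iffD1[OF lin_comb_boundary *])
  then show "\<exists>w\<in>kos_chain ys e (Suc 0) n. kd ys 0 w = z"
    by (simp only: kchains_0_eq[OF kos_chain_kchains[OF z], symmetric])
qed

lemma exact_0_D:
  assumes "exact ys e 0 n" "F \<in> twist e n"
  shows "F \<in> lin_comb ys e n"
proof -
  have "uv F \<in> kos_chain ys e 0 n" using assms(2) by (simp add: kos_chain_def kchains_def uv_def)
  then show ?thesis unfolding lin_comb_boundary using assms(1) unfolding exact_def by (auto dest!: bspec)
qed

lemma mult_inj_0:
  assumes "\<And>F. F \<in> twist e m \<Longrightarrow> y * F \<in> lin_comb ys e (m + 1) \<Longrightarrow> F \<in> lin_comb ys e m"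
  shows "mult_inj ys y e 0 m"
  unfolding mult_inj_def
proof (intro ballI impI)
  fix v assume v: "v \<in> kos_chain ys e 0 m" and ex: "\<exists>u\<in>kos_chain ys e (Suc 0) (m + 1). kd ys 0 u = smul y v"
  have ve: "uv (v 0) = v" by (rule kchains_0_eq[OF kos_chain_kchains[OF v], symmetric])
  have "uv (y * v 0) = smul y (uv (v 0))" by (rule ext) (simp add: uv_def)
  then have "y * v 0 \<in> lin_comb ys e (m + 1)" unfolding lin_comb_boundary ve using ex by simp
  moreover have "v 0 \<in> twist e m" using v by (simp add: kos_chain_def)
  ultimately have "v 0 \<in> lin_comb ys e m" by (intro assms)
  then show "\<exists>w\<in>kos_chain ys e (Suc 0) m. kd ys 0 w = v" unfolding lin_comb_boundary ve .
qed

lemma exact_Nil: "exact [] e (Suc k) n"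
proof -
  have "z = 0" if "z \<in> kos_chain [] e (Suc k) n" for z :: "nat \<Rightarrow> 'a cox"
    by (rule ext) (use kos_chain_kchains[OF that] in \<open>simp add: kchains_def\<close>)
  then have "\<exists>w\<in>kos_chain [] e (Suc (Suc k)) n. kd [] (Suc k) w = z" if "z \<in> kos_chain [] e (Suc k) n" for z :: "nat \<Rightarrow> 'a cox"
    using that by (intro bexI[of _ 0]) simp_all
  then show ?thesis unfolding exact_def by simp
qed

lemma twist_monomials_lin_comb:
  assumes F: "F \<in> twist e n"
    and mon: "\<And>i j k l m. cf F i j k l m \<noteq> 0 \<Longrightarrow> mon i j k l m \<in> lin_comb ys e n"
  shows "F \<in> lin_comb ys e n"
proof (cases "n < 0")
  case True
  then show ?thesis using F by (simp add: twist_neg lin_comb_0)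
next
  case False
  then obtain p where p: "n = int p" by (metis nonneg_int_cases not_less)
  have Fb: "F \<in> bih p (p + e)" using F unfolding p twist_nat .
  have "(\<Sum>x\<in>bimons p (p + e). scB (cft F x) (mont x)) \<in> lin_comb ys e n"
  proof (rule lin_comb_sum)
    fix x assume "x \<in> bimons p (p + e)"
    obtain i j k l m where x: "x = (i, j, k, l, m)" by (cases x)
    show "scB (cft F x) (mont x) \<in> lin_comb ys e n"
    proof (cases "cft F x = 0")
      case False
      then show ?thesis using mon[of i j k l m] by (intro lin_comb_scB) (simp add: x cft_def mont_def)
    qed (simp add: lin_comb_0)
  qed
  then show ?thesis using bih_expand[OF Fb] by simp
qed

lemma twist_cf: "F \<in> twist e (int n) \<Longrightarrow> cf F i j k l m \<noteq> 0 \<Longrightarrow> i + j = n \<and> k + l + m = n + e"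
  unfolding twist_nat using bih_cf by metis

lemma mon_twist: "i + j = n \<Longrightarrow> k + l + m = n + e \<Longrightarrow> mon i j k l m \<in> twist e (int n)"
  unfolding twist_nat using mon_bih[of i j k l m] by simp

declare lin_comb.simps(2) [simp del]

section \<open>The four parameters and the partial quotients of the modules\<close>

text \<open>\<open>h0\<close>, \<open>h1\<close>, \<open>h2\<close>, \<open>h3\<close> are the
  coefficients of (s0 + s1 x) (t0 + t1 x + t2 x^2). They vanish together only if one of the two
  factors is zero, hence nowhere on the scroll, so they are parameters in every characteristic. The
  monomials \<open>h0\<close> and \<open>h3\<close> are used first.\<close>

definition h0 :: "'a::field cox" where "h0 = seg 0"
definition h3 :: "'a::field cox" where "h3 = seg 5"
definition h1 :: "'a::field cox" where "h1 = seg 1 + seg 2"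
definition h2 :: "'a::field cox" where "h2 = seg 3 + seg 4"

lemma h_bih: "h0 \<in> bih 1 1" "h3 \<in> bih 1 1" "h1 \<in> bih 1 1" "h2 \<in> bih 1 1"
  unfolding h0_def h1_def h2_def h3_def by (intro bih_add seg_bih)+

lemma h_eqs: "h0 * F = s0 * (t0 * F)" "h3 * F = s1 * (t2 * F)"
  "h1 * F = s1 * (t0 * F) + s0 * (t1 * F)" "h2 * F = s1 * (t1 * F) + s0 * (t2 * F)"
  by (simp_all add: h0_def h1_def h2_def h3_def seg_def algebra_simps)

lemma cf_h0: "cf (h0 * F) a b c d q = (if a = 0 \<or> c = 0 then 0 else cf F (a - 1) b (c - 1) d q)"
  and cf_h3: "cf (h3 * F) a b c d q = (if b = 0 \<or> q = 0 then 0 else cf F a (b - 1) c d (q - 1))"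
  and cf_h1: "cf (h1 * F) a b c d q = (if b = 0 \<or> c = 0 then 0 else cf F a (b - 1) (c - 1) d q)
    + (if a = 0 \<or> d = 0 then 0 else cf F (a - 1) b c (d - 1) q)"
  and cf_h2: "cf (h2 * F) a b c d q = (if b = 0 \<or> d = 0 then 0 else cf F a (b - 1) c (d - 1) q)
    + (if a = 0 \<or> q = 0 then 0 else cf F (a - 1) b c d (q - 1))"
  unfolding h_eqs cf_add cf_vars by simp_all

lemma h_mon:
  "h0 * mon i j k l m = mon (Suc i) j (Suc k) l m"
  "h3 * mon i j k l m = mon i (Suc j) k l (Suc m)"
  "h1 * mon i j k l m = mon i (Suc j) (Suc k) l m + mon (Suc i) j k (Suc l) m"
  "h2 * mon i j k l m = mon i (Suc j) k (Suc l) m + mon (Suc i) j k l (Suc m)"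
  unfolding h_eqs by (simp_all add: mon_Suc algebra_simps)

abbreviation "hs2 \<equiv> [h3, h0]"
abbreviation "hs3 \<equiv> h1 # hs2"
abbreviation "hs4 \<equiv> h2 # hs3"

lemma lin_comb_mon_h0:
  assumes "(mon (Suc i) j (Suc k) l m :: 'a::field cox) \<in> twist e n"
  shows "(mon (Suc i) j (Suc k) l m :: 'a cox) \<in> lin_comb [h0] e n"
proof -
  have nz: "cf (mon (Suc i) j (Suc k) l m :: 'a cox) (Suc i) j (Suc k) l m \<noteq> 0" by (simp add: cf_mon)
  have "\<not> n < 0"
  proof
    assume "n < 0"
    then have "mon (Suc i) j (Suc k) l m = (0 :: 'a cox)" using assms by (simp add: twist_neg)
    then show False using nz by simp
  qed
  then obtain p where p: "n = int p" by (metis nonneg_int_cases not_less)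
  have d: "Suc i + j = p" "Suc k + l + m = p + e" using twist_cf[of _ e p, OF assms[unfolded p] nz] by simp_all
  have "mon i j k l m \<in> twist e (int (i + j))" using d by (intro mon_twist) simp_all
  moreover have "int (i + j) = n - 1" using d p by simp
  ultimately have "h0 * mon i j k l m \<in> lin_comb [h0] e n" by (intro lin_comb_head) simp
  then show ?thesis unfolding h_mon .
qed

lemma twist_nonneg:
  assumes "F \<in> twist e n" "F \<noteq> 0"
  obtains p where "n = int p"
  using assms by (metis twist_neg nonneg_int_cases not_less singletonD)

lemma lin_comb_mon_h3:
  assumes "(mon i (Suc j) k l (Suc m) :: 'a::field cox) \<in> twist e n"
  shows "(mon i (Suc j) k l (Suc m) :: 'a cox) \<in> lin_comb hs2 e n"
proof -
  have nz: "cf (mon i (Suc j) k l (Suc m) :: 'a cox) i (Suc j) k l (Suc m) \<noteq> 0" by (simp add: cf_mon)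
  then have "mon i (Suc j) k l (Suc m) \<noteq> (0 :: 'a cox)" by (metis cf_0)
  then obtain p where p: "n = int p" using twist_nonneg[OF assms] by blast
  have d: "i + Suc j = p" "k + l + Suc m = p + e" using twist_cf[of _ e p, OF assms[unfolded p] nz] by simp_all
  have "mon i j k l m \<in> twist e (int (i + j))" using d by (intro mon_twist) simp_all
  moreover have "int (i + j) = n - 1" using d p by simp
  ultimately have "h3 * mon i j k l m \<in> lin_comb hs2 e n" by (intro lin_comb_head) simp
  then show ?thesis unfolding h_mon .
qed

lemma lin_comb_hs2_mon:
  assumes "(mon i j k l m :: 'a::field cox) \<in> twist e n" "(i \<noteq> 0 \<and> k \<noteq> 0) \<or> (j \<noteq> 0 \<and> m \<noteq> 0)"
  shows "(mon i j k l m :: 'a cox) \<in> lin_comb hs2 e n"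
  using assms(2)
proof
  assume "i \<noteq> 0 \<and> k \<noteq> 0"
  then obtain i' k' where "i = Suc i'" "k = Suc k'" by (meson not0_implies_Suc)
  then show ?thesis using lin_comb_weaken[OF lin_comb_mon_h0] assms(1) by blast
next
  assume "j \<noteq> 0 \<and> m \<noteq> 0"
  then obtain j' m' where "j = Suc j'" "m = Suc m'" by (meson not0_implies_Suc)
  then show ?thesis using lin_comb_mon_h3 assms(1) by blast
qed

text \<open>\<open>h1\<close> times a monomial is a sum of two monomials, so modulo
  \<open>h1\<close> each is minus the other and one may be exchanged for the other.\<close>

lemma lin_comb_hs3_swap:
  assumes M: "i + j = n" "k + l + m + 1 = n + 1 + e"
    and other: "(mon i (Suc j) (Suc k) l m :: 'a::field cox) \<in> lin_comb hs2 e (int n + 1)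
      \<or> (mon (Suc i) j k (Suc l) m :: 'a cox) \<in> lin_comb hs2 e (int n + 1)"
  shows "(mon i (Suc j) (Suc k) l m :: 'a cox) \<in> lin_comb hs3 e (int n + 1)"
    and "(mon (Suc i) j k (Suc l) m :: 'a cox) \<in> lin_comb hs3 e (int n + 1)"
proof -
  let ?a = "mon i (Suc j) (Suc k) l m :: 'a cox" and ?b = "mon (Suc i) j k (Suc l) m :: 'a cox"
  have "mon i j k l m \<in> twist e (int n)" using M by (intro mon_twist) simp_all
  then have "h1 * mon i j k l m \<in> lin_comb hs3 e (int n + 1)" by (intro lin_comb_head) simp
  then have s: "?a + ?b \<in> lin_comb hs3 e (int n + 1)" unfolding h_mon .
  have "?a \<in> lin_comb hs3 e (int n + 1) \<or> ?b \<in> lin_comb hs3 e (int n + 1)" using other by (elim disjE) (simp_all add: lin_comb_weaken)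
  moreover have "?b \<in> lin_comb hs3 e (int n + 1)" if "?a \<in> lin_comb hs3 e (int n + 1)" using lin_comb_add[OF s lin_comb_uminus[OF that]] by simp
  moreover have "?a \<in> lin_comb hs3 e (int n + 1)" if "?b \<in> lin_comb hs3 e (int n + 1)" using lin_comb_add[OF s lin_comb_uminus[OF that]] by simp
  ultimately show "?a \<in> lin_comb hs3 e (int n + 1)" "?b \<in> lin_comb hs3 e (int n + 1)" by blast+
qed

lemma lin_comb_hs2_cf:
  assumes "G \<in> lin_comb hs2 e n" "a = 0 \<or> c = 0" "b = 0 \<or> q = 0"
  shows "cf G a b c d q = 0"
proof -
  obtain A H where G: "G = h3 * A + H" "H \<in> lin_comb [h0] e n" using assms(1) by (rule lin_comb_ConsE)
  obtain A' H' where H: "H = h0 * A' + H'" "H' \<in> lin_comb [] e n" using G(2) by (rule lin_comb_ConsE)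
  have "H' = 0" using H(2) by simp
  then show ?thesis unfolding G(1) H(1) using assms(2,3) by (auto simp: cf_add cf_h0 cf_h3)
qed

text \<open>The monomials s0 t0 and s1 t2 are coprime, which is read off coefficient by
  coefficient.\<close>

lemma mult_inj_h3: "mult_inj [h0] h3 e 0 m"
proof (rule mult_inj_0)
  fix F :: "'a cox" assume F: "F \<in> twist e m" and hF: "h3 * F \<in> lin_comb [h0] e (m + 1)"
  obtain G H where G: "h3 * F = h0 * G + H" "H \<in> lin_comb [] e (m + 1)" using hF by (rule lin_comb_ConsE)
  then have e: "h3 * F = h0 * G" by simp
  show "F \<in> lin_comb [h0] e m"
  proof (rule twist_monomials_lin_comb[OF F])
    fix i j k l p assume nz: "cf F i j k l p \<noteq> 0"
    have "cf (h3 * F) i (Suc j) k l (Suc p) \<noteq> 0" using nz by (simp add: cf_h3)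
    then have "i \<noteq> 0" "k \<noteq> 0" unfolding e cf_h0 by (auto split: if_splits)
    then obtain i' k' where ik: "i = Suc i'" "k = Suc k'" by (meson not0_implies_Suc)
    have "F \<noteq> 0" using nz by auto
    then obtain n where n: "m = int n" using twist_nonneg[OF F] by blast
    have "mon i j k l p \<in> twist e m" using twist_cf[of F e n] F nz unfolding n by (intro mon_twist) simp_all
    then show "mon i j k l p \<in> lin_comb [h0] e m" unfolding ik by (rule lin_comb_mon_h0)
  qed
qed

text \<open>For e >= 2 degree 0 has to be left out. The element t0^(e-1) t2 is nonzero there, while
  the submodule generated by \<open>h0\<close> and \<open>h3\<close> starts in degree 1; yet its
  product with \<open>h1\<close> is \<open>h3\<close> t0^e + \<open>h0\<close> t0^(e-2) t1
  t2.\<close>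

lemma mult_inj_h1:
  assumes "m \<noteq> 0 \<or> e = 0"
  shows "mult_inj hs2 h1 e 0 m"
proof (rule mult_inj_0)
  fix F :: "'a cox" assume F: "F \<in> twist e m" and hF: "h1 * F \<in> lin_comb hs2 e (m + 1)"
  show "F \<in> lin_comb hs2 e m"
  proof (rule twist_monomials_lin_comb[OF F])
    fix i j k l p assume nz: "cf F i j k l p \<noteq> 0"
    have "F \<noteq> 0" using nz by auto
    then obtain n where n: "m = int n" using twist_nonneg[OF F] by blast
    have d: "i + j = n" "k + l + p = n + e" using twist_cf[of F e n] F nz unfolding n by simp_all
    have M: "mon i j k l p \<in> twist e m" unfolding n by (rule mon_twist[OF d])
    have "(i \<noteq> 0 \<and> k \<noteq> 0) \<or> (j \<noteq> 0 \<and> p \<noteq> 0)"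
    proof (rule ccontr)
      assume c: "\<not> ?thesis"
      \<comment> \<open>A monomial of \<open>F\<close> outside the submodule reappears in
        \<open>h1 * F\<close> uncancelled and still outside: its shift by s0 t1 if
        \<open>k = 0\<close>, its shift by s1 t0 otherwise.\<close>
      show False
      proof (cases "k = 0")
        case True
        have "cf (h1 * F) (Suc i) j 0 (Suc l) p = 0" by (rule lin_comb_hs2_cf[OF hF]) (use c in auto)
        then show False using nz True by (simp add: cf_h1)
      next
        case False
        then have i: "i = 0" using c by simp
        have "j \<noteq> 0"
        proof
          assume "j = 0"
          then have "m = 0" using d(1) i n by simp
          then show False using assms d i \<open>j = 0\<close> False by simp
        qed
        then have p: "p = 0" using c by simp
        have "cf (h1 * F) 0 (Suc j) (Suc k) l 0 = 0" by (rule lin_comb_hs2_cf[OF hF]) simp_all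
        then show False using nz i p by (simp add: cf_h1)
      qed
    qed
    then show "mon i j k l p \<in> lin_comb hs2 e m" by (rule lin_comb_hs2_mon[OF M])
  qed
qed

text \<open>Three linear functionals on the degree-\<open>n\<close> piece, \<open>n \<ge> 1\<close>, whose common kernel is the
  degree-\<open>n\<close> part of the submodule generated by \<open>h0\<close>, \<open>h3\<close>, \<open>h1\<close>; multiplication by \<open>h2\<close> preserves them.\<close>

definition rho_zero :: "'a::field cox \<Rightarrow> nat \<Rightarrow> nat \<Rightarrow> bool" where
  "rho_zero F n N \<longleftrightarrow> cf F n 0 0 0 N = 0 \<and> cf F 0 n 0 N 0 = 0 \<and> cf F 1 (n - 1) 0 N 0 = cf F 0 n 1 (N - 1) 0"

lemma lin_comb_hs3_rho:
  assumes "G \<in> lin_comb hs3 e (int n)" "n \<ge> 1"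
  shows "rho_zero G n (n + e)"
proof -
  obtain D H where G: "G = h1 * D + H" "H \<in> lin_comb hs2 e (int n)" using assms(1) by (rule lin_comb_ConsE)
  have H: "cf H a b c d q = 0" if "a = 0 \<or> c = 0" "b = 0 \<or> q = 0" for a b c d q
    by (rule lin_comb_hs2_cf[OF G(2) that])
  show ?thesis
    unfolding rho_zero_def G(1) cf_add cf_h1 using assms(2) by (simp add: H)
qed

text \<open>A monomial divisible by neither s0 t0 nor s1 t2 becomes divisible by one of them after a
  single exchange along \<open>h1\<close>, with four exceptions. Two of these are excluded by the
  first two functionals; the other two are exchanged for each other, and the third functional
  accounts for them.\<close>

lemma rho_imp_lin_comb_hs3:
  fixes F :: "'a::field cox"
  assumes F: "F \<in> twist e (int n)" and n: "n \<ge> 1" and rho: "rho_zero F n (n + e)"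
  shows "F \<in> lin_comb hs3 e (int n)"
proof -
  let ?N = "n + e"
  obtain n' where n': "n = Suc n'" using n by (cases n) simp_all
  \<comment> \<open>The third functional says that the two remaining exceptional coefficients agree.
    Both are removed at once by a multiple of \<open>h1 * mon 0 n' 0 (?N - 1) 0\<close>, which is
    the sum of the two monomials.\<close>
  define c where "c = cf F 0 n 1 (?N - 1) 0"
  define F' where "F' = F - scB c (h1 * mon 0 n' 0 (?N - 1) 0)"
  have m: "mon 0 n' 0 (?N - 1) 0 \<in> twist e (int n')" by (rule mon_twist) (simp_all add: n')
  then have h1m: "h1 * mon 0 n' 0 (?N - 1) 0 \<in> lin_comb hs3 e (int n)" by (intro lin_comb_head) (simp add: n')
  have "h1 * mon 0 n' 0 (?N - 1) 0 \<in> twist e (int n)" by (rule twist_mult[OF h_bih(3)]) (use m n' in simp)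
  then have F'M: "F' \<in> twist e (int n)" unfolding F'_def by (intro twist_diff F twist_scB)
  have cfF': "cf F' i j k l p = cf F i j k l p - c * ((if (i, j, k, l, p) = (0, n, 1, ?N - 1, 0) then 1 else 0)
      + (if (i, j, k, l, p) = (1, n', 0, ?N, 0) then 1 else 0))" for i j k l p
    unfolding F'_def h_mon cf_diff cf_scB cf_add cf_mon n' by auto
  have z: "cf F' n 0 0 0 ?N = 0" "cf F' 0 n 0 ?N 0 = 0" "cf F' 1 n' 0 ?N 0 = 0" "cf F' 0 n 1 (?N - 1) 0 = 0"
    using rho unfolding cfF' rho_zero_def c_def by (simp_all add: n')
  have "F' \<in> lin_comb hs3 e (int n)"
  proof (rule twist_monomials_lin_comb[OF F'M])
    fix i j k l p assume nz: "cf F' i j k l p \<noteq> 0"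
    have d: "i + j = n" "k + l + p = ?N" using twist_cf[OF F'M nz] by simp_all
    have M: "(mon i j k l p :: 'a cox) \<in> twist e (int n)" by (rule mon_twist[OF d])
    have sw: "int n' + 1 = int n" by (simp add: n')
    show "(mon i j k l p :: 'a cox) \<in> lin_comb hs3 e (int n)"
    proof (cases "(i \<noteq> 0 \<and> k \<noteq> 0) \<or> (j \<noteq> 0 \<and> p \<noteq> 0)")
      case True
      then show ?thesis by (intro lin_comb_weaken lin_comb_hs2_mon[OF M])
    next
      case False
      show ?thesis
      proof (cases "i = 0")
        case i: True
        then have jn: "j = n" and p0: "p = 0" using d n False by auto
        have "k \<noteq> 0"
        proof
          assume "k = 0"
          then show False using nz z(2) d i jn p0 by simp
        qed
        then obtain k' where k: "k = Suc k'" by (cases k) simp_all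
        have "k' \<noteq> 0"
        proof
          assume "k' = 0"
          then have "l = ?N - 1" using d k p0 by simp
          then show False using nz z(4) i jn p0 k \<open>k' = 0\<close> by simp
        qed
        have "(mon (Suc 0) n' k' (Suc l) 0 :: 'a cox) \<in> twist e (int n)" using d i jn p0 k n' by (intro mon_twist) simp_all
        then have "(mon (Suc 0) n' k' (Suc l) 0 :: 'a cox) \<in> lin_comb hs2 e (int n)" using \<open>k' \<noteq> 0\<close> by (intro lin_comb_hs2_mon) simp_all
        then have "(mon 0 (Suc n') (Suc k') l 0 :: 'a cox) \<in> lin_comb hs3 e (int n' + 1)"
          unfolding sw[symmetric] by (intro lin_comb_hs3_swap(1)[OF _ _ disjI2]) (use d i jn p0 k n' in simp_all)
        then show ?thesis unfolding sw using i jn p0 k n' by simp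
      next
        case False': False
        then obtain i' where i: "i = Suc i'" by (cases i) simp_all
        have k: "k = 0" using False False' by simp
        have "l \<noteq> 0"
        proof
          assume l: "l = 0"
          then have "p = ?N" using d k by simp
          then have "j = 0" using False n by simp
          then show False using nz z(1) d k l \<open>p = ?N\<close> by simp
        qed
        then obtain l' where l: "l = Suc l'" by (cases l) simp_all
        have ex: "i' \<noteq> 0 \<or> p \<noteq> 0"
        proof (rule ccontr)
          assume "\<not> ?thesis"
          then have "i' = 0" "p = 0" by simp_all
          then have "l = ?N" "j = n'" using d k i n' by simp_all
          then show False using nz z(3) i \<open>i' = 0\<close> \<open>p = 0\<close> k by simp
        qed
        have "(mon i' (Suc j) (Suc 0) l' p :: 'a cox) \<in> twist e (int n)" using d i k l by (intro mon_twist) simp_all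
        then have "(mon i' (Suc j) (Suc 0) l' p :: 'a cox) \<in> lin_comb hs2 e (int n)" using ex by (intro lin_comb_hs2_mon) simp_all
        then have "(mon (Suc i') j 0 (Suc l') p :: 'a cox) \<in> lin_comb hs3 e (int n' + 1)"
          unfolding sw[symmetric] by (intro lin_comb_hs3_swap(2)[OF _ _ disjI1]) (use d i k l n' in simp_all)
        then show ?thesis unfolding sw using i k l by simp
      qed
    qed
  qed
  then have "F' + scB c (h1 * mon 0 n' 0 (?N - 1) 0) \<in> lin_comb hs3 e (int n)" by (intro lin_comb_add lin_comb_scB h1m)
  then show ?thesis by (simp add: F'_def)
qed

text \<open>At each monomial entering the functionals only one summand of \<open>h2\<close>
  contributes, so in positive degree the functionals of \<open>h2 * F\<close> are those of
  \<open>F\<close>. Degree 0 occurs only for \<open>e = 0\<close>, where \<open>F\<close> is a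
  scalar and the first functional is its value.\<close>

lemma mult_inj_h2:
  assumes "m \<noteq> 0 \<or> e = 0"
  shows "mult_inj hs3 h2 e 0 m"
proof (rule mult_inj_0)
  fix F :: "'a cox" assume F: "F \<in> twist e m" and hF: "h2 * F \<in> lin_comb hs3 e (m + 1)"
  show "F \<in> lin_comb hs3 e m"
  proof (cases "F = 0")
    case False
    then obtain n where n: "m = int n" using twist_nonneg[OF F] by blast
    have "rho_zero (h2 * F) (Suc n) (Suc n + e)"
      by (rule lin_comb_hs3_rho[of _ e]) (use hF n in \<open>simp_all add: add.commute\<close>)
    then have r: "cf F n 0 0 0 (n + e) = 0" "cf F 0 n 0 (n + e) 0 = 0"
      "n \<ge> 1 \<Longrightarrow> cf F 1 (n - 1) 0 (n + e) 0 = cf F 0 n 1 (n + e - 1) 0"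
      unfolding rho_zero_def cf_h2 by (auto split: if_splits)
    show ?thesis
    proof (cases "n = 0")
      case True
      then have e: "e = 0" using assms n by simp
      have "F = 0"
      proof (rule cox_eqI)
        fix i j k l p
        show "cf F i j k l p = cf 0 i j k l p"
          using twist_cf[of F e n i j k l p] F r(1) n True e by fastforce
      qed
      then show ?thesis using False by simp
    next
      case False
      then show ?thesis using rho_imp_lin_comb_hs3[of F e n] F r n by (simp add: rho_zero_def)
    qed
  qed (simp add: lin_comb_0)
qed

text \<open>\<open>G\<close> is built so that \<open>F\<close> and \<open>h2 * G\<close> agree under
  all three functionals. The degree below \<open>n\<close> has to be large enough to prescribe three
  values, which fails for \<open>n = 1\<close> and \<open>e = 0\<close>.\<close>

lemma lin_comb_hs4_all:
  assumes F: "F \<in> twist e (int n)" and n: "n \<ge> 2 \<or> (n = 1 \<and> e \<ge> 1)"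
  shows "F \<in> lin_comb hs4 e (int n)"
proof -
  let ?N = "n + e"
  obtain n' where n': "n = Suc n'" using n by (cases n) auto
  obtain N' where N': "?N = Suc (Suc N')" using n by (cases "?N"; cases "?N - 1") auto
  define a where "a = cf F n 0 0 0 ?N"
  define b where "b = cf F 0 n 0 ?N 0"
  define c where "c = cf F 1 n' 0 ?N 0 - cf F 0 n 1 (Suc N') 0"
  define C where "C = (if n' = 0 then - mon 0 0 1 N' 0 else mon 1 (n' - 1) 0 (Suc N') 0 :: 'a cox)"
  define G where "G = scB a (mon n' 0 0 0 (Suc N')) + scB b (mon 0 n' 0 (Suc N') 0) + scB c C"
  have d: "Suc N' = n' + e" using N' n' by simp
  have CM: "C \<in> twist e (int n')"
  proof (cases "n' = 0")
    case True
    have "- mon 0 0 1 N' 0 \<in> twist e (int n')" by (intro twist_uminus mon_twist) (use d True in simp_all)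
    then show ?thesis using True by (simp add: C_def)
  next
    case False
    have "mon 1 (n' - 1) 0 (Suc N') 0 \<in> twist e (int n')" by (rule mon_twist) (use d False in simp_all)
    then show ?thesis using False by (simp add: C_def)
  qed
  have GM: "G \<in> twist e (int n')"
    unfolding G_def by (intro twist_add twist_scB CM mon_twist) (simp_all add: d)
  have "h2 * G \<in> twist e (int n)" by (rule twist_mult[OF h_bih(4)]) (use GM n' in simp)
  then have FM: "F - h2 * G \<in> twist e (int n)" by (rule twist_diff[OF F])
  have cG: "cf G n' 0 0 0 (Suc N') = a" "cf G 0 n' 0 (Suc N') 0 = b"
    "n' \<noteq> 0 \<Longrightarrow> cf G 1 (n' - 1) 0 (Suc N') 0 = c" "cf G 0 n' 1 N' 0 = (if n' = 0 then - c else 0)"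
    unfolding G_def C_def cf_add cf_scB by (auto simp: cf_mon cf_uminus)
  have "rho_zero (F - h2 * G) n ?N"
  proof (cases "n' = 0")
    case True
    then have "e = Suc N'" using d by simp
    then show ?thesis
      unfolding rho_zero_def cf_diff cf_h2 using cG True by (simp add: a_def b_def c_def n')
  next
    case False
    have ne: "n' + e = Suc N'" using d by simp
    show ?thesis
      unfolding rho_zero_def cf_diff cf_h2 using cG False by (simp add: a_def b_def c_def n' ne)
  qed
  then have "F - h2 * G \<in> lin_comb hs3 e (int n)" using rho_imp_lin_comb_hs3[OF FM] n by auto
  moreover have "G \<in> twist e (int n - 1)" using GM n' by simp
  ultimately show ?thesis by (elim lin_comb_ConsI[rotated]) simp_all
qed

lemma exact1: "exact [h0 :: 'a::field cox] e (Suc k) n"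
proof (rule exact_Cons[OF h_bih(1) exact_Nil])
  show "mult_inj [] (h0 :: 'a cox) e k (n - 1)"
  proof (cases k)
    case 0
    have "cf (h0 * mon 0 0 0 0 0 :: 'a cox) 1 0 1 0 0 = 1" by (simp add: cf_h0 cf_mon)
    then have "h0 \<noteq> (0 :: 'a cox)" by (metis cf_0 mult_zero_left zero_neq_one)
    then have "mult_inj [] (h0 :: 'a cox) e 0 (n - 1)" by (intro mult_inj_0) simp
    then show ?thesis using 0 by simp
  next
    case (Suc l)
    then show ?thesis using exact_imp_mult_inj[OF exact_Nil] by simp
  qed
qed

lemma exact2: "exact hs2 e (Suc k) n"
proof (rule exact_Cons[OF h_bih(2) exact1])
  show "mult_inj [h0] h3 e k (n - 1)"
    by (cases k) (simp_all add: mult_inj_h3 exact_imp_mult_inj[OF exact1])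
qed

text \<open>The excluded place is the trace of the failure in \<open>mult_inj_h1\<close>: for e >= 2
  the kernel of \<open>h1\<close> in degree 0 appears as first homology in internal degree
  1.\<close>

lemma exact3:
  assumes "k \<noteq> 0 \<or> n \<noteq> 1 \<or> e = 0"
  shows "exact hs3 e (Suc k) n"
proof (rule exact_Cons[OF h_bih(3) exact2])
  show "mult_inj hs2 h1 e k (n - 1)"
  proof (cases k)
    case 0
    then show ?thesis using mult_inj_h1[of "n - 1" e] assms by auto
  qed (simp add: exact_imp_mult_inj[OF exact2])
qed

lemma exact4:
  assumes "n > int (Suc k) \<or> e = 0"
  shows "exact hs4 e (Suc k) n"
proof (rule exact_Cons[OF h_bih(4)])
  show "exact hs3 e (Suc k) n" by (rule exact3) (use assms in auto)
  show "mult_inj hs3 h2 e k (n - 1)"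
  proof (cases k)
    case 0
    then show ?thesis using mult_inj_h2[of "n - 1" e] assms by auto
  next
    case (Suc l)
    have "exact hs3 e (Suc l) (n - 1)" by (rule exact3) (use assms Suc in auto)
    then show ?thesis using exact_imp_mult_inj Suc by simp
  qed
qed

lemma exact4_0:
  assumes "n \<ge> 2 \<or> (n = 1 \<and> e \<ge> 1)"
  shows "exact hs4 e 0 n"
proof (rule exact_0)
  fix F :: "'a cox" assume F: "F \<in> twist e n"
  obtain p where p: "n = int p" using assms by (metis nonneg_int_cases order_trans zero_le_numeral zero_le_one le_numeral_extra(4))
  show "F \<in> lin_comb hs4 e n" unfolding p by (rule lin_comb_hs4_all) (use F p assms in auto)
qed

abbreviation "hs5 \<equiv> seg 1 # hs4"
abbreviation "hs6 \<equiv> seg 3 # hs5"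

text \<open>The cone relates (i, n) to (i - 1, n - 1), and the region \<open>n - i >= c\<close> is
  stable under this. Once homology vanishes there, it does so after adding any further form, regular
  or not.\<close>

lemma exact_Cons_all:
  assumes y: "y \<in> bih 1 1" and ex: "\<And>i n. n \<ge> int i + c \<Longrightarrow> exact ys e i n"
  shows "n \<ge> int i + c \<Longrightarrow> exact (y # ys) e i n"
proof (cases i)
  case 0
  assume n: "n \<ge> int i + c"
  have "exact ys e 0 n" using ex[of 0 n] n 0 by simp
  then show ?thesis unfolding 0 by (intro exact_0) (rule lin_comb_weaken, rule exact_0_D)
next
  case (Suc k)
  assume n: "n \<ge> int i + c"
  have "exact ys e (Suc k) n" "exact ys e k (n - 1)" using ex n Suc by simp_all
  then show ?thesis unfolding Suc by (intro exact_Cons[OF y] exact_imp_mult_inj)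
qed

text \<open>Hence Tor_i of M_e lives only in degree i for e >= 1, and for e = 0 only in degrees i
  and i + 1.\<close>

lemma exact6:
  assumes "n \<ge> int i + (if e = 0 then 2 else 1)"
  shows "exact hs6 e i n"
proof -
  let ?c = "if e = 0 then 2 else 1 :: int"
  have e4: "exact hs4 e i n" if n: "n \<ge> int i + ?c" for i n
  proof (cases i)
    case 0
    then show ?thesis using n by (simp only:) (rule exact4_0, auto split: if_splits)
  next
    case (Suc k)
    then show ?thesis using n by (simp only:) (rule exact4, auto split: if_splits)
  qed
  show ?thesis
    by (rule exact_Cons_all[OF seg_bih exact_Cons_all[OF seg_bih e4] assms])
qed

text \<open>In the remaining diagonal degrees for \<open>e = 0\<close>, exactness amounts to the linear independence of
  the six forms.\<close>

lemma twist_0_0: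
  assumes "F \<in> twist 0 0"
  shows "\<exists>c. F = scB c 1"
proof -
  have "F \<in> bih 0 0" using assms by (simp add: twist_def)
  from bih_unit_const[OF this] have "F = scB (cf F 0 0 0 0 0) 1" by (simp add: scB_def)
  then show ?thesis by blast
qed

lemma lin_comb_ConsE_1:
  assumes "F \<in> lin_comb (y # ys) 0 1"
  obtains c H where "F = scB c y + H" "H \<in> lin_comb ys 0 1"
proof -
  obtain G H where G: "F = y * G + H" "G \<in> twist 0 (1 - 1)" "H \<in> lin_comb ys 0 1" using assms by (rule lin_comb_ConsE)
  obtain c where "G = scB c 1" using twist_0_0[of G] G(2) by auto
  then have "F = scB c y + H" using G(1) by (simp add: scB_mult)
  then show ?thesis using that G(3) by blast
qed

text \<open>In degree 0 the module is the base field, so the claim is that \<open>y\<close> is no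
  combination of \<open>ys\<close>. In \<open>hs4\<close> the element \<open>seg 1\<close> occurs
  only together with \<open>seg 2\<close>, and \<open>seg 3\<close> only together with
  \<open>seg 4\<close>; two coefficients decide.\<close>

lemma mult_inj_seg:
  assumes "y = seg 1 \<and> ys = hs4 \<or> y = seg 3 \<and> ys = hs5"
  shows "mult_inj ys y 0 0 0"
proof (rule mult_inj_0)
  fix F :: "'a cox" assume F: "F \<in> twist 0 0" and yF: "y * F \<in> lin_comb ys 0 (0 + 1)"
  obtain c where c: "F = scB c 1" using twist_0_0[OF F] by blast
  have l4: "\<exists>c0 c5 c12 c34. H = scB c0 (seg 0) + scB c5 (seg 5) + scB c12 (seg 1 + seg 2) + scB c34 (seg 3 + seg 4)"
    if Hin: "H \<in> lin_comb hs4 0 1" for H :: "'a cox"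
  proof -
    obtain c4 H4 where 4: "H = scB c4 h2 + H4" "H4 \<in> lin_comb hs3 0 1" using Hin by (rule lin_comb_ConsE_1)
    obtain c3 H3 where 3: "H4 = scB c3 h1 + H3" "H3 \<in> lin_comb hs2 0 1" using 4(2) by (rule lin_comb_ConsE_1)
    obtain c2 H2 where 2: "H3 = scB c2 h3 + H2" "H2 \<in> lin_comb [h0] 0 1" using 3(2) by (rule lin_comb_ConsE_1)
    obtain c1 H1 where 1: "H2 = scB c1 h0 + H1" "H1 \<in> lin_comb [] 0 1" using 2(2) by (rule lin_comb_ConsE_1)
    have "H = scB c1 (seg 0) + scB c2 (seg 5) + scB c3 (seg 1 + seg 2) + scB c4 (seg 3 + seg 4)"
      using 1(2) unfolding 4(1) 3(1) 2(1) 1(1) h0_def h1_def h2_def h3_def by (simp add: algebra_simps)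
    then show ?thesis by blast
  qed
  have "c = 0"
    using assms
  proof
    assume y: "y = seg 1 \<and> ys = hs4"
    then have "scB c (seg 1) \<in> lin_comb hs4 0 1" using yF c by (simp add: scB_mult)
    then obtain c0 c5 c12 c34 where
      e: "scB c (seg 1) = scB c0 (seg 0) + scB c5 (seg 5) + scB c12 (seg 1 + seg 2) + scB c34 (seg 3 + seg 4)"
      using l4 by blast
    have "c = c12" using arg_cong[OF e, of "\<lambda>H. cf H 0 1 1 0 0"] unfolding cf_add cf_scB cf_seg by simp
    moreover have "0 = c12" using arg_cong[OF e, of "\<lambda>H. cf H 1 0 0 1 0"] unfolding cf_add cf_scB cf_seg by simp
    ultimately show ?thesis by simp
  next
    assume y: "y = seg 3 \<and> ys = hs5"
    then have "scB c (seg 3) \<in> lin_comb hs5 0 1" using yF c by (simp add: scB_mult)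
    then obtain c1 H where H: "scB c (seg 3) = scB c1 (seg 1) + H" "H \<in> lin_comb hs4 0 1" by (rule lin_comb_ConsE_1)
    then obtain c0 c5 c12 c34 where
      e: "scB c (seg 3) = scB c1 (seg 1) + (scB c0 (seg 0) + scB c5 (seg 5) + scB c12 (seg 1 + seg 2) + scB c34 (seg 3 + seg 4))"
      using l4[OF H(2)] by auto
    have "c = c34" using arg_cong[OF e, of "\<lambda>H. cf H 0 1 0 1 0"] unfolding cf_add cf_scB cf_seg by simp
    moreover have "0 = c34" using arg_cong[OF e, of "\<lambda>H. cf H 1 0 0 0 1"] unfolding cf_add cf_scB cf_seg by simp
    ultimately show ?thesis by simp
  qed
  then show "F \<in> lin_comb ys 0 0" using c by (simp add: lin_comb_0)
qed

text \<open>For \<open>e = 0\<close> the four parameters form a regular sequence and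
  \<open>exact4\<close> covers the diagonal. The last two forms need an argument only at the bottom,
  in degree 0.\<close>

lemma exact6_diag: "exact hs6 0 (Suc k) (int (Suc k))"
proof -
  have e4: "exact hs4 0 (Suc k) (int (Suc k))" for k by (rule exact4) simp
  have e5: "exact hs5 0 (Suc k) (int (Suc k))" for k
  proof (rule exact_Cons[OF seg_bih e4])
    show "mult_inj hs4 (seg 1) 0 k (int (Suc k) - 1)"
    proof (cases k)
      case 0
      then show ?thesis using mult_inj_seg[of "seg 1" hs4] by simp
    next
      case (Suc l)
      then show ?thesis using exact_imp_mult_inj[OF e4[of l]] by simp
    qed
  qed
  show ?thesis
  proof (rule exact_Cons[OF seg_bih e5])
    show "mult_inj hs5 (seg 3) 0 k (int (Suc k) - 1)"
    proof (cases k)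
      case 0
      then show ?thesis using mult_inj_seg[of "seg 3" hs5] by simp
    next
      case (Suc l)
      then show ?thesis using exact_imp_mult_inj[OF e5[of l]] by simp
    qed
  qed
qed

subsection \<open>Dimensions\<close>

definition scV :: "'a::field \<Rightarrow> (nat \<Rightarrow> 'a cox) \<Rightarrow> nat \<Rightarrow> 'a cox" where
  "scV c v = (\<lambda>b. scB c (v b))"

lemma scV_apply: "scV c v b = scB c (v b)"
  by (simp add: scV_def)

lemma vector_space_scV: "vector_space scV"
  by unfold_locales
    (rule ext, simp add: scV_apply sB.scale_right_distrib sB.scale_left_distrib)+

interpretation sV: vector_space "scV :: 'a::field \<Rightarrow> (nat \<Rightarrow> 'a cox) \<Rightarrow> _"
  by (rule vector_space_scV)

lemma scV_eq_smul: "scV c v = smul (kB (to_copy c)) v"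
  by (rule ext) (simp add: scB_def scV_apply)

lemma slin_linear_scV:
  fixes L :: "(nat \<Rightarrow> 'a::field cox) \<Rightarrow> nat \<Rightarrow> 'a cox"
  assumes "slin L"
  shows "Vector_Spaces.linear scV scV L"
  by unfold_locales (simp_all add: scV_eq_smul slin_add[OF assms] slin_smul[OF assms])

lemma fin_dim_sum:
  assumes "vector_space s" "fin_dim s U" "fin_dim s V" "module.subspace s W" "\<And>w. w \<in> W \<Longrightarrow> \<exists>u\<in>U. \<exists>v\<in>V. w = u + v"
  shows "fin_dim s W"
proof -
  interpret vector_space s by fact
  obtain B C where B: "finite B" "U \<subseteq> span B" and C: "finite C" "V \<subseteq> span C"
    using assms(2,3) unfolding fin_dim_def by (elim conjE exE)
  have "W \<subseteq> span (B \<union> C)"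
  proof
    fix w assume "w \<in> W"
    then obtain u v where w: "u \<in> U" "v \<in> V" "w = u + v" using assms(5)[of w] by blast
    have "u \<in> span (B \<union> C)" "v \<in> span (B \<union> C)"
      using w(1,2) B(2) C(2) span_mono[of B "B \<union> C"] span_mono[of C "B \<union> C"] by auto
    then show "w \<in> span (B \<union> C)" unfolding w(3) by (rule span_add)
  qed
  then show ?thesis unfolding fin_dim_def using assms(4) B(1) C(1) by (intro conjI exI[of _ "B \<union> C"]) simp_all
qed

definition bounded_vec :: "nat \<Rightarrow> 'a::field cox set \<Rightarrow> (nat \<Rightarrow> 'a cox) set" where
  "bounded_vec r M = {v. (\<forall>b. v b \<in> M) \<and> (\<forall>b\<ge>r. v b = 0)}"

lemma bounded_vec_subspace:
  assumes "module.subspace scB M"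
  shows "module.subspace scV (bounded_vec r M)"
  by (rule sV.subspaceI)
    (simp_all add: bounded_vec_def scV_apply sB.subspace_0[OF assms] sB.subspace_add[OF assms] sB.subspace_scale[OF assms])

lemma bounded_vec_dim:
  fixes M :: "'a::field cox set"
  assumes M: "fin_dim scB M"
  shows "fin_dim scV (bounded_vec r M) \<and> vector_space.dim scV (bounded_vec r M) = r * vector_space.dim scB M"
proof (induction r)
  case 0
  have "bounded_vec 0 M = {0}" using sB.subspace_0[OF fin_dim_subspace[OF M]] by (auto simp: bounded_vec_def fun_eq_iff)
  moreover have "fin_dim scV ({0} :: (nat \<Rightarrow> 'a cox) set)"
    unfolding fin_dim_def by (intro conjI sV.subspace_single_0 exI[of _ "{}"]) (simp_all only: finite.emptyI sV.span_empty subset_refl)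
  ultimately show ?case
    by (simp only: dim_zero_subspace[OF vector_space_scV] mult_0 simp_thms)
next
  case (Suc r)
  let ?g = "\<lambda>F b. if b = r then F else 0 :: 'a cox" and ?p = "\<lambda>v :: nat \<Rightarrow> 'a cox. v r"
  have sM: "sB.subspace M" by (rule fin_dim_subspace[OF M])
  interpret BV: vector_space_pair scB scV by (rule vector_space_pair.intro[OF vector_space_scB vector_space_scV])
  interpret VB: vector_space_pair scV scB by (rule vector_space_pair.intro[OF vector_space_scV vector_space_scB])
  have g: "Vector_Spaces.linear scB scV ?g" by unfold_locales (rule ext, simp add: scV_apply)+
  have p: "Vector_Spaces.linear scV scB ?p" by unfold_locales (simp_all add: scV_apply)
  have mem: "?g F \<in> bounded_vec (Suc r) M" if "F \<in> M" for F using that sB.subspace_0[OF sM] by (simp add: bounded_vec_def)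
  have fd: "fin_dim scV (bounded_vec (Suc r) M)"
  proof (rule fin_dim_sum[OF vector_space_scV _ BV.fin_dim_image[OF g M] bounded_vec_subspace[OF sM]])
    show "fin_dim scV (bounded_vec r M)" using Suc.IH ..
    fix w assume w: "w \<in> bounded_vec (Suc r) M"
    have "w - ?g (w r) \<in> bounded_vec r M" using w sB.subspace_0[OF sM] by (simp add: bounded_vec_def)
    moreover have "?g (w r) \<in> ?g ` M" by (rule imageI) (use w in \<open>simp add: bounded_vec_def\<close>)
    moreover have "w = (w - ?g (w r)) + ?g (w r)" by simp
    ultimately show "\<exists>u\<in>bounded_vec r M. \<exists>v\<in>?g ` M. w = u + v" by (intro bexI)
  qed
  have im: "?p ` bounded_vec (Suc r) M = M"
  proof
    show "?p ` bounded_vec (Suc r) M \<subseteq> M" by (rule image_subsetI) (simp add: bounded_vec_def)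
    show "M \<subseteq> ?p ` bounded_vec (Suc r) M"
    proof
      fix F assume "F \<in> M"
      then show "F \<in> ?p ` bounded_vec (Suc r) M" by (intro image_eqI[of _ _ "?g F"] mem) simp
    qed
  qed
  have ker: "{v \<in> bounded_vec (Suc r) M. ?p v = 0} = bounded_vec r M"
  proof (intro subset_antisym subsetI)
    fix v assume v: "v \<in> {v \<in> bounded_vec (Suc r) M. v r = 0}"
    have "v b = 0" if "b \<ge> r" for b using v that by (cases "b = r") (simp_all add: bounded_vec_def)
    then show "v \<in> bounded_vec r M" using v by (simp add: bounded_vec_def)
  qed (simp add: bounded_vec_def)
  have "vector_space.dim scV (bounded_vec (Suc r) M) = Suc r * vector_space.dim scB M"
    using VB.dim_image_plus_kernel[OF p fd] Suc.IH unfolding im ker by simp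
  then show ?case using fd by (rule conjI[rotated])
qed

lemma kos_chain_eq_bounded_vec: "kos_chain ys e i n = bounded_vec (length ys choose i) (twist e (n - int i))"
  by (auto simp: kos_chain_def bounded_vec_def kchains_def)

lemma twist_dim:
  shows "fin_dim scB (twist e k :: 'a::field cox set)"
    and "vector_space.dim scB (twist e k :: 'a cox set) = (if k < 0 then 0 else (nat k + 1) * ((nat k + e + 2) choose 2))"
proof -
  have "fin_dim scB ({0} :: 'a cox set)"
    unfolding fin_dim_def by (intro conjI sB.subspace_single_0 exI[of _ "{}"]) simp_all
  then show "fin_dim scB (twist e k :: 'a cox set)" by (simp add: twist_def fin_dim_bih)
  show "vector_space.dim scB (twist e k :: 'a cox set) = (if k < 0 then 0 else (nat k + 1) * ((nat k + e + 2) choose 2))"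
    by (cases "k < 0") (simp_all only: twist_def dim_bih dim_zero_subspace[OF vector_space_scB] if_True if_False simp_thms)
qed

abbreviation dimV :: "(nat \<Rightarrow> 'a::field cox) set \<Rightarrow> nat" where
  "dimV \<equiv> vector_space.dim scV"

lemma fin_dim_kos_chain: "fin_dim scV (kos_chain ys e i n)"
  unfolding kos_chain_eq_bounded_vec using bounded_vec_dim[OF twist_dim(1)] ..

lemma dim_kos_chain: "dimV (kos_chain ys e i n) = (length ys choose i) *
    (if n < int i then 0 else (nat (n - int i) + 1) * ((nat (n - int i) + e + 2) choose 2))"
  unfolding kos_chain_eq_bounded_vec bounded_vec_dim[OF twist_dim(1), THEN conjunct2] twist_dim(2) by simp

lemma rank_nullity:
  assumes "slin (L :: (nat \<Rightarrow> 'a::field cox) \<Rightarrow> _)" "fin_dim scV U"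
  shows "dimV U = dimV (L ` U) + dimV {v \<in> U. L v = 0}"
  using vector_space_pair.dim_image_plus_kernel[OF vector_space_pair.intro[OF vector_space_scV vector_space_scV]
      slin_linear_scV[OF assms(1)] assms(2)] .

definition kos_cyc :: "'a::field cox list \<Rightarrow> nat \<Rightarrow> nat \<Rightarrow> int \<Rightarrow> (nat \<Rightarrow> 'a cox) set" where
  "kos_cyc ys e i n = {z \<in> kos_chain ys e i n. cyc ys i z}"

lemma kos_cyc_0: "kos_cyc ys e 0 n = kos_chain ys e 0 n" and kos_cyc_Suc: "kos_cyc ys e (Suc k) n = {z \<in> kos_chain ys e (Suc k) n. kd ys k z = 0}"
  by (simp_all add: kos_cyc_def)

lemma exact_image:
  assumes ys: "set ys \<subseteq> bih 1 1" and ex: "exact ys e i n"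
  shows "kd ys i ` kos_chain ys e (Suc i) n = kos_cyc ys e i n"
proof
  show "kd ys i ` kos_chain ys e (Suc i) n \<subseteq> kos_cyc ys e i n"
  proof (rule image_subsetI)
    fix w assume w: "w \<in> kos_chain ys e (Suc i) n"
    have "cyc ys i (kd ys i w)"
    proof (cases i)
      case (Suc k)
      then show ?thesis using kd_kd[of w ys k] kos_chain_kchains[OF w] by simp
    qed simp
    then show "kd ys i w \<in> kos_cyc ys e i n" unfolding kos_cyc_def using kd_kos_chain[OF ys w] by simp
  qed
  show "kos_cyc ys e i n \<subseteq> kd ys i ` kos_chain ys e (Suc i) n"
  proof
    fix z assume "z \<in> kos_cyc ys e i n"
    then have "\<exists>w\<in>kos_chain ys e (Suc i) n. kd ys i w = z" using ex by (simp add: exact_def kos_cyc_def)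
    then show "z \<in> kd ys i ` kos_chain ys e (Suc i) n" by (elim bexE) (rule image_eqI[OF sym])
  qed
qed

lemma dim_kos_chain_split:
  "dimV (kos_chain ys e (Suc i) n) = dimV (kd ys i ` kos_chain ys e (Suc i) n) + dimV (kos_cyc ys e (Suc i) n)"
  unfolding kos_cyc_Suc by (rule rank_nullity[OF slin_kd fin_dim_kos_chain])

lemma dim_kos_cyc_Suc:
  assumes "set ys \<subseteq> bih 1 1" "exact ys e i n"
  shows "dimV (kos_chain ys e (Suc i) n) = dimV (kos_cyc ys e i n) + dimV (kos_cyc ys e (Suc i) n)"
  using dim_kos_chain_split[of ys e i n] unfolding exact_image[OF assms] .

lemma hs6_bih: "set hs6 \<subseteq> bih 1 1"
  by (simp only: list.set insert_subset h_bih seg_bih empty_subsetI simp_thms)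

lemma fin_dim_kos_cyc: "fin_dim scV (kos_cyc ys e i n)"
proof (cases i)
  case 0
  then show ?thesis by (simp add: kos_cyc_0 fin_dim_kos_chain)
next
  case (Suc k)
  have "sV.subspace (kos_cyc ys e (Suc k) n)"
    using fin_dim_subspace[OF fin_dim_kos_chain[of ys e "Suc k" n]]
    by (intro sV.subspaceI) (simp_all add: kos_cyc_Suc sV.subspace_0 sV.subspace_add sV.subspace_scale kd_add kd_smul[of ys k "kB (to_copy _)", folded scV_eq_smul])
  then show ?thesis unfolding Suc by (rule fin_dim_subset[OF fin_dim_kos_chain[of ys e "Suc k" n]]) (simp add: kos_cyc_def)
qed

text \<open>Where the strand is exact, the boundaries fill the cycles, and the cycle dimension
  telescopes into a truncated Euler characteristic.\<close>

lemma dim_kos_cyc_strand: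
  assumes "\<And>i. i < k \<Longrightarrow> exact (hs6 :: 'a::field cox list) e i n"
  shows "int (dimV (kos_cyc (hs6 :: 'a cox list) e k n))
    = (\<Sum>j\<le>k. (- 1) ^ (k - j) * int (dimV (kos_chain (hs6 :: 'a cox list) e j n)))"
  using assms
proof (induction k)
  case 0
  then show ?case by (simp add: kos_cyc_0)
next
  case (Suc k)
  have "int (dimV (kos_cyc (hs6 :: 'a cox list) e (Suc k) n))
    = int (dimV (kos_chain (hs6 :: 'a cox list) e (Suc k) n)) - int (dimV (kos_cyc (hs6 :: 'a cox list) e k n))"
    using dim_kos_cyc_Suc[OF hs6_bih Suc.prems[of k]] by simp
  moreover have "int (dimV (kos_cyc (hs6 :: 'a cox list) e k n))
    = (\<Sum>j\<le>k. (- 1) ^ (k - j) * int (dimV (kos_chain (hs6 :: 'a cox list) e j n)))" using Suc by simp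
  moreover have "- (\<Sum>j\<le>k. (- 1) ^ (k - j) * int (dimV (kos_chain (hs6 :: 'a cox list) e j n)))
    = (\<Sum>j\<le>k. (- 1) ^ (Suc k - j) * int (dimV (kos_chain (hs6 :: 'a cox list) e j n)))"
    by (simp add: sum_negf[symmetric] Suc_diff_le)
  ultimately show ?case by simp
qed

subsection \<open>Transport to the Cox ring\<close>

definition vphi :: "(nat \<Rightarrow> (6, 'a::field) mvpoly) \<Rightarrow> nat \<Rightarrow> 'a cox" where
  "vphi v = (\<lambda>b. phi (v b))"

lemma vphi_linear: "Vector_Spaces.linear cscale scV (vphi :: _ \<Rightarrow> nat \<Rightarrow> 'a::field cox)"
  by unfold_locales
    (rule ext, simp add: vphi_def scV_apply rhom_add[OF rhom_phi] cscale_def phi_scale)+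

lemma map_phi_x_forms: "map phi x_forms = hs6"
  by (simp add: x_forms_def phi_var rhom_add[OF rhom_phi] h0_def h1_def h2_def h3_def)

lemma vphi_kd: "vphi (kd x_forms i w) = kd hs6 i (vphi w)"
  unfolding vphi_def map_phi_x_forms[symmetric] by (rule kd_hom[OF rhom_phi])

lemma length_6: "length x_forms = 6" "length hs6 = 6"
  by (simp_all add: x_forms_def)

declare kd.simps(2) [simp del]

lemma free_mod_deg_kos:
  "free_mod_deg (kos x_forms) i n = {v \<in> kchains x_forms i. \<forall>b. v b \<in> homog (n - int i)}"
proof (rule set_eqI)
  fix v :: "nat \<Rightarrow> (6, 'a) mvpoly"
  have g: "gdeg (kos x_forms) i b = int i" if "b < 6 choose i" for b
    by (rule gdeg_kos) (use that in \<open>simp only: length_6\<close>)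
  have "v b \<in> homog (n - int i)"
    if "v \<in> kchains x_forms i" "\<forall>b<6 choose i. v b \<in> homog (n - int i)" for b
    using that by (cases "b < 6 choose i") (simp_all add: length_6 kchains_def)
  then show "v \<in> free_mod_deg (kos x_forms) i n \<longleftrightarrow> v \<in> {v \<in> kchains x_forms i. \<forall>b. v b \<in> homog (n - int i)}"
    unfolding free_mod_deg_def free_mod_kos rk_kos mem_Collect_eq length_6 by (auto simp: g)
qed

lemma phi_twist: "F \<in> homog m \<Longrightarrow> phi F \<in> twist 0 m"
proof (cases "phi F = 0")
  case False
  assume "F \<in> homog m"
  from phi_homog_int[OF this False] show ?thesis by (simp add: twist_def)
qed simp

lemma phi_surj_twist:
  assumes "G \<in> twist 0 m"
  shows "\<exists>F\<in>homog m. phi F = G"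
proof (cases "m < 0")
  case True
  then show ?thesis using assms by (intro bexI[of _ 0]) (simp_all add: twist_def rhom_0[OF rhom_phi])
next
  case False
  then have "G \<in> bih (nat m) (nat m)" using assms by (simp add: twist_def)
  from phi_surj[OF this] show ?thesis using False by simp
qed

lemma vphi_kos_chain: "v \<in> free_mod_deg (kos x_forms) i n \<Longrightarrow> vphi v \<in> kos_chain hs6 0 i n"
  unfolding free_mod_deg_kos kos_chain_def kchains_def mem_Collect_eq vphi_def length_6
  by (simp add: phi_twist rhom_0[OF rhom_phi])

lemma vphi_surj:
  assumes w: "w \<in> kos_chain hs6 0 i n"
  shows "\<exists>v\<in>free_mod_deg (kos x_forms) i n. vphi v = w"
proof -
  \<comment> \<open>Zero entries are lifted to zero, so that the lifted vector keeps its support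
    within the chain module.\<close>
  have "\<exists>F\<in>homog (n - int i). phi F = w b \<and> (w b = 0 \<longrightarrow> F = 0)" for b
  proof (cases "w b = 0")
    case True
    then show ?thesis by (intro bexI[of _ 0]) (simp_all add: rhom_0[OF rhom_phi])
  next
    case False
    have "w b \<in> twist 0 (n - int i)" using w by (simp add: kos_chain_def)
    from phi_surj_twist[OF this] show ?thesis using False by simp
  qed
  then have "\<forall>b. \<exists>F. F \<in> homog (n - int i) \<and> phi F = w b \<and> (w b = 0 \<longrightarrow> F = 0)"
    unfolding Bex_def by simp
  from choice[OF this] obtain v where
    vv: "\<forall>b. v b \<in> homog (n - int i) \<and> phi (v b) = w b \<and> (w b = 0 \<longrightarrow> v b = 0)" ..
  then have v: "\<And>b. v b \<in> homog (n - int i)" "\<And>b. phi (v b) = w b" "\<And>b. w b = 0 \<Longrightarrow> v b = 0"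
    by simp_all
  have "v \<in> free_mod_deg (kos x_forms) i n"
    using w v(1,3) unfolding free_mod_deg_kos kos_chain_def kchains_def mem_Collect_eq length_6 by simp
  moreover have "vphi v = w" by (rule ext) (simp add: vphi_def v(2))
  ultimately show ?thesis by (intro bexI[of _ v])
qed

lemma kos_res: "graded_free_resolution irrelevant_ideal (kos (x_forms :: (6, 'a::field) mvpoly list))"
  using kos_x_forms_resolution unfolding kos_ideal_x_forms .

lemma kd_x_forms_deg:
  assumes "v \<in> free_mod_deg (kos x_forms) (Suc i) n"
  shows "kd x_forms i v \<in> free_mod_deg (kos x_forms) i n"
  using gmap_free_mod_deg[OF gmap_dmap[OF kos_res] assms] unfolding dmap_kos .

section \<open>Koszul homology modulo the equation of the divisor\<close>

text \<open>The image of the tensor cycles under \<open>vphi\<close>: membership in the ideal of X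
  becomes divisibility by \<open>q\<close>, taken in the Cox ring, since \<open>q\<close> itself is
  in general not the restriction of a form.\<close>

definition rel_cyc :: "'a::field cox \<Rightarrow> nat \<Rightarrow> int \<Rightarrow> (nat \<Rightarrow> 'a cox) set" where
  "rel_cyc q k n = {z \<in> kos_chain hs6 0 (Suc k) n. \<forall>b. q dvd kd hs6 k z b}"

definition rel_bd :: "'a::field cox \<Rightarrow> nat \<Rightarrow> int \<Rightarrow> (nat \<Rightarrow> 'a cox) set" where
  "rel_bd q k n = {z \<in> kos_chain hs6 0 (Suc k) n. \<exists>w\<in>kos_chain hs6 0 (Suc (Suc k)) n. \<forall>b. q dvd z b - kd hs6 (Suc k) w b}"

lemma vphi_diff_kd: "phi (v b - kd x_forms i w b) = vphi v b - kd hs6 i (vphi w) b"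
proof -
  have "phi (v b - kd x_forms i w b) = vphi v b - vphi (kd x_forms i w) b"
    unfolding vphi_def by (simp add: rhom_diff[OF rhom_phi])
  then show ?thesis unfolding vphi_kd .
qed

context
  fixes q :: "'a::alg_closed_field cox" and a b :: nat and I :: "(6, 'a) mvpoly set"
  assumes q: "prime_elem q" "q \<in> bih a b"
  defines "I \<equiv> vanishing_ideal (zset q)"
begin

lemma mem_I: "F \<in> homog m \<Longrightarrow> F \<in> I \<longleftrightarrow> q dvd phi F"
  unfolding I_def by (rule vanishing_ideal_zset_homog[OF q])

lemma I_ideal: "is_ideal I"
  unfolding I_def vanishing_ideal_def by (rule is_ideal_span)

lemma tensor_cycles_iff:
  "v \<in> tensor_cycles (kos x_forms) I (Suc k) n \<longleftrightarrow> v \<in> free_mod_deg (kos x_forms) (Suc k) n \<and> vphi v \<in> rel_cyc q k n"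
proof (cases "v \<in> free_mod_deg (kos x_forms) (Suc k) n")
  case True
  have "kd x_forms k v c \<in> homog (n - int k)" for c
    using kd_x_forms_deg[OF True] unfolding free_mod_deg_kos by simp
  from mem_I[OF this] have "kd x_forms k v c \<in> I \<longleftrightarrow> q dvd vphi (kd x_forms k v) c" for c
    unfolding vphi_def .
  then have "kd x_forms k v c \<in> I \<longleftrightarrow> q dvd kd hs6 k (vphi v) c" for c unfolding vphi_kd .
  then show ?thesis using True vphi_kos_chain[OF True] by (simp add: tensor_cycles_def rel_cyc_def dmap_kos)
qed (simp add: tensor_cycles_def)

lemma tensor_boundaries_iff:
  "v \<in> tensor_boundaries (kos x_forms) I (Suc k) n \<longleftrightarrow> v \<in> free_mod_deg (kos x_forms) (Suc k) n \<and> vphi v \<in> rel_bd q k n"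
proof (cases "v \<in> free_mod_deg (kos x_forms) (Suc k) n")
  case True
  have *: "v c - kd x_forms (Suc k) w c \<in> I \<longleftrightarrow> q dvd vphi v c - kd hs6 (Suc k) (vphi w) c"
    if w: "w \<in> free_mod_deg (kos x_forms) (Suc (Suc k)) n" for w c
  proof -
    have "v c - kd x_forms (Suc k) w c \<in> homog (n - int (Suc k))"
      using True kd_x_forms_deg[OF w] unfolding free_mod_deg_kos by (intro homog_diff) simp_all
    from mem_I[OF this] show ?thesis unfolding vphi_diff_kd .
  qed
  have "(\<exists>w\<in>free_mod_deg (kos x_forms) (Suc (Suc k)) n. \<forall>c. v c - kd x_forms (Suc k) w c \<in> I)
    \<longleftrightarrow> (\<exists>w\<in>kos_chain hs6 0 (Suc (Suc k)) n. \<forall>c. q dvd vphi v c - kd hs6 (Suc k) w c)" (is "?L \<longleftrightarrow> ?R")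
  proof
    assume ?L
    then obtain w where w: "w \<in> free_mod_deg (kos x_forms) (Suc (Suc k)) n" "\<forall>c. v c - kd x_forms (Suc k) w c \<in> I" ..
    then show ?R using *[OF w(1)] by (intro bexI[OF _ vphi_kos_chain[OF w(1)]]) simp
  next
    assume ?R
    then obtain w where w: "w \<in> kos_chain hs6 0 (Suc (Suc k)) n" "\<forall>c. q dvd vphi v c - kd hs6 (Suc k) w c" ..
    obtain u where u: "u \<in> free_mod_deg (kos x_forms) (Suc (Suc k)) n" "vphi u = w" using vphi_surj[OF w(1)] ..
    show ?L using *[OF u(1)] w(2) u(2) by (intro bexI[OF _ u(1)]) simp
  qed
  then show ?thesis using True vphi_kos_chain[OF True] by (simp add: tensor_boundaries_def rel_bd_def dmap_kos)
qed (simp add: tensor_boundaries_def)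

text \<open>\<open>vphi\<close> maps cycles onto \<open>rel_cyc\<close> and boundaries onto
  \<open>rel_bd\<close>; its kernel on the cycles consists of boundaries, so it cancels in the
  difference of dimensions.\<close>

lemma betti_zset:
  "betti (zset q) (Suc k) j = dimV (rel_cyc q k (int (Suc k + j))) - dimV (rel_bd q k (int (Suc k + j)))"
proof -
  let ?n = "int (Suc k + j)"
  let ?Z = "tensor_cycles (kos x_forms) I (Suc k) ?n" and ?B = "tensor_boundaries (kos x_forms) I (Suc k) ?n"
  let ?d = "vector_space.dim (cscale :: 'a \<Rightarrow> (nat \<Rightarrow> (6, 'a) mvpoly) \<Rightarrow> _)"
  interpret P: vector_space_pair "cscale :: 'a \<Rightarrow> (nat \<Rightarrow> (6, 'a) mvpoly) \<Rightarrow> _" "scV :: 'a \<Rightarrow> _"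
    by (rule vector_space_pair.intro[OF vector_space_cscale vector_space_scV])
  have fZ: "fin_dim cscale ?Z" by (rule fin_dim_tensor_cycles[OF I_ideal])
  have fB: "fin_dim cscale ?B"
    by (rule fin_dim_subset[OF fZ tensor_boundaries_subspace[OF I_ideal] tensor_boundaries_sub_cycles[OF kos_res I_ideal]])
  have iZ: "vphi ` ?Z = rel_cyc q k ?n"
  proof
    show "vphi ` ?Z \<subseteq> rel_cyc q k ?n" by (rule image_subsetI) (simp add: tensor_cycles_iff)
    show "rel_cyc q k ?n \<subseteq> vphi ` ?Z"
    proof
      fix z assume z: "z \<in> rel_cyc q k ?n"
      then have "z \<in> kos_chain hs6 0 (Suc k) ?n" by (simp add: rel_cyc_def)
      from vphi_surj[OF this] obtain v where "v \<in> free_mod_deg (kos x_forms) (Suc k) ?n" "vphi v = z" ..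
      then show "z \<in> vphi ` ?Z" using z by (intro image_eqI[of _ _ v]) (simp_all add: tensor_cycles_iff)
    qed
  qed
  have iB: "vphi ` ?B = rel_bd q k ?n"
  proof
    show "vphi ` ?B \<subseteq> rel_bd q k ?n" by (rule image_subsetI) (simp add: tensor_boundaries_iff)
    show "rel_bd q k ?n \<subseteq> vphi ` ?B"
    proof
      fix z assume z: "z \<in> rel_bd q k ?n"
      then have "z \<in> kos_chain hs6 0 (Suc k) ?n" by (simp add: rel_bd_def)
      from vphi_surj[OF this] obtain v where "v \<in> free_mod_deg (kos x_forms) (Suc k) ?n" "vphi v = z" ..
      then show "z \<in> vphi ` ?B" using z by (intro image_eqI[of _ _ v]) (simp_all add: tensor_boundaries_iff)
    qed
  qed
  have z: "0 \<in> rel_bd q k ?n" "0 \<in> rel_cyc q k ?n"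
    by (simp_all only: rel_bd_def rel_cyc_def mem_Collect_eq kos_chain_0 kd_0 zero_fun_apply dvd_0_right simp_thms)
      (intro bexI[OF _ kos_chain_0] allI, simp)
  have ker: "{v \<in> ?Z. vphi v = 0} = {v \<in> ?B. vphi v = 0}"
  proof (rule Collect_cong)
    fix v show "v \<in> ?Z \<and> vphi v = 0 \<longleftrightarrow> v \<in> ?B \<and> vphi v = 0"
      unfolding tensor_cycles_iff tensor_boundaries_iff using z by (intro iffI; elim conjE; simp only: simp_thms)
  qed
  have "?d ?Z - ?d ?B = dimV (rel_cyc q k ?n) - dimV (rel_bd q k ?n)"
    using P.dim_image_plus_kernel[OF vphi_linear fZ] P.dim_image_plus_kernel[OF vphi_linear fB]
    unfolding iZ iB ker by simp
  then show ?thesis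
    unfolding betti_def tor_dim_eq[OF kos_res graded_ideal_irrelevant I_ideal, unfolded I_def] I_def .
qed

end

lemma low_degree_not_dvd:
  assumes q: "q \<in> bih a b" "q \<noteq> 0" and F: "F \<in> twist 0 m" "m < int a" and dvd: "q dvd F"
  shows "F = 0"
proof (rule ccontr)
  assume nz: "F \<noteq> 0"
  obtain n where n: "m = int n" using twist_nonneg[OF F(1) nz] by blast
  obtain G where G: "F = q * G" using dvd by (rule dvdE)
  have "q * G \<in> bih n n" using F(1) unfolding n twist_nat G by simp
  then have "a \<le> n" using bih_cancel(2)[OF _ q] nz G by auto
  then show False using F(2) n by simp
qed

lemma rel_bd_low:
  fixes q :: "'a::field cox"
  assumes q: "q \<in> bih a c" "q \<noteq> 0" and n: "n - int (Suc k) < int a"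
  shows "rel_bd q k n = kd hs6 (Suc k) ` kos_chain hs6 0 (Suc (Suc k)) n"
proof (rule set_eqI)
  fix z :: "nat \<Rightarrow> 'a cox"
  have "z = kd hs6 (Suc k) w"
    if "z \<in> kos_chain hs6 0 (Suc k) n" "w \<in> kos_chain hs6 0 (Suc (Suc k)) n" "\<forall>b. q dvd z b - kd hs6 (Suc k) w b" for w
  proof (rule ext)
    fix b
    have "z - kd hs6 (Suc k) w \<in> kos_chain hs6 0 (Suc k) n"
      by (rule kos_chain_diff[OF that(1) kd_kos_chain[OF hs6_bih that(2)]])
    then have "z b - kd hs6 (Suc k) w b \<in> twist 0 (n - int (Suc k))" by (simp add: kos_chain_def)
    then have "z b - kd hs6 (Suc k) w b = 0" by (rule low_degree_not_dvd[OF q _ n that(3)[rule_format]])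
    then show "z b = kd hs6 (Suc k) w b" by simp
  qed
  note eq = this
  show "z \<in> rel_bd q k n \<longleftrightarrow> z \<in> kd hs6 (Suc k) ` kos_chain hs6 0 (Suc (Suc k)) n"
  proof
    assume "z \<in> rel_bd q k n"
    then obtain w where w: "z \<in> kos_chain hs6 0 (Suc k) n" "w \<in> kos_chain hs6 0 (Suc (Suc k)) n"
      "\<forall>b. q dvd z b - kd hs6 (Suc k) w b" unfolding rel_bd_def by (elim CollectE conjE bexE)
    then show "z \<in> kd hs6 (Suc k) ` kos_chain hs6 0 (Suc (Suc k)) n" using eq[OF w] by (intro image_eqI)
  next
    assume "z \<in> kd hs6 (Suc k) ` kos_chain hs6 0 (Suc (Suc k)) n"
    then obtain w where w: "w \<in> kos_chain hs6 0 (Suc (Suc k)) n" "z = kd hs6 (Suc k) w" by (elim imageE)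
    show "z \<in> rel_bd q k n"
      unfolding rel_bd_def by (intro CollectI conjI bexI[OF _ w(1)] allI) (simp_all only: w(2) kd_kos_chain[OF hs6_bih w(1)] diff_self dvd_0_right)
  qed
qed

text \<open>The entries of \<open>kd hs6 k z\<close> have degree one higher than those of
  \<open>z\<close>, so the bound is stricter by one than in \<open>rel_bd_low\<close>. For n = k + 1
  + j the two differ exactly at j = a - 1, where the connecting map appears.\<close>

lemma rel_cyc_low:
  fixes q :: "'a::field cox"
  assumes q: "q \<in> bih a c" "q \<noteq> 0" and n: "n - int k < int a"
  shows "rel_cyc q k n = kos_cyc hs6 0 (Suc k) n"
proof (rule set_eqI)
  fix z :: "nat \<Rightarrow> 'a cox"
  have "kd hs6 k z = 0" if "z \<in> kos_chain hs6 0 (Suc k) n" "\<forall>b. q dvd kd hs6 k z b"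
  proof (rule ext)
    fix b
    have "kd hs6 k z b \<in> twist 0 (n - int k)" using kd_kos_chain[OF hs6_bih that(1)] by (simp add: kos_chain_def)
    then show "kd hs6 k z b = 0 b" using low_degree_not_dvd[OF q _ n that(2)[rule_format]] by simp
  qed
  note z = this
  show "z \<in> rel_cyc q k n \<longleftrightarrow> z \<in> kos_cyc hs6 0 (Suc k) n"
    unfolding rel_cyc_def kos_cyc_Suc mem_Collect_eq
  proof (rule conj_cong[OF refl], rule iffI)
    assume "kd hs6 k z = 0"
    then show "\<forall>b. q dvd kd hs6 k z b" by simp
  qed (rule z)
qed

text \<open>The sum (d - 2, 1) + (m, m + d - 3) is balanced; this fixes the twist
  \<open>d - 3\<close> and the shift \<open>d - 2\<close>.\<close>

lemma smul_kos_chain: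
  assumes q: "q \<in> bih (d - 2) 1" and d: "d \<ge> 3" and y: "y \<in> kos_chain ys (d - 3) k (int p)"
  shows "smul q y \<in> kos_chain ys 0 k (int p + int (d - 2))"
proof -
  have "q * y b \<in> twist 0 (int p + int (d - 2) - int k)" for b
  proof (cases "y b = 0")
    case False
    have yb: "y b \<in> twist (d - 3) (int p - int k)" using y by (simp add: kos_chain_def)
    obtain m where m: "int p - int k = int m" using twist_nonneg[OF yb False] by blast
    have "q * y b \<in> bih (d - 2 + m) (1 + (m + (d - 3)))" using yb unfolding m twist_nat by (rule bih_mult[OF q])
    moreover have e1: "1 + (m + (d - 3)) = d - 2 + m" using d by linarith
    moreover have e2: "int p + int (d - 2) - int k = int (d - 2 + m)" using m by linarith
    ultimately show ?thesis unfolding e2 twist_nat e1 by (simp only: add_0_right)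
  qed simp
  then show ?thesis using kchains_smul[OF kos_chain_kchains[OF y]] by (simp add: kos_chain_def)
qed

lemma smul_kos_chain_surj:
  fixes q :: "'a::field cox"
  assumes q: "q \<in> bih (d - 2) 1" "q \<noteq> 0" and d: "d \<ge> 3"
    and z: "z \<in> kos_chain ys 0 k (int p + int (d - 2))" "\<And>b. q dvd z b"
  shows "\<exists>y\<in>kos_chain ys (d - 3) k (int p). smul q y = z"
proof -
  have "\<exists>G. z b = q * G" for b using z(2) by (auto elim: dvdE)
  then obtain y where y: "\<And>b. z b = q * y b" by metis
  have "y b \<in> twist (d - 3) (int p - int k)" for b
  proof (cases "y b = 0")
    case False
    then have nz: "z b \<noteq> 0" using y q(2) by simp
    have zb: "z b \<in> twist 0 (int p + int (d - 2) - int k)" using z(1) by (simp add: kos_chain_def)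
    obtain m where m: "int p + int (d - 2) - int k = int m" using twist_nonneg[OF zb nz] by blast
    have "q * y b \<in> bih m m" using zb unfolding m twist_nat y by simp
    note c = bih_cancel[OF this q False]
    have e1: "int p - int k = int (m - (d - 2))" using m c(2) by linarith
    have e2: "m - 1 = m - (d - 2) + (d - 3)" using c(2) d by linarith
    show ?thesis using c(1) unfolding e1 twist_nat e2 .
  qed simp
  moreover have "y \<in> kchains ys k" using kos_chain_kchains[OF z(1)] y q(2) by (simp add: kchains_def)
  moreover have "smul q y = z" by (rule ext) (simp add: y)
  ultimately show ?thesis by (intro bexI[of _ y]) (simp_all add: kos_chain_def)
qed

lemma smul_eq_0_iff: "q \<noteq> 0 \<Longrightarrow> smul q y = 0 \<longleftrightarrow> y = 0" for q :: "'a::field cox"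
  by (simp add: fun_eq_iff)

lemma cyc_smul: "q \<noteq> 0 \<Longrightarrow> cyc ys k (smul q y) \<longleftrightarrow> cyc ys k y" for q :: "'a::field cox"
  by (cases k) (simp_all add: kd_smul smul_eq_0_iff del: smul_0)

lemma rel_cyc_subspace: "module.subspace scV (rel_cyc q k n)" for q :: "'a::field cox"
proof -
  have C: "sV.subspace (kos_chain (hs6 :: 'a cox list) 0 (Suc k) n)" by (rule fin_dim_subspace[OF fin_dim_kos_chain])
  show ?thesis
  proof (rule sV.subspaceI)
    show "0 \<in> rel_cyc q k n" by (simp add: rel_cyc_def)
    show "x + y \<in> rel_cyc q k n" if "x \<in> rel_cyc q k n" "y \<in> rel_cyc q k n" for x y
      using that sV.subspace_add[OF C] by (simp add: rel_cyc_def kd_add)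
    show "scV c x \<in> rel_cyc q k n" if "x \<in> rel_cyc q k n" for c x
      using that sV.subspace_scale[OF C, of x c] by (simp add: rel_cyc_def scV_eq_smul kd_smul)
  qed
qed

lemma slin_smul_const: "slin (smul q)"
  by (simp add: slin_def smul_add smul_smul mult.commute)

text \<open>The connecting homomorphism sends \<open>z\<close> to its differential divided by
  \<open>q\<close>. It reaches every cycle because the strand of M_0 is exact at homological degree
  \<open>k\<close> in internal degree \<open>k + d - 2\<close>.\<close>

lemma kd_rel_cyc:
  fixes q :: "'a::field cox"
  assumes q: "q \<in> bih (d - 2) 1" "q \<noteq> 0" and d: "d \<ge> 5"
  shows "kd hs6 k ` rel_cyc q k (int k + int (d - 2)) = smul q ` kos_cyc hs6 (d - 3) k (int k)"
proof (intro equalityI image_subsetI)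
  let ?n = "int k + int (d - 2)"
  fix z assume "z \<in> rel_cyc q k ?n"
  then have z: "z \<in> kos_chain hs6 0 (Suc k) ?n" "\<And>b. q dvd kd hs6 k z b" by (simp_all add: rel_cyc_def)
  have kz: "kd hs6 k z \<in> kos_chain hs6 0 k ?n" by (rule kd_kos_chain[OF hs6_bih z(1)])
  obtain y where y: "y \<in> kos_chain hs6 (d - 3) k (int k)" "smul q y = kd hs6 k z"
    using smul_kos_chain_surj[OF q _ kz z(2)] d by auto
  have "cyc hs6 k (smul q y)"
    unfolding y(2) using kd_kd[of z hs6] kos_chain_kchains[OF z(1)] by (cases k) simp_all
  then have "y \<in> kos_cyc hs6 (d - 3) k (int k)" using y(1) by (simp add: kos_cyc_def cyc_smul[OF q(2)])
  then show "kd hs6 k z \<in> smul q ` kos_cyc hs6 (d - 3) k (int k)" unfolding y(2)[symmetric] by (rule imageI)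
next
  let ?n = "int k + int (d - 2)"
  fix y :: "nat \<Rightarrow> 'a cox" assume "y \<in> kos_cyc hs6 (d - 3) k (int k)"
  then have y: "y \<in> kos_chain hs6 (d - 3) k (int k)" "cyc hs6 k y" by (simp_all add: kos_cyc_def)
  have s: "smul q y \<in> kos_chain hs6 0 k ?n" using smul_kos_chain[OF q(1) _ y(1)] d by simp
  have "exact (hs6 :: 'a cox list) 0 k ?n" by (rule exact6) (use d in simp)
  then obtain z where z: "z \<in> kos_chain hs6 0 (Suc k) ?n" "kd hs6 k z = smul q y"
    using s y(2) unfolding exact_def by (auto simp: cyc_smul[OF q(2)])
  then have "z \<in> rel_cyc q k ?n" by (simp add: rel_cyc_def)
  then show "smul q y \<in> kd hs6 k ` rel_cyc q k ?n" unfolding z(2)[symmetric] by (rule imageI)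
qed

text \<open>Rank and nullity of the connecting map. Its kernel consists of the honest cycles, which
  are the boundaries by exactness of M_0 at homological degree \<open>k + 1\<close>; this requires d
  - 2 >= 3.\<close>

lemma rel_cyc_dim:
  fixes q :: "'a::field cox"
  assumes q: "q \<in> bih (d - 2) 1" "q \<noteq> 0" and d: "d \<ge> 5"
  shows "dimV (rel_cyc q k (int k + int (d - 2)))
    = dimV (kos_cyc (hs6 :: 'a cox list) (d - 3) k (int k)) + dimV (rel_bd q k (int k + int (d - 2)))"
proof -
  let ?n = "int k + int (d - 2)"
  have f: "fin_dim scV (rel_cyc q k ?n)"
    by (rule fin_dim_subset[OF fin_dim_kos_chain[of hs6 0 "Suc k" ?n] rel_cyc_subspace]) (simp add: rel_cyc_def)
  have "exact (hs6 :: 'a cox list) 0 (Suc k) ?n" by (rule exact6) (use d in simp)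
  then have "rel_bd q k ?n = kos_cyc hs6 0 (Suc k) ?n"
    by (subst rel_bd_low[OF q]) (simp, rule exact_image[OF hs6_bih])
  moreover have "{z \<in> rel_cyc q k ?n. kd hs6 k z = 0} = kos_cyc hs6 0 (Suc k) ?n"
    unfolding rel_cyc_def kos_cyc_Suc by (intro Collect_cong) (auto simp only: mem_Collect_eq zero_fun_apply dvd_0_right)
  moreover have "dimV (kos_cyc (hs6 :: 'a cox list) (d - 3) k (int k)) = dimV (smul q ` kos_cyc hs6 (d - 3) k (int k))"
  proof -
    have "{v \<in> kos_cyc hs6 (d - 3) k (int k). smul q v = 0} = {0}"
      unfolding smul_eq_0_iff[OF q(2)] by (cases k) (auto simp: kos_cyc_def)
    then show ?thesis
      using rank_nullity[OF slin_smul_const[of q] fin_dim_kos_cyc[of hs6 "d - 3" k "int k"]]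
      by (simp only: dim_zero_subspace[OF vector_space_scV] add_0_right)
  qed
  ultimately show ?thesis
    using rank_nullity[OF slin_kd f, of hs6 k] unfolding kd_rel_cyc[OF q d] by simp
qed

subsection \<open>The Betti numbers\<close>

lemma dim_kos_cyc_sum:
  assumes "k \<le> p" "k + (if e = 0 then 1 else 0) \<le> p"
  shows "int (dimV (kos_cyc (hs6 :: 'a::field cox list) e k (int p)))
    = (\<Sum>j\<le>k. (- 1) ^ (k - j) * (int (6 choose j) * (int (p - j + 1) * int ((p - j + e + 2) choose 2))))"
proof -
  have "exact (hs6 :: 'a cox list) e i (int p)" if "i < k" for i
    by (rule exact6) (use assms that in auto)
  moreover have "int (dimV (kos_chain (hs6 :: 'a cox list) e j (int p)))
    = int (6 choose j) * (int (p - j + 1) * int ((p - j + e + 2) choose 2))" if "j \<le> k" for j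
  proof -
    have "nat (int p - int j) = p - j" "\<not> int p < int j" using that assms(1) by auto
    then show ?thesis unfolding dim_kos_chain length_6 by (simp only: if_False of_nat_mult)
  qed
  ultimately show ?thesis by (subst dim_kos_cyc_strand) (auto intro!: sum.cong)
qed

lemma sum_atMost_numeral:
  "(\<Sum>j\<le>1. f j) = f 0 + f 1" "(\<Sum>j\<le>2. f j) = f 0 + f 1 + f 2"
  "(\<Sum>j\<le>3. f j) = f 0 + f 1 + f 2 + f 3" "(\<Sum>j\<le>4. f j) = f 0 + f 1 + f 2 + f 3 + f 4"
  "(\<Sum>j\<le>5. f j) = f 0 + f 1 + f 2 + f 3 + f 4 + f 5" for f :: "nat \<Rightarrow> int"
  by (simp_all add: numeral_eq_Suc)

lemma choose_6: "(6 choose Suc (Suc 0)) = (15 :: nat)" "(6 choose 2) = (15 :: nat)" "(6 choose 3) = (20 :: nat)" "(6 choose 4) = (15 :: nat)" "(6 choose 5) = (6 :: nat)"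
  by (simp_all add: numeral_eq_Suc)

lemma choose_2: "(Suc (Suc (Suc 0)) choose 2) = 3" "(3 choose 2) = (3 :: nat)" "(4 choose 2) = (6 :: nat)" "(5 choose 2) = (10 :: nat)" "(7 choose 2) = (21 :: nat)"
    "(8 choose 2) = (28 :: nat)"
  by (simp_all add: choose_two)

text \<open>Subtracting the binomial coefficients 15, 20, 15, 6, 1 as in \<open>betti_linear\<close>
  leaves the linear Betti numbers 3, 2, 0, 0, 0.\<close>

lemma strand_scroll:
  "dimV (kos_cyc (hs6 :: 'a::field cox list) 0 1 2) = 18" "dimV (kos_cyc (hs6 :: 'a cox list) 0 2 3) = 22"
  "dimV (kos_cyc (hs6 :: 'a cox list) 0 3 4) = 15" "dimV (kos_cyc (hs6 :: 'a cox list) 0 4 5) = 6"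
  "dimV (kos_cyc (hs6 :: 'a cox list) 0 5 6) = 1"
  using dim_kos_cyc_sum[of 1 2 0, where 'a='a] dim_kos_cyc_sum[of 2 3 0, where 'a='a] dim_kos_cyc_sum[of 3 4 0, where 'a='a]
    dim_kos_cyc_sum[of 4 5 0, where 'a='a] dim_kos_cyc_sum[of 5 6 0, where 'a='a]
  unfolding sum_atMost_numeral by (simp_all add: choose_6 choose_2)

lemma strand_divisor:
  fixes e :: nat
  assumes e: "e \<ge> 1"
  shows "dimV (kos_cyc (hs6 :: 'a::field cox list) e 0 0) = (e + 2) choose 2"
    and "int (dimV (kos_cyc (hs6 :: 'a::field cox list) e 1 1)) = 2 * (int e + 2) * int e"
    and "int (dimV (kos_cyc (hs6 :: 'a::field cox list) e 2 2)) = 3 * ((int e)\<^sup>2 + int e - 1)"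
    and "int (dimV (kos_cyc (hs6 :: 'a::field cox list) e 3 3)) = 2 * (int e + 1) * (int e - 1)"
    and "dimV (kos_cyc (hs6 :: 'a::field cox list) e 4 4) = e choose 2"
proof -
  \<comment> \<open>Doubling clears the denominators; the Euler characteristics then become linear
    identities in \<open>int e\<close> and its square.\<close>
  have ch: "2 * int (m choose 2) = int m * (int m - 1)" for m
  proof (cases m)
    case (Suc k)
    have "even (m * (m - 1))" by (cases m) simp_all
    then have "2 * (m choose 2) = Suc k * k" by (simp add: choose_two Suc)
    then have "2 * int (m choose 2) = int (Suc k * k)" by (metis of_nat_mult of_nat_numeral)
    then show ?thesis using Suc by (simp add: algebra_simps)
  qed simp
  let ?E = "\<lambda>m. int ((m + e + 2) choose 2)"
  have E: "2 * ?E m = (int m + int e + 2) * (int m + int e + 1)" for m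
    using ch[of "m + e + 2"] by (simp add: algebra_simps)
  have E0: "2 * int ((e + 2) choose 2) = int e * int e + 3 * int e + 2" using E[of 0] by (simp add: algebra_simps)
  have E1: "2 * int ((1 + e + 2) choose 2) = int e * int e + 5 * int e + 6" using E[of 1] by (simp add: algebra_simps)
  have E2: "2 * int ((2 + e + 2) choose 2) = int e * int e + 7 * int e + 12" using E[of 2] by (simp add: algebra_simps)
  have E3: "2 * int ((3 + e + 2) choose 2) = int e * int e + 9 * int e + 20" using E[of 3] by (simp add: algebra_simps)
  have E4: "2 * int ((4 + e + 2) choose 2) = int e * int e + 11 * int e + 30" using E[of 4] by (simp add: algebra_simps)
  have C: "2 * int (e choose 2) = int e * int e - int e" using ch[of e] by (simp add: algebra_simps)
  show "dimV (kos_cyc (hs6 :: 'a::field cox list) e 0 0) = (e + 2) choose 2"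
    using dim_kos_cyc_sum[of 0 0 e, where 'a='a] e by simp
  have "int (dimV (kos_cyc (hs6 :: 'a::field cox list) e 1 1)) = 6 * int ((e + 2) choose 2) - 2 * int ((1 + e + 2) choose 2)"
    using dim_kos_cyc_sum[of 1 1 e, where 'a='a] e unfolding sum_atMost_numeral by simp
  then show "int (dimV (kos_cyc (hs6 :: 'a::field cox list) e 1 1)) = 2 * (int e + 2) * int e"
    using E0 E1 by (simp add: algebra_simps)
  have "int (dimV (kos_cyc (hs6 :: 'a::field cox list) e 2 2)) = 15 * int ((e + 2) choose 2)
      - 12 * int ((1 + e + 2) choose 2) + 3 * int ((2 + e + 2) choose 2)"
    using dim_kos_cyc_sum[of 2 2 e, where 'a='a] e unfolding sum_atMost_numeral by (simp add: choose_6)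
  moreover have "3 * ((int e)\<^sup>2 + int e - 1) = 3 * (int e * int e) + 3 * int e - 3" by (simp add: power2_eq_square)
  ultimately show "int (dimV (kos_cyc (hs6 :: 'a::field cox list) e 2 2)) = 3 * ((int e)\<^sup>2 + int e - 1)"
    using E0 E1 E2 by linarith
  have "int (dimV (kos_cyc (hs6 :: 'a::field cox list) e 3 3)) = 20 * int ((e + 2) choose 2)
      - 30 * int ((1 + e + 2) choose 2) + 18 * int ((2 + e + 2) choose 2) - 4 * int ((3 + e + 2) choose 2)"
    using dim_kos_cyc_sum[of 3 3 e, where 'a='a] e unfolding sum_atMost_numeral by (simp add: choose_6)
  moreover have "2 * (int e + 1) * (int e - 1) = 2 * (int e * int e) - 2" by (simp add: algebra_simps)
  ultimately show "int (dimV (kos_cyc (hs6 :: 'a::field cox list) e 3 3)) = 2 * (int e + 1) * (int e - 1)"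
    using E0 E1 E2 E3 by linarith
  have "int (dimV (kos_cyc (hs6 :: 'a::field cox list) e 4 4)) = 15 * int ((e + 2) choose 2)
      - 40 * int ((1 + e + 2) choose 2) + 45 * int ((2 + e + 2) choose 2) - 24 * int ((3 + e + 2) choose 2)
      + 5 * int ((4 + e + 2) choose 2)"
    using dim_kos_cyc_sum[of 4 4 e, where 'a='a] e unfolding sum_atMost_numeral by (simp add: choose_6)
  then have "int (dimV (kos_cyc (hs6 :: 'a::field cox list) e 4 4)) = int (e choose 2)"
    using E0 E1 E2 E3 E4 C by linarith
  then show "dimV (kos_cyc (hs6 :: 'a::field cox list) e 4 4) = e choose 2" by simp
qed

context
  fixes q :: "'a::alg_closed_field cox" and d :: nat
  assumes q: "prime_elem q" "q \<in> bih (d - 2) 1" and d: "d \<ge> 5"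
begin

text \<open>The subtracted binomial is the dimension of the boundaries. Chains of homological and
  internal degree i + 1 have scalar entries, and the differential is injective on them: cycles there
  are boundaries by \<open>exact6_diag\<close>, and no nonzero chains lie above.\<close>

lemma betti_linear:
  assumes i: "i = Suc k"
  shows "betti (zset q) i 1 = dimV (kos_cyc (hs6 :: 'a cox list) 0 i (int (Suc i))) - (6 choose Suc i)"
proof -
  let ?n = "int (Suc k + 1)"
  have q0: "q \<noteq> 0" using q(1) by auto
  have Z: "rel_cyc q k ?n = kos_cyc hs6 0 (Suc k) ?n" by (rule rel_cyc_low[OF q(2) q0]) (use d in auto)
  have B: "rel_bd q k ?n = kd hs6 (Suc k) ` kos_chain hs6 0 (Suc (Suc k)) ?n" by (rule rel_bd_low[OF q(2) q0]) (use d in auto)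
  have "z = 0" if z: "z \<in> kos_cyc (hs6 :: 'a cox list) 0 (Suc (Suc k)) ?n" for z
  proof -
    have "exact (hs6 :: 'a cox list) 0 (Suc (Suc k)) ?n" using exact6_diag[of "Suc k"] by simp
    then obtain w where w: "w \<in> kos_chain hs6 0 (Suc (Suc (Suc k))) ?n" "kd hs6 (Suc (Suc k)) w = z"
      using z unfolding exact_def kos_cyc_def by (auto simp del: cyc_simps)
    have "w = 0" by (rule ext) (use w(1) in \<open>simp add: kos_chain_def twist_neg\<close>)
    then show ?thesis using w(2) by simp
  qed
  then have "kos_cyc (hs6 :: 'a cox list) 0 (Suc (Suc k)) ?n = {0}" by (auto simp: kos_cyc_def)
  then have "dimV (kd (hs6 :: 'a cox list) (Suc k) ` kos_chain hs6 0 (Suc (Suc k)) ?n) = dimV (kos_chain (hs6 :: 'a cox list) 0 (Suc (Suc k)) ?n)"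
    using dim_kos_chain_split[of "hs6 :: 'a cox list" 0 "Suc k" ?n] dim_zero_subspace[OF vector_space_scV, where 'a='a] by simp
  also have "\<dots> = 6 choose Suc (Suc k)" unfolding dim_kos_chain length_6 by (simp add: numeral_2_eq_2)
  finally show ?thesis unfolding i betti_zset[OF q] Z B by simp
qed

lemma betti_middle:
  assumes i: "i = Suc k" and j: "2 \<le> j" "j \<le> d - 4"
  shows "betti (zset q) i j = 0"
proof -
  let ?n = "int (Suc k + j)"
  have q0: "q \<noteq> 0" using q(1) by auto
  have Z: "rel_cyc q k ?n = kos_cyc hs6 0 (Suc k) ?n" by (rule rel_cyc_low[OF q(2) q0]) (use d j in linarith)
  have B: "rel_bd q k ?n = kd hs6 (Suc k) ` kos_chain hs6 0 (Suc (Suc k)) ?n" by (rule rel_bd_low[OF q(2) q0]) (use d j in linarith)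
  have "exact (hs6 :: 'a cox list) 0 (Suc k) ?n" by (rule exact6) (use j in simp)
  then have "rel_bd q k ?n = kos_cyc hs6 0 (Suc k) ?n" unfolding B by (rule exact_image[OF hs6_bih])
  then show ?thesis unfolding i betti_zset[OF q] Z by simp
qed

text \<open>Cycles count homology here: boundaries would come from chains with entries of degree -1,
  so this is the degree \<open>k\<close> part of Tor_k of the module with twist
  \<open>d - 3\<close>.\<close>

lemma betti_last:
  assumes i: "i = Suc k"
  shows "betti (zset q) i (d - 3) = dimV (kos_cyc (hs6 :: 'a cox list) (d - 3) k (int k))"
proof -
  have q0: "q \<noteq> 0" using q(1) by auto
  have n: "int (Suc k + (d - 3)) = int k + int (d - 2)" using d by linarith
  show ?thesis unfolding i betti_zset[OF q] n using rel_cyc_dim[OF q(2) q0 d, of k] by simp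
qed

end

theorem theorem4p2:
  fixes X :: "(6 \<Rightarrow> 'a::alg_closed_field) set"
    and d :: nat
    and l :: "(6, 'a) mvpoly"
    and p :: "2 \<Rightarrow> 'a"
  assumes "d \<ge> 5"
    and "prime_divisor scroll111 X"
    and "l \<in> homog 1" and "l \<noteq> 0"
    and "p \<noteq> 0"
    and "lin_equiv scroll111 (prime_div X)
           (\<lambda>Y. form_div scroll111 l Y + (int d - 3) * prime_div (ruling_plane p) Y)"
  shows "betti X 1 1 = 3 \<and> betti X 2 1 = 2 \<and>
         betti X 3 1 = 0 \<and> betti X 4 1 = 0 \<and> betti X 5 1 = 0 \<and>
         (\<forall>i j. 1 \<le> i \<and> i \<le> 5 \<and> 2 \<le> j \<and> j \<le> d - 4 \<longrightarrow> betti X i j = 0) \<and>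
         betti X 1 (d - 3) = (d - 1) choose 2 \<and>
         betti X 2 (d - 3) = 2 * (d - 1) * (d - 3) \<and>
         int (betti X 3 (d - 3)) = 3 * ((int d)\<^sup>2 - 5 * int d + 5) \<and>
         betti X 4 (d - 3) = 2 * (d - 2) * (d - 4) \<and>
         betti X 5 (d - 3) = (d - 3) choose 2"
proof -
  have "d \<ge> 3" using assms(1) by simp
  from divisor_equation[OF this assms(2-6)] obtain q where
    q: "prime_elem q" "q \<in> bih (d - 2) 1" and X: "X = zset q" by (elim exE conjE)
  note lin = betti_linear[OF q assms(1)] and mid = betti_middle[OF q assms(1)] and last = betti_last[OF q assms(1)]
  \<comment> \<open>In terms of the twist \<open>e = d - 3\<close> the closed forms are polynomials;
    passing through \<open>int\<close> avoids truncated subtraction.\<close>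
  obtain e where e: "d = e + 3" "e \<ge> 2" using assms(1) by (intro that[of "d - 3"]) simp_all
  have e1: "e \<ge> 1" and d3: "d - 3 = e" using e by simp_all
  have 1: "betti X 1 1 = 3" "betti X 2 1 = 2" "betti X 3 1 = 0" "betti X 4 1 = 0" "betti X 5 1 = 0"
    unfolding X using lin[of 1 0] lin[of 2 1] lin[of 3 2] lin[of 4 3] lin[of 5 4]
    by (simp_all add: strand_scroll[unfolded One_nat_def] choose_6)
  have 2: "betti X i j = 0" if "1 \<le> i" "2 \<le> j" "j \<le> d - 4" for i j
    unfolding X by (rule mid[of i "i - 1"]) (use that in simp_all)
  have 3: "betti X 1 (d - 3) = (d - 1) choose 2" "betti X 5 (d - 3) = (d - 3) choose 2"
    unfolding X using last[of 1 0] last[of 5 4] strand_divisor(1,5)[OF e1, where 'a='a] e by simp_all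
  have "int (betti X 2 (d - 3)) = 2 * (int e + 2) * int e"
    unfolding X using last[of 2 1] strand_divisor(2)[OF e1, where 'a='a] d3 by simp
  also have "\<dots> = int (2 * (d - 1) * (d - 3))" unfolding e(1) by (simp add: algebra_simps)
  finally have 4: "betti X 2 (d - 3) = 2 * (d - 1) * (d - 3)" by (simp only: of_nat_eq_iff)
  have "int (betti X 3 (d - 3)) = 3 * ((int e)\<^sup>2 + int e - 1)"
    unfolding X using last[of 3 2] strand_divisor(3)[OF e1, where 'a='a] d3 by simp
  also have "\<dots> = 3 * ((int d)\<^sup>2 - 5 * int d + 5)" unfolding e(1) by (simp add: power2_eq_square algebra_simps)
  finally have 5: "int (betti X 3 (d - 3)) = 3 * ((int d)\<^sup>2 - 5 * int d + 5)" .
  have "int (betti X 4 (d - 3)) = 2 * (int e + 1) * (int e - 1)"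
    unfolding X using last[of 4 3] strand_divisor(4)[OF e1, where 'a='a] d3 by simp
  also have "\<dots> = int (2 * (d - 2) * (d - 4))"
    using e by (simp only: of_nat_mult of_nat_numeral) (simp add: of_nat_diff)
  finally have 6: "betti X 4 (d - 3) = 2 * (d - 2) * (d - 4)" by (simp only: of_nat_eq_iff)
  show ?thesis using 1 2 3 4 5 6 by simp
qed

end
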